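(* Let $0\le a\le1/4$ and $s\in\mathbb{R}$ with $s+a<1/4$. Then the data-to-solution map $v_0\mapsto v$ associated with the Cauchy problem $$\partial_tv+(\partial_x^3+\partial_y^3)v+(\partial_x+\partial_y)(v^3)=0\quad\text{on }\mathbb{R}^2,\qquad v|_{t=0}=v_0,$$ is not $C^3$ in the $H^{s,a}(\mathbb{R}^2)$ topology. That is, there are no $T>0$, $\delta>0$ for which the data-to-solution map is given by a map of class $C^3$ from $\{f\in H^{s,a}(\mathbb{R}^2):\|f\|_{H^{s,a}}<\delta\}$ to $C([0,T];H^{s,a}(\mathbb{R}^2))$.
   Context: For $\alpha\in\mathbb{R}$, $|D_x|^\alpha$ and $|D_y|^\alpha$ are the Fourier multipliers $|\xi|^\alpha$ and $|\eta|^\alpha$, where $(\xi,\eta)$ are the Fourier variables dual to $(x,y)\in\mathbb{R}^2$. Define $$H^{s,a}(\mathbb{R}^2)=\{u\in L^2(\mathbb{R}^2): |D_x|^a|D_y|^{-a}u,\ |D_y|^a|D_x|^{-a}u\in H^s(\mathbb{R}^2)\},$$ $$\|u\|_{H^{s,a}}=\||D_x|^a|D_y|^{-a}u\|_{H^s}+\||D_y|^a|D_x|^{-a}u\|_{H^s}.$$ A map $S$ from the $\delta$-ball of $H^{s,a}(\mathbb{R}^2)$ to $C([0,T];H^{s,a}(\mathbb{R}^2))$ is said to give the data-to-solution map if $S(v_0)=v$ for every Schwartz function $v_0$ in the ball for which the Cauchy problem has a (necessarily unique) smooth solution $v\in C([0,T];H^\infty(\mathbb{R}^2))$, where $H^\infty=\bigcap_kH^k$.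 $C^3$ is meant in the Fréchet sense. *)

theory Defs
  imports "HOL-Analysis.Analysis" "HOL-Library.Function_Algebras"
begin

section \<open>Maps of class \<open>C\<^sup>3\<close> between seminormed spaces\<close>

instantiation "fun" :: (type, real_vector) real_vector
begin
definition scaleR_fun :: "real \<Rightarrow> ('a \<Rightarrow> 'b) \<Rightarrow> 'a \<Rightarrow> 'b"
  where "scaleR_fun c f = (\<lambda>x. c *\<^sub>R f x)"
instance
  by standard (auto simp: scaleR_fun_def plus_fun_def fun_eq_iff scaleR_add_right scaleR_add_left)
end

text \<open>
  The spaces of the statement depend on real parameters, so they are given by a carrier
  (a linear subspace of a type) and a seminorm on it, rather than by types. The carriers consist
  of functions and not of classes modulo equality almost everywhere: the underlying normed space
  is the quotient by the null space of the seminorm. All notions below are invariant under changing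
  elements by null elements; in particular, linearity is required modulo null elements only, and a
  map continuous in the sense below sends equivalent elements to equivalent ones.
\<close>

type_synonym 'a seminormed = "'a set \<times> ('a \<Rightarrow> real)"

definition open_ball0 :: "'a::real_vector seminormed \<Rightarrow> real \<Rightarrow> 'a set" where
  "open_ball0 X r = {u \<in> fst X. snd X u < r}"

text \<open>The continuous linear maps from \<open>X\<close> to \<open>Y\<close>, with the operator norm.\<close>

definition lin_maps ::
  "'a::real_vector seminormed \<Rightarrow> 'b::real_vector seminormed \<Rightarrow> ('a \<Rightarrow> 'b) seminormed" where
  "lin_maps X Y =
    ({L. (\<forall>h\<in>fst X. L h \<in> fst Y)
       \<and> (\<forall>h\<in>fst X. \<forall>k\<in>fst X. snd Y (L (h + k) - (L h + L k)) = 0)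
       \<and> (\<forall>c. \<forall>h\<in>fst X. snd Y (L (c *\<^sub>R h) - c *\<^sub>R L h) = 0)
       \<and> (\<exists>C. \<forall>h\<in>fst X. snd Y (L h) \<le> C * snd X h)},
     \<lambda>L. SUP h\<in>{h \<in> fst X. snd X h \<le> 1}. snd Y (L h))"

definition C0_map ::
  "'a::real_vector seminormed \<Rightarrow> 'a set \<Rightarrow> 'b::real_vector seminormed \<Rightarrow> ('a \<Rightarrow> 'b) \<Rightarrow> bool" where
  "C0_map X U Y F \<longleftrightarrow>
    (\<forall>u\<in>U. F u \<in> fst Y \<and>
      (\<forall>\<epsilon>>0. \<exists>d>0. \<forall>w\<in>U. snd X (w - u) < d \<longrightarrow> snd Y (F w - F u) < \<epsilon>))"

definition has_frechet_deriv ::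
  "'a::real_vector seminormed \<Rightarrow> 'a set \<Rightarrow> 'b::real_vector seminormed
    \<Rightarrow> ('a \<Rightarrow> 'b) \<Rightarrow> ('a \<Rightarrow> 'a \<Rightarrow> 'b) \<Rightarrow> bool" where
  "has_frechet_deriv X U Y F F' \<longleftrightarrow>
    (\<forall>u\<in>U. F u \<in> fst Y \<and> F' u \<in> fst (lin_maps X Y) \<and>
      (\<forall>\<epsilon>>0. \<exists>d>0. \<forall>h\<in>fst X. u + h \<in> U \<and> snd X h < d \<longrightarrow>
         snd Y (F (u + h) - F u - F' u h) \<le> \<epsilon> * snd X h))"

text \<open>The set \<open>U\<close> is meant to be open in \<open>X\<close>.\<close>

definition C1_map ::
  "'a::real_vector seminormed \<Rightarrow> 'a set \<Rightarrow> 'b::real_vector seminormed \<Rightarrow> ('a \<Rightarrow> 'b) \<Rightarrow> bool" where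
  "C1_map X U Y F \<longleftrightarrow> (\<exists>F'. has_frechet_deriv X U Y F F' \<and> C0_map X U (lin_maps X Y) F')"

definition C2_map ::
  "'a::real_vector seminormed \<Rightarrow> 'a set \<Rightarrow> 'b::real_vector seminormed \<Rightarrow> ('a \<Rightarrow> 'b) \<Rightarrow> bool" where
  "C2_map X U Y F \<longleftrightarrow> (\<exists>F'. has_frechet_deriv X U Y F F' \<and> C1_map X U (lin_maps X Y) F')"

definition C3_map ::
  "'a::real_vector seminormed \<Rightarrow> 'a set \<Rightarrow> 'b::real_vector seminormed \<Rightarrow> ('a \<Rightarrow> 'b) \<Rightarrow> bool" where
  "C3_map X U Y F \<longleftrightarrow> (\<exists>F'. has_frechet_deriv X U Y F F' \<and> C2_map X U (lin_maps X Y) F')"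

text \<open>The space \<open>C([0,T];X)\<close>; values at times outside \<open>[0,T]\<close> are irrelevant.\<close>

definition C_space :: "real \<Rightarrow> 'a::real_vector seminormed \<Rightarrow> (real \<Rightarrow> 'a) seminormed" where
  "C_space T X =
    ({w. \<forall>t\<in>{0..T}. w t \<in> fst X \<and>
        (\<forall>\<epsilon>>0. \<exists>d>0. \<forall>t'\<in>{0..T}. \<bar>t' - t\<bar> < d \<longrightarrow> snd X (w t' - w t) < \<epsilon>)},
     \<lambda>w. SUP t\<in>{0..T}. snd X (w t))"


section \<open>Fourier transform and Sobolev-type spaces\<close>

type_synonym plane = "real \<times> real"

definition square_integrable :: "(plane \<Rightarrow> complex) \<Rightarrow> bool" where
  "square_integrable u \<longleftrightarrow>
    u \<in> borel_measurable lborel \<and> integrable lborel (\<lambda>z. (cmod (u z))\<^sup>2)"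

text \<open>
  The unitary Fourier transform on \<open>L\<^sup>2\<close>, with kernel \<open>e\<^bsup>-i(x\<xi>+y\<eta>)\<^esup> / (2\<pi>)\<close>, as the \<open>L\<^sup>2\<close>-limit of
  the transforms of the truncations of \<open>u\<close> to balls. By Plancherel's theorem every
  square integrable \<open>u\<close> has such a transform \<open>g\<close>, and \<open>g\<close> is unique almost everywhere.
\<close>

definition truncated_fourier :: "real \<Rightarrow> (plane \<Rightarrow> complex) \<Rightarrow> plane \<Rightarrow> complex" where
  "truncated_fourier R u \<zeta> =
    complex_of_real (1 / (2 * pi)) *
      (LINT z:cball 0 R|lborel. exp (- (\<i> * complex_of_real (z \<bullet> \<zeta>))) * u z)"

definition has_fourier :: "(plane \<Rightarrow> complex) \<Rightarrow> (plane \<Rightarrow> complex) \<Rightarrow> bool" where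
  "has_fourier u g \<longleftrightarrow> square_integrable u \<and> square_integrable g \<and>
    ((\<lambda>R. \<integral>\<^sup>+\<zeta>. ennreal ((cmod (truncated_fourier R u \<zeta> - g \<zeta>))\<^sup>2) \<partial>lborel) \<longlongrightarrow> 0) at_top"

definition fourier :: "(plane \<Rightarrow> complex) \<Rightarrow> plane \<Rightarrow> complex" where
  "fourier u = (SOME g. has_fourier u g)"

text \<open>
  \<open>mult_in_Hs m s u\<close> says that \<open>u \<in> L\<^sup>2\<close> and that \<open>m(D)u\<close>, the tempered distribution with Fourier
  transform \<open>m \<cdot> fourier u\<close>, lies in \<open>H\<^sup>s\<close>; \<open>mult_Hs_norm m s u\<close> is its \<open>H\<^sup>s\<close> norm.
\<close>

definition mult_in_Hs :: "(plane \<Rightarrow> real) \<Rightarrow> real \<Rightarrow> (plane \<Rightarrow> complex) \<Rightarrow> bool" where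
  "mult_in_Hs m s u \<longleftrightarrow> (\<exists>g. has_fourier u g \<and>
     square_integrable (\<lambda>\<zeta>. complex_of_real ((1 + (norm \<zeta>)\<^sup>2) powr (s / 2) * m \<zeta>) * g \<zeta>))"

definition mult_Hs_norm :: "(plane \<Rightarrow> real) \<Rightarrow> real \<Rightarrow> (plane \<Rightarrow> complex) \<Rightarrow> real" where
  "mult_Hs_norm m s u =
     sqrt (\<integral>\<zeta>. ((1 + (norm \<zeta>)\<^sup>2) powr (s / 2) * m \<zeta> * cmod (fourier u \<zeta>))\<^sup>2 \<partial>lborel)"

text \<open>The value \<open>0 powr b = 0\<close> on the coordinate axes affects only a null set of frequencies.\<close>

definition symb_xy :: "real \<Rightarrow> plane \<Rightarrow> real" where
  "symb_xy a = (\<lambda>(\<xi>, \<eta>). \<bar>\<xi>\<bar> powr a * \<bar>\<eta>\<bar> powr (- a))"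

definition symb_yx :: "real \<Rightarrow> plane \<Rightarrow> real" where
  "symb_yx a = (\<lambda>(\<xi>, \<eta>). \<bar>\<eta>\<bar> powr a * \<bar>\<xi>\<bar> powr (- a))"

text \<open>
  \<open>K\<close> is the set of scalars, \<open>\<real>\<close> or \<open>\<complex>\<close>, in which the functions take their values. In both cases
  the spaces are regarded as real vector spaces (Frechet derivatives are real-linear).
\<close>

definition Hsa :: "complex set \<Rightarrow> real \<Rightarrow> real \<Rightarrow> (plane \<Rightarrow> complex) seminormed" where
  "Hsa K s a =
    ({u. square_integrable u \<and> (\<forall>z. u z \<in> K)
        \<and> mult_in_Hs (symb_xy a) s u \<and> mult_in_Hs (symb_yx a) s u},
     \<lambda>u. mult_Hs_norm (symb_xy a) s u + mult_Hs_norm (symb_yx a) s u)"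

definition Hk :: "complex set \<Rightarrow> nat \<Rightarrow> (plane \<Rightarrow> complex) seminormed" where
  "Hk K k =
    ({u. square_integrable u \<and> (\<forall>z. u z \<in> K) \<and> mult_in_Hs (\<lambda>_. 1) (real k) u},
     \<lambda>u. mult_Hs_norm (\<lambda>_. 1) (real k) u)"


section \<open>The Cauchy problem\<close>

text \<open>\<open>D j k\<close> is the partial derivative of order \<open>j\<close> in \<open>x\<close> and \<open>k\<close> in \<open>y\<close>.\<close>

definition schwartz :: "(plane \<Rightarrow> complex) \<Rightarrow> bool" where
  "schwartz f \<longleftrightarrow> (\<exists>D :: nat \<Rightarrow> nat \<Rightarrow> plane \<Rightarrow> complex. D 0 0 = f \<and>
     (\<forall>j k x y.
        ((\<lambda>x. D j k (x, y)) has_vector_derivative D (Suc j) k (x, y)) (at x) \<and>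
        ((\<lambda>y. D j k (x, y)) has_vector_derivative D j (Suc k) (x, y)) (at y)) \<and>
     (\<forall>j k n. \<exists>C. \<forall>z. (1 + norm z) ^ n * cmod (D j k z) \<le> C))"

text \<open>
  \<open>v\<close> is of class \<open>C\<^sup>\<infinity>\<close> on \<open>[0,T] \<times> \<real>\<^sup>2\<close>: all partial derivatives \<open>D i j k\<close>, of order \<open>i\<close> in \<open>t\<close>, \<open>j\<close> in
  \<open>x\<close> and \<open>k\<close> in \<open>y\<close>, exist and are jointly continuous (one-sided in \<open>t\<close> at \<open>0\<close> and \<open>T\<close>).
\<close>

definition smooth_slab :: "real \<Rightarrow> (real \<Rightarrow> plane \<Rightarrow> complex) \<Rightarrow> bool" where
  "smooth_slab T v \<longleftrightarrow> (\<exists>D :: nat \<Rightarrow> nat \<Rightarrow> nat \<Rightarrow> real \<Rightarrow> plane \<Rightarrow> complex.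
     (\<forall>t\<in>{0..T}. D 0 0 0 t = v t) \<and>
     (\<forall>i j k. continuous_on ({0..T} \<times> UNIV) (\<lambda>(t, z). D i j k t z) \<and>
       (\<forall>t\<in>{0..T}. \<forall>x y.
          ((\<lambda>\<tau>. D i j k \<tau> (x, y)) has_vector_derivative D (Suc i) j k t (x, y)) (at t within {0..T}) \<and>
          ((\<lambda>x. D i j k t (x, y)) has_vector_derivative D i (Suc j) k t (x, y)) (at x) \<and>
          ((\<lambda>y. D i j k t (x, y)) has_vector_derivative D i j (Suc k) t (x, y)) (at y))))"

definition dx :: "(plane \<Rightarrow> complex) \<Rightarrow> plane \<Rightarrow> complex" where
  "dx f = (\<lambda>(x, y). vector_derivative (\<lambda>x. f (x, y)) (at x))"

definition dy :: "(plane \<Rightarrow> complex) \<Rightarrow> plane \<Rightarrow> complex" where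
  "dy f = (\<lambda>(x, y). vector_derivative (\<lambda>y. f (x, y)) (at y))"

definition smooth_solution ::
  "complex set \<Rightarrow> real \<Rightarrow> (plane \<Rightarrow> complex) \<Rightarrow> (real \<Rightarrow> plane \<Rightarrow> complex) \<Rightarrow> bool" where
  "smooth_solution K T v0 v \<longleftrightarrow>
     smooth_slab T v \<and>
     (\<forall>k. v \<in> fst (C_space T (Hk K k))) \<and>
     v 0 = v0 \<and>
     (\<forall>t\<in>{0..T}. \<forall>z.
        vector_derivative (\<lambda>\<tau>. v \<tau> z) (at t within {0..T})
        + (dx (dx (dx (v t))) z + dy (dy (dy (v t))) z)
        + (dx (\<lambda>w. (v t w) ^ 3) z + dy (\<lambda>w. (v t w) ^ 3) z) = 0)"

text \<open>
  \<open>S\<close> gives the data-to-solution map on the \<open>\<delta>\<close>-ball of \<open>H\<^bsup>s,a\<^esup>\<close>; since \<open>S v0 t\<close> represents an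
  element of \<open>L\<^sup>2\<close>, the identity \<open>S v0 = v\<close> is equality almost everywhere at each time.
\<close>

definition data_to_solution ::
  "complex set \<Rightarrow> real \<Rightarrow> real \<Rightarrow> real \<Rightarrow> real
    \<Rightarrow> ((plane \<Rightarrow> complex) \<Rightarrow> real \<Rightarrow> plane \<Rightarrow> complex) \<Rightarrow> bool" where
  "data_to_solution K s a T \<delta> S \<longleftrightarrow>
     (\<forall>v0 \<in> open_ball0 (Hsa K s a) \<delta>. S v0 \<in> fst (C_space T (Hsa K s a))) \<and>
     (\<forall>v0 v. v0 \<in> open_ball0 (Hsa K s a) \<delta> \<and> schwartz v0 \<and> smooth_solution K T v0 v \<longrightarrow>
        (\<forall>t\<in>{0..T}. AE z in lborel. S v0 t z = v t z))"

end

theory Submission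
  imports Defs "HOL-Probability.Characteristic_Functions" "HOL-Probability.Sinc_Integral"
begin

text \<open>
  If \<open>S\<close> is \<open>C\<^sup>3\<close>, the coefficient of \<open>h\<^sup>3\<close> in any scalar functional of \<open>S (h \<phi>)\<close> is at most a constant
  times the norm of the functional times the cube of the norm of \<open>\<phi>\<close>. For small \<open>h\<close> and \<open>\<phi>\<close> with smooth
  compactly supported spectrum, a smooth solution with initial value \<open>h \<phi>\<close> exists on all of \<open>[0,T]\<close>:
  it is a fixed point of the Duhamel formula in a space of spectra with an exponential weight whose rate
  shrinks in time. Hence the cubic coefficient of \<open>S\<close> is the cubic Picard iterate.

  Take \<open>\<phi>\<close> with spectrum concentrated near the four points \<open>(\<plusminus>N, \<plusminus>3)\<close>, in boxes of width
  \<open>\<gamma> = N\<^bsup>-1/2\<^esup>\<close> in \<open>\<xi>\<close> and \<open>1\<close> in \<open>\<eta>\<close>; its norm has order \<open>N\<^bsup>s+a\<^esup> \<gamma>\<^bsup>1/2\<^esup>\<close>. Since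
  \<open>a\<^sup>3 + b\<^sup>3 + c\<^sup>3 - (a + b + c)\<^sup>3 = -3 (a + b) (b + c) (c + a)\<close>, the phase of the interactions with output
  near \<open>(N, 3)\<close> is bounded, so for small \<open>t\<close> the iterate has size at least of order \<open>t N \<gamma>\<^sup>2\<close> there.
  Testing against this box gives \<open>t N \<gamma>\<^sup>3 \<lesssim> N\<^bsup>2(s+a)\<^esup> \<gamma>\<^sup>2\<close>, that is
  \<open>N\<^bsup>1/2 - 2(s+a)\<^esup> \<lesssim> 1/t\<close>, which fails for large \<open>N\<close> when \<open>s + a < 1/4\<close>.
\<close>

section \<open>Calculus in seminormed spaces\<close>

section \<open>The cubic coefficient of a \<open>C\<^sup>3\<close> map\<close>

text \<open>The hypothesis on \<open>S\<close> speaks only about Schwartz data that have a smooth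
  solution on all of [0,T], so such solutions must be produced. The construction may be crude: the
  smallness of h may depend on N, because the bound drawn from \<open>C3_map\<close> concerns a
  Taylor coefficient at the origin and is uniform in the direction. Hence exponential weights
  suffice, and the derivative in the nonlinearity is absorbed as in the Cauchy-Kovalevskaya theorem.

  The four centres are symmetric under \<zeta> \<mapsto> -\<zeta>, so the data are real and both
  scalar fields are treated at once. They reproduce themselves through N + N - N = N and 3 + 3 - 3 =
  3. Staying near \<plusminus>3 in \<eta> keeps the powers of |\<eta>| in the norm bounded above and
  below, and lets the \<eta> part of the phase stay bounded with width 1. In \<xi> the phase has
  size N \<gamma>^2, so N^(-1/2) is, up to constants, the largest width without oscillation; a
  larger width gives a stronger inequality, since testing yields N \<gamma> \<lesssim> N^(2(s+a)) /
  t.\<close>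

definition seminormed_space :: "'a::real_vector seminormed \<Rightarrow> bool" where
  "seminormed_space X \<longleftrightarrow> 0 \<in> fst X
     \<and> (\<forall>u\<in>fst X. \<forall>v\<in>fst X. u + v \<in> fst X \<and> snd X (u + v) \<le> snd X u + snd X v)
     \<and> (\<forall>c. \<forall>u\<in>fst X. c *\<^sub>R u \<in> fst X \<and> snd X (c *\<^sub>R u) = \<bar>c\<bar> * snd X u)"

lemma seminormed_spaceD:
  assumes "seminormed_space X"
  shows "0 \<in> fst X"
    and "u \<in> fst X \<Longrightarrow> v \<in> fst X \<Longrightarrow> u + v \<in> fst X"
    and "u \<in> fst X \<Longrightarrow> v \<in> fst X \<Longrightarrow> snd X (u + v) \<le> snd X u + snd X v"
    and "u \<in> fst X \<Longrightarrow> c *\<^sub>R u \<in> fst X"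
    and "u \<in> fst X \<Longrightarrow> snd X (c *\<^sub>R u) = \<bar>c\<bar> * snd X u"
  using assms unfolding seminormed_space_def by blast+

lemma seminormed_space_more:
  assumes X: "seminormed_space X"
  shows "snd X 0 = 0"
    and "u \<in> fst X \<Longrightarrow> - u \<in> fst X"
    and "u \<in> fst X \<Longrightarrow> snd X (- u) = snd X u"
    and "u \<in> fst X \<Longrightarrow> v \<in> fst X \<Longrightarrow> u - v \<in> fst X"
    and "u \<in> fst X \<Longrightarrow> v \<in> fst X \<Longrightarrow> snd X (u - v) \<le> snd X u + snd X v"
    and "u \<in> fst X \<Longrightarrow> 0 \<le> snd X u"
    and "u \<in> fst X \<Longrightarrow> v \<in> fst X \<Longrightarrow> snd X u \<le> snd X v + snd X (u - v)"
proof -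
  show z: "snd X 0 = 0"
    using seminormed_spaceD(5)[OF X seminormed_spaceD(1)[OF X], of 0] by simp
  show m: "- u \<in> fst X" if "u \<in> fst X" for u
    using seminormed_spaceD(4)[OF X that, of "-1"] by simp
  show mn: "snd X (- u) = snd X u" if "u \<in> fst X" for u
    using seminormed_spaceD(5)[OF X that, of "-1"] by simp
  show d: "u - v \<in> fst X" if "u \<in> fst X" "v \<in> fst X" for u v
    using seminormed_spaceD(2)[OF X that(1) m[OF that(2)]] by simp
  show "snd X (u - v) \<le> snd X u + snd X v" if "u \<in> fst X" "v \<in> fst X" for u v
    using seminormed_spaceD(3)[OF X that(1) m[OF that(2)]] mn[OF that(2)] by simp
  show "0 \<le> snd X u" if "u \<in> fst X"
    using seminormed_spaceD(3)[OF X that m[OF that]] z mn[OF that] by simp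
  show "snd X u \<le> snd X v + snd X (u - v)" if "u \<in> fst X" "v \<in> fst X"
    using seminormed_spaceD(3)[OF X that(2) d[OF that]] by simp
qed

lemma fst_lin_maps_iff:
  "L \<in> fst (lin_maps X Y) \<longleftrightarrow> (\<forall>h\<in>fst X. L h \<in> fst Y)
       \<and> (\<forall>h\<in>fst X. \<forall>k\<in>fst X. snd Y (L (h + k) - (L h + L k)) = 0)
       \<and> (\<forall>c. \<forall>h\<in>fst X. snd Y (L (c *\<^sub>R h) - c *\<^sub>R L h) = 0)
       \<and> (\<exists>C. \<forall>h\<in>fst X. snd Y (L h) \<le> C * snd X h)"
  by (simp add: lin_maps_def)

lemma lin_maps_bdd:
  assumes X: "seminormed_space X" and Y: "seminormed_space Y" and L: "L \<in> fst (lin_maps X Y)"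
  shows "bdd_above ((\<lambda>h. snd Y (L h)) ` {h \<in> fst X. snd X h \<le> 1})"
proof -
  obtain C where C: "\<And>h. h \<in> fst X \<Longrightarrow> snd Y (L h) \<le> C * snd X h"
    using L unfolding fst_lin_maps_iff by blast
  have "snd Y (L h) \<le> \<bar>C\<bar>" if h: "h \<in> fst X" "snd X h \<le> 1" for h
  proof -
    have "C * snd X h \<le> \<bar>C\<bar> * 1"
      by (rule mult_mono) (use h seminormed_space_more(6)[OF X] in auto)
    with C[OF h(1)] show ?thesis by simp
  qed
  then show ?thesis by (intro bdd_aboveI2[of _ _ "\<bar>C\<bar>"]) auto
qed

text \<open>For h of positive seminorm, scale to the unit ball; linearity holds only up to a null
  element, which the triangle inequality discards. Scaling fails for null h, but there the constant
  in the definition of a bounded map forces the image to be null as well.\<close>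

lemma lin_maps_norm_bound:
  assumes X: "seminormed_space X" and Y: "seminormed_space Y"
    and L: "L \<in> fst (lin_maps X Y)" and h: "h \<in> fst X"
  shows "snd Y (L h) \<le> snd (lin_maps X Y) L * snd X h"
proof (cases "snd X h = 0")
  case True
  obtain C where C: "\<And>h. h \<in> fst X \<Longrightarrow> snd Y (L h) \<le> C * snd X h"
    using L unfolding fst_lin_maps_iff by blast
  from C[OF h] True show ?thesis by simp
next
  case False
  define p where "p = snd X h"
  have p: "p > 0" using False seminormed_space_more(6)[OF X h] by (simp add: p_def)
  define k where "k = (1 / p) *\<^sub>R h"
  have k: "k \<in> fst X" "snd X k \<le> 1"
    using seminormed_spaceD(4,5)[OF X h, of "1/p"] p by (auto simp: k_def p_def)
  have hk: "h = p *\<^sub>R k" using p by (simp add: k_def)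
  have LY: "\<And>h. h \<in> fst X \<Longrightarrow> L h \<in> fst Y" using L unfolding fst_lin_maps_iff by blast
  have z: "snd Y (L (p *\<^sub>R k) - p *\<^sub>R L k) = 0"
    using L k unfolding fst_lin_maps_iff by blast
  have "snd Y (L h) \<le> snd Y (p *\<^sub>R L k) + snd Y (L h - p *\<^sub>R L k)"
    using seminormed_space_more(7)[OF Y LY[OF h] seminormed_spaceD(4)[OF Y LY[OF k(1)]]] .
  also have "\<dots> = p * snd Y (L k)"
    using z seminormed_spaceD(5)[OF Y LY[OF k(1)], of p] p by (simp add: hk[symmetric])
  also have "snd Y (L k) \<le> snd (lin_maps X Y) L"
    unfolding lin_maps_def snd_conv by (rule cSUP_upper) (use k lin_maps_bdd[OF X Y L] in auto)
  finally show ?thesis using p by (simp add: p_def mult.commute)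
qed

text \<open>Linearity modulo null elements survives sums because a sum of null elements is null. The
  unit ball contains 0, so the suprema over it are taken over nonempty sets.\<close>

lemma seminormed_space_lin_maps:
  assumes X: "seminormed_space X" and Y: "seminormed_space Y"
  shows "seminormed_space (lin_maps X Y)"
proof -
  note Y0 = seminormed_space_more[OF Y] and YD = seminormed_spaceD[OF Y]
  note XD = seminormed_spaceD[OF X]
  have ne: "{h \<in> fst X. snd X h \<le> 1} \<noteq> {}"
    using XD(1) seminormed_space_more(1)[OF X] by auto
  have null_add: "snd Y (u + v) = 0"
    if "snd Y u = 0" "snd Y v = 0" "u \<in> fst Y" "v \<in> fst Y" for u v
    using YD(3)[OF that(3,4)] Y0(6)[OF YD(2)[OF that(3,4)]] that by simp
  have in0: "0 \<in> fst (lin_maps X Y)"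
    unfolding fst_lin_maps_iff using Y0(1) YD(1)
    by (auto simp: zero_fun_def intro!: exI[of _ 0])
  have add: "L + M \<in> fst (lin_maps X Y) \<and>
      snd (lin_maps X Y) (L + M) \<le> snd (lin_maps X Y) L + snd (lin_maps X Y) M"
    if L: "L \<in> fst (lin_maps X Y)" and M: "M \<in> fst (lin_maps X Y)" for L M
  proof
    have LY: "\<And>h. h \<in> fst X \<Longrightarrow> L h \<in> fst Y" and MY: "\<And>h. h \<in> fst X \<Longrightarrow> M h \<in> fst Y"
      using L M unfolding fst_lin_maps_iff by blast+
    obtain C D where C: "\<And>h. h \<in> fst X \<Longrightarrow> snd Y (L h) \<le> C * snd X h"
      and D: "\<And>h. h \<in> fst X \<Longrightarrow> snd Y (M h) \<le> D * snd X h"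
      using L M unfolding fst_lin_maps_iff by meson
    have 1: "snd Y ((L + M) (h + k) - ((L + M) h + (L + M) k)) = 0"
      if "h \<in> fst X" "k \<in> fst X" for h k
    proof -
      have "snd Y (L (h + k) - (L h + L k)) = 0" "snd Y (M (h + k) - (M h + M k)) = 0"
        using L M that unfolding fst_lin_maps_iff by blast+
      then have "snd Y ((L (h + k) - (L h + L k)) + (M (h + k) - (M h + M k))) = 0"
        by (rule null_add) (intro Y0(4) YD(2) LY MY XD(2) that)+
      then show ?thesis by (simp add: algebra_simps)
    qed
    have 2: "snd Y ((L + M) (c *\<^sub>R h) - c *\<^sub>R (L + M) h) = 0" if "h \<in> fst X" for h c
    proof -
      have "snd Y (L (c *\<^sub>R h) - c *\<^sub>R L h) = 0" "snd Y (M (c *\<^sub>R h) - c *\<^sub>R M h) = 0"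
        using L M that unfolding fst_lin_maps_iff by blast+
      then have "snd Y ((L (c *\<^sub>R h) - c *\<^sub>R L h) + (M (c *\<^sub>R h) - c *\<^sub>R M h)) = 0"
        by (rule null_add) (intro Y0(4) YD(4) LY MY XD(4) that)+
      then show ?thesis by (simp add: algebra_simps)
    qed
    have 3: "snd Y ((L + M) h) \<le> (C + D) * snd X h" if "h \<in> fst X" for h
      using YD(3)[OF LY[OF that] MY[OF that]] C[OF that] D[OF that] by (simp add: algebra_simps)
    show LM: "L + M \<in> fst (lin_maps X Y)"
      unfolding fst_lin_maps_iff
      by (intro conjI ballI allI exI[of _ "C + D"] 1 2 3) (use LY MY YD(2) in auto)
    show "snd (lin_maps X Y) (L + M) \<le> snd (lin_maps X Y) L + snd (lin_maps X Y) M"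
      unfolding lin_maps_def snd_conv
    proof (rule cSUP_least[OF ne])
      fix h assume "h \<in> {h \<in> fst X. snd X h \<le> 1}"
      then have h: "h \<in> fst X" "snd X h \<le> 1" by auto
      have "snd Y ((L + M) h) \<le> snd Y (L h) + snd Y (M h)"
        using YD(3)[OF LY[OF h(1)] MY[OF h(1)]] by simp
      also have "\<dots> \<le> (SUP h\<in>{h \<in> fst X. snd X h \<le> 1}. snd Y (L h)) +
          (SUP h\<in>{h \<in> fst X. snd X h \<le> 1}. snd Y (M h))"
        by (intro add_mono cSUP_upper lin_maps_bdd[OF X Y] L M) (use h in auto)
      finally show "snd Y ((L + M) h) \<le> \<dots>" .
    qed
  qed
  have scale: "c *\<^sub>R L \<in> fst (lin_maps X Y) \<and>
      snd (lin_maps X Y) (c *\<^sub>R L) \<le> \<bar>c\<bar> * snd (lin_maps X Y) L"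
    if L: "L \<in> fst (lin_maps X Y)" for L c
  proof
    have LY: "\<And>h. h \<in> fst X \<Longrightarrow> L h \<in> fst Y"
      using L unfolding fst_lin_maps_iff by blast
    obtain C where C: "\<And>h. h \<in> fst X \<Longrightarrow> snd Y (L h) \<le> C * snd X h"
      using L unfolding fst_lin_maps_iff by meson
    have 1: "snd Y ((c *\<^sub>R L) (h + k) - ((c *\<^sub>R L) h + (c *\<^sub>R L) k)) = 0"
      if "h \<in> fst X" "k \<in> fst X" for h k
    proof -
      have "snd Y (L (h + k) - (L h + L k)) = 0" using L that unfolding fst_lin_maps_iff by blast
      then have "snd Y (c *\<^sub>R (L (h + k) - (L h + L k))) = 0"
        by (subst YD(5)) (auto intro!: Y0(4) YD(2) LY XD(2) that)
      then show ?thesis by (simp add: scaleR_fun_def algebra_simps)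
    qed
    have 2: "snd Y ((c *\<^sub>R L) (d *\<^sub>R h) - d *\<^sub>R (c *\<^sub>R L) h) = 0" if "h \<in> fst X" for h d
    proof -
      have "snd Y (L (d *\<^sub>R h) - d *\<^sub>R L h) = 0" using L that unfolding fst_lin_maps_iff by blast
      then have "snd Y (c *\<^sub>R (L (d *\<^sub>R h) - d *\<^sub>R L h)) = 0"
        by (subst YD(5)) (auto intro!: Y0(4) YD(4) LY XD(4) that)
      then show ?thesis by (simp add: scaleR_fun_def algebra_simps)
    qed
    have 3: "snd Y ((c *\<^sub>R L) h) \<le> (\<bar>c\<bar> * C) * snd X h" if "h \<in> fst X" for h
      using YD(5)[OF LY[OF that], of c] mult_left_mono[OF C[OF that], of "\<bar>c\<bar>"]
      by (simp add: scaleR_fun_def mult.assoc)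
    show "c *\<^sub>R L \<in> fst (lin_maps X Y)"
      unfolding fst_lin_maps_iff
      by (intro conjI ballI allI exI[of _ "\<bar>c\<bar> * C"] 1 2 3) (use LY YD(4) in \<open>auto simp: scaleR_fun_def\<close>)
    show "snd (lin_maps X Y) (c *\<^sub>R L) \<le> \<bar>c\<bar> * snd (lin_maps X Y) L"
      unfolding lin_maps_def snd_conv
    proof (rule cSUP_least[OF ne])
      fix h assume "h \<in> {h \<in> fst X. snd X h \<le> 1}"
      then have h: "h \<in> fst X" "snd X h \<le> 1" by auto
      have "snd Y ((c *\<^sub>R L) h) = \<bar>c\<bar> * snd Y (L h)"
        using YD(5)[OF LY[OF h(1)]] by (simp add: scaleR_fun_def)
      also have "\<dots> \<le> \<bar>c\<bar> * (SUP h\<in>{h \<in> fst X. snd X h \<le> 1}. snd Y (L h))"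
        by (intro mult_left_mono cSUP_upper lin_maps_bdd[OF X Y] L) (use h in auto)
      finally show "snd Y ((c *\<^sub>R L) h) \<le> \<dots>" .
    qed
  qed
  \<comment> \<open>The inequality for \<open>c\<close>, applied a second time with
    \<open>1/c\<close>, gives the reverse inequality.\<close>
  have scale_eq: "snd (lin_maps X Y) (c *\<^sub>R L) = \<bar>c\<bar> * snd (lin_maps X Y) L"
    if L: "L \<in> fst (lin_maps X Y)" for L c
  proof (cases "c = 0")
    case True
    have "snd (lin_maps X Y) (0::'a \<Rightarrow> 'b) = 0"
      unfolding lin_maps_def snd_conv zero_fun_def using ne by (simp add: Y0(1))
    with True show ?thesis by simp
  next
    case False
    have "snd (lin_maps X Y) ((1/c) *\<^sub>R (c *\<^sub>R L)) \<le> \<bar>1/c\<bar> * snd (lin_maps X Y) (c *\<^sub>R L)"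
      using scale scale[OF L] by blast
    then have "\<bar>c\<bar> * snd (lin_maps X Y) L \<le> snd (lin_maps X Y) (c *\<^sub>R L)"
      using False by (simp add: field_simps)
    with scale[OF L, of c] show ?thesis by simp
  qed
  show ?thesis unfolding seminormed_space_def using in0 add scale scale_eq by blast
qed

text \<open>The constant \<open>C\<close> is recorded because its dependence on N enters the final
  inequality. The bound makes \<open>l\<close> vanish on null elements, so exact linearity of
  \<open>l\<close> is compatible with operators that are linear only modulo null elements.\<close>

definition bounded_functional :: "'a::real_vector seminormed \<Rightarrow> ('a \<Rightarrow> real) \<Rightarrow> real \<Rightarrow> bool" where
  "bounded_functional X l C \<longleftrightarrow> 0 \<le> C
     \<and> (\<forall>u\<in>fst X. \<forall>v\<in>fst X. l (u + v) = l u + l v)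
     \<and> (\<forall>c. \<forall>u\<in>fst X. l (c *\<^sub>R u) = c * l u)
     \<and> (\<forall>u\<in>fst X. \<bar>l u\<bar> \<le> C * snd X u)"

lemma bounded_functionalD:
  assumes "bounded_functional X l C"
  shows "0 \<le> C"
    and "u \<in> fst X \<Longrightarrow> v \<in> fst X \<Longrightarrow> l (u + v) = l u + l v"
    and "u \<in> fst X \<Longrightarrow> l (c *\<^sub>R u) = c * l u"
    and "u \<in> fst X \<Longrightarrow> \<bar>l u\<bar> \<le> C * snd X u"
  using assms unfolding bounded_functional_def by blast+

lemma bounded_functional_diff:
  assumes X: "seminormed_space X" and l: "bounded_functional X l C" and uv: "u \<in> fst X" "v \<in> fst X"
  shows "l (u - v) = l u - l v"
  using bounded_functionalD(2)[OF l seminormed_space_more(4)[OF X uv] uv(2)] by simp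

text \<open>Evaluation in a direction turns a functional on the target into one on the space of
  operators, at the cost of one factor of the norm of the direction. Three applications reduce the
  third derivative to a scalar.\<close>

lemma bounded_functional_eval:
  assumes X: "seminormed_space X" and Y: "seminormed_space Y"
    and l: "bounded_functional Y l C" and h: "h \<in> fst X"
  shows "bounded_functional (lin_maps X Y) (\<lambda>L. l (L h)) (C * snd X h)"
proof -
  have LY: "L h \<in> fst Y" if "L \<in> fst (lin_maps X Y)" for L
    using that h unfolding fst_lin_maps_iff by blast
  have "\<bar>l (L h)\<bar> \<le> C * snd X h * snd (lin_maps X Y) L" if L: "L \<in> fst (lin_maps X Y)" for L
  proof -
    have "\<bar>l (L h)\<bar> \<le> C * snd Y (L h)" by (rule bounded_functionalD(4)[OF l LY[OF L]])
    also have "\<dots> \<le> C * (snd (lin_maps X Y) L * snd X h)"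
      by (intro mult_left_mono lin_maps_norm_bound X Y L h bounded_functionalD(1)[OF l])
    finally show ?thesis by (simp add: algebra_simps)
  qed
  then show ?thesis
    unfolding bounded_functional_def
    using bounded_functionalD[OF l] LY seminormed_space_more(6)[OF X h]
    by (auto simp: scaleR_fun_def)
qed

text \<open>The scalar chain rule along a ray. It applies in the same form to the derivatives
  themselves, since spaces of operators are again seminormed spaces and evaluations are again
  bounded functionals.\<close>

lemma frechet_deriv_along_line:
  assumes X: "seminormed_space X" and Y: "seminormed_space Y"
    and F: "has_frechet_deriv X (open_ball0 X \<delta>) Y F F'"
    and l: "bounded_functional Y l C" and \<phi>: "\<phi> \<in> fst X" and r: "\<bar>r\<bar> * snd X \<phi> < \<delta>"
  shows "((\<lambda>r. l (F (r *\<^sub>R \<phi>))) has_real_derivative l (F' (r *\<^sub>R \<phi>) \<phi>)) (at r)"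
  unfolding DERIV_def
proof (rule LIM_I)
  fix e :: real assume e: "e > 0"
  define p where "p = snd X \<phi>"
  have p: "p \<ge> 0" using seminormed_space_more(6)[OF X \<phi>] by (simp add: p_def)
  have C: "C \<ge> 0" using bounded_functionalD(1)[OF l] .
  have inb: "q *\<^sub>R \<phi> \<in> open_ball0 X \<delta>" if "\<bar>q\<bar> * p < \<delta>" for q
    using seminormed_spaceD(4,5)[OF X \<phi>, of q] that by (simp add: open_ball0_def p_def)
  define u where "u = r *\<^sub>R \<phi>"
  have u: "u \<in> open_ball0 X \<delta>" unfolding u_def using inb r by (simp add: p_def)
  \<comment> \<open>Dominates \<open>C * p\<close> and stays positive when \<open>C\<close> or
    \<open>p\<close> vanishes, so that dividing by it is harmless.\<close>
  define q where "q = (C + 1) * (p + 1)"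
  have q: "q > 0" "C * p \<le> q" using C p mult_nonneg_nonneg[OF C p] unfolding q_def
    by (simp, simp add: algebra_simps)
  define \<epsilon> where "\<epsilon> = e / 2 / q"
  have \<epsilon>: "\<epsilon> > 0" using e q by (simp add: \<epsilon>_def)
  obtain d where d: "d > 0" "\<And>h. h \<in> fst X \<Longrightarrow> u + h \<in> open_ball0 X \<delta> \<Longrightarrow> snd X h < d \<Longrightarrow>
      snd Y (F (u + h) - F u - F' u h) \<le> \<epsilon> * snd X h"
    using F u \<epsilon> unfolding has_frechet_deriv_def by meson
  \<comment> \<open>Keeps \<open>\<bar>k\<bar> * p\<close> below the Frechet radius and below the
    room left inside the ball; \<open>p + 1\<close> covers the case \<open>p = 0\<close>.\<close>
  define s where "s = min d (\<delta> - \<bar>r\<bar> * p) / (p + 1)"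
  have s: "s > 0" using d r p by (simp add: s_def p_def)
  show "\<exists>s>0. \<forall>k. k \<noteq> 0 \<and> norm (k - 0) < s \<longrightarrow>
     norm ((l (F ((r + k) *\<^sub>R \<phi>)) - l (F (r *\<^sub>R \<phi>))) / k - l (F' (r *\<^sub>R \<phi>) \<phi>)) < e"
  proof (intro exI[of _ s] conjI s allI impI)
    fix k :: real assume "k \<noteq> 0 \<and> norm (k - 0) < s"
    then have k: "k \<noteq> 0" "\<bar>k\<bar> < s" by auto
    have "\<bar>k\<bar> * (p + 1) < s * (p + 1)" using k(2) p by (intro mult_strict_right_mono) auto
    moreover have "\<bar>k\<bar> * p \<le> \<bar>k\<bar> * (p + 1)" by (intro mult_left_mono) auto
    ultimately have kp: "\<bar>k\<bar> * p < min d (\<delta> - \<bar>r\<bar> * p)" using p by (simp add: s_def)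
    have "\<bar>r + k\<bar> * p \<le> \<bar>r\<bar> * p + \<bar>k\<bar> * p"
      using mult_right_mono[OF abs_triangle_ineq p, of r k] by (simp add: algebra_simps)
    with kp have rk: "\<bar>r + k\<bar> * p < \<delta>" by simp
    define h where "h = k *\<^sub>R \<phi>"
    have h: "h \<in> fst X" "snd X h = \<bar>k\<bar> * p"
      using seminormed_spaceD(4,5)[OF X \<phi>, of k] by (auto simp: h_def p_def)
    have uh: "u + h = (r + k) *\<^sub>R \<phi>" by (simp add: u_def h_def scaleR_add_left)
    have uhb: "u + h \<in> open_ball0 X \<delta>" unfolding uh using inb rk .
    have FY: "F (u + h) \<in> fst Y" "F u \<in> fst Y" and L: "F' u \<in> fst (lin_maps X Y)"
      using F u uhb unfolding has_frechet_deriv_def by blast+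
    have LY: "F' u h \<in> fst Y" "F' u \<phi> \<in> fst Y" using L h(1) \<phi> unfolding fst_lin_maps_iff by blast+
    \<comment> \<open>Homogeneity of \<open>F' u\<close> holds only modulo null elements; the
      functional does not see the error.\<close>
    have "snd Y (F' u h - k *\<^sub>R F' u \<phi>) = 0"
      using L \<phi> unfolding fst_lin_maps_iff h_def by blast
    then have "\<bar>l (F' u h - k *\<^sub>R F' u \<phi>)\<bar> \<le> C * 0"
      using bounded_functionalD(4)[OF l seminormed_space_more(4)[OF Y LY(1) seminormed_spaceD(4)[OF Y LY(2)]], of k]
      by simp
    then have lin: "l (F' u h) = k * l (F' u \<phi>)"
      using bounded_functional_diff[OF Y l LY(1) seminormed_spaceD(4)[OF Y LY(2)], of k]
        bounded_functionalD(3)[OF l LY(2)] by simp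
    have "\<bar>l (F (u + h) - F u - F' u h)\<bar> \<le> C * snd Y (F (u + h) - F u - F' u h)"
      by (intro bounded_functionalD(4)[OF l] seminormed_space_more(4)[OF Y] FY LY)
    also have "\<dots> \<le> C * (\<epsilon> * (\<bar>k\<bar> * p))"
      using d(2)[OF h(1) uhb] kp h(2) C by (intro mult_left_mono) auto
    also have "l (F (u + h) - F u - F' u h) = l (F (u + h)) - l (F u) - k * l (F' u \<phi>)"
      by (simp add: bounded_functional_diff[OF Y l] seminormed_space_more(4)[OF Y] FY LY lin)
    finally have *: "\<bar>l (F (u + h)) - l (F u) - k * l (F' u \<phi>)\<bar> \<le> C * \<epsilon> * p * \<bar>k\<bar>"
      by (simp add: algebra_simps)
    have "\<bar>(l (F (u + h)) - l (F u)) / k - l (F' u \<phi>)\<bar>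
        = \<bar>l (F (u + h)) - l (F u) - k * l (F' u \<phi>)\<bar> / \<bar>k\<bar>"
    proof -
      have "(l (F (u + h)) - l (F u)) / k - l (F' u \<phi>) = (l (F (u + h)) - l (F u) - k * l (F' u \<phi>)) / k"
        using k(1) by (simp add: diff_divide_distrib)
      then show ?thesis by (simp only: abs_divide)
    qed
    also have "\<dots> \<le> C * \<epsilon> * p" using * k(1) by (simp add: field_simps)
    also have "\<dots> = (e / 2) * (C * p / q)" by (simp add: \<epsilon>_def)
    also have "\<dots> \<le> (e / 2) * 1" using e q by (intro mult_left_mono) (auto simp: divide_simps)
    also have "\<dots> < e" using e by simp
    finally show "norm ((l (F ((r + k) *\<^sub>R \<phi>)) - l (F (r *\<^sub>R \<phi>))) / k - l (F' (r *\<^sub>R \<phi>) \<phi>)) < e"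
      unfolding uh[symmetric] u_def[symmetric] by simp
  qed
qed

text \<open>The third difference f(3h) - 3 f(2h) + 3 f(h) - f(0) annihilates quadratic polynomials,
  in particular c1 h, and turns c3 h^3 into 6 c3 h^3. Comparing with Taylor's formula and letting h
  tend to 0 gives 3/2 M, rounded up to 2 M. All sample points are nonnegative, since the expansion
  is one-sided.\<close>

lemma cubic_coefficient_bound:
  fixes f f1 f2 f3 :: "real \<Rightarrow> real"
  assumes r: "r > 0"
    and d1: "\<And>x. \<bar>x\<bar> < r \<Longrightarrow> (f has_real_derivative f1 x) (at x)"
    and d2: "\<And>x. \<bar>x\<bar> < r \<Longrightarrow> (f1 has_real_derivative f2 x) (at x)"
    and d3: "\<And>x. \<bar>x\<bar> < r \<Longrightarrow> (f2 has_real_derivative f3 x) (at x)"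
    and b: "\<And>x. \<bar>x\<bar> < r \<Longrightarrow> \<bar>f3 x\<bar> \<le> M"
    and h0: "h0 > 0" and e: "\<And>h. 0 \<le> h \<Longrightarrow> h \<le> h0 \<Longrightarrow> \<bar>f h - c1 * h - c3 * h^3\<bar> \<le> K * h^4"
  shows "\<bar>c3\<bar> \<le> 2 * M"
proof -
  have M: "M \<ge> 0" using b[of 0] r by simp
  have tay: "\<exists>t. \<bar>t\<bar> \<le> M \<and> f h = f 0 + f1 0 * h + f2 0 / 2 * h^2 + t / 6 * h^3"
    if h: "0 < h" "h < r" for h
  proof -
    define D where "D = (\<lambda>m::nat. if m = 0 then f else if m = 1 then f1 else if m = 2 then f2 else f3)"
    have "\<exists>t>0. t < h \<and> f h = (\<Sum>m<3. D m 0 / fact m * h^m) + D 3 t / fact 3 * h^3"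
    proof (rule Maclaurin)
      show "\<forall>m t. m < 3 \<and> 0 \<le> t \<and> t \<le> h \<longrightarrow> DERIV (D m) t :> D (Suc m) t"
      proof (intro allI impI)
        fix m :: nat and t :: real assume *: "m < 3 \<and> 0 \<le> t \<and> t \<le> h"
        then have t: "\<bar>t\<bar> < r" using h by auto
        have "m = 0 \<or> m = 1 \<or> m = 2" using * by auto
        then show "DERIV (D m) t :> D (Suc m) t" using d1[OF t] d2[OF t] d3[OF t] by (auto simp: D_def)
      qed
    qed (use h in \<open>auto simp: D_def\<close>)
    then obtain t where t: "0 < t" "t < h"
      "f h = (\<Sum>m<3. D m 0 / fact m * h^m) + D 3 t / fact 3 * h^3" by blast
    have "f h = f 0 + f1 0 * h + f2 0 / 2 * h^2 + f3 t / 6 * h^3"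
      using t(3) by (simp add: D_def numeral_3_eq_3 fact_numeral power2_eq_square)
    with b[of t] t h show ?thesis by (intro exI[of _ "f3 t"]) auto
  qed
  have main: "\<bar>c3\<bar> \<le> 3/2 * M + 27 * \<bar>K\<bar> * h" if h: "0 < h" "3 * h < r" "3 * h \<le> h0" for h
  proof -
    obtain t1 where t1: "\<bar>t1\<bar> \<le> M" "f h = f 0 + f1 0 * h + f2 0 / 2 * h^2 + t1 / 6 * h^3"
      using tay[of h] h by auto
    obtain t2 where t2: "\<bar>t2\<bar> \<le> M" "f (2*h) = f 0 + f1 0 * (2*h) + f2 0 / 2 * (2*h)^2 + t2 / 6 * (2*h)^3"
      using tay[of "2*h"] h by auto
    obtain t3 where t3: "\<bar>t3\<bar> \<le> M" "f (3*h) = f 0 + f1 0 * (3*h) + f2 0 / 2 * (3*h)^2 + t3 / 6 * (3*h)^3"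
      using tay[of "3*h"] h by auto
    define E where "E = (\<lambda>h. f h - c1 * h - c3 * h^3)"
    have K: "\<bar>E x\<bar> \<le> \<bar>K\<bar> * x^4" if "0 \<le> x" "x \<le> h0" for x
      using order_trans[OF e[OF that] mult_right_mono[of K "\<bar>K\<bar>" "x^4"]] by (simp add: E_def)
    have E0: "\<bar>E 0\<bar> \<le> 0" using K[of 0] h0 by simp
    have E1: "\<bar>E h\<bar> \<le> \<bar>K\<bar> * h^4" using K[of h] h by simp
    have E2: "\<bar>E (2*h)\<bar> \<le> 16 * (\<bar>K\<bar> * h^4)" using K[of "2*h"] h by (simp add: power_mult_distrib)
    have E3: "\<bar>E (3*h)\<bar> \<le> 81 * (\<bar>K\<bar> * h^4)" using K[of "3*h"] h by (simp add: power_mult_distrib)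
    \<comment> \<open>The factors are 27/6, 3 * 8/6 and 3/6; their sum 9 bounds the Taylor
      side.\<close>
    have s: "f (3*h) - 3 * f (2*h) + 3 * f h - f 0 = (9/2 * t3 - 4 * t2 + 1/2 * t1) * h^3"
      unfolding t1(2) t2(2) t3(2) by (simp add: algebra_simps power2_eq_square power3_eq_cube)
    have s2: "f (3*h) - 3 * f (2*h) + 3 * f h - f 0
       = 6 * c3 * h^3 + (E (3*h) - 3 * E (2*h) + 3 * E h - E 0)"
      by (simp add: E_def algebra_simps power2_eq_square power3_eq_cube)
    have "\<bar>(9/2 * t3 - 4 * t2 + 1/2 * t1)\<bar> \<le> 9 * M" using t1 t2 t3 by linarith
    then have a: "\<bar>(9/2 * t3 - 4 * t2 + 1/2 * t1) * h^3\<bar> \<le> 9 * M * h^3"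
      using h by (simp add: abs_mult mult_right_mono)
    have "\<bar>6 * c3 * h^3 + (E (3*h) - 3 * E (2*h) + 3 * E h - E 0)\<bar> \<le> 9 * M * h^3"
      using a unfolding s[symmetric] s2 .
    \<comment> \<open>132 = 81 + 3 * 16 + 3 collects the quartic errors at 3h, 2h and h; the error
      at 0 vanishes.\<close>
    then have "\<bar>6 * c3 * h^3\<bar> \<le> 9 * M * h^3 + 132 * (\<bar>K\<bar> * h^4)"
      using E0 E1 E2 E3 by linarith
    also have "\<dots> = (9 * M + 132 * \<bar>K\<bar> * h) * h^3" by (simp add: algebra_simps power3_eq_cube power4_eq_xxxx)
    finally have "\<bar>6 * c3\<bar> * h^3 \<le> (9 * M + 132 * \<bar>K\<bar> * h) * h^3" using h by (simp add: abs_mult)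
    then have "\<bar>6 * c3\<bar> \<le> 9 * M + 132 * \<bar>K\<bar> * h" using h by simp
    moreover have "0 \<le> \<bar>K\<bar> * h" using h by simp
    ultimately show ?thesis by linarith
  qed
  have "\<bar>c3\<bar> \<le> 3/2 * M"
  proof (rule tendsto_lowerbound)
    show "((\<lambda>h. 3/2 * M + 27 * \<bar>K\<bar> * h) \<longlongrightarrow> 3/2 * M) (at_right 0)"
      by (auto intro!: tendsto_eq_intros)
    have "eventually (\<lambda>h. h \<in> {0<..<min (r/3) (h0/3)}) (at_right (0::real))"
      using r h0 by (intro eventually_at_right_real) auto
    then show "eventually (\<lambda>h. \<bar>c3\<bar> \<le> 3/2 * M + 27 * \<bar>K\<bar> * h) (at_right 0)"
      by eventually_elim (rule main, auto)
  qed simp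
  with M show ?thesis by simp
qed

text \<open>A \<open>C\<^sup>3\<close> map has third derivative bounded near \<open>0\<close>, uniformly in the direction; this bounds the
  cubic coefficient of any scalar expansion along a line.\<close>

lemma C3_map_cubic_coefficient:
  assumes X: "seminormed_space X" and Y: "seminormed_space Y" and \<delta>: "\<delta> > 0"
    and F: "C3_map X (open_ball0 X \<delta>) Y F"
  shows "\<exists>M. \<forall>\<phi> l C c1 c3 K h0. \<phi> \<in> fst X \<longrightarrow> bounded_functional Y l C \<longrightarrow> h0 > 0 \<longrightarrow>
     (\<forall>h. 0 \<le> h \<longrightarrow> h \<le> h0 \<longrightarrow> \<bar>l (F (h *\<^sub>R \<phi>)) - c1 * h - c3 * h^3\<bar> \<le> K * h^4) \<longrightarrow>
     \<bar>c3\<bar> \<le> M * C * snd X \<phi> ^ 3"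
proof -
  let ?U = "open_ball0 X \<delta>"
  define Y1 where "Y1 = lin_maps X Y"
  define Y2 where "Y2 = lin_maps X Y1"
  define Y3 where "Y3 = lin_maps X Y2"
  have Y1: "seminormed_space Y1" and Y2: "seminormed_space Y2" and Y3: "seminormed_space Y3"
    unfolding Y1_def Y2_def Y3_def by (intro seminormed_space_lin_maps X Y)+
  obtain F1 F2 F3 where F1: "has_frechet_deriv X ?U Y F F1" and F2: "has_frechet_deriv X ?U Y1 F1 F2"
    and F3: "has_frechet_deriv X ?U Y2 F2 F3" and cF3: "C0_map X ?U Y3 F3"
    using F unfolding C3_map_def C2_map_def C1_map_def Y1_def Y2_def Y3_def by blast
  have z: "0 \<in> ?U" using seminormed_spaceD(1)[OF X] seminormed_space_more(1)[OF X] \<delta>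
    by (simp add: open_ball0_def)
  \<comment> \<open>Continuity of the third derivative at the origin bounds it in operator norm on a
    small ball, hence uniformly over all directions.\<close>
  obtain d where d: "d > 0" "\<And>w. w \<in> ?U \<Longrightarrow> snd X (w - 0) < d \<Longrightarrow> snd Y3 (F3 w - F3 0) < 1"
    using cF3 z zero_less_one unfolding C0_map_def by meson
  have in3: "F3 w \<in> fst Y3" if "w \<in> ?U" for w using cF3 that unfolding C0_map_def by blast
  define B where "B = snd Y3 (F3 0) + 1"
  have B: "snd Y3 (F3 w) \<le> B" if "w \<in> ?U" "snd X w < d" for w
    using seminormed_space_more(7)[OF Y3 in3[OF that(1)] in3[OF z]] d(2)[OF that(1)] that(2)
    by (simp add: B_def)
  show ?thesis
  proof (intro exI[of _ "2 * B"] allI impI)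
    fix \<phi> l C c1 c3 K h0
    assume \<phi>: "\<phi> \<in> fst X" and l: "bounded_functional Y l C" and h0: "h0 > (0::real)"
      and e: "\<forall>h. 0 \<le> h \<longrightarrow> h \<le> h0 \<longrightarrow> \<bar>l (F (h *\<^sub>R \<phi>)) - c1 * h - c3 * h^3\<bar> \<le> K * h^4"
    define p where "p = snd X \<phi>"
    have p: "p \<ge> 0" using seminormed_space_more(6)[OF X \<phi>] by (simp add: p_def)
    \<comment> \<open>Each evaluation at \<phi> contributes one factor \<open>p\<close>; this is
      where the cube of the norm of \<phi> comes from.\<close>
    have l1_norm: "bounded_functional Y1 (\<lambda>L. l (L \<phi>)) (C * p)"
      unfolding Y1_def p_def by (rule bounded_functional_eval[OF X Y l \<phi>])
    have l2: "bounded_functional Y2 (\<lambda>L. l (L \<phi> \<phi>)) (C * p * p)"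
      using bounded_functional_eval[OF X Y1 l1_norm \<phi>] unfolding Y2_def p_def .
    have l3: "bounded_functional Y3 (\<lambda>L. l (L \<phi> \<phi> \<phi>)) (C * p * p * p)"
      using bounded_functional_eval[OF X Y2 l2 \<phi>] unfolding Y3_def p_def .
    define r where "r = min \<delta> d / (p + 1)"
    have r: "r > 0" using \<delta> d p by (simp add: r_def)
    have small: "\<bar>x\<bar> * p < min \<delta> d" if "\<bar>x\<bar> < r" for x
    proof -
      have "\<bar>x\<bar> * p \<le> \<bar>x\<bar> * (p + 1)" by (intro mult_left_mono) auto
      also have "\<dots> < r * (p + 1)" using that p by (intro mult_strict_right_mono) auto
      finally show ?thesis using p by (simp add: r_def)
    qed
    have "\<bar>c3\<bar> \<le> 2 * (C * p * p * p * B)"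
    proof (rule cubic_coefficient_bound[OF r _ _ _ _ h0])
      fix x :: real assume x: "\<bar>x\<bar> < r"
      have x1: "\<bar>x\<bar> * snd X \<phi> < \<delta>" and x2: "\<bar>x\<bar> * snd X \<phi> < d" using small[OF x] by (auto simp: p_def)
      show "((\<lambda>r. l (F (r *\<^sub>R \<phi>))) has_real_derivative l (F1 (x *\<^sub>R \<phi>) \<phi>)) (at x)"
        by (rule frechet_deriv_along_line[OF X Y F1 l \<phi> x1])
      show "((\<lambda>x. l (F1 (x *\<^sub>R \<phi>) \<phi>)) has_real_derivative l (F2 (x *\<^sub>R \<phi>) \<phi> \<phi>)) (at x)"
        by (rule frechet_deriv_along_line[OF X Y1 F2 l1_norm \<phi> x1])
      show "((\<lambda>x. l (F2 (x *\<^sub>R \<phi>) \<phi> \<phi>)) has_real_derivative l (F3 (x *\<^sub>R \<phi>) \<phi> \<phi> \<phi>)) (at x)"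
        by (rule frechet_deriv_along_line[OF X Y2 F3 l2 \<phi> x1])
      have w: "x *\<^sub>R \<phi> \<in> ?U" "snd X (x *\<^sub>R \<phi>) < d"
        using seminormed_spaceD(4,5)[OF X \<phi>, of x] x1 x2 by (auto simp: open_ball0_def)
      have "\<bar>l (F3 (x *\<^sub>R \<phi>) \<phi> \<phi> \<phi>)\<bar> \<le> C * p * p * p * snd Y3 (F3 (x *\<^sub>R \<phi>))"
        by (rule bounded_functionalD(4)[OF l3 in3[OF w(1)]])
      also have "\<dots> \<le> C * p * p * p * B"
        by (intro mult_left_mono B w bounded_functionalD(1)[OF l3])
      finally show "\<bar>l (F3 (x *\<^sub>R \<phi>) \<phi> \<phi> \<phi>)\<bar> \<le> C * p * p * p * B" .
    qed (use e in auto)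
    then show "\<bar>c3\<bar> \<le> 2 * B * C * snd X \<phi> ^ 3"
      by (simp add: p_def power3_eq_cube algebra_simps)
  qed
qed

text \<open>A supremum of reals carries information only for bounded sets. Here the seminorm is
  continuous along the curve and [0,T] is compact.\<close>

lemma C_space_bdd:
  assumes X: "seminormed_space X" and w: "w \<in> fst (C_space T X)"
  shows "bdd_above ((\<lambda>t. snd X (w t)) ` {0..T})"
proof -
  have wX: "w t \<in> fst X" if "t \<in> {0..T}" for t using w that unfolding C_space_def by auto
  have "continuous_on {0..T} (\<lambda>t. snd X (w t))"
    unfolding continuous_on_iff
  proof (intro ballI allI impI)
    fix t e :: real assume t: "t \<in> {0..T}" and e: "e > 0"
    have "\<exists>d>0. \<forall>t'\<in>{0..T}. \<bar>t' - t\<bar> < d \<longrightarrow> snd X (w t' - w t) < e"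
      using w t e unfolding C_space_def fst_conv mem_Collect_eq by blast
    then obtain d where d: "d > 0" "\<And>t'. t' \<in> {0..T} \<Longrightarrow> \<bar>t' - t\<bar> < d \<Longrightarrow> snd X (w t' - w t) < e"
      by blast
    show "\<exists>d>0. \<forall>x'\<in>{0..T}. dist x' t < d \<longrightarrow> dist (snd X (w x')) (snd X (w t)) < e"
    proof (intro exI[of _ d] conjI d(1) ballI impI)
      fix t' assume t': "t' \<in> {0..T}" "dist t' t < d"
      have "snd X (w t - w t') = snd X (w t' - w t)"
        using seminormed_space_more(3)[OF X seminormed_space_more(4)[OF X wX[OF t] wX[OF t'(1)]]] by simp
      then show "dist (snd X (w t')) (snd X (w t)) < e"
        using seminormed_space_more(7)[OF X wX[OF t] wX[OF t'(1)]]
          seminormed_space_more(7)[OF X wX[OF t'(1)] wX[OF t]] d(2)[OF t'(1)] t'(2)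
        by (auto simp: dist_real_def)
    qed
  qed
  then have "compact ((\<lambda>t. snd X (w t)) ` {0..T})" by (intro compact_continuous_image) auto
  then show ?thesis by (simp add: bounded_imp_bdd_above compact_imp_bounded)
qed

lemma seminormed_space_C_space:
  assumes X: "seminormed_space X" and T: "T \<ge> 0"
  shows "seminormed_space (C_space T X)"
proof -
  note XD = seminormed_spaceD[OF X] and X0 = seminormed_space_more[OF X]
  have ne: "{0..T} \<noteq> {}" using T by auto
  have memI: "w \<in> fst (C_space T X)" if "\<And>t. t \<in> {0..T} \<Longrightarrow> w t \<in> fst X"
    "\<And>t e. t \<in> {0..T} \<Longrightarrow> e > 0 \<Longrightarrow> \<exists>d>0. \<forall>t'\<in>{0..T}. \<bar>t' - t\<bar> < d \<longrightarrow> snd X (w t' - w t) < e" for w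
    using that unfolding C_space_def by auto
  have memD: "w t \<in> fst X" "e > 0 \<Longrightarrow> \<exists>d>0. \<forall>t'\<in>{0..T}. \<bar>t' - t\<bar> < d \<longrightarrow> snd X (w t' - w t) < e"
    if "w \<in> fst (C_space T X)" "t \<in> {0..T}" for w t e using that unfolding C_space_def by auto
  have in0: "0 \<in> fst (C_space T X)" by (rule memI) (use XD(1) X0(1) in \<open>auto intro!: exI[of _ 1]\<close>)
  have add: "v + w \<in> fst (C_space T X) \<and> snd (C_space T X) (v + w) \<le> snd (C_space T X) v + snd (C_space T X) w"
    if v: "v \<in> fst (C_space T X)" and w: "w \<in> fst (C_space T X)" for v w
  proof
    show "v + w \<in> fst (C_space T X)"
    proof (rule memI)
      fix t assume t: "t \<in> {0..T}"
      show "(v + w) t \<in> fst X" using XD(2) memD(1)[OF v t] memD(1)[OF w t] by simp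
      fix e :: real assume e: "e > 0"
      obtain d1 where d1: "d1 > 0" "\<And>t'. t' \<in> {0..T} \<Longrightarrow> \<bar>t' - t\<bar> < d1 \<Longrightarrow> snd X (v t' - v t) < e/2"
        using memD(2)[OF v t, of "e/2"] e by auto
      obtain d2 where d2: "d2 > 0" "\<And>t'. t' \<in> {0..T} \<Longrightarrow> \<bar>t' - t\<bar> < d2 \<Longrightarrow> snd X (w t' - w t) < e/2"
        using memD(2)[OF w t, of "e/2"] e by auto
      show "\<exists>d>0. \<forall>t'\<in>{0..T}. \<bar>t' - t\<bar> < d \<longrightarrow> snd X ((v + w) t' - (v + w) t) < e"
      proof (intro exI[of _ "min d1 d2"] conjI ballI impI)
        fix t' assume t': "t' \<in> {0..T}" "\<bar>t' - t\<bar> < min d1 d2"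
        have "snd X ((v t' - v t) + (w t' - w t)) \<le> snd X (v t' - v t) + snd X (w t' - w t)"
          by (intro XD(3) X0(4) memD(1)[OF v] memD(1)[OF w] t t')
        also have "\<dots> < e" using d1(2)[OF t'(1)] d2(2)[OF t'(1)] t'(2) by simp
        finally show "snd X ((v + w) t' - (v + w) t) < e" by (simp add: algebra_simps)
      qed (use d1 d2 in auto)
    qed
    show "snd (C_space T X) (v + w) \<le> snd (C_space T X) v + snd (C_space T X) w"
      unfolding C_space_def snd_conv
    proof (rule cSUP_least[OF ne])
      fix t assume t: "t \<in> {0..T}"
      have "snd X ((v + w) t) \<le> snd X (v t) + snd X (w t)"
        using XD(3)[OF memD(1)[OF v t] memD(1)[OF w t]] by simp
      also have "\<dots> \<le> (SUP t\<in>{0..T}. snd X (v t)) + (SUP t\<in>{0..T}. snd X (w t))"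
        by (intro add_mono cSUP_upper C_space_bdd[OF X] v w t)
      finally show "snd X ((v + w) t) \<le> \<dots>" .
    qed
  qed
  have scale: "c *\<^sub>R v \<in> fst (C_space T X) \<and> snd (C_space T X) (c *\<^sub>R v) \<le> \<bar>c\<bar> * snd (C_space T X) v"
    if v: "v \<in> fst (C_space T X)" for v c
  proof
    show "c *\<^sub>R v \<in> fst (C_space T X)"
    proof (rule memI)
      fix t assume t: "t \<in> {0..T}"
      show "(c *\<^sub>R v) t \<in> fst X" using XD(4) memD(1)[OF v t] by (simp add: scaleR_fun_def)
      fix e :: real assume e: "e > 0"
      obtain d1 where d1: "d1 > 0" "\<And>t'. t' \<in> {0..T} \<Longrightarrow> \<bar>t' - t\<bar> < d1 \<Longrightarrow> snd X (v t' - v t) < e/(\<bar>c\<bar>+1)"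
        using memD(2)[OF v t, of "e/(\<bar>c\<bar>+1)"] e by auto
      show "\<exists>d>0. \<forall>t'\<in>{0..T}. \<bar>t' - t\<bar> < d \<longrightarrow> snd X ((c *\<^sub>R v) t' - (c *\<^sub>R v) t) < e"
      proof (intro exI[of _ d1] conjI ballI impI d1(1))
        fix t' assume t': "t' \<in> {0..T}" "\<bar>t' - t\<bar> < d1"
        have m: "v t' - v t \<in> fst X" by (intro X0(4) memD(1)[OF v] t t')
        have "snd X (c *\<^sub>R (v t' - v t)) = \<bar>c\<bar> * snd X (v t' - v t)"
          by (intro XD(5) m)
        also have "\<dots> \<le> (\<bar>c\<bar>+1) * snd X (v t' - v t)" using X0(6)[OF m] by (simp add: algebra_simps)
        also have "\<dots> < (\<bar>c\<bar>+1) * (e/(\<bar>c\<bar>+1))" by (intro mult_strict_left_mono d1(2) t') auto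
        also have "\<dots> = e" by (simp add: field_simps add_nonneg_eq_0_iff)
        finally show "snd X ((c *\<^sub>R v) t' - (c *\<^sub>R v) t) < e" by (simp add: scaleR_fun_def scaleR_diff_right[symmetric])
      qed
    qed
    show "snd (C_space T X) (c *\<^sub>R v) \<le> \<bar>c\<bar> * snd (C_space T X) v"
      unfolding C_space_def snd_conv
    proof (rule cSUP_least[OF ne])
      fix t assume t: "t \<in> {0..T}"
      have "snd X ((c *\<^sub>R v) t) = \<bar>c\<bar> * snd X (v t)"
        using XD(5)[OF memD(1)[OF v t]] by (simp add: scaleR_fun_def)
      also have "\<dots> \<le> \<bar>c\<bar> * (SUP t\<in>{0..T}. snd X (v t))"
        by (intro mult_left_mono cSUP_upper C_space_bdd[OF X] v t) auto
      finally show "snd X ((c *\<^sub>R v) t) \<le> \<dots>" .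
    qed
  qed
  have scale_eq: "snd (C_space T X) (c *\<^sub>R v) = \<bar>c\<bar> * snd (C_space T X) v"
    if v: "v \<in> fst (C_space T X)" for v c
  proof (cases "c = 0")
    case True
    have "snd (C_space T X) 0 = 0" unfolding C_space_def using ne by (simp add: X0(1))
    with True show ?thesis by simp
  next
    case False
    have "snd (C_space T X) ((1/c) *\<^sub>R (c *\<^sub>R v)) \<le> \<bar>1/c\<bar> * snd (C_space T X) (c *\<^sub>R v)"
      using scale scale[OF v] by blast
    then have "\<bar>c\<bar> * snd (C_space T X) v \<le> snd (C_space T X) (c *\<^sub>R v)"
      using False by (simp add: field_simps)
    with scale[OF v, of c] show ?thesis by simp
  qed
  show ?thesis unfolding seminormed_space_def using in0 add scale scale_eq by blast
qed

lemma bounded_functional_C_space: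
  assumes X: "seminormed_space X" and t: "t \<in> {0..T}" and l: "bounded_functional X l C"
  shows "bounded_functional (C_space T X) (\<lambda>w. l (w t)) C"
proof -
  have m: "w t \<in> fst X" if "w \<in> fst (C_space T X)" for w using that t unfolding C_space_def by auto
  have "\<bar>l (w t)\<bar> \<le> C * snd (C_space T X) w" if w: "w \<in> fst (C_space T X)" for w
  proof -
    have "\<bar>l (w t)\<bar> \<le> C * snd X (w t)" by (rule bounded_functionalD(4)[OF l m[OF w]])
    also have "\<dots> \<le> C * (SUP t\<in>{0..T}. snd X (w t))"
      by (intro mult_left_mono cSUP_upper C_space_bdd[OF X] w t bounded_functionalD(1)[OF l])
    finally show ?thesis by (simp add: C_space_def)
  qed
  then show ?thesis using bounded_functionalD[OF l] m
    by (auto simp: bounded_functional_def scaleR_fun_def)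
qed

section \<open>Real and Fourier analysis on the plane\<close>

section \<open>Integrals depending on a parameter\<close>

text \<open>Dominated convergence speaks about sequences, and first countability of the parameter
  space makes sequential continuity enough. The parameter is later a time, a frequency, a point or a
  pair of these.\<close>

lemma continuous_on_integral_dominated:
  fixes F :: "'p::{first_countable_topology,t2_space} \<Rightarrow> 'x \<Rightarrow> 'b::{banach,second_countable_topology}"
  assumes meas: "\<And>p. p \<in> S \<Longrightarrow> F p \<in> borel_measurable M"
    and cont: "\<And>x. continuous_on S (\<lambda>p. F p x)"
    and B: "integrable M B" "\<And>p x. p \<in> S \<Longrightarrow> norm (F p x) \<le> B x"
  shows "continuous_on S (\<lambda>p. \<integral>x. F p x \<partial>M)"
proof (rule continuous_on_sequentiallyI)
  fix u a assume u: "\<forall>n. u n \<in> S" "a \<in> S" "u \<longlonglongrightarrow> a"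
  have "(\<lambda>n. F (u n) x) \<longlonglongrightarrow> F a x" for x
    using cont[of x] u unfolding continuous_on_sequentially by (auto simp: o_def)
  then show "(\<lambda>n. \<integral>x. F (u n) x \<partial>M) \<longlonglongrightarrow> (\<integral>x. F a x \<partial>M)"
    by (intro integral_dominated_convergence[where w=B]) (use u meas B in auto)
qed

text \<open>Differentiation is within a convex set, which covers the one-sided time derivatives at 0
  and T as well as derivatives on the whole line.\<close>

lemma has_vector_derivative_integral_dominated:
  fixes F :: "real \<Rightarrow> 'x \<Rightarrow> 'b::{banach,second_countable_topology}"
  assumes S: "convex S" and t: "t \<in> S"
    and int: "\<And>s. s \<in> S \<Longrightarrow> integrable M (F s)"
    and meas: "F' t \<in> borel_measurable M"
    and der: "\<And>s x. s \<in> S \<Longrightarrow> ((\<lambda>s. F s x) has_vector_derivative F' s x) (at s within S)"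
    and B: "integrable M B" "\<And>s x. s \<in> S \<Longrightarrow> norm (F' s x) \<le> B x"
  shows "((\<lambda>s. \<integral>x. F s x \<partial>M) has_vector_derivative (\<integral>x. F' t x \<partial>M)) (at t within S)"
proof -
  have B0: "0 \<le> B x" for x using order_trans[OF norm_ge_zero B(2)[OF t]] .
  have intF': "integrable M (F' t)"
    by (rule Bochner_Integration.integrable_bound[OF B(1) meas]) (use B0 B(2)[OF t] in auto)
  have lip: "norm (F r x - F s x) \<le> B x * \<bar>r - s\<bar>" if "r \<in> S" "s \<in> S" for r s x
    using differentiable_bound[OF S, of "\<lambda>s. F s x" "\<lambda>s h. h *\<^sub>R F' s x" "B x" r s] that der B(2) B0
    by (auto simp: has_vector_derivative_def onorm_scaleR_left[OF bounded_linear_ident] onorm_id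
        intro!: onorm_le)
  show ?thesis
    unfolding has_vector_derivative_def has_derivative_within
  proof (intro conjI bounded_linear_scaleR_left)
    show "((\<lambda>s. (1 / norm (s - t)) *\<^sub>R ((\<integral>x. F s x \<partial>M) - ((\<integral>x. F t x \<partial>M)
        + (s - t) *\<^sub>R (\<integral>x. F' t x \<partial>M)))) \<longlongrightarrow> 0) (at t within S)"
      unfolding tendsto_at_iff_sequentially
    proof (intro allI impI)
      fix X :: "nat \<Rightarrow> real" assume X: "\<forall>i. X i \<in> S - {t}" "X \<longlonglongrightarrow> t"
      define G where "G = (\<lambda>n x. (1 / norm (X n - t)) *\<^sub>R (F (X n) x - (F t x + (X n - t) *\<^sub>R F' t x)))"
      have G: "((\<lambda>s. (1 / norm (s - t)) *\<^sub>R ((\<integral>x. F s x \<partial>M) - ((\<integral>x. F t x \<partial>M)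
        + (s - t) *\<^sub>R (\<integral>x. F' t x \<partial>M)))) \<circ> X) n = (\<integral>x. G n x \<partial>M)" for n
        unfolding G_def o_def using X(1) int t intF' by simp
      have G': "(\<lambda>s. (1 / norm (s - t)) *\<^sub>R ((\<integral>x. F s x \<partial>M) - ((\<integral>x. F t x \<partial>M)
        + (s - t) *\<^sub>R (\<integral>x. F' t x \<partial>M)))) \<circ> X = (\<lambda>n. \<integral>x. G n x \<partial>M)"
        by (intro ext G)
      have "(\<lambda>n. \<integral>x. G n x \<partial>M) \<longlonglongrightarrow> (\<integral>x. 0 \<partial>M)"
      \<comment> \<open>One \<open>B x\<close> bounds the difference quotient and the other the
        derivative subtracted from it.\<close>
      proof (rule integral_dominated_convergence[where w="\<lambda>x. 2 * B x"])
        show "G n \<in> borel_measurable M" for n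
        proof -
          have [measurable]: "F (X n) \<in> borel_measurable M" "F t \<in> borel_measurable M"
              "F' t \<in> borel_measurable M"
            using int t X(1) meas by auto
          show ?thesis unfolding G_def by measurable
        qed
        show "AE x in M. (\<lambda>n. G n x) \<longlonglongrightarrow> 0"
        proof (rule AE_I2)
          fix x
          have "((\<lambda>s. (1 / norm (s - t)) *\<^sub>R (F s x - (F t x + (s - t) *\<^sub>R F' t x))) \<longlongrightarrow> 0) (at t within S)"
            using der[OF t, of x] unfolding has_vector_derivative_def has_derivative_within by simp
          then show "(\<lambda>n. G n x) \<longlonglongrightarrow> 0"
            unfolding tendsto_at_iff_sequentially G_def using X by (auto simp: o_def)
        qed
        show "AE x in M. norm (G n x) \<le> 2 * B x" for n
        proof (rule AE_I2)
          fix x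
          have Xn: "X n \<in> S" "X n \<noteq> t" using X(1) by auto
          define d where "d = norm (F (X n) x - (F t x + (X n - t) *\<^sub>R F' t x))"
          have "d \<le> norm (F (X n) x - F t x) + norm ((X n - t) *\<^sub>R F' t x)"
            unfolding d_def diff_diff_eq[symmetric] by (rule norm_triangle_ineq4)
          also have "\<dots> \<le> B x * \<bar>X n - t\<bar> + \<bar>X n - t\<bar> * B x"
            unfolding norm_scaleR real_norm_def
            by (intro add_mono lip[OF Xn(1) t] mult_left_mono B(2)[OF t]) auto
          finally have "d \<le> 2 * B x * \<bar>X n - t\<bar>" by (simp add: algebra_simps)
          moreover have "norm (G n x) = 1 / \<bar>X n - t\<bar> * d"
            unfolding G_def d_def norm_scaleR by simp
          ultimately show "norm (G n x) \<le> 2 * B x"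
            using Xn(2) by (simp add: divide_le_eq)
        qed
      qed (use B(1) in auto)
      then show "((\<lambda>s. (1 / norm (s - t)) *\<^sub>R ((\<integral>x. F s x \<partial>M) - ((\<integral>x. F t x \<partial>M)
        + (s - t) *\<^sub>R (\<integral>x. F' t x \<partial>M)))) \<circ> X) \<longlonglongrightarrow> 0"
        unfolding G' by simp
    qed
  qed
qed

section \<open>Affine changes of variables\<close>

lemma lborel_integral_affine:
  fixes f :: "'a::euclidean_space \<Rightarrow> 'b::{banach, second_countable_topology}"
  assumes c: "c \<noteq> 0" and [measurable]: "f \<in> borel_measurable borel"
  shows "(\<integral>x. f x \<partial>lborel) = \<bar>c\<bar> ^ DIM('a) *\<^sub>R (\<integral>x. f (t + c *\<^sub>R x) \<partial>lborel)"
  by (subst lborel_affine[OF c, of t])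
     (simp add: integral_density integral_distr)

lemma lborel_integrable_affine:
  fixes f :: "'a::euclidean_space \<Rightarrow> 'b::{banach, second_countable_topology}"
  assumes c: "c \<noteq> 0" and f: "integrable lborel f"
  shows "integrable lborel (\<lambda>x. f (t + c *\<^sub>R x))"
proof -
  have [measurable]: "f \<in> borel_measurable borel" using f by auto
  have "integrable (density (distr lborel borel (\<lambda>x. t + c *\<^sub>R x)) (\<lambda>_. \<bar>c\<bar> ^ DIM('a))) f"
    using f by (subst (asm) lborel_affine[OF c, of t])
  then have "integrable (distr lborel borel (\<lambda>x. t + c *\<^sub>R x)) (\<lambda>x. \<bar>c\<bar> ^ DIM('a) *\<^sub>R f x)"
    by (subst (asm) integrable_density) auto
  from integrable_scaleR_right[OF this, of "1 / \<bar>c\<bar> ^ DIM('a)"]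
  have "integrable (distr lborel borel (\<lambda>x. t + c *\<^sub>R x)) f" using c by simp
  then show ?thesis by (subst (asm) integrable_distr_eq) auto
qed

lemma lborel_integral_reflect:
  fixes f :: "'a::euclidean_space \<Rightarrow> 'b::{banach, second_countable_topology}"
  assumes "f \<in> borel_measurable borel"
  shows "(\<integral>x. f (a - x) \<partial>lborel) = (\<integral>x. f x \<partial>lborel)"
  using lborel_integral_affine[OF _ assms, of "-1" a] by simp

lemma lborel_integrable_reflect:
  fixes f :: "'a::euclidean_space \<Rightarrow> 'b::{banach, second_countable_topology}"
  assumes "integrable lborel f"
  shows "integrable lborel (\<lambda>x. f (a - x))"
  using lborel_integrable_affine[OF _ assms, of "-1" a] by simp

lemma lborel_integral_shift:
  fixes f :: "'a::euclidean_space \<Rightarrow> 'b::{banach, second_countable_topology}"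
  assumes "f \<in> borel_measurable borel"
  shows "(\<integral>x. f (x - a) \<partial>lborel) = (\<integral>x. f x \<partial>lborel)"
  using lborel_integral_affine[OF _ assms, of 1 "-a"] by simp

lemma lborel_integrable_shift:
  fixes f :: "'a::euclidean_space \<Rightarrow> 'b::{banach, second_countable_topology}"
  assumes "integrable lborel f"
  shows "integrable lborel (\<lambda>x. f (x - a))"
  using lborel_integrable_affine[OF _ assms, of 1 "-a"] by simp

lemma integrable_lborel_product:
  fixes f :: "'a::euclidean_space \<Rightarrow> 'c::{banach,second_countable_topology,real_normed_algebra}"
    and g :: "'b::euclidean_space \<Rightarrow> 'c"
  assumes f: "integrable lborel f" and g: "integrable lborel g"
  shows "integrable (lborel \<Otimes>\<^sub>M lborel) (\<lambda>(x, y). f x * g y)"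
proof (rule lborel_pair.Fubini_integrable)
  have [measurable]: "f \<in> borel_measurable borel" "g \<in> borel_measurable borel" using f g by auto
  show "(\<lambda>(x, y). f x * g y) \<in> borel_measurable (lborel \<Otimes>\<^sub>M lborel)" by measurable
  show "AE x in lborel. integrable lborel (\<lambda>y. case (x, y) of (x, y) \<Rightarrow> f x * g y)"
    using g by auto
  show "integrable lborel (\<lambda>x. \<integral>y. norm (case (x, y) of (x, y) \<Rightarrow> f x * g y) \<partial>lborel)"
  proof (rule Bochner_Integration.integrable_bound)
    show "integrable lborel (\<lambda>x. norm (f x) * (\<integral>y. norm (g y) \<partial>lborel))" using f by auto
    have "(\<integral>y. norm (f x * g y) \<partial>lborel) \<le> norm (f x) * (\<integral>y. norm (g y) \<partial>lborel)" for x
    proof -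
      have "(\<integral>y. norm (f x * g y) \<partial>lborel) \<le> (\<integral>y. norm (f x) * norm (g y) \<partial>lborel)"
        by (intro integral_mono) (use g in \<open>auto simp: norm_mult_ineq\<close>)
      then show ?thesis by simp
    qed
    then show "AE x in lborel. norm (\<integral>y. norm (case (x, y) of (x, y) \<Rightarrow> f x * g y) \<partial>lborel)
        \<le> norm (norm (f x) * (\<integral>y. norm (g y) \<partial>lborel))"
      by auto
  qed measurable
qed

text \<open>With an oscillating exponential as kernel, this moves a Fourier transform from one
  factor of a pairing to the other.\<close>

lemma Fubini_bounded_kernel:
  fixes f :: "'a::euclidean_space \<Rightarrow> complex" and g :: "'b::euclidean_space \<Rightarrow> complex"
  assumes f: "integrable lborel f" and g: "integrable lborel g"
    and k[measurable]: "case_prod k \<in> borel_measurable borel" and b: "\<And>x y. cmod (k x y) \<le> 1"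
  shows "(\<integral>y. g y * (\<integral>x. k x y * f x \<partial>lborel) \<partial>lborel) = (\<integral>x. f x * (\<integral>y. k x y * g y \<partial>lborel) \<partial>lborel)"
proof -
  have [measurable]: "f \<in> borel_measurable borel" "g \<in> borel_measurable borel" using f g by auto
  have [measurable]: "case_prod k \<in> borel_measurable (borel \<Otimes>\<^sub>M borel)" using k by (simp add: borel_prod)
  have "integrable (lborel \<Otimes>\<^sub>M lborel) (\<lambda>(x, y). k x y * (f x * g y))"
  proof (rule Bochner_Integration.integrable_bound[OF integrable_lborel_product[OF f g]])
    show "(\<lambda>(x, y). k x y * (f x * g y)) \<in> borel_measurable (lborel \<Otimes>\<^sub>M lborel)" by measurable
    show "AE p in lborel \<Otimes>\<^sub>M lborel. norm (case p of (x, y) \<Rightarrow> k x y * (f x * g y)) \<le> norm (case p of (x, y) \<Rightarrow> f x * g y)"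
      by (rule AE_I2) (auto simp: norm_mult mult_left_le_one_le b)
  qed
  from lborel_pair.Fubini_integral[OF this] show ?thesis
    by (simp add: algebra_simps flip: integral_mult_right_zero)
qed

section \<open>Convolution and the inverse Fourier transform\<close>

definition conv :: "(plane \<Rightarrow> complex) \<Rightarrow> (plane \<Rightarrow> complex) \<Rightarrow> plane \<Rightarrow> complex" where
  "conv f g \<zeta> = (LINT \<mu>|lborel. f \<mu> * g (\<zeta> - \<mu>))"

definition inv_fourier :: "(plane \<Rightarrow> complex) \<Rightarrow> plane \<Rightarrow> complex" where
  "inv_fourier g z = complex_of_real (1 / (2 * pi)) * (LINT \<zeta>|lborel. iexp (z \<bullet> \<zeta>) * g \<zeta>)"

lemma norm_iexp_mult [simp]: "cmod (iexp x * w) = cmod w"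
  by (simp add: norm_mult)

lemma iexp_add: "iexp (x + y) = iexp x * iexp y"
  by (simp add: algebra_simps exp_add)

lemma continuous_on_iexp [continuous_intros]:
  "continuous_on S f \<Longrightarrow> continuous_on S (\<lambda>x. iexp (f x))"
  by (intro continuous_intros)

lemma integrable_iexp_mult:
  fixes g :: "'a::euclidean_space \<Rightarrow> complex"
  assumes g: "integrable lborel g"
  shows "integrable lborel (\<lambda>\<zeta>. iexp (z \<bullet> \<zeta>) * g \<zeta>)"
proof -
  have [measurable]: "g \<in> borel_measurable borel" using g by auto
  have "(\<lambda>\<zeta>. iexp (z \<bullet> \<zeta>) * g \<zeta>) \<in> borel_measurable lborel" by measurable
  then show ?thesis by (intro Bochner_Integration.integrable_bound[OF g]) auto
qed

lemma integrable_conv_kernel: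
  assumes f: "integrable lborel f" and g: "integrable lborel g"
  shows "integrable (lborel \<Otimes>\<^sub>M lborel) (\<lambda>(\<mu>::plane, \<zeta>::plane). f \<mu> * g (\<zeta> - \<mu>) :: complex)"
proof (rule lborel_pair.Fubini_integrable)
  have [measurable]: "f \<in> borel_measurable borel" "g \<in> borel_measurable borel" using f g by auto
  show "(\<lambda>(\<mu>, \<zeta>). f \<mu> * g (\<zeta> - \<mu>)) \<in> borel_measurable (lborel \<Otimes>\<^sub>M lborel)" by measurable
  show "AE \<mu> in lborel. integrable lborel (\<lambda>\<zeta>. case (\<mu>, \<zeta>) of (\<mu>, \<zeta>) \<Rightarrow> f \<mu> * g (\<zeta> - \<mu>))"
    using lborel_integrable_shift[OF g] by auto
  have "(\<integral>\<zeta>. norm (case (\<mu>, \<zeta>) of (\<mu>, \<zeta>) \<Rightarrow> f \<mu> * g (\<zeta> - \<mu>)) \<partial>lborel) = norm (f \<mu>) * (\<integral>\<zeta>. norm (g \<zeta>) \<partial>lborel)" for \<mu>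
    using lborel_integral_shift[of "\<lambda>x. norm (g x)" \<mu>] by (simp add: norm_mult)
  then show "integrable lborel (\<lambda>\<mu>. \<integral>\<zeta>. norm (case (\<mu>, \<zeta>) of (\<mu>, \<zeta>) \<Rightarrow> f \<mu> * g (\<zeta> - \<mu>)) \<partial>lborel)"
    using f by simp
qed

lemma
  assumes f: "integrable lborel f" and g: "integrable lborel g"
  shows integrable_conv: "integrable lborel (conv f g)"
    and integral_conv: "integral\<^sup>L lborel (conv f g) = integral\<^sup>L lborel f * integral\<^sup>L lborel g"
proof -
  note k = integrable_conv_kernel[OF f g]
  have [measurable]: "f \<in> borel_measurable borel" "g \<in> borel_measurable borel" using f g by auto
  show "integrable lborel (conv f g)"
    using lborel_pair.integrable_snd[OF k] unfolding conv_def[abs_def] .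
  have "integral\<^sup>L lborel (conv f g) = (\<integral>\<mu>. (\<integral>\<zeta>. f \<mu> * g (\<zeta> - \<mu>) \<partial>lborel) \<partial>lborel)"
    unfolding conv_def[abs_def] by (rule lborel_pair.Fubini_integral[OF k])
  also have "\<dots> = integral\<^sup>L lborel f * integral\<^sup>L lborel g"
    using lborel_integral_shift[of g] by simp
  finally show "integral\<^sup>L lborel (conv f g) = \<dots>" .
qed

text \<open>Characters are multiplicative, so multiplying both functions by the same character
  multiplies their convolution by it. What remains is \<open>integral_conv\<close>, with one of the
  two normalising factors left over.\<close>

lemma inv_fourier_mult:
  assumes f: "integrable lborel f" and g: "integrable lborel g"
  shows "inv_fourier f z * inv_fourier g z = complex_of_real (1 / (2 * pi)) * inv_fourier (conv f g) z"
proof -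
  have "conv (\<lambda>\<zeta>. iexp (z \<bullet> \<zeta>) * f \<zeta>) (\<lambda>\<zeta>. iexp (z \<bullet> \<zeta>) * g \<zeta>) = (\<lambda>\<zeta>. iexp (z \<bullet> \<zeta>) * conv f g \<zeta>)"
  proof
    fix \<zeta>
    have *: "iexp (z \<bullet> \<mu>) * f \<mu> * (iexp (z \<bullet> (\<zeta> - \<mu>)) * g (\<zeta> - \<mu>)) = iexp (z \<bullet> \<zeta>) * (f \<mu> * g (\<zeta> - \<mu>))" for \<mu>
    proof -
      have "iexp (z \<bullet> \<zeta>) = iexp (z \<bullet> \<mu> + z \<bullet> (\<zeta> - \<mu>))" by (simp add: inner_diff_right)
      then show ?thesis unfolding iexp_add by simp
    qed
    then show "conv (\<lambda>\<zeta>. iexp (z \<bullet> \<zeta>) * f \<zeta>) (\<lambda>\<zeta>. iexp (z \<bullet> \<zeta>) * g \<zeta>) \<zeta> = iexp (z \<bullet> \<zeta>) * conv f g \<zeta>"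
      unfolding conv_def by (simp only: * integral_mult_right_zero)
  qed
  then show ?thesis
    unfolding inv_fourier_def
    using integral_conv[OF integrable_iexp_mult[OF f] integrable_iexp_mult[OF g], of z z] by simp
qed

lemma inv_fourier_bound:
  assumes "integrable lborel g"
  shows "cmod (inv_fourier g z) \<le> (\<integral>\<zeta>. cmod (g \<zeta>) \<partial>lborel)"
proof -
  have "cmod (LINT \<zeta>|lborel. iexp (z \<bullet> \<zeta>) * g \<zeta>) \<le> (\<integral>\<zeta>. cmod (iexp (z \<bullet> \<zeta>) * g \<zeta>) \<partial>lborel)"
    by (rule integral_norm_bound)
  then have a: "cmod (LINT \<zeta>|lborel. iexp (z \<bullet> \<zeta>) * g \<zeta>) \<le> (\<integral>\<zeta>. cmod (g \<zeta>) \<partial>lborel)"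
    by simp
  have "1 / (2 * pi) \<le> 1" using pi_gt3 by simp
  then have "1 / (2 * pi) * cmod (LINT \<zeta>|lborel. iexp (z \<bullet> \<zeta>) * g \<zeta>) \<le> 1 * (\<integral>\<zeta>. cmod (g \<zeta>) \<partial>lborel)"
    by (intro mult_mono a) auto
  then show ?thesis by (simp add: inv_fourier_def norm_mult norm_divide)
qed

lemma continuous_on_inv_fourier:
  assumes g: "integrable lborel g"
  shows "continuous_on S (inv_fourier g)"
  unfolding inv_fourier_def[abs_def]
proof (intro continuous_intros continuous_on_integral_dominated[where B="\<lambda>\<zeta>. cmod (g \<zeta>)"])
  show "(\<lambda>\<zeta>. iexp (p \<bullet> \<zeta>) * g \<zeta>) \<in> borel_measurable lborel" for p
    using integrable_iexp_mult[OF g, of p] by auto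
qed (use g in auto)

lemma measurable_inv_fourier: "integrable lborel g \<Longrightarrow> inv_fourier g \<in> borel_measurable borel"
  by (intro borel_measurable_continuous_onI continuous_on_inv_fourier)

section \<open>Gaussian regularization and Plancherel's theorem\<close>

text \<open>Normalised by its value 1 at the origin instead of its mass 2 \<pi>, so that its
  dilations are cutoffs increasing to 1. Its transform with kernel \<open>iexp\<close> is 2 \<pi>
  times itself.\<close>

definition gauss :: "plane \<Rightarrow> real" where "gauss z = exp (- (norm z)\<^sup>2 / 2)"

lemma gauss_prod: "gauss (x, y) = exp (- x\<^sup>2 / 2) * exp (- y\<^sup>2 / 2)"
  by (simp add: gauss_def norm_Pair exp_add[symmetric] field_simps)

lemma gauss_properties:
  shows gauss_pos: "gauss z > 0" and gauss_le_1: "gauss z \<le> 1" and gauss_0: "gauss 0 = 1"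
    and continuous_gauss: "continuous_on S gauss"
    and measurable_gauss [measurable]: "gauss \<in> borel_measurable borel"
proof -
  show c: "continuous_on S gauss" for S
    unfolding gauss_def[abs_def] by (intro continuous_intros) auto
  show "gauss \<in> borel_measurable borel" by (intro borel_measurable_continuous_onI c)
qed (auto simp: gauss_def)

lemma gauss_1D:
  shows "integrable lborel (\<lambda>x::real. complex_of_real (exp (- x\<^sup>2 / 2)))"
    and "(\<integral>x. iexp (t * x) * complex_of_real (exp (- x\<^sup>2 / 2)) \<partial>lborel)
        = complex_of_real (sqrt (2 * pi) * exp (- t\<^sup>2 / 2))"
proof -
  have e: "exp (- x\<^sup>2 / 2) = sqrt (2 * pi) * std_normal_density x" for x :: real
    by (simp add: std_normal_density_def)
  have "integrable lborel (\<lambda>x. sqrt (2 * pi) * std_normal_density x)"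
    by (intro integrable_mult_right integrable_normal_density) auto
  then show "integrable lborel (\<lambda>x::real. complex_of_real (exp (- x\<^sup>2 / 2)))"
    unfolding e by (rule integrable_of_real)
  have "(\<integral>x. iexp (t * x) * complex_of_real (exp (- x\<^sup>2 / 2)) \<partial>lborel)
     = (\<integral>x. complex_of_real (sqrt (2 * pi)) * (std_normal_density x *\<^sub>R iexp (t * x)) \<partial>lborel)"
    unfolding e by (simp add: scaleR_conv_of_real algebra_simps)
  also have "\<dots> = complex_of_real (sqrt (2 * pi)) * (\<integral>x. std_normal_density x *\<^sub>R iexp (t * x) \<partial>lborel)"
    by (rule integral_mult_right_zero)
  also have "(\<integral>x. std_normal_density x *\<^sub>R iexp (t * x) \<partial>lborel) = char std_normal_distribution t"
    unfolding char_def by (subst integral_density) auto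
  also have "\<dots> = complex_of_real (exp (- t\<^sup>2 / 2))" by (simp add: char_std_normal_distribution)
  finally show "(\<integral>x. iexp (t * x) * complex_of_real (exp (- x\<^sup>2 / 2)) \<partial>lborel)
        = complex_of_real (sqrt (2 * pi) * exp (- t\<^sup>2 / 2))" by simp
qed

lemma integrable_gauss: "integrable lborel gauss"
  and integral_iexp_gauss: "(\<integral>z. iexp (z \<bullet> \<tau>) * complex_of_real (gauss z) \<partial>lborel) = complex_of_real (2 * pi * gauss \<tau>)"
proof -
  let ?g = "\<lambda>t x::real. iexp (t * x) * complex_of_real (exp (- x\<^sup>2 / 2))"
  have i1: "integrable lborel (?g t)" for t
    using integrable_iexp_mult[OF gauss_1D(1), of t] by simp
  have i2: "integrable lborel (\<lambda>(x, y). ?g s x * ?g t y)" for s t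
    using integrable_lborel_product[OF i1[of s] i1[of t]] by (simp only: lborel_prod)
  have eq: "(\<lambda>(x, y). ?g s x * ?g t y) = (\<lambda>z. iexp (z \<bullet> (s, t)) * complex_of_real (gauss z))" for s t
  proof
    fix z :: plane
    obtain x y where z: "z = (x, y)" by (cases z)
    have "iexp (z \<bullet> (s, t)) = iexp (s * x) * iexp (t * y)"
      unfolding z inner_Pair inner_real_def iexp_add by (simp add: mult.commute)
    then show "(case z of (x, y) \<Rightarrow> ?g s x * ?g t y) = iexp (z \<bullet> (s, t)) * complex_of_real (gauss z)"
      by (simp add: z gauss_prod)
  qed
  have "integrable lborel (\<lambda>z. iexp (z \<bullet> (0, 0)) * complex_of_real (gauss z))"
    using i2[of 0 0] unfolding eq .
  then have "integrable lborel (\<lambda>z. complex_of_real (gauss z))" by (simp add: zero_prod_def[symmetric])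
  from integrable_Re[OF this] show "integrable lborel gauss" by simp
  obtain s t where st: "\<tau> = (s, t)" by (cases \<tau>)
  have "(\<integral>z. iexp (z \<bullet> \<tau>) * complex_of_real (gauss z) \<partial>lborel) = (\<integral>z. (case z of (x, y) \<Rightarrow> ?g s x * ?g t y) \<partial>lborel)"
    unfolding st eq ..
  also have "\<dots> = (\<integral>x. (\<integral>y. ?g s x * ?g t y \<partial>lborel) \<partial>lborel)"
    using lborel_pair.integral_fst[OF integrable_lborel_product[OF i1[of s] i1[of t]]]
    by (simp only: lborel_prod)
  also have "\<dots> = (\<integral>x. ?g s x \<partial>lborel) * (\<integral>y. ?g t y \<partial>lborel)"
    by (simp only: integral_mult_right_zero integral_mult_left_zero)
  also have "\<dots> = complex_of_real ((sqrt (2 * pi) * exp (- s\<^sup>2 / 2)) * (sqrt (2 * pi) * exp (- t\<^sup>2 / 2)))"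
    unfolding gauss_1D(2) by (simp only: of_real_mult)
  also have "(sqrt (2 * pi) * exp (- s\<^sup>2 / 2)) * (sqrt (2 * pi) * exp (- t\<^sup>2 / 2))
      = (sqrt (2 * pi))\<^sup>2 * gauss \<tau>"
    by (simp only: st gauss_prod power2_eq_square mult_ac)
  also have "\<dots> = 2 * pi * gauss \<tau>" by simp
  finally show "(\<integral>z. iexp (z \<bullet> \<tau>) * complex_of_real (gauss z) \<partial>lborel) = complex_of_real (2 * pi * gauss \<tau>)" .
qed

lemma integral_gauss: "integral\<^sup>L lborel gauss = 2 * pi"
proof -
  have "complex_of_real (integral\<^sup>L lborel gauss) = complex_of_real (2 * pi)"
    using integral_iexp_gauss[of 0] by (simp add: gauss_0)
  then show ?thesis by (simp only: of_real_eq_iff)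
qed

lemma DIM_plane: "DIM(plane) = 2" by simp

lemma integral_iexp_gauss_scaled:
  assumes c: "c > 0"
  shows "(\<integral>z. iexp (z \<bullet> \<tau>) * complex_of_real (gauss (z /\<^sub>R c)) \<partial>lborel) = complex_of_real (c\<^sup>2 * (2 * pi * gauss (c *\<^sub>R \<tau>)))"
proof -
  have "(\<integral>z. iexp (z \<bullet> \<tau>) * complex_of_real (gauss (z /\<^sub>R c)) \<partial>lborel)
     = \<bar>c\<bar> ^ DIM(plane) *\<^sub>R (\<integral>z. iexp ((0 + c *\<^sub>R z) \<bullet> \<tau>) * complex_of_real (gauss ((0 + c *\<^sub>R z) /\<^sub>R c)) \<partial>lborel)"
    using c by (intro lborel_integral_affine) auto
  also have "\<dots> = c\<^sup>2 *\<^sub>R (\<integral>z. iexp (z \<bullet> (c *\<^sub>R \<tau>)) * complex_of_real (gauss z) \<partial>lborel)"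
    using c unfolding DIM_plane
    by (simp only: add_0 inner_scaleR_left inner_scaleR_right scaleR_scaleR left_inverse
        less_imp_neq[symmetric] scaleR_one power2_abs) simp
  finally show ?thesis unfolding integral_iexp_gauss by (simp add: scaleR_conv_of_real)
qed

text \<open>Fourier inversion at the origin for a function whose transform is not known to be
  integrable. By Fubini the Gaussian cutoff acts on \<open>A\<close> as an approximate identity. One
  factor 2 \<pi> comes from the transform of the Gaussian, the other from its mass.\<close>

lemma gauss_inversion_limit:
  fixes A :: "plane \<Rightarrow> complex"
  assumes A: "integrable lborel A" and b: "\<And>\<tau>. cmod (A \<tau>) \<le> b" and c: "isCont A 0"
  shows "(\<lambda>n. \<integral>z. complex_of_real (gauss (z /\<^sub>R real (Suc n))) * (\<integral>\<tau>. iexp (z \<bullet> \<tau>) * A \<tau> \<partial>lborel) \<partial>lborel)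
     \<longlonglongrightarrow> (2 * pi)\<^sup>2 * A 0"
proof -
  have [measurable]: "A \<in> borel_measurable borel" using A by auto
  have eq: "(\<integral>z. complex_of_real (gauss (z /\<^sub>R r)) * (\<integral>\<tau>. iexp (z \<bullet> \<tau>) * A \<tau> \<partial>lborel) \<partial>lborel)
     = 2 * pi * (\<integral>\<tau>. A (\<tau> /\<^sub>R r) * gauss \<tau> \<partial>lborel)" if r: "r > 0" for r
  proof -
    have ig: "integrable lborel (\<lambda>z. complex_of_real (gauss (z /\<^sub>R r)))"
      using lborel_integrable_affine[OF _ integrable_gauss, of "1/r" 0] r
      by (intro integrable_of_real) (auto simp: divide_inverse)
    have "(\<integral>z. complex_of_real (gauss (z /\<^sub>R r)) * (\<integral>\<tau>. iexp (z \<bullet> \<tau>) * A \<tau> \<partial>lborel) \<partial>lborel)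
       = (\<integral>\<tau>. A \<tau> * (\<integral>z. iexp (z \<bullet> \<tau>) * complex_of_real (gauss (z /\<^sub>R r)) \<partial>lborel) \<partial>lborel)"
      by (rule Fubini_bounded_kernel[OF A ig])
        (auto simp: split_def intro!: borel_measurable_continuous_onI continuous_intros)
    also have "\<dots> = (\<integral>\<tau>. A \<tau> * complex_of_real (r\<^sup>2 * (2 * pi * gauss (r *\<^sub>R \<tau>))) \<partial>lborel)"
      unfolding integral_iexp_gauss_scaled[OF r] ..
    \<comment> \<open>Substituting \<tau> / r undoes the concentration of the kernel; its integrable
      bound then no longer depends on r.\<close>
    also have "\<dots> = \<bar>1/r\<bar> ^ DIM(plane) *\<^sub>R (\<integral>\<tau>. A (0 + (1/r) *\<^sub>R \<tau>) * complex_of_real (r\<^sup>2 * (2 * pi * gauss (r *\<^sub>R (0 + (1/r) *\<^sub>R \<tau>)))) \<partial>lborel)"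
      using r by (intro lborel_integral_affine) auto
    also have "\<dots> = (1/r)\<^sup>2 *\<^sub>R (\<integral>\<tau>. complex_of_real (r\<^sup>2 * (2 * pi)) * (A (\<tau> /\<^sub>R r) * gauss \<tau>) \<partial>lborel)"
      using r unfolding DIM_plane power2_abs
      by (intro arg_cong[where f="\<lambda>x. (1/r)\<^sup>2 *\<^sub>R x"] Bochner_Integration.integral_cong)
        (auto simp: divide_inverse algebra_simps)
    also have "\<dots> = 2 * pi * (\<integral>\<tau>. A (\<tau> /\<^sub>R r) * gauss \<tau> \<partial>lborel)"
      using r by (simp only: integral_mult_right_zero) (simp add: scaleR_conv_of_real power2_eq_square)
    finally show ?thesis .
  qed
  have "(\<lambda>n. \<integral>\<tau>. A (\<tau> /\<^sub>R real (Suc n)) * gauss \<tau> \<partial>lborel) \<longlonglongrightarrow> (\<integral>\<tau>. A 0 * gauss \<tau> \<partial>lborel)"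
  proof (rule integral_dominated_convergence[where w="\<lambda>\<tau>. b * gauss \<tau>"])
    show "integrable lborel (\<lambda>\<tau>. b * gauss \<tau>)" using integrable_gauss by simp
    show "AE \<tau> in lborel. (\<lambda>n. A (\<tau> /\<^sub>R real (Suc n)) * gauss \<tau>) \<longlonglongrightarrow> A 0 * gauss \<tau>"
    proof (intro AE_I2 tendsto_mult tendsto_const)
      fix \<tau> :: plane
      have "(\<lambda>n. inverse (real (Suc n)) *\<^sub>R \<tau>) \<longlonglongrightarrow> 0 *\<^sub>R \<tau>"
        by (intro tendsto_scaleR tendsto_const LIMSEQ_inverse_real_of_nat)
      then have "(\<lambda>n. inverse (real (Suc n)) *\<^sub>R \<tau>) \<longlonglongrightarrow> 0" by simp
      from isCont_tendsto_compose[OF c this] show "(\<lambda>n. A (\<tau> /\<^sub>R real (Suc n))) \<longlonglongrightarrow> A 0" .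
    qed
    show "AE \<tau> in lborel. cmod (A (\<tau> /\<^sub>R real (Suc n)) * gauss \<tau>) \<le> b * gauss \<tau>" for n
      using b gauss_pos by (intro AE_I2) (auto simp: norm_mult less_imp_le intro!: mult_right_mono)
  qed auto
  from tendsto_mult[OF tendsto_const[of "2 * pi :: complex"] this]
  have "(\<lambda>n. 2 * pi * (\<integral>\<tau>. A (\<tau> /\<^sub>R real (Suc n)) * gauss \<tau> \<partial>lborel)) \<longlonglongrightarrow> 2 * pi * (A 0 * (2 * pi))"
    by (simp add: integral_gauss)
  then show ?thesis by (simp only: eq of_nat_0_less_iff zero_less_Suc) (simp add: power2_eq_square algebra_simps)
qed

text \<open>The autocorrelation \<open>A\<close> of \<open>f\<close> has value
  \<parallel>f\<parallel>^2 at the origin, and its inverse transform is, up to a constant, the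
  square modulus of that of \<open>f\<close>. The inversion limit at 0 is therefore the identity
  claimed. Continuity of \<open>f\<close> is asked for almost everywhere only, because the result
  will be applied to truncations to balls.\<close>

lemma Plancherel_inv_fourier:
  assumes f: "integrable lborel f" and b: "\<And>\<zeta>. cmod (f \<zeta>) \<le> b"
    and c: "AE \<zeta> in lborel. isCont f \<zeta>"
  shows "integrable lborel (\<lambda>\<zeta>. (cmod (f \<zeta>))\<^sup>2)"
    and "integrable lborel (\<lambda>z. (cmod (inv_fourier f z))\<^sup>2)"
    and "(\<integral>z. (cmod (inv_fourier f z))\<^sup>2 \<partial>lborel) = (\<integral>\<zeta>. (cmod (f \<zeta>))\<^sup>2 \<partial>lborel)"
proof -
  have [measurable]: "f \<in> borel_measurable borel" using f by auto
  have b0: "b \<ge> 0" using order_trans[OF norm_ge_zero b] .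
  have sq: "(cmod (f \<zeta>))\<^sup>2 \<le> b * cmod (f \<zeta>)" for \<zeta>
    using mult_right_mono[OF b[of \<zeta>], of "cmod (f \<zeta>)"] by (simp add: power2_eq_square)
  show if2: "integrable lborel (\<lambda>\<zeta>. (cmod (f \<zeta>))\<^sup>2)"
    by (rule Bochner_Integration.integrable_bound[of _ "\<lambda>\<zeta>. b * cmod (f \<zeta>)"]) (use f sq b0 in auto)
  define f' where "f' = (\<lambda>\<zeta>. cnj (f (- \<zeta>)))"
  have f': "integrable lborel f'"
    using lborel_integrable_reflect[OF f, of 0] unfolding f'_def by (intro integrable_cnj) auto
  have [measurable]: "f' \<in> borel_measurable borel" using f' by auto
  define A where "A = conv f f'"
  have A: "integrable lborel A" unfolding A_def by (rule integrable_conv[OF f f'])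
  have Ab: "cmod (A \<tau>) \<le> b * (\<integral>\<zeta>. cmod (f \<zeta>) \<partial>lborel)" for \<tau>
  proof -
    have i: "integrable lborel (\<lambda>\<mu>. cmod (f \<mu>) * b)" using f by simp
    have le: "cmod (f \<mu> * f' (\<tau> - \<mu>)) \<le> cmod (f \<mu>) * b" for \<mu>
      by (auto simp: norm_mult f'_def intro!: mult_left_mono b)
    have "integrable lborel (\<lambda>\<mu>. f \<mu> * f' (\<tau> - \<mu>))"
      by (rule Bochner_Integration.integrable_bound[OF i]) (use le b0 in \<open>auto intro!: AE_I2\<close>)
    then have "cmod (A \<tau>) \<le> (\<integral>\<mu>. cmod (f \<mu>) * b \<partial>lborel)"
      unfolding A_def conv_def by (rule Bochner_Integration.integral_norm_bound_integral[OF _ i le])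
    then show ?thesis by (simp add: mult.commute)
  qed
  \<comment> \<open>The shift in the argument of \<open>f'\<close> passes to the limit wherever
    \<open>f\<close> is continuous, that is almost everywhere.\<close>
  have Ac: "isCont A 0"
    unfolding continuous_at_sequentially
  proof (intro allI impI)
    fix X :: "nat \<Rightarrow> plane" assume X: "X \<longlonglongrightarrow> 0"
    have "(\<lambda>n. \<integral>\<mu>. f \<mu> * f' (X n - \<mu>) \<partial>lborel) \<longlonglongrightarrow> (\<integral>\<mu>. f \<mu> * f' (0 - \<mu>) \<partial>lborel)"
    proof (rule integral_dominated_convergence[where w="\<lambda>\<mu>. b * cmod (f \<mu>)"])
      show "AE \<mu> in lborel. (\<lambda>n. f \<mu> * f' (X n - \<mu>)) \<longlonglongrightarrow> f \<mu> * f' (0 - \<mu>)"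
        using c
      proof eventually_elim
        case (elim \<mu>)
        have "(\<lambda>n. \<mu> - X n) \<longlonglongrightarrow> \<mu> - 0" by (intro tendsto_diff tendsto_const X)
        then have "(\<lambda>n. f (\<mu> - X n)) \<longlonglongrightarrow> f \<mu>" using isCont_tendsto_compose[OF elim] by simp
        then show ?case unfolding f'_def by (auto intro!: tendsto_intros)
      qed
      show "AE \<mu> in lborel. cmod (f \<mu> * f' (X n - \<mu>)) \<le> b * cmod (f \<mu>)" for n
        by (intro AE_I2) (auto simp: norm_mult f'_def mult.commute[of b] intro!: mult_left_mono b)
    qed (use f in auto)
    then show "(A \<circ> X) \<longlonglongrightarrow> A 0" by (simp add: A_def conv_def o_def)
  qed
  have A0: "A 0 = complex_of_real (\<integral>\<zeta>. (cmod (f \<zeta>))\<^sup>2 \<partial>lborel)"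
    unfolding A_def conv_def f'_def
    by (simp only: diff_0 minus_minus complex_norm_square[symmetric] integral_complex_of_real)
  have If': "inv_fourier f' z = cnj (inv_fourier f z)" for z
  proof -
    have "(\<integral>\<zeta>. iexp (z \<bullet> \<zeta>) * f' \<zeta> \<partial>lborel) = (\<integral>\<zeta>. iexp (z \<bullet> (0 - \<zeta>)) * f' (0 - \<zeta>) \<partial>lborel)"
      by (rule lborel_integral_reflect[symmetric]) measurable
    also have "\<dots> = (\<integral>\<zeta>. cnj (iexp (z \<bullet> \<zeta>) * f \<zeta>) \<partial>lborel)"
      by (simp add: f'_def exp_cnj)
    finally show ?thesis unfolding inv_fourier_def by (simp only: Bochner_Integration.integral_cnj) simp
  qed
  have sqA: "complex_of_real ((cmod (inv_fourier f z))\<^sup>2) = complex_of_real (1 / (2 * pi)\<^sup>2) * (\<integral>\<tau>. iexp (z \<bullet> \<tau>) * A \<tau> \<partial>lborel)" for z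
    unfolding complex_norm_square If'[symmetric] inv_fourier_mult[OF f f'] A_def[symmetric]
    by (simp add: inv_fourier_def power2_eq_square)
  let ?G = "\<lambda>n z. gauss (z /\<^sub>R real (Suc n)) * (cmod (inv_fourier f z))\<^sup>2"
  have "(\<lambda>n. complex_of_real (1 / (2 * pi)\<^sup>2) * (\<integral>z. complex_of_real (gauss (z /\<^sub>R real (Suc n))) * (\<integral>\<tau>. iexp (z \<bullet> \<tau>) * A \<tau> \<partial>lborel) \<partial>lborel))
     \<longlonglongrightarrow> complex_of_real (1 / (2 * pi)\<^sup>2) * ((2 * pi)\<^sup>2 * A 0)"
    by (intro tendsto_mult tendsto_const gauss_inversion_limit[OF A Ab Ac])
  also have "(\<lambda>n. complex_of_real (1 / (2 * pi)\<^sup>2) * (\<integral>z. complex_of_real (gauss (z /\<^sub>R real (Suc n))) * (\<integral>\<tau>. iexp (z \<bullet> \<tau>) * A \<tau> \<partial>lborel) \<partial>lborel))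
     = (\<lambda>n. \<integral>z. complex_of_real (?G n z) \<partial>lborel)"
    unfolding of_real_mult sqA by (rule ext) (simp add: mult.left_commute flip: integral_mult_right_zero)
  also have "complex_of_real (1 / (2 * pi)\<^sup>2) * ((2 * pi)\<^sup>2 * A 0) = A 0" by simp
  finally have "(\<lambda>n. complex_of_real (\<integral>z. ?G n z \<partial>lborel)) \<longlonglongrightarrow> A 0"
    unfolding integral_complex_of_real .
  then have lim: "(\<lambda>n. \<integral>z. ?G n z \<partial>lborel) \<longlonglongrightarrow> (\<integral>\<zeta>. (cmod (f \<zeta>))\<^sup>2 \<partial>lborel)"
    unfolding A0 by (simp only: tendsto_of_real_iff)
  have Im[measurable]: "inv_fourier f \<in> borel_measurable borel" by (rule measurable_inv_fourier[OF f])
  let ?b = "\<integral>\<zeta>. cmod (f \<zeta>) \<partial>lborel"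
  have iG: "integrable lborel (?G n)" for n
  proof (rule Bochner_Integration.integrable_bound)
    show "integrable lborel (\<lambda>z. gauss (z /\<^sub>R real (Suc n)) * ?b\<^sup>2)"
      using lborel_integrable_affine[OF _ integrable_gauss, of "1/real (Suc n)" 0]
      by (intro integrable_mult_left) (auto simp: divide_inverse)
    show "AE z in lborel. norm (?G n z) \<le> norm (gauss (z /\<^sub>R real (Suc n)) * ?b\<^sup>2)"
      by (intro AE_I2) (auto simp: abs_mult gauss_pos intro!: mult_left_mono power_mono inv_fourier_bound f)
  qed measurable
  \<comment> \<open>Wider Gaussians are larger, so monotone convergence gives integrability of the
    limit together with its integral.\<close>
  have mono: "mono (\<lambda>n. ?G n z)" for z
  proof (intro monoI mult_right_mono)
    fix m n :: nat assume "m \<le> n"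
    then have "norm (z /\<^sub>R real (Suc n)) \<le> norm (z /\<^sub>R real (Suc m))"
      by (auto intro!: mult_right_mono simp: field_simps)
    then have "(norm (z /\<^sub>R real (Suc n)))\<^sup>2 \<le> (norm (z /\<^sub>R real (Suc m)))\<^sup>2" by (intro power_mono) auto
    then show "gauss (z /\<^sub>R real (Suc m)) \<le> gauss (z /\<^sub>R real (Suc n))" by (simp only: gauss_def exp_le_cancel_iff)
  qed auto
  have plim: "(\<lambda>n. ?G n z) \<longlonglongrightarrow> (cmod (inv_fourier f z))\<^sup>2" for z
  proof -
    have "(\<lambda>n. inverse (real (Suc n)) *\<^sub>R z) \<longlonglongrightarrow> 0 *\<^sub>R z"
      by (intro tendsto_scaleR tendsto_const LIMSEQ_inverse_real_of_nat)
    then have "(\<lambda>n. inverse (real (Suc n)) *\<^sub>R z) \<longlonglongrightarrow> 0" by simp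
    moreover have "isCont gauss 0" using continuous_gauss[of UNIV] continuous_on_eq_continuous_at[OF open_UNIV, of gauss] by blast
    ultimately have "(\<lambda>n. gauss (z /\<^sub>R real (Suc n))) \<longlonglongrightarrow> 1"
      using isCont_tendsto_compose[of 0 gauss] by (fastforce simp: gauss_0)
    from tendsto_mult[OF this tendsto_const[of "(cmod (inv_fourier f z))\<^sup>2"]] show ?thesis by simp
  qed
  show "integrable lborel (\<lambda>z. (cmod (inv_fourier f z))\<^sup>2)"
    by (rule integral_monotone_convergence_nonneg(1)[OF iG _ _ _ lim])
      (use mono plim gauss_pos in \<open>auto simp: less_imp_le\<close>)
  show "(\<integral>z. (cmod (inv_fourier f z))\<^sup>2 \<partial>lborel) = (\<integral>\<zeta>. (cmod (f \<zeta>))\<^sup>2 \<partial>lborel)"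
    by (rule integral_monotone_convergence_nonneg(2)[OF iG _ _ _ lim])
      (use mono plim gauss_pos in \<open>auto simp: less_imp_le\<close>)
qed

section \<open>The Fourier transform on square integrable functions\<close>

lemma square_integrableD:
  assumes "square_integrable u"
  shows "u \<in> borel_measurable borel" "integrable lborel (\<lambda>z. (cmod (u z))\<^sup>2)"
  using assms by (auto simp: square_integrable_def)

lemma square_integrableI:
  "u \<in> borel_measurable borel \<Longrightarrow> integrable lborel (\<lambda>z. (cmod (u z))\<^sup>2) \<Longrightarrow> square_integrable u"
  by (auto simp: square_integrable_def)

lemma cmod_add_sq_le: "(cmod (x + y))\<^sup>2 \<le> 2 * (cmod x)\<^sup>2 + 2 * (cmod y)\<^sup>2"
proof -
  have "(cmod (x + y))\<^sup>2 \<le> (cmod x + cmod y)\<^sup>2" by (intro power_mono norm_triangle_ineq) auto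
  also have "\<dots> \<le> 2 * (cmod x)\<^sup>2 + 2 * (cmod y)\<^sup>2"
    using zero_le_power2[of "cmod x - cmod y"] by (simp add: power2_eq_square algebra_simps)
  finally show ?thesis .
qed

lemma square_integrable_add:
  assumes u: "square_integrable u" and v: "square_integrable v"
  shows "square_integrable (\<lambda>z. u z + v z)"
proof (rule square_integrableI)
  note [measurable] = square_integrableD(1)[OF u] square_integrableD(1)[OF v]
  show "(\<lambda>z. u z + v z) \<in> borel_measurable borel" by measurable
  show "integrable lborel (\<lambda>z. (cmod (u z + v z))\<^sup>2)"
    by (rule Bochner_Integration.integrable_bound[of _ "\<lambda>z. 2 * (cmod (u z))\<^sup>2 + 2 * (cmod (v z))\<^sup>2"])
      (use square_integrableD(2)[OF u] square_integrableD(2)[OF v] cmod_add_sq_le in auto)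
qed

lemma square_integrable_cmult:
  assumes u: "square_integrable u"
  shows "square_integrable (\<lambda>z. c * u z)"
proof (rule square_integrableI)
  note [measurable] = square_integrableD(1)[OF u]
  show "(\<lambda>z. c * u z) \<in> borel_measurable borel" by measurable
  show "integrable lborel (\<lambda>z. (cmod (c * u z))\<^sup>2)"
    using square_integrableD(2)[OF u] by (simp add: norm_mult power_mult_distrib)
qed

lemma truncated_fourier_eq_inv_fourier:
  "truncated_fourier R u \<zeta> = inv_fourier (\<lambda>z. indicator (cball 0 R) z *\<^sub>R u z) (- \<zeta>)"
  unfolding truncated_fourier_def inv_fourier_def set_lebesgue_integral_def
  by (simp add: inner_commute mult.left_commute scaleR_conv_of_real)

lemma integrable_on_cball:
  assumes u: "square_integrable u"
  shows "integrable lborel (\<lambda>z. indicator (cball 0 R) z *\<^sub>R u z)"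
proof (rule Bochner_Integration.integrable_bound)
  note [measurable] = square_integrableD(1)[OF u]
  have "emeasure lborel (cball (0::plane) R) < \<infinity>" by (intro emeasure_bounded_finite bounded_cball)
  then have "integrable lborel (\<lambda>z::plane. indicator (cball 0 R) z :: real)"
    by (intro integrable_real_indicator) auto
  then show "integrable lborel (\<lambda>z. indicator (cball 0 R) z + (cmod (u z))\<^sup>2 :: real)"
    using square_integrableD(2)[OF u] by auto
  have "cmod (u z) \<le> 1 + (cmod (u z))\<^sup>2" for z
  proof -
    have "2 * cmod (u z) \<le> 1 + (cmod (u z))\<^sup>2"
      using zero_le_power2[of "cmod (u z) - 1"] by (simp add: power2_eq_square algebra_simps)
    with norm_ge_zero[of "u z"] show ?thesis by linarith
  qed
  then show "AE z in lborel. norm (indicator (cball 0 R) z *\<^sub>R u z) \<le> norm (indicator (cball 0 R) z + (cmod (u z))\<^sup>2 :: real)"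
    by (intro AE_I2) (auto simp: indicator_def abs_of_nonneg)
qed (use square_integrableD(1)[OF u] in \<open>auto intro!: borel_measurable_scaleR borel_measurable_indicator\<close>)

lemma measurable_truncated_fourier:
  assumes u: "square_integrable u"
  shows "truncated_fourier R u \<in> borel_measurable borel"
proof -
  have "continuous_on UNIV (\<lambda>\<zeta>. inv_fourier (\<lambda>z. indicator (cball 0 R) z *\<^sub>R u z) (- \<zeta>))"
    by (intro continuous_on_compose2[OF continuous_on_inv_fourier[OF integrable_on_cball[OF u], of UNIV]]
        continuous_intros) auto
  then show ?thesis
    unfolding truncated_fourier_eq_inv_fourier[abs_def] by (rule borel_measurable_continuous_onI)
qed

lemma isCont_indicator_cball:
  fixes u :: "plane \<Rightarrow> complex"
  assumes u: "continuous_on UNIV u" and z: "norm z \<noteq> R"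
  shows "isCont (\<lambda>z. indicator (cball 0 R) z *\<^sub>R u z) z"
proof (cases "norm z < R")
  case True
  have "continuous_on (ball 0 R) (\<lambda>z. indicator (cball 0 R) z *\<^sub>R u z)"
    using continuous_on_subset[OF u, of "ball 0 R"]
    by (rule continuous_on_eq) (auto simp: indicator_def)
  with True show ?thesis by (auto simp: continuous_on_eq_continuous_at)
next
  case False
  have "continuous_on (- cball 0 R) (\<lambda>z. indicator (cball 0 R) z *\<^sub>R u z)"
    by (rule continuous_on_eq[of _ "\<lambda>_. 0"]) (auto simp: indicator_def)
  moreover have "z \<in> - cball 0 R" using False z by auto
  ultimately show ?thesis using continuous_on_eq_continuous_at[of "- cball 0 R"] open_Compl[OF closed_cball]
    by blast
qed

lemma AE_norm_neq: "AE z in lborel. norm (z::plane) \<noteq> R"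
proof -
  have "sphere (0::plane) R \<in> null_sets lborel"
    using negligible_sphere[of "0::plane" R]
    by (simp add: negligible_iff_null_sets null_sets_completion_iff)
  then have "AE z in lborel. z \<notin> sphere (0::plane) R" by (rule AE_not_in)
  then show ?thesis by eventually_elim auto
qed

text \<open>Let u be the inverse transform of g and F_R the transform of its truncation to the ball
  of radius R. Plancherel for the truncation gives \<parallel>F_R\<parallel>^2 = \<open>a R\<close>,
  the square norm of the truncation, and Fubini gives the same value for the inner product of F_R
  and g. Hence \<parallel>F_R - g\<parallel>^2 = \<parallel>g\<parallel>^2 - \<open>a R\<close>,
  which tends to 0 because \<open>a R\<close> increases to \<parallel>u\<parallel>^2 =
  \<parallel>g\<parallel>^2.\<close>

theorem has_fourier_inv_fourier:
  assumes g: "integrable lborel g" and b: "\<And>\<zeta>. cmod (g \<zeta>) \<le> b"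
    and c: "AE \<zeta> in lborel. isCont g \<zeta>"
  shows "has_fourier (inv_fourier g) g"
proof -
  define u where "u = inv_fourier g"
  note P = Plancherel_inv_fourier[OF g b c]
  have [measurable]: "g \<in> borel_measurable borel" using g by auto
  have um[measurable]: "u \<in> borel_measurable borel" unfolding u_def by (rule measurable_inv_fourier[OF g])
  have uc: "continuous_on UNIV u" unfolding u_def by (rule continuous_on_inv_fourier[OF g])
  have ub: "cmod (u z) \<le> (\<integral>\<zeta>. cmod (g \<zeta>) \<partial>lborel)" for z unfolding u_def by (rule inv_fourier_bound[OF g])
  have u2: "square_integrable u" using P(2) by (intro square_integrableI um) (simp add: u_def)
  have g2: "square_integrable g" using P(1) by (intro square_integrableI) auto
  define uR where "uR = (\<lambda>R z. indicator (cball 0 R) z *\<^sub>R u z)"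
  define F where "F = (\<lambda>R. truncated_fourier R u)"
  have F: "F R \<zeta> = inv_fourier (uR R) (- \<zeta>)" for R \<zeta>
    unfolding F_def uR_def by (rule truncated_fourier_eq_inv_fourier)
  have iuR: "integrable lborel (uR R)" for R unfolding uR_def by (rule integrable_on_cball[OF u2])
  have uRb: "cmod (uR R z) \<le> (\<integral>\<zeta>. cmod (g \<zeta>) \<partial>lborel)" for R z
    unfolding uR_def using ub[of z] order_trans[OF norm_ge_zero ub[of z]] by (auto simp: indicator_def)
  \<comment> \<open>Truncation creates jumps only on a sphere, which is a null set.\<close>
  have uRc: "AE z in lborel. isCont (uR R) z" for R
    using AE_norm_neq[of R] by eventually_elim (auto simp: uR_def intro!: isCont_indicator_cball[OF uc])
  note PR = Plancherel_inv_fourier[OF iuR uRb uRc]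
  have Fm[measurable]: "F R \<in> borel_measurable borel" for R
    unfolding F_def by (rule measurable_truncated_fourier[OF u2])
  define a where "a = (\<lambda>R. \<integral>z. (cmod (uR R z))\<^sup>2 \<partial>lborel)"
  define G where "G = (\<integral>\<zeta>. (cmod (g \<zeta>))\<^sup>2 \<partial>lborel)"
  have F2: "integrable lborel (\<lambda>\<zeta>. (cmod (F R \<zeta>))\<^sup>2)" for R
    using lborel_integrable_reflect[OF PR(2)[of R], of 0] by (simp add: F)
  have F2a: "(\<integral>\<zeta>. (cmod (F R \<zeta>))\<^sup>2 \<partial>lborel) = a R" for R
  proof -
    have "(\<integral>\<zeta>. (cmod (F R \<zeta>))\<^sup>2 \<partial>lborel) = (\<integral>\<zeta>. (cmod (inv_fourier (uR R) (0 - \<zeta>)))\<^sup>2 \<partial>lborel)"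
      by (simp add: F)
    also have "\<dots> = (\<integral>\<zeta>. (cmod (inv_fourier (uR R) \<zeta>))\<^sup>2 \<partial>lborel)"
      by (rule lborel_integral_reflect) (use measurable_inv_fourier[OF iuR] in measurable)
    finally show ?thesis using PR(3) by (simp add: a_def)
  qed
  have [measurable]: "(\<lambda>\<zeta>. cnj (g \<zeta>)) \<in> borel_measurable borel"
    using borel_measurable_integrable[OF integrable_cnj[OF g]] by simp
  have ix: "integrable lborel (\<lambda>\<zeta>. cnj (g \<zeta>) * F R \<zeta>)" for R
  proof (rule Bochner_Integration.integrable_bound)
    show "integrable lborel (\<lambda>\<zeta>. cmod (g \<zeta>) * (\<integral>\<zeta>. cmod (uR R \<zeta>) \<partial>lborel))" using g by auto
    show "AE \<zeta> in lborel. norm (cnj (g \<zeta>) * F R \<zeta>) \<le> norm (cmod (g \<zeta>) * (\<integral>\<zeta>. cmod (uR R \<zeta>) \<partial>lborel))"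
      by (intro AE_I2) (auto simp: norm_mult F abs_mult intro!: mult_left_mono inv_fourier_bound iuR)
  qed measurable
  \<comment> \<open>Fubini moves the transform from the truncation of \<open>u\<close> to
    \<open>g\<close>, where it reproduces the conjugate of \<open>u\<close>.\<close>
  have cross: "(\<integral>\<zeta>. cnj (g \<zeta>) * F R \<zeta> \<partial>lborel) = complex_of_real (a R)" for R
  proof -
    have "(\<integral>\<zeta>. cnj (g \<zeta>) * F R \<zeta> \<partial>lborel)
       = (\<integral>\<zeta>. complex_of_real (1 / (2 * pi)) * (cnj (g \<zeta>) * (\<integral>z. iexp (- \<zeta> \<bullet> z) * uR R z \<partial>lborel)) \<partial>lborel)"
      unfolding F inv_fourier_def by (simp only: mult.left_commute)
    also have "\<dots> = complex_of_real (1 / (2 * pi)) * (\<integral>\<zeta>. cnj (g \<zeta>) * (\<integral>z. iexp (- \<zeta> \<bullet> z) * uR R z \<partial>lborel) \<partial>lborel)"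
      by (rule integral_mult_right_zero)
    also have "(\<integral>\<zeta>. cnj (g \<zeta>) * (\<integral>z. iexp (- \<zeta> \<bullet> z) * uR R z \<partial>lborel) \<partial>lborel)
       = (\<integral>z. uR R z * (\<integral>\<zeta>. iexp (- \<zeta> \<bullet> z) * cnj (g \<zeta>) \<partial>lborel) \<partial>lborel)"
      using g by (intro Fubini_bounded_kernel[OF iuR])
        (auto simp: split_def intro!: borel_measurable_continuous_onI continuous_intros)
    also have "(\<lambda>z. \<integral>\<zeta>. iexp (- \<zeta> \<bullet> z) * cnj (g \<zeta>) \<partial>lborel) = (\<lambda>z. cnj (\<integral>\<zeta>. iexp (z \<bullet> \<zeta>) * g \<zeta> \<partial>lborel))"
      by (simp add: exp_cnj inner_commute flip: Bochner_Integration.integral_cnj)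
    also have "complex_of_real (1 / (2 * pi)) * (\<integral>z. uR R z * cnj (\<integral>\<zeta>. iexp (z \<bullet> \<zeta>) * g \<zeta> \<partial>lborel) \<partial>lborel)
       = (\<integral>z. uR R z * cnj (u z) \<partial>lborel)"
      unfolding u_def inv_fourier_def integral_mult_right_zero[symmetric] by (simp add: mult.left_commute)
    also have "(\<lambda>z. uR R z * cnj (u z)) = (\<lambda>z. complex_of_real ((cmod (uR R z))\<^sup>2))"
      by (rule ext) (auto simp: uR_def indicator_def complex_norm_square simp del: of_real_power)
    finally show ?thesis by (simp only: integral_complex_of_real a_def)
  qed
  have diff: "integrable lborel (\<lambda>\<zeta>. (cmod (F R \<zeta> - g \<zeta>))\<^sup>2)"
      "(\<integral>\<zeta>. (cmod (F R \<zeta> - g \<zeta>))\<^sup>2 \<partial>lborel) = G - a R" for R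
  proof -
    define r where "r = (\<lambda>\<zeta>. Re (cnj (g \<zeta>) * F R \<zeta>))"
    have e: "(cmod (F R \<zeta> - g \<zeta>))\<^sup>2 = (cmod (F R \<zeta>))\<^sup>2 + (cmod (g \<zeta>))\<^sup>2 - 2 * r \<zeta>" for \<zeta>
      unfolding cmod_power2 r_def by (simp add: power2_eq_square algebra_simps)
    have i: "integrable lborel r" unfolding r_def by (rule integrable_Re[OF ix])
    show "integrable lborel (\<lambda>\<zeta>. (cmod (F R \<zeta> - g \<zeta>))\<^sup>2)"
      unfolding e using F2 P(1) i by auto
    have "integral\<^sup>L lborel r = a R"
      using cross[of R] integral_Re[OF ix[of R]] by (simp add: r_def[abs_def])
    then show "(\<integral>\<zeta>. (cmod (F R \<zeta> - g \<zeta>))\<^sup>2 \<partial>lborel) = G - a R"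
      unfolding e using F2[of R] P(1) i by (simp add: F2a G_def)
  qed
  have lim: "(a \<longlongrightarrow> G) at_top"
  proof -
    have "((\<lambda>R. \<integral>z. indicator (cball 0 R) z * (cmod (u z))\<^sup>2 \<partial>lborel) \<longlongrightarrow> (\<integral>z. (cmod (u z))\<^sup>2 \<partial>lborel)) at_top"
    proof (rule integral_dominated_convergence_at_top[where w="\<lambda>z. (cmod (u z))\<^sup>2"])
      show "AE z in lborel. ((\<lambda>R. indicator (cball 0 R) z * (cmod (u z))\<^sup>2) \<longlongrightarrow> (cmod (u z))\<^sup>2) at_top"
      proof (rule AE_I2)
        fix z
        have "eventually (\<lambda>R. indicator (cball 0 R) z * (cmod (u z))\<^sup>2 = (cmod (u z))\<^sup>2) at_top"
          using eventually_ge_at_top[of "norm z"] by eventually_elim (auto simp: indicator_def)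
        then show "((\<lambda>R. indicator (cball 0 R) z * (cmod (u z))\<^sup>2) \<longlongrightarrow> (cmod (u z))\<^sup>2) at_top"
          by (rule tendsto_eventually)
      qed
    qed (use square_integrableD(2)[OF u2] in \<open>auto simp: indicator_def\<close>)
    moreover have "(\<lambda>R. \<integral>z. indicator (cball 0 R) z * (cmod (u z))\<^sup>2 \<partial>lborel) = a"
      unfolding a_def uR_def
      by (intro ext Bochner_Integration.integral_cong) (auto simp: indicator_def)
    ultimately show ?thesis using P(3) by (simp add: u_def G_def)
  qed
  have "((\<lambda>R. ennreal (G - a R)) \<longlongrightarrow> ennreal (G - G)) at_top"
    by (intro tendsto_ennrealI tendsto_intros lim)
  moreover have "(\<integral>\<^sup>+\<zeta>. ennreal ((cmod (F R \<zeta> - g \<zeta>))\<^sup>2) \<partial>lborel) = ennreal (G - a R)" for R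
    using nn_integral_eq_integral[OF diff(1)[of R]] diff(2)[of R] by simp
  ultimately show ?thesis
    unfolding has_fourier_def using u2 g2 by (simp add: u_def F_def)
qed

lemma nn_integral_sq_add_le:
  assumes [measurable]: "f \<in> borel_measurable borel" "h \<in> borel_measurable borel"
  shows "(\<integral>\<^sup>+\<zeta>. ennreal ((cmod (f \<zeta> + h \<zeta>))\<^sup>2) \<partial>(lborel::plane measure))
    \<le> 2 * (\<integral>\<^sup>+\<zeta>. ennreal ((cmod (f \<zeta>))\<^sup>2) \<partial>lborel) + 2 * (\<integral>\<^sup>+\<zeta>. ennreal ((cmod (h \<zeta>))\<^sup>2) \<partial>lborel)"
proof -
  have "(\<integral>\<^sup>+\<zeta>. ennreal ((cmod (f \<zeta> + h \<zeta>))\<^sup>2) \<partial>lborel)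
    \<le> (\<integral>\<^sup>+\<zeta>. 2 * ennreal ((cmod (f \<zeta>))\<^sup>2) + 2 * ennreal ((cmod (h \<zeta>))\<^sup>2) \<partial>(lborel::plane measure))"
  proof (rule nn_integral_mono)
    fix \<zeta>
    have "ennreal ((cmod (f \<zeta> + h \<zeta>))\<^sup>2) \<le> ennreal (2 * (cmod (f \<zeta>))\<^sup>2 + 2 * (cmod (h \<zeta>))\<^sup>2)"
      by (intro ennreal_leI cmod_add_sq_le)
    then show "ennreal ((cmod (f \<zeta> + h \<zeta>))\<^sup>2) \<le> 2 * ennreal ((cmod (f \<zeta>))\<^sup>2) + 2 * ennreal ((cmod (h \<zeta>))\<^sup>2)"
      by (simp add: ennreal_plus ennreal_mult)
  qed
  also have "\<dots> = 2 * (\<integral>\<^sup>+\<zeta>. ennreal ((cmod (f \<zeta>))\<^sup>2) \<partial>lborel) + 2 * (\<integral>\<^sup>+\<zeta>. ennreal ((cmod (h \<zeta>))\<^sup>2) \<partial>lborel)"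
    by (simp add: nn_integral_add nn_integral_cmult)
  finally show ?thesis .
qed

lemma tendsto_two_ennreal:
  fixes f h :: "real \<Rightarrow> ennreal"
  assumes "(f \<longlongrightarrow> 0) at_top" "(h \<longlongrightarrow> 0) at_top"
  shows "((\<lambda>R. 2 * f R + 2 * h R) \<longlongrightarrow> 0) at_top"
  using tendsto_add[OF ennreal_tendsto_cmult[OF _ assms(1), of 2] ennreal_tendsto_cmult[OF _ assms(2), of 2]]
  by simp

lemma has_fourierD:
  assumes "has_fourier u g"
  shows "square_integrable u" "square_integrable g"
    "((\<lambda>R. \<integral>\<^sup>+\<zeta>. ennreal ((cmod (truncated_fourier R u \<zeta> - g \<zeta>))\<^sup>2) \<partial>lborel) \<longlongrightarrow> 0) at_top"
  using assms unfolding has_fourier_def by blast+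

lemma has_fourier_unique:
  assumes g: "has_fourier u g" and h: "has_fourier u h"
  shows "AE \<zeta> in lborel. g \<zeta> = h \<zeta>"
proof -
  note [measurable] = square_integrableD(1)[OF has_fourierD(2)[OF g]] square_integrableD(1)[OF has_fourierD(2)[OF h]]
    measurable_truncated_fourier[OF has_fourierD(1)[OF g]]
  have le: "(\<integral>\<^sup>+\<zeta>. ennreal ((cmod (h \<zeta> - g \<zeta>))\<^sup>2) \<partial>lborel)
    \<le> 2 * (\<integral>\<^sup>+\<zeta>. ennreal ((cmod (truncated_fourier R u \<zeta> - g \<zeta>))\<^sup>2) \<partial>lborel)
     + 2 * (\<integral>\<^sup>+\<zeta>. ennreal ((cmod (truncated_fourier R u \<zeta> - h \<zeta>))\<^sup>2) \<partial>lborel)" for R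
    using nn_integral_sq_add_le[of "\<lambda>\<zeta>. truncated_fourier R u \<zeta> - g \<zeta>" "\<lambda>\<zeta>. h \<zeta> - truncated_fourier R u \<zeta>"]
    by (simp add: norm_minus_commute[of "h _"])
  have "(\<integral>\<^sup>+\<zeta>. ennreal ((cmod (h \<zeta> - g \<zeta>))\<^sup>2) \<partial>lborel) \<le> 0"
    by (rule tendsto_lowerbound[OF tendsto_two_ennreal[OF has_fourierD(3)[OF g] has_fourierD(3)[OF h]]])
      (use le in auto)
  then have "(\<integral>\<^sup>+\<zeta>. ennreal ((cmod (h \<zeta> - g \<zeta>))\<^sup>2) \<partial>lborel) = 0" by simp
  then have "AE \<zeta> in lborel. ennreal ((cmod (h \<zeta> - g \<zeta>))\<^sup>2) = 0"
    by (subst (asm) nn_integral_0_iff_AE) auto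
  then show ?thesis by eventually_elim simp
qed

lemma has_fourier_add:
  assumes g: "has_fourier u g" and h: "has_fourier v h"
  shows "has_fourier (\<lambda>z. u z + v z) (\<lambda>\<zeta>. g \<zeta> + h \<zeta>)"
  unfolding has_fourier_def
proof (intro conjI square_integrable_add has_fourierD(1)[OF g] has_fourierD(1)[OF h] has_fourierD(2)[OF g] has_fourierD(2)[OF h])
  note u = has_fourierD(1)[OF g] and v = has_fourierD(1)[OF h]
  note [measurable] = square_integrableD(1)[OF has_fourierD(2)[OF g]] square_integrableD(1)[OF has_fourierD(2)[OF h]]
    measurable_truncated_fourier[OF u] measurable_truncated_fourier[OF v]
  have tf: "truncated_fourier R (\<lambda>z. u z + v z) \<zeta> = truncated_fourier R u \<zeta> + truncated_fourier R v \<zeta>" for R \<zeta>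
    unfolding truncated_fourier_eq_inv_fourier inv_fourier_def
    using integrable_iexp_mult[OF integrable_on_cball[OF u, of R], of "-\<zeta>"]
      integrable_iexp_mult[OF integrable_on_cball[OF v, of R], of "-\<zeta>"]
    by (simp only: scaleR_add_right distrib_left Bochner_Integration.integral_add)
  show "((\<lambda>R. \<integral>\<^sup>+\<zeta>. ennreal ((cmod (truncated_fourier R (\<lambda>z. u z + v z) \<zeta> - (g \<zeta> + h \<zeta>)))\<^sup>2) \<partial>lborel) \<longlongrightarrow> 0) at_top"
  proof (rule tendsto_sandwich[OF _ _ tendsto_const tendsto_two_ennreal[OF has_fourierD(3)[OF g] has_fourierD(3)[OF h]]])
    show "eventually (\<lambda>R. (\<integral>\<^sup>+\<zeta>. ennreal ((cmod (truncated_fourier R (\<lambda>z. u z + v z) \<zeta> - (g \<zeta> + h \<zeta>)))\<^sup>2) \<partial>lborel)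
      \<le> 2 * (\<integral>\<^sup>+\<zeta>. ennreal ((cmod (truncated_fourier R u \<zeta> - g \<zeta>))\<^sup>2) \<partial>lborel)
     + 2 * (\<integral>\<^sup>+\<zeta>. ennreal ((cmod (truncated_fourier R v \<zeta> - h \<zeta>))\<^sup>2) \<partial>lborel)) at_top"
    proof (intro always_eventually allI)
      fix R
      have "truncated_fourier R (\<lambda>z. u z + v z) \<zeta> - (g \<zeta> + h \<zeta>)
         = (truncated_fourier R u \<zeta> - g \<zeta>) + (truncated_fourier R v \<zeta> - h \<zeta>)" for \<zeta>
        unfolding tf by simp
      then show "(\<integral>\<^sup>+\<zeta>. ennreal ((cmod (truncated_fourier R (\<lambda>z. u z + v z) \<zeta> - (g \<zeta> + h \<zeta>)))\<^sup>2) \<partial>lborel)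
      \<le> 2 * (\<integral>\<^sup>+\<zeta>. ennreal ((cmod (truncated_fourier R u \<zeta> - g \<zeta>))\<^sup>2) \<partial>lborel)
     + 2 * (\<integral>\<^sup>+\<zeta>. ennreal ((cmod (truncated_fourier R v \<zeta> - h \<zeta>))\<^sup>2) \<partial>lborel)"
        by (simp only:) (rule nn_integral_sq_add_le; measurable)
    qed
  qed auto
qed

lemma has_fourier_cmult:
  assumes g: "has_fourier u g"
  shows "has_fourier (\<lambda>z. c * u z) (\<lambda>\<zeta>. c * g \<zeta>)"
  unfolding has_fourier_def
proof (intro conjI square_integrable_cmult has_fourierD(1)[OF g] has_fourierD(2)[OF g])
  note u = has_fourierD(1)[OF g]
  note [measurable] = square_integrableD(1)[OF has_fourierD(2)[OF g]] measurable_truncated_fourier[OF u]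
  have tf: "truncated_fourier R (\<lambda>z. c * u z) \<zeta> = c * truncated_fourier R u \<zeta>" for R \<zeta>
    unfolding truncated_fourier_eq_inv_fourier inv_fourier_def
    by (simp only: mult_scaleR_right[symmetric] mult.left_commute[of _ c] integral_mult_right_zero)
  have "(\<integral>\<^sup>+\<zeta>. ennreal ((cmod (truncated_fourier R (\<lambda>z. c * u z) \<zeta> - c * g \<zeta>))\<^sup>2) \<partial>lborel)
     = ennreal ((cmod c)\<^sup>2) * (\<integral>\<^sup>+\<zeta>. ennreal ((cmod (truncated_fourier R u \<zeta> - g \<zeta>))\<^sup>2) \<partial>lborel)" for R
    unfolding tf right_diff_distrib[symmetric] norm_mult power_mult_distrib
    by (simp add: ennreal_mult nn_integral_cmult)
  moreover have "((\<lambda>R. ennreal ((cmod c)\<^sup>2) * (\<integral>\<^sup>+\<zeta>. ennreal ((cmod (truncated_fourier R u \<zeta> - g \<zeta>))\<^sup>2) \<partial>lborel)) \<longlongrightarrow> ennreal ((cmod c)\<^sup>2) * 0) at_top"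
    by (intro ennreal_tendsto_cmult has_fourierD(3)[OF g]) simp
  ultimately show "((\<lambda>R. \<integral>\<^sup>+\<zeta>. ennreal ((cmod (truncated_fourier R (\<lambda>z. c * u z) \<zeta> - c * g \<zeta>))\<^sup>2) \<partial>lborel) \<longlongrightarrow> 0) at_top"
    by simp
qed

text \<open>The map \<open>S\<close> returns representatives that agree with the smooth solution
  only almost everywhere; this transfers the known spectrum to them.\<close>

lemma has_fourier_cong_AE:
  assumes g: "has_fourier u g" and v: "square_integrable v" and uv: "AE z in lborel. v z = u z"
  shows "has_fourier v g"
proof -
  note [measurable] = square_integrableD(1)[OF has_fourierD(1)[OF g]] square_integrableD(1)[OF v]
  have "truncated_fourier R v \<zeta> = truncated_fourier R u \<zeta>" for R \<zeta>
  proof -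
    have "(\<integral>z. iexp (- \<zeta> \<bullet> z) * (indicator (cball 0 R) z *\<^sub>R v z) \<partial>lborel)
       = (\<integral>z. iexp (- \<zeta> \<bullet> z) * (indicator (cball 0 R) z *\<^sub>R u z) \<partial>lborel)"
      by (rule integral_cong_AE[OF borel_measurable_integrable[OF integrable_iexp_mult[OF integrable_on_cball[OF v]]]
        borel_measurable_integrable[OF integrable_iexp_mult[OF integrable_on_cball[OF has_fourierD(1)[OF g]]]]])
        (use uv in \<open>auto elim!: eventually_mono\<close>)
    then show ?thesis unfolding truncated_fourier_eq_inv_fourier inv_fourier_def by simp
  qed
  then show ?thesis using g v unfolding has_fourier_def by simp
qed

text \<open>\<open>fourier\<close> is a choice among almost everywhere equal functions; integrals
  involving it are computed by exchanging it for an explicit transform.\<close>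

lemma fourier_AE_eq:
  assumes g: "has_fourier u g"
  shows "has_fourier u (fourier u)" "AE \<zeta> in lborel. fourier u \<zeta> = g \<zeta>"
proof -
  show *: "has_fourier u (fourier u)" unfolding fourier_def by (rule someI[of "has_fourier u", OF g])
  show "AE \<zeta> in lborel. fourier u \<zeta> = g \<zeta>" by (rule has_fourier_unique[OF * g])
qed

section \<open>Weighted square integrable spectra\<close>

lemma integral_Cauchy_Schwarz:
  fixes f h :: "'a \<Rightarrow> real"
  assumes [measurable]: "f \<in> borel_measurable M" "h \<in> borel_measurable M"
    and f: "integrable M (\<lambda>x. (f x)\<^sup>2)" and h: "integrable M (\<lambda>x. (h x)\<^sup>2)"
  shows "integrable M (\<lambda>x. f x * h x)"
    and "\<bar>\<integral>x. f x * h x \<partial>M\<bar> \<le> sqrt (\<integral>x. (f x)\<^sup>2 \<partial>M) * sqrt (\<integral>x. (h x)\<^sup>2 \<partial>M)"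
proof -
  \<comment> \<open>Young's inequality with a free parameter, optimised below.\<close>
  have bd: "\<bar>x * y\<bar> \<le> c * x\<^sup>2 / 2 + y\<^sup>2 / (2 * c)" if "c > 0" for x y c :: real
  proof -
    have "0 \<le> (c * \<bar>x\<bar> - \<bar>y\<bar>)\<^sup>2 / (2 * c)" using that by simp
    also have "\<dots> = c * x\<^sup>2 / 2 + y\<^sup>2 / (2 * c) - \<bar>x * y\<bar>"
      using that by (simp add: power2_eq_square field_simps abs_mult)
    finally show ?thesis by simp
  qed
  show i: "integrable M (\<lambda>x. f x * h x)"
  proof (rule Bochner_Integration.integrable_bound)
    show "integrable M (\<lambda>x. 1 * (f x)\<^sup>2 / 2 + (h x)\<^sup>2 / (2 * 1))" using f h by auto
    show "AE x in M. norm (f x * h x) \<le> norm (1 * (f x)\<^sup>2 / 2 + (h x)\<^sup>2 / (2 * 1))"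
      using bd[of 1] by (intro AE_I2) (auto simp: abs_of_nonneg)
  qed measurable
  define A where "A = sqrt (\<integral>x. (f x)\<^sup>2 \<partial>M)"
  define B where "B = sqrt (\<integral>x. (h x)\<^sup>2 \<partial>M)"
  have A: "A \<ge> 0" "A\<^sup>2 = (\<integral>x. (f x)\<^sup>2 \<partial>M)" and B: "B \<ge> 0" "B\<^sup>2 = (\<integral>x. (h x)\<^sup>2 \<partial>M)"
    by (auto simp: A_def B_def)
  have "\<bar>\<integral>x. f x * h x \<partial>M\<bar> \<le> A * B"
  proof (cases "A = 0 \<or> B = 0")
    case True
    then have "AE x in M. f x * h x = 0"
    proof
      assume "A = 0"
      then have "(\<integral>x. (f x)\<^sup>2 \<partial>M) = 0" using A by simp
      then have "AE x in M. (f x)\<^sup>2 = 0"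
        using integral_nonneg_eq_0_iff_AE[OF f] by auto
      then show ?thesis by eventually_elim auto
    next
      assume "B = 0"
      then have "(\<integral>x. (h x)\<^sup>2 \<partial>M) = 0" using B by simp
      then have "AE x in M. (h x)\<^sup>2 = 0"
        using integral_nonneg_eq_0_iff_AE[OF h] by auto
      then show ?thesis by eventually_elim auto
    qed
    then have "(\<integral>x. f x * h x \<partial>M) = (\<integral>x. 0 \<partial>M)" by (intro integral_cong_AE) auto
    with A B show ?thesis by simp
  next
    case False
    then have AB: "A > 0" "B > 0" using A B by auto
    \<comment> \<open>This choice balances the two terms after integration. It needs both norms
      nonzero, whence the separate degenerate case.\<close>
    define c where "c = B / A"
    have c: "c > 0" using AB by (simp add: c_def)
    have "\<bar>\<integral>x. f x * h x \<partial>M\<bar> \<le> (\<integral>x. \<bar>f x * h x\<bar> \<partial>M)" by (rule integral_abs_bound)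
    also have "\<dots> \<le> (\<integral>x. c * (f x)\<^sup>2 / 2 + (h x)\<^sup>2 / (2 * c) \<partial>M)"
      using i f h by (intro integral_mono) (auto intro!: bd[OF c])
    also have "\<dots> = c * A\<^sup>2 / 2 + B\<^sup>2 / (2 * c)"
      using f h by (simp add: A(2) B(2))
    also have "\<dots> = A * B" using AB by (simp add: c_def power2_eq_square field_simps)
    finally show ?thesis .
  qed
  then show "\<bar>\<integral>x. f x * h x \<partial>M\<bar> \<le> sqrt (\<integral>x. (f x)\<^sup>2 \<partial>M) * sqrt (\<integral>x. (h x)\<^sup>2 \<partial>M)"
    by (simp add: A_def B_def)
qed

lemma integral_Minkowski:
  fixes f h :: "'a \<Rightarrow> real"
  assumes m: "f \<in> borel_measurable M" "h \<in> borel_measurable M"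
    and f: "integrable M (\<lambda>x. (f x)\<^sup>2)" and h: "integrable M (\<lambda>x. (h x)\<^sup>2)"
  shows "integrable M (\<lambda>x. (f x + h x)\<^sup>2)"
    and "sqrt (\<integral>x. (f x + h x)\<^sup>2 \<partial>M) \<le> sqrt (\<integral>x. (f x)\<^sup>2 \<partial>M) + sqrt (\<integral>x. (h x)\<^sup>2 \<partial>M)"
proof -
  note CS = integral_Cauchy_Schwarz[OF m f h]
  have e: "(f x + h x)\<^sup>2 = (f x)\<^sup>2 + 2 * (f x * h x) + (h x)\<^sup>2" for x
    by (simp add: power2_eq_square algebra_simps)
  show "integrable M (\<lambda>x. (f x + h x)\<^sup>2)" unfolding e using CS(1) f h by auto
  define A where "A = sqrt (\<integral>x. (f x)\<^sup>2 \<partial>M)"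
  define B where "B = sqrt (\<integral>x. (h x)\<^sup>2 \<partial>M)"
  have A: "A \<ge> 0" "A\<^sup>2 = (\<integral>x. (f x)\<^sup>2 \<partial>M)" and B: "B \<ge> 0" "B\<^sup>2 = (\<integral>x. (h x)\<^sup>2 \<partial>M)"
    by (auto simp: A_def B_def)
  have "(\<integral>x. (f x + h x)\<^sup>2 \<partial>M) = A\<^sup>2 + 2 * (\<integral>x. f x * h x \<partial>M) + B\<^sup>2"
    unfolding e using CS(1) f h by (simp add: A B)
  also have "\<dots> \<le> A\<^sup>2 + 2 * (A * B) + B\<^sup>2"
    using CS(2) unfolding A_def[symmetric] B_def[symmetric] by simp
  also have "\<dots> = (A + B)\<^sup>2" by (simp add: power2_eq_square algebra_simps)
  finally have "sqrt (\<integral>x. (f x + h x)\<^sup>2 \<partial>M) \<le> A + B" using A(1) B(1) by (simp add: real_le_lsqrt)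
  then show "sqrt (\<integral>x. (f x + h x)\<^sup>2 \<partial>M) \<le> sqrt (\<integral>x. (f x)\<^sup>2 \<partial>M) + sqrt (\<integral>x. (h x)\<^sup>2 \<partial>M)"
    by (simp add: A_def B_def)
qed

definition sob_weight :: "(plane \<Rightarrow> real) \<Rightarrow> real \<Rightarrow> plane \<Rightarrow> real" where
  "sob_weight m s \<zeta> = (1 + (norm \<zeta>)\<^sup>2) powr (s / 2) * m \<zeta>"

lemma mult_in_Hs_iff:
  "mult_in_Hs m s u \<longleftrightarrow> (\<exists>g. has_fourier u g \<and> square_integrable (\<lambda>\<zeta>. complex_of_real (sob_weight m s \<zeta>) * g \<zeta>))"
  by (simp add: mult_in_Hs_def sob_weight_def)

lemma measurable_sob_weight [measurable]:
  assumes [measurable]: "m \<in> borel_measurable borel"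
  shows "sob_weight m s \<in> borel_measurable borel"
  unfolding sob_weight_def[abs_def] by measurable

lemma measurable_symb_xy [measurable]: "symb_xy a \<in> borel_measurable borel"
  and measurable_symb_yx [measurable]: "symb_yx a \<in> borel_measurable borel"
  unfolding symb_xy_def symb_yx_def borel_prod[symmetric] by measurable

lemma sq_integrable_cong_AE:
  assumes gh: "AE \<zeta> in lborel. g \<zeta> = h \<zeta>" and g: "square_integrable (\<lambda>\<zeta>. M \<zeta> * g \<zeta>)"
    and [measurable]: "h \<in> borel_measurable borel" "M \<in> borel_measurable borel"
  shows "square_integrable (\<lambda>\<zeta>. M \<zeta> * h \<zeta>)"
proof (rule square_integrableI)
  show [measurable]: "(\<lambda>\<zeta>. M \<zeta> * h \<zeta>) \<in> borel_measurable borel" by measurable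
  note [measurable] = square_integrableD(1)[OF g]
  show "integrable lborel (\<lambda>z. (cmod (M z * h z))\<^sup>2)"
    by (rule Bochner_Integration.integrable_cong_AE[THEN iffD1, OF _ _ _ square_integrableD(2)[OF g]])
      (use gh in \<open>auto elim!: eventually_mono\<close>)
qed

lemma mult_Hs_norm_eq:
  assumes g: "has_fourier u g" and m[measurable]: "m \<in> borel_measurable borel"
  shows "mult_Hs_norm m s u = sqrt (\<integral>\<zeta>. (sob_weight m s \<zeta> * cmod (g \<zeta>))\<^sup>2 \<partial>lborel)"
proof -
  note [measurable] = square_integrableD(1)[OF has_fourierD(2)[OF g]]
    square_integrableD(1)[OF has_fourierD(2)[OF fourier_AE_eq(1)[OF g]]]
  have "(\<integral>\<zeta>. (sob_weight m s \<zeta> * cmod (fourier u \<zeta>))\<^sup>2 \<partial>lborel) = (\<integral>\<zeta>. (sob_weight m s \<zeta> * cmod (g \<zeta>))\<^sup>2 \<partial>lborel)"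
    by (rule integral_cong_AE) (use fourier_AE_eq(2)[OF g] in \<open>auto elim!: eventually_mono\<close>)
  then show ?thesis by (simp add: mult_Hs_norm_def sob_weight_def)
qed

lemma mult_in_HsD:
  assumes u: "mult_in_Hs m s u" and g: "has_fourier u g" and m[measurable]: "m \<in> borel_measurable borel"
  shows "square_integrable (\<lambda>\<zeta>. complex_of_real (sob_weight m s \<zeta>) * g \<zeta>)"
    and "integrable lborel (\<lambda>\<zeta>. (sob_weight m s \<zeta> * cmod (g \<zeta>))\<^sup>2)"
proof -
  obtain h where h: "has_fourier u h" "square_integrable (\<lambda>\<zeta>. complex_of_real (sob_weight m s \<zeta>) * h \<zeta>)"
    using u unfolding mult_in_Hs_iff by blast
  show *: "square_integrable (\<lambda>\<zeta>. complex_of_real (sob_weight m s \<zeta>) * g \<zeta>)"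
    by (rule sq_integrable_cong_AE[OF has_fourier_unique[OF h(1) g] h(2) square_integrableD(1)[OF has_fourierD(2)[OF g]]])
      measurable
  show "integrable lborel (\<lambda>\<zeta>. (sob_weight m s \<zeta> * cmod (g \<zeta>))\<^sup>2)"
    using square_integrableD(2)[OF *] by (simp add: norm_mult power_mult_distrib)
qed

lemma mult_Hs_add:
  assumes u: "mult_in_Hs m s u" and v: "mult_in_Hs m s v" and m[measurable]: "m \<in> borel_measurable borel"
    and m0: "\<And>\<zeta>. 0 \<le> m \<zeta>"
  shows "mult_in_Hs m s (u + v)" "mult_Hs_norm m s (u + v) \<le> mult_Hs_norm m s u + mult_Hs_norm m s v"
proof -
  obtain g where g: "has_fourier u g" using u unfolding mult_in_Hs_iff by blast
  obtain h where h: "has_fourier v h" using v unfolding mult_in_Hs_iff by blast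
  note [measurable] = square_integrableD(1)[OF has_fourierD(2)[OF g]] square_integrableD(1)[OF has_fourierD(2)[OF h]]
  have gh: "has_fourier (u + v) (\<lambda>\<zeta>. g \<zeta> + h \<zeta>)" using has_fourier_add[OF g h] by (simp add: plus_fun_def)
  show uv: "mult_in_Hs m s (u + v)"
    unfolding mult_in_Hs_iff
    using gh square_integrable_add[OF mult_in_HsD(1)[OF u g m] mult_in_HsD(1)[OF v h m]]
    by (intro exI[of _ "\<lambda>\<zeta>. g \<zeta> + h \<zeta>"]) (simp add: distrib_left)
  let ?w = "sob_weight m s"
  have w0: "0 \<le> ?w \<zeta>" for \<zeta> using m0 by (simp add: sob_weight_def)
  note M = integral_Minkowski[of "\<lambda>\<zeta>. ?w \<zeta> * cmod (g \<zeta>)" lborel "\<lambda>\<zeta>. ?w \<zeta> * cmod (h \<zeta>)",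
      OF _ _ mult_in_HsD(2)[OF u g m] mult_in_HsD(2)[OF v h m]]
  have "(\<integral>\<zeta>. (?w \<zeta> * cmod (g \<zeta> + h \<zeta>))\<^sup>2 \<partial>lborel) \<le> (\<integral>\<zeta>. (?w \<zeta> * cmod (g \<zeta>) + ?w \<zeta> * cmod (h \<zeta>))\<^sup>2 \<partial>lborel)"
  proof (rule integral_mono)
    show "integrable lborel (\<lambda>\<zeta>. (?w \<zeta> * cmod (g \<zeta> + h \<zeta>))\<^sup>2)"
      by (rule mult_in_HsD(2)[OF uv gh m])
    show "integrable lborel (\<lambda>\<zeta>. (?w \<zeta> * cmod (g \<zeta>) + ?w \<zeta> * cmod (h \<zeta>))\<^sup>2)"
      by (rule M(1)) measurable
    fix \<zeta>
    show "(?w \<zeta> * cmod (g \<zeta> + h \<zeta>))\<^sup>2 \<le> (?w \<zeta> * cmod (g \<zeta>) + ?w \<zeta> * cmod (h \<zeta>))\<^sup>2"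
      unfolding distrib_left[symmetric]
      by (intro power_mono mult_left_mono norm_triangle_ineq w0 mult_nonneg_nonneg) auto
  qed
  then have "sqrt (\<integral>\<zeta>. (?w \<zeta> * cmod (g \<zeta> + h \<zeta>))\<^sup>2 \<partial>lborel)
      \<le> sqrt (\<integral>\<zeta>. (?w \<zeta> * cmod (g \<zeta>) + ?w \<zeta> * cmod (h \<zeta>))\<^sup>2 \<partial>lborel)" by simp
  also have "\<dots> \<le> sqrt (\<integral>\<zeta>. (?w \<zeta> * cmod (g \<zeta>))\<^sup>2 \<partial>lborel) + sqrt (\<integral>\<zeta>. (?w \<zeta> * cmod (h \<zeta>))\<^sup>2 \<partial>lborel)"
    by (rule M(2)) measurable
  finally show "mult_Hs_norm m s (u + v) \<le> mult_Hs_norm m s u + mult_Hs_norm m s v"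
    by (simp add: mult_Hs_norm_eq[OF gh m] mult_Hs_norm_eq[OF g m] mult_Hs_norm_eq[OF h m])
qed

lemma mult_Hs_scale:
  assumes u: "mult_in_Hs m s u" and m: "m \<in> borel_measurable borel"
  shows "mult_in_Hs m s (c *\<^sub>R u)" "mult_Hs_norm m s (c *\<^sub>R u) = \<bar>c\<bar> * mult_Hs_norm m s u"
proof -
  obtain g where g: "has_fourier u g" using u unfolding mult_in_Hs_iff by blast
  have cg: "has_fourier (c *\<^sub>R u) (\<lambda>\<zeta>. complex_of_real c * g \<zeta>)"
    using has_fourier_cmult[OF g, of "complex_of_real c"] by (simp add: scaleR_fun_def scaleR_conv_of_real)
  show "mult_in_Hs m s (c *\<^sub>R u)"
    unfolding mult_in_Hs_iff
    using cg square_integrable_cmult[OF mult_in_HsD(1)[OF u g m], of "complex_of_real c"]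
    by (intro exI[of _ "\<lambda>\<zeta>. complex_of_real c * g \<zeta>"]) (simp add: mult.left_commute)
  have "(sob_weight m s \<zeta> * cmod (complex_of_real c * g \<zeta>))\<^sup>2 = c\<^sup>2 * (sob_weight m s \<zeta> * cmod (g \<zeta>))\<^sup>2" for \<zeta>
    by (simp add: norm_mult power_mult_distrib)
  then show "mult_Hs_norm m s (c *\<^sub>R u) = \<bar>c\<bar> * mult_Hs_norm m s u"
    by (simp add: mult_Hs_norm_eq[OF g m] mult_Hs_norm_eq[OF cg m] real_sqrt_mult)
qed

lemma symb_nonneg: "0 \<le> symb_xy a \<zeta>" "0 \<le> symb_yx a \<zeta>"
  by (auto simp: symb_xy_def symb_yx_def split: prod.split)

lemma has_fourier_zero: "has_fourier (\<lambda>_. 0) (\<lambda>_. 0)"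
  unfolding has_fourier_def truncated_fourier_def square_integrable_def by simp

text \<open>From here on frequencies are handled as points of the plane, and quantifiers over them
  are not split into coordinates.\<close>

declare split_paired_All [simp del] split_paired_Ex [simp del]

section \<open>Construction of smooth solutions with small data\<close>

section \<open>A fixed point theorem for trilinear equations\<close>

text \<open>Contraction on the ball of radius 2 \<parallel>x0\<parallel>: there the Lipschitz
  constant of the cubic map is at most 3 C (2 \<parallel>x0\<parallel>)^2 = 12 C
  \<parallel>x0\<parallel>^2, and the smallness condition makes it at most 1/2. The closed invariant
  set \<open>S\<close> carries a symmetry over to the fixed point.\<close>

lemma trilinear_fixed_point:
  fixes Q :: "'a \<Rightarrow> 'a \<Rightarrow> 'a \<Rightarrow> 'a::{real_normed_vector,complete_space}"
  assumes d1: "\<And>x x' y z. Q (x - x') y z = Q x y z - Q x' y z"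
    and d2: "\<And>x y y' z. Q x (y - y') z = Q x y z - Q x y' z"
    and d3: "\<And>x y z z'. Q x y (z - z') = Q x y z - Q x y z'"
    and b: "\<And>x y z. norm (Q x y z) \<le> C * norm x * norm y * norm z" and C: "0 \<le> C"
    and S: "closed S" "x0 \<in> S" "\<And>x. x \<in> S \<Longrightarrow> x0 + Q x x x \<in> S"
    and small: "24 * C * (norm x0)\<^sup>2 \<le> 1"
  shows "\<exists>x\<in>S. norm x \<le> 2 * norm x0 \<and> x = x0 + Q x x x
    \<and> norm (x - x0 - Q x0 x0 x0) \<le> 96 * C\<^sup>2 * norm x0 ^ 5"
proof -
  define n where "n = norm x0"
  have n: "n \<ge> 0" by (simp add: n_def)
  have bb: "norm (Q x y z) \<le> C * (a * b * c)"
    if "norm x \<le> a" "norm y \<le> b" "norm z \<le> c" for x y z a b c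
  proof -
    have "norm x * norm y * norm z \<le> a * b * c"
      using that order_trans[OF norm_ge_zero that(1)] order_trans[OF norm_ge_zero that(2)]
      by (intro mult_mono) auto
    then have "C * (norm x * norm y * norm z) \<le> C * (a * b * c)" using C by (rule mult_left_mono)
    with b[of x y z] show ?thesis by (simp add: mult.assoc)
  qed
  \<comment> \<open>Exchange the arguments one at a time; this is all that linearity is wanted for,
    and explains why it is assumed for differences.\<close>
  have tel: "Q x x x - Q y y y = Q (x - y) x x + Q y (x - y) x + Q y y (x - y)" for x y
    by (simp add: d1 d2 d3)
  have dif: "norm (Q x x x - Q y y y) \<le> 12 * C * n\<^sup>2 * e"
    if "norm x \<le> 2 * n" "norm y \<le> 2 * n" "norm (x - y) \<le> e" for x y e
  proof -
    have "norm (Q x x x - Q y y y) \<le> C * (e * (2*n) * (2*n)) + C * ((2*n) * e * (2*n)) + C * ((2*n) * (2*n) * e)"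
      unfolding tel by (intro norm_triangle_mono bb that)
    then show ?thesis by (simp add: power2_eq_square algebra_simps)
  qed
  have small': "24 * C * n\<^sup>2 \<le> 1" using small by (simp add: n_def)
  define B where "B = S \<inter> cball 0 (2 * n)"
  have Q8: "norm (Q x x x) \<le> 8 * C * n ^ 3" if "norm x \<le> 2 * n" for x
    using bb[OF that that that] by (simp add: power3_eq_cube algebra_simps)
  have "\<exists>!x\<in>B. x0 + Q x x x = x"
  proof (rule Banach_fix)
    show "complete B" unfolding B_def using S(1) by (simp add: complete_eq_closed closed_Int)
    show "B \<noteq> {}" using S(2) n by (auto simp: B_def n_def)
    show "(\<lambda>x. x0 + Q x x x) ` B \<subseteq> B"
    proof
      fix y assume "y \<in> (\<lambda>x. x0 + Q x x x) ` B"
      then obtain x where x: "x \<in> S" "norm x \<le> 2 * n" "y = x0 + Q x x x" by (auto simp: B_def)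
      have "norm y \<le> n + 8 * C * n ^ 3"
        unfolding x(3) using Q8[OF x(2)] by (intro norm_triangle_mono) (auto simp: n_def)
      also have "8 * C * n ^ 3 = (8 * C * n\<^sup>2) * n" by (simp add: power2_eq_square power3_eq_cube)
      also have "\<dots> \<le> 1 * n" using small' n C by (intro mult_right_mono) auto
      finally show "y \<in> B" using S(3)[OF x(1)] x(3) by (simp add: B_def)
    qed
    fix x y assume "x \<in> B" "y \<in> B"
    then have xy: "norm x \<le> 2 * n" "norm y \<le> 2 * n" by (auto simp: B_def)
    have "norm (Q x x x - Q y y y) \<le> 12 * C * n\<^sup>2 * norm (x - y)" by (rule dif[OF xy order_refl])
    also have "\<dots> \<le> 1/2 * norm (x - y)" using small' by (intro mult_right_mono) auto
    finally show "dist (x0 + Q x x x) (x0 + Q y y y) \<le> 1/2 * dist x y" by (simp add: dist_norm)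
  qed auto
  then obtain x where x: "x \<in> S" "norm x \<le> 2 * n" "x0 + Q x x x = x" by (auto simp: B_def)
  \<comment> \<open>The first correction is cubic in \<open>n\<close>. Inserted into the Lipschitz
    bound it makes the remainder after the cubic term quintic, with 96 = 12 * 8.\<close>
  have "norm (x - x0) \<le> 8 * C * n ^ 3" using Q8[OF x(2)] x(3) by (metis add_diff_cancel_left')
  then have "norm (Q x x x - Q x0 x0 x0) \<le> 12 * C * n\<^sup>2 * (8 * C * n ^ 3)"
    using n by (intro dif x(2)) (auto simp: n_def)
  also have "\<dots> = 96 * C\<^sup>2 * n ^ 5" by (simp add: power2_eq_square power3_eq_cube eval_nat_numeral)
  finally have "norm (x - x0 - Q x0 x0 x0) \<le> 96 * C\<^sup>2 * n ^ 5"
    using x(3) by (metis add_diff_cancel_left')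
  then show ?thesis using x by (intro bexI[of _ x]) (auto simp: n_def)
qed

section \<open>Submultiplicative weights\<close>

text \<open>A weight whose convolution square is bounded by a multiple of itself, so that weighted
  sup norms are compatible with convolution. It also supplies integrability.\<close>

definition lorentz :: "real \<Rightarrow> real" where "lorentz x = 1 / (1 + x\<^sup>2)"

text \<open>The phase of the linear flow: minus the sum of the third derivatives in x and y has
  symbol i (\<xi>^3 + \<eta>^3).\<close>

definition dispersion :: "plane \<Rightarrow> real" where "dispersion \<zeta> = fst \<zeta> ^ 3 + snd \<zeta> ^ 3"

text \<open>Bounds |\<xi> + \<eta>|, the size of the derivative in the nonlinearity, and is
  subadditive, so that its negative exponential is compatible with convolution.\<close>

definition l1_norm :: "plane \<Rightarrow> real" where "l1_norm \<zeta> = \<bar>fst \<zeta>\<bar> + \<bar>snd \<zeta>\<bar>"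

definition lorentz2 :: "plane \<Rightarrow> real" where "lorentz2 \<zeta> = lorentz (fst \<zeta>) * lorentz (snd \<zeta>)"

lemma lorentz_den_pos [simp]: "1 + (x::real)\<^sup>2 > 0" "1 + (x::real)\<^sup>2 \<noteq> 0"
proof -
  show "1 + x\<^sup>2 > 0" using zero_le_power2[of x] by linarith
  then show "1 + x\<^sup>2 \<noteq> 0" by simp
qed

lemma lorentz_pos: "lorentz x > 0" and lorentz_le_1: "lorentz x \<le> 1"
  by (auto simp: lorentz_def divide_simps)

lemma continuous_lorentz [continuous_intros]: "continuous_on S f \<Longrightarrow> continuous_on S (\<lambda>x. lorentz (f x))"
  unfolding lorentz_def by (intro continuous_intros) auto

lemma measurable_lorentz [measurable]: "lorentz \<in> borel_measurable borel"
  by (intro borel_measurable_continuous_onI continuous_lorentz continuous_on_id)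

lemma integrable_lorentz: "integrable lborel lorentz"
proof -
  have "integrable lborel (\<lambda>x::real. indicator UNIV x *\<^sub>R inverse (1 + x\<^sup>2))"
    using integrable_inverse_1_plus_square by (simp add: set_integrable_def einterval_eq)
  then show ?thesis by (simp add: lorentz_def[abs_def] inverse_eq_divide)
qed

text \<open>One of y and x - y has at least half the size of x. In terms of the denominators: 2 (1 +
  (x - y)^2) + 2 (1 + y^2) - (1 + x^2) = 3 + (x - 2y)^2.\<close>

lemma lorentz_mult_le: "lorentz y * lorentz (x - y) \<le> 2 * lorentz x * (lorentz y + lorentz (x - y))"
proof -
  define A B D where "A = 1 + (x - y)\<^sup>2" and "B = 1 + y\<^sup>2" and "D = 1 + x\<^sup>2"
  have pos: "A > 0" "B > 0" "D > 0" by (auto simp: A_def B_def D_def)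
  have "0 \<le> (x - 2 * y)\<^sup>2" by simp
  then have D: "D \<le> 2 * (A + B)"
    by (simp add: A_def B_def D_def power2_eq_square algebra_simps)
  have "1 / (A * B) = D / (D * (A * B))" using pos by simp
  also have "\<dots> \<le> 2 * (A + B) / (D * (A * B))" using D pos by (intro divide_right_mono) auto
  also have "\<dots> = 2 * (1 / D) * (1 / B + 1 / A)" using pos by (simp add: field_simps)
  finally show ?thesis by (simp add: lorentz_def A_def B_def D_def mult.commute)
qed

lemma lorentz2_pos: "lorentz2 \<zeta> > 0" and lorentz2_le_1: "lorentz2 \<zeta> \<le> 1"
  using lorentz_pos[of "fst \<zeta>"] lorentz_pos[of "snd \<zeta>"] lorentz_le_1[of "fst \<zeta>"] lorentz_le_1[of "snd \<zeta>"]
  by (auto simp: lorentz2_def intro!: mult_le_one)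

lemma l1_norm_nonneg: "l1_norm \<zeta> \<ge> 0" by (simp add: l1_norm_def)

lemma l1_norm_triangle: "l1_norm \<zeta> \<le> l1_norm \<mu> + l1_norm (\<zeta> - \<mu>)"
  by (simp add: l1_norm_def)

lemma continuous_dispersion [continuous_intros]: "continuous_on S f \<Longrightarrow> continuous_on S (\<lambda>x. dispersion (f x))"
  and continuous_l1_norm [continuous_intros]: "continuous_on S f \<Longrightarrow> continuous_on S (\<lambda>x. l1_norm (f x))"
  and continuous_lorentz2 [continuous_intros]: "continuous_on S f \<Longrightarrow> continuous_on S (\<lambda>x. lorentz2 (f x))"
  unfolding dispersion_def l1_norm_def lorentz2_def by (intro continuous_intros; assumption)+

definition lorentz_mass :: real where "lorentz_mass = integral\<^sup>L lborel lorentz"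

lemma integrable_lorentz2: "integrable lborel lorentz2"
  using integrable_lborel_product[OF integrable_lorentz integrable_lorentz]
  by (simp add: lborel_prod lorentz2_def[abs_def] split_def)

definition conv_const :: real where "conv_const = 16 * lorentz_mass\<^sup>2"

text \<open>Multiply the one-dimensional inequalities. Their factors 2 give 4, and the integral of
  each sum of two Lorentzians is twice \<open>lorentz_mass\<close>, which gives another 4 and hence
  the 16 in \<open>conv_const\<close>.\<close>

lemma lorentz2_conv:
  shows "integrable lborel (\<lambda>\<mu>. lorentz2 \<mu> * lorentz2 (\<zeta> - \<mu>))"
    and "(\<integral>\<mu>. lorentz2 \<mu> * lorentz2 (\<zeta> - \<mu>) \<partial>lborel) \<le> conv_const * lorentz2 \<zeta>"
proof -
  have [measurable]: "lorentz2 \<in> borel_measurable borel"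
    by (intro borel_measurable_continuous_onI continuous_lorentz2 continuous_on_id)
  show i: "integrable lborel (\<lambda>\<mu>. lorentz2 \<mu> * lorentz2 (\<zeta> - \<mu>))"
    by (rule Bochner_Integration.integrable_bound[OF integrable_lorentz2])
      (auto intro!: AE_I2 simp: abs_mult less_imp_le[OF lorentz2_pos] lorentz2_le_1 mult_left_le)
  obtain a b where ab: "\<zeta> = (a, b)" by (cases \<zeta>)
  define p where "p = (\<lambda>(c::real) (x::real). lorentz x + lorentz (c - x))"
  have ip: "integrable lborel (p c)" for c :: real
    unfolding p_def by (intro Bochner_Integration.integrable_add integrable_lorentz lborel_integrable_reflect)
  have vp: "integral\<^sup>L lborel (p c) = 2 * lorentz_mass" for c :: real
    unfolding p_def
    by (subst Bochner_Integration.integral_add[OF integrable_lorentz lborel_integrable_reflect[OF integrable_lorentz]])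
      (simp add: lorentz_mass_def lborel_integral_reflect)
  note pp = integrable_lborel_product[OF ip[of a] ip[of b]]
  have ipp: "integrable lborel (\<lambda>\<mu>. p a (fst \<mu>) * p b (snd \<mu>))"
    using pp by (simp add: lborel_prod split_def)
  have "(\<integral>\<mu>. p a (fst \<mu>) * p b (snd \<mu>) \<partial>lborel) = (\<integral>x. (\<integral>y. p a x * p b y \<partial>lborel) \<partial>lborel)"
    using lborel_pair.integral_fst[OF pp] by (simp only: lborel_prod split_def)
  also have "\<dots> = 4 * lorentz_mass\<^sup>2" by (simp add: vp power2_eq_square)
  finally have vpp: "(\<integral>\<mu>. p a (fst \<mu>) * p b (snd \<mu>) \<partial>lborel) = 4 * lorentz_mass\<^sup>2" .
  have "(\<integral>\<mu>. lorentz2 \<mu> * lorentz2 (\<zeta> - \<mu>) \<partial>lborel) \<le> (\<integral>\<mu>. 4 * lorentz2 \<zeta> * (p a (fst \<mu>) * p b (snd \<mu>)) \<partial>lborel)"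
  proof (rule integral_mono[OF i])
    show "integrable lborel (\<lambda>\<mu>. 4 * lorentz2 \<zeta> * (p a (fst \<mu>) * p b (snd \<mu>)))" using ipp by simp
    fix \<mu> :: plane
    obtain x y where \<mu>: "\<mu> = (x, y)" by (cases \<mu>)
    have "(lorentz x * lorentz (a - x)) * (lorentz y * lorentz (b - y)) \<le> (2 * lorentz a * p a x) * (2 * lorentz b * p b y)"
      unfolding p_def by (intro mult_mono lorentz_mult_le mult_nonneg_nonneg add_nonneg_nonneg less_imp_le[OF lorentz_pos]) auto
    then show "lorentz2 \<mu> * lorentz2 (\<zeta> - \<mu>) \<le> 4 * lorentz2 \<zeta> * (p a (fst \<mu>) * p b (snd \<mu>))"
      by (simp add: lorentz2_def \<mu> ab mult_ac)
  qed
  then show "(\<integral>\<mu>. lorentz2 \<mu> * lorentz2 (\<zeta> - \<mu>) \<partial>lborel) \<le> conv_const * lorentz2 \<zeta>"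
    by (simp add: vpp conv_const_def mult_ac)
qed

section \<open>The space-time weight\<close>

text \<open>Clamping the time to \<open>[0,T]\<close> makes space-time spectra functions on the whole of
  \<open>\<real> \<times> \<real>\<^sup>2\<close>, so that the library's complete space of bounded continuous functions applies.\<close>

definition clamp_time :: "real \<Rightarrow> real \<Rightarrow> real" where "clamp_time T t = max 0 (min t T)"

text \<open>The weight allows the exponential decay rate to shrink from \<open>2\<close> to \<open>1\<close> during \<open>[0,T]\<close>; integrating
  the ratio of weights in time gains the factor \<open>1 / l1_norm \<zeta>\<close> that pays for the derivative in the
  nonlinearity.\<close>

definition evol_weight :: "real \<Rightarrow> real \<Rightarrow> plane \<Rightarrow> real" where
  "evol_weight T t \<zeta> = exp (- ((2 - clamp_time T t / T) * l1_norm \<zeta>)) * lorentz2 \<zeta>"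

text \<open>Membership, with explicit bound, in the weighted space of spectra. Continuity is joint
  in time and frequency so that division by the weight yields a bounded continuous function.\<close>

definition controlled :: "real \<Rightarrow> (real \<Rightarrow> plane \<Rightarrow> complex) \<Rightarrow> real \<Rightarrow> bool" where
  "controlled T a A \<longleftrightarrow> continuous_on UNIV (\<lambda>(t, \<zeta>). a t \<zeta>) \<and> (\<forall>t \<zeta>. cmod (a t \<zeta>) \<le> A * evol_weight T t \<zeta>)"

lemma clamp_time_id: "t \<in> {0..T} \<Longrightarrow> clamp_time T t = t" by (auto simp: clamp_time_def)

lemma clamp_time_bounds: "T > 0 \<Longrightarrow> 0 \<le> clamp_time T t" "T > 0 \<Longrightarrow> clamp_time T t \<le> T" "T > 0 \<Longrightarrow> clamp_time T t / T \<le> 1"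
  by (auto simp: clamp_time_def)

lemma continuous_clamp_time [continuous_intros]: "continuous_on S f \<Longrightarrow> continuous_on S (\<lambda>x. clamp_time T (f x))"
  unfolding clamp_time_def by (intro continuous_intros; assumption)

lemma evol_weight_pos: "evol_weight T t \<zeta> > 0" by (simp add: evol_weight_def lorentz2_pos)

lemma evol_weight_le_lorentz2: "T > 0 \<Longrightarrow> evol_weight T t \<zeta> \<le> lorentz2 \<zeta>"
proof -
  assume "T > 0"
  then have "0 \<le> 2 - clamp_time T t / T" using clamp_time_bounds(3)[of T t] by linarith
  then have "0 \<le> (2 - clamp_time T t / T) * l1_norm \<zeta>" using l1_norm_nonneg by (rule mult_nonneg_nonneg)
  then have "exp (- ((2 - clamp_time T t / T) * l1_norm \<zeta>)) \<le> 1" by simp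
  from mult_right_mono[OF this less_imp_le[OF lorentz2_pos]] show "evol_weight T t \<zeta> \<le> lorentz2 \<zeta>" by (simp add: evol_weight_def)
qed

text \<open>The exponential rate is still at least 1 at time T, so solutions decay faster than any
  power on all of [0,T].\<close>

lemma evol_weight_le_end: "T > 0 \<Longrightarrow> evol_weight T t \<zeta> \<le> exp (- l1_norm \<zeta>) * lorentz2 \<zeta>"
proof -
  assume T: "T > 0"
  have "1 * l1_norm \<zeta> \<le> (2 - clamp_time T t / T) * l1_norm \<zeta>"
    using clamp_time_bounds(3)[OF T, of t] l1_norm_nonneg[of \<zeta>] by (intro mult_right_mono) auto
  then show "evol_weight T t \<zeta> \<le> exp (- l1_norm \<zeta>) * lorentz2 \<zeta>"
    unfolding evol_weight_def using lorentz2_pos[of \<zeta>] by (intro mult_right_mono) auto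
qed

text \<open>The free evolution preserves moduli, so a datum must fit under the smallest of the
  weights, the one with rate 2.\<close>

lemma evol_weight_ge_start: "T > 0 \<Longrightarrow> exp (- (2 * l1_norm \<zeta>)) * lorentz2 \<zeta> \<le> evol_weight T t \<zeta>"
proof -
  assume T: "T > 0"
  have "(2 - clamp_time T t / T) * l1_norm \<zeta> \<le> 2 * l1_norm \<zeta>"
    using clamp_time_bounds(1)[OF T, of t] T l1_norm_nonneg[of \<zeta>] by (intro mult_right_mono) auto
  then show "exp (- (2 * l1_norm \<zeta>)) * lorentz2 \<zeta> \<le> evol_weight T t \<zeta>"
    unfolding evol_weight_def using lorentz2_pos[of \<zeta>] by (intro mult_right_mono) auto
qed

lemma continuous_evol_weight [continuous_intros]:
  "T > 0 \<Longrightarrow> continuous_on S f \<Longrightarrow> continuous_on S g \<Longrightarrow> continuous_on S (\<lambda>x. evol_weight T (f x) (g x))"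
  unfolding evol_weight_def by (intro continuous_intros; simp)

lemma controlledD:
  assumes "controlled T a A"
  shows "continuous_on UNIV (\<lambda>(t, \<zeta>). a t \<zeta>)" "cmod (a t \<zeta>) \<le> A * evol_weight T t \<zeta>" "0 \<le> A"
    "continuous_on UNIV (a t)" "a t \<in> borel_measurable borel"
proof -
  show c: "continuous_on UNIV (\<lambda>(t, \<zeta>). a t \<zeta>)" and le: "cmod (a t \<zeta>) \<le> A * evol_weight T t \<zeta>" for \<zeta>
    using assms unfolding controlled_def by blast+
  show "0 \<le> A" using order_trans[OF norm_ge_zero le[of 0]] evol_weight_pos[of T t 0] by (simp add: zero_le_mult_iff)
  show c2: "continuous_on UNIV (a t)"
    using continuous_on_compose2[OF c, of UNIV "\<lambda>\<zeta>. (t, \<zeta>)"] by (simp add: continuous_on_Pair)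
  show "a t \<in> borel_measurable borel" by (rule borel_measurable_continuous_onI[OF c2])
qed

lemma controlled_lorentz2:
  assumes "controlled T a A" "T > 0"
  shows "cmod (a t \<zeta>) \<le> A * lorentz2 \<zeta>" "cmod (a t \<zeta>) \<le> A" "integrable lborel (a t)"
proof -
  show le: "cmod (a t \<zeta>) \<le> A * lorentz2 \<zeta>" for \<zeta>
    using order_trans[OF controlledD(2)[OF assms(1)] mult_left_mono[OF evol_weight_le_lorentz2[OF assms(2)] controlledD(3)[OF assms(1)]]] .
  show "cmod (a t \<zeta>) \<le> A"
    using order_trans[OF le mult_left_mono[OF lorentz2_le_1 controlledD(3)[OF assms(1)], of \<zeta>]] by simp
  show "integrable lborel (a t)"
    by (rule Bochner_Integration.integrable_bound[of _ "\<lambda>\<zeta>. A * lorentz2 \<zeta>"])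
      (use integrable_lorentz2 controlledD(5)[OF assms(1)] le controlledD(3)[OF assms(1)]
        in \<open>auto intro!: AE_I2 simp: abs_mult abs_of_pos[OF lorentz2_pos]\<close>)
qed

lemma controlled_conv_integrable:
  assumes a: "controlled T a A" and b: "controlled T b B" and T: "T > 0"
  shows "integrable lborel (\<lambda>\<mu>. a t \<mu> * b t (\<zeta> - \<mu>))"
proof -
  have [measurable]: "a t \<in> borel_measurable borel" "b t \<in> borel_measurable borel"
    using controlledD(5)[OF a] controlledD(5)[OF b] .
  show ?thesis
  proof (rule Bochner_Integration.integrable_bound)
    show "integrable lborel (\<lambda>\<mu>. A * lorentz2 \<mu> * B)" using integrable_lorentz2 by simp
    show "AE \<mu> in lborel. norm (a t \<mu> * b t (\<zeta> - \<mu>)) \<le> norm (A * lorentz2 \<mu> * B)"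
    proof (rule AE_I2)
      fix \<mu>
      have "cmod (a t \<mu>) * cmod (b t (\<zeta> - \<mu>)) \<le> (A * lorentz2 \<mu>) * B"
        using controlled_lorentz2[OF a T] controlled_lorentz2[OF b T] controlledD(3)[OF a] lorentz2_pos[of \<mu>]
        by (intro mult_mono) auto
      then show "norm (a t \<mu> * b t (\<zeta> - \<mu>)) \<le> norm (A * lorentz2 \<mu> * B)"
        by (simp add: norm_mult)
    qed
  qed measurable
qed

text \<open>At a fixed time both factors have the same exponential rate, so the exponential comes
  out by the triangle inequality for \<open>l1_norm\<close>; the Lorentz factors are left to
  \<open>lorentz2_conv\<close>.\<close>

lemma controlled_conv:
  assumes a: "controlled T a A" and b: "controlled T b B" and T: "T > 0"
  shows "controlled T (\<lambda>t. conv (a t) (b t)) (conv_const * A * B)"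
  unfolding controlled_def
proof (intro conjI allI)
  note A0 = controlledD(3)[OF a] and B0 = controlledD(3)[OF b]
  have "continuous_on UNIV (\<lambda>p. \<integral>\<mu>. a (fst p) \<mu> * b (fst p) (snd p - \<mu>) \<partial>lborel)"
  proof (rule continuous_on_integral_dominated[where B="\<lambda>\<mu>. A * lorentz2 \<mu> * B"])
    show "(\<lambda>\<mu>. a (fst p) \<mu> * b (fst p) (snd p - \<mu>)) \<in> borel_measurable lborel" for p
      using borel_measurable_integrable[OF controlled_conv_integrable[OF a b T]] .
    show "continuous_on UNIV (\<lambda>p. a (fst p) \<mu> * b (fst p) (snd p - \<mu>))" for \<mu>
    proof (intro continuous_intros)
      show "continuous_on UNIV (\<lambda>p::real \<times> plane. a (fst p) \<mu>)"
        using continuous_on_compose2[OF controlledD(1)[OF a], of UNIV "\<lambda>p::real \<times> plane. (fst p, \<mu>)"]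
        by (simp add: continuous_intros)
      show "continuous_on UNIV (\<lambda>p::real \<times> plane. b (fst p) (snd p - \<mu>))"
        using continuous_on_compose2[OF controlledD(1)[OF b], of UNIV "\<lambda>p::real \<times> plane. (fst p, snd p - \<mu>)"]
        by (simp add: continuous_intros)
    qed
    show "norm (a (fst p) \<mu> * b (fst p) (snd p - \<mu>)) \<le> A * lorentz2 \<mu> * B" for p \<mu>
      unfolding norm_mult using controlled_lorentz2[OF a T] controlled_lorentz2[OF b T] A0 lorentz2_pos[of \<mu>]
      by (intro mult_mono) auto
  qed (use integrable_lorentz2 in auto)
  then show "continuous_on UNIV (\<lambda>(t, \<zeta>). conv (a t) (b t) \<zeta>)"
    by (simp add: conv_def split_def)
  fix t \<zeta>
  define r where "r = 2 - clamp_time T t / T"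
  have r: "r \<ge> 0" using clamp_time_bounds(3)[OF T, of t] by (simp add: r_def)
  have pt: "cmod (a t \<mu> * b t (\<zeta> - \<mu>)) \<le> A * B * exp (- (r * l1_norm \<zeta>)) * (lorentz2 \<mu> * lorentz2 (\<zeta> - \<mu>))" for \<mu>
  proof -
    have "cmod (a t \<mu> * b t (\<zeta> - \<mu>)) \<le> (A * evol_weight T t \<mu>) * (B * evol_weight T t (\<zeta> - \<mu>))"
      unfolding norm_mult using controlledD(2)[OF a] controlledD(2)[OF b] A0 evol_weight_pos[of T t \<mu>]
      by (intro mult_mono) auto
    also have "\<dots> = A * B * exp (- (r * (l1_norm \<mu> + l1_norm (\<zeta> - \<mu>)))) * (lorentz2 \<mu> * lorentz2 (\<zeta> - \<mu>))"
      by (simp add: evol_weight_def r_def exp_add[symmetric] algebra_simps)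
    also have "\<dots> \<le> A * B * exp (- (r * l1_norm \<zeta>)) * (lorentz2 \<mu> * lorentz2 (\<zeta> - \<mu>))"
    proof (intro mult_right_mono mult_left_mono)
      show "exp (- (r * (l1_norm \<mu> + l1_norm (\<zeta> - \<mu>)))) \<le> exp (- (r * l1_norm \<zeta>))"
        using mult_left_mono[OF l1_norm_triangle r, of \<zeta> \<mu>] by simp
    qed (use A0 B0 lorentz2_pos in \<open>auto simp: less_imp_le\<close>)
    finally show ?thesis .
  qed
  have "cmod (conv (a t) (b t) \<zeta>) \<le> (\<integral>\<mu>. A * B * exp (- (r * l1_norm \<zeta>)) * (lorentz2 \<mu> * lorentz2 (\<zeta> - \<mu>)) \<partial>lborel)"
    unfolding conv_def
    by (rule Bochner_Integration.integral_norm_bound_integral[OF controlled_conv_integrable[OF a b T] _ pt])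
      (use lorentz2_conv(1) in simp)
  also have "\<dots> \<le> A * B * exp (- (r * l1_norm \<zeta>)) * (conv_const * lorentz2 \<zeta>)"
    unfolding integral_mult_right_zero using A0 B0 by (intro mult_left_mono lorentz2_conv(2)) auto
  finally show "cmod (conv (a t) (b t) \<zeta>) \<le> conv_const * A * B * evol_weight T t \<zeta>"
    by (simp add: evol_weight_def r_def mult_ac)
qed

lemma conv_diff:
  assumes "controlled T a A" "controlled T a' A'" "controlled T b B" "T > 0"
  shows "conv (\<lambda>\<zeta>. a t \<zeta> - a' t \<zeta>) (b t) = (\<lambda>\<zeta>. conv (a t) (b t) \<zeta> - conv (a' t) (b t) \<zeta>)"
    and "conv (b t) (\<lambda>\<zeta>. a t \<zeta> - a' t \<zeta>) = (\<lambda>\<zeta>. conv (b t) (a t) \<zeta> - conv (b t) (a' t) \<zeta>)"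
  unfolding conv_def
  using controlled_conv_integrable[OF assms(1,3,4)] controlled_conv_integrable[OF assms(2,3,4)]
    controlled_conv_integrable[OF assms(3,1,4)] controlled_conv_integrable[OF assms(3,2,4)]
  by (auto simp: left_diff_distrib right_diff_distrib)

section \<open>The Duhamel operator\<close>

text \<open>The factor \<open>(2\<pi>)\<^sup>-\<^sup>2\<close> comes from the unitary normalization: the transform of \<open>v\<^sup>3\<close> is
  \<open>(2\<pi>)\<^sup>-\<^sup>2\<close> times the threefold convolution of the transform of \<open>v\<close>.\<close>

definition nl_symbol :: "plane \<Rightarrow> complex" where
  "nl_symbol \<zeta> = - (\<i> * complex_of_real ((fst \<zeta> + snd \<zeta>) / (2 * pi)\<^sup>2))"

text \<open>The Duhamel integral with the propagator split as exp(i t \<omega>) exp(-i \<tau>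
  \<omega>), \<omega> being \<open>dispersion\<close>: the integrand then depends on t only through
  the interval of integration.\<close>

definition duhamel :: "real \<Rightarrow> (real \<Rightarrow> plane \<Rightarrow> complex) \<Rightarrow> real \<Rightarrow> plane \<Rightarrow> complex" where
  "duhamel T G t \<zeta> = iexp (clamp_time T t * dispersion \<zeta>) * nl_symbol \<zeta> *
     (LINT \<tau>|lborel. indicator {0..clamp_time T t} \<tau> *\<^sub>R (iexp (- \<tau> * dispersion \<zeta>) * G \<tau> \<zeta>))"

lemma cmod_nl_symbol: "cmod (nl_symbol \<zeta>) \<le> l1_norm \<zeta> / (2 * pi)\<^sup>2"
proof -
  have "cmod (nl_symbol \<zeta>) = \<bar>fst \<zeta> + snd \<zeta>\<bar> / (2 * pi)\<^sup>2"
    unfolding nl_symbol_def norm_minus_cancel norm_mult norm_of_real abs_divide by simp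
  also have "\<dots> \<le> l1_norm \<zeta> / (2 * pi)\<^sup>2"
    unfolding l1_norm_def by (intro divide_right_mono abs_triangle_ineq) auto
  finally show ?thesis .
qed

lemma continuous_nl_symbol [continuous_intros]:
  "continuous_on S f \<Longrightarrow> continuous_on S (\<lambda>x. nl_symbol (f x))"
  unfolding nl_symbol_def by (intro continuous_intros) auto

lemma controlled_slice_continuous:
  assumes "controlled T G A"
  shows "continuous_on S (\<lambda>\<tau>. G \<tau> \<zeta>)"
  using continuous_on_compose2[OF controlledD(1)[OF assms], of S "\<lambda>\<tau>. (\<tau>, \<zeta>)"]
  by (simp add: continuous_intros)

lemma duhamel_integrable:
  assumes G: "controlled T G A"
  shows "integrable lborel (\<lambda>\<tau>. indicator {0..c} \<tau> *\<^sub>R (iexp (- \<tau> * dispersion \<zeta>) * G \<tau> \<zeta>))"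
proof -
  have "continuous_on {0..c} (\<lambda>\<tau>. iexp (- \<tau> * dispersion \<zeta>) * G \<tau> \<zeta>)"
    by (intro continuous_intros controlled_slice_continuous[OF G])
  from borel_integrable_atLeastAtMost'[OF this] show ?thesis by (simp add: set_integrable_def)
qed

lemma AE_neq_real: "AE \<tau> in lborel. \<tau> \<noteq> (c::real)"
  by (rule AE_lborel_singleton)

text \<open>When the end point of the time interval moves, its indicator converges except at the
  limiting end point, a null set; dominated convergence does the rest.\<close>

lemma continuous_duhamel:
  assumes G: "controlled T G A" and T: "T > 0"
  shows "continuous_on UNIV (\<lambda>(t, \<zeta>). duhamel T G t \<zeta>)"
proof -
  let ?I = "\<lambda>p \<tau>. indicator {0..clamp_time T (fst p)} \<tau> *\<^sub>R (iexp (- \<tau> * dispersion (snd p)) * G \<tau> (snd p)) :: complex"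
  have "continuous_on UNIV (\<lambda>p. \<integral>\<tau>. ?I p \<tau> \<partial>lborel)"
  proof (rule continuous_on_sequentiallyI)
    fix u :: "nat \<Rightarrow> real \<times> plane" and a assume u: "u \<longlonglongrightarrow> a"
    have cont: "continuous_on UNIV (\<lambda>p. iexp (- \<tau> * dispersion (snd p)) * G \<tau> (snd p))" for \<tau>
      by (intro continuous_intros continuous_on_compose2[OF controlledD(4)[OF G, of \<tau>]]) auto
    have tcu: "(\<lambda>n. clamp_time T (fst (u n))) \<longlonglongrightarrow> clamp_time T (fst a)"
      using u unfolding clamp_time_def by (intro tendsto_intros)
    show "(\<lambda>n. \<integral>\<tau>. ?I (u n) \<tau> \<partial>lborel) \<longlonglongrightarrow> (\<integral>\<tau>. ?I a \<tau> \<partial>lborel)"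
    proof (rule integral_dominated_convergence[where w="\<lambda>\<tau>. A * indicator {0..T} \<tau>"])
      show "?I p \<in> borel_measurable lborel" for p
        using borel_measurable_integrable[OF duhamel_integrable[OF G]] .
      show "?I (u n) \<in> borel_measurable lborel" for n
        using borel_measurable_integrable[OF duhamel_integrable[OF G]] .
      show "integrable lborel (\<lambda>\<tau>. A * indicator {0..T} \<tau> :: real)"
        by (intro integrable_mult_right integrable_real_indicator emeasure_bounded_finite) auto
      show "AE \<tau> in lborel. cmod (?I (u n) \<tau>) \<le> A * indicator {0..T} \<tau>" for n
      proof (rule AE_I2)
        fix \<tau>
        have "cmod (G \<tau> (snd (u n))) \<le> A" by (rule controlled_lorentz2(2)[OF G T])
        moreover have "indicator {0..clamp_time T (fst (u n))} \<tau> \<le> (indicator {0..T} \<tau> :: real)"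
          using clamp_time_bounds(2)[OF T, of "fst (u n)"] by (auto simp: indicator_def)
        ultimately have "indicator {0..clamp_time T (fst (u n))} \<tau> * cmod (G \<tau> (snd (u n))) \<le> indicator {0..T} \<tau> * A"
          by (intro mult_mono) auto
        then show "cmod (?I (u n) \<tau>) \<le> A * indicator {0..T} \<tau>"
          unfolding norm_scaleR norm_iexp_mult by (simp add: mult.commute)
      qed
      show "AE \<tau> in lborel. (\<lambda>n. ?I (u n) \<tau>) \<longlonglongrightarrow> ?I a \<tau>"
        using AE_neq_real[of "clamp_time T (fst a)"]
      proof eventually_elim
        case (elim \<tau>)
        have "eventually (\<lambda>n. indicator {0..clamp_time T (fst (u n))} \<tau> = (indicator {0..clamp_time T (fst a)} \<tau> :: real)) sequentially"
        proof (cases "\<tau> < clamp_time T (fst a)")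
          case True
          from order_tendstoD(1)[OF tcu True] show ?thesis
            by eventually_elim (use True in \<open>auto simp: indicator_def\<close>)
        next
          case False
          then have "clamp_time T (fst a) < \<tau>" using elim by simp
          from order_tendstoD(2)[OF tcu this] show ?thesis
            by eventually_elim (use False elim in \<open>auto simp: indicator_def\<close>)
        qed
        then have "(\<lambda>n. indicator {0..clamp_time T (fst (u n))} \<tau> :: real) \<longlonglongrightarrow> indicator {0..clamp_time T (fst a)} \<tau>"
          by (rule tendsto_eventually)
        moreover have "(\<lambda>n. iexp (- \<tau> * dispersion (snd (u n))) * G \<tau> (snd (u n))) \<longlonglongrightarrow> iexp (- \<tau> * dispersion (snd a)) * G \<tau> (snd a)"
          by (rule continuous_on_tendsto_compose[OF cont[of \<tau>] u]) auto
        ultimately show ?case by (rule tendsto_scaleR)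
      qed
    qed
  qed
  then show ?thesis unfolding duhamel_def split_def by (intro continuous_intros)
qed

text \<open>The integral is T (1 - exp(-c p / T)) when the factor p is taken inside. An arbitrarily
  large p is thus paid for by a bound independent of p, which is how the derivative loss will be
  absorbed.\<close>

lemma exp_time_integral:
  fixes T c p :: real
  assumes T: "T > 0" and c: "c \<ge> 0" and p: "p \<ge> 0"
  shows "p * (LINT \<tau>|lborel. indicator {0..c} \<tau> *\<^sub>R exp (- ((c - \<tau>) / T * p))) \<le> T"
proof -
  define Fn where "Fn = (\<lambda>\<tau>. T * exp (- ((c - \<tau>) / T * p)))"
  have "(LINT \<tau>|lborel. indicator {0..c} \<tau> *\<^sub>R (p * exp (- ((c - \<tau>) / T * p)))) = Fn c - Fn 0"
  proof (rule integral_FTC_atLeastAtMost[OF c])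
    show "(Fn has_vector_derivative p * exp (- ((c - \<tau>) / T * p))) (at \<tau> within {0..c})" for \<tau>
      unfolding Fn_def using T
      by (auto intro!: derivative_eq_intros simp flip: has_real_derivative_iff_has_vector_derivative)
    show "continuous_on {0..c} (\<lambda>\<tau>. p * exp (- ((c - \<tau>) / T * p)))"
      using T by (intro continuous_intros) auto
  qed
  also have "\<dots> \<le> T" using T by (simp add: Fn_def)
  finally have "(LINT \<tau>|lborel. p * (indicator {0..c} \<tau> *\<^sub>R exp (- ((c - \<tau>) / T * p)))) \<le> T"
    by (simp add: mult.left_commute)
  then show ?thesis by simp
qed

text \<open>Because the rate shrinks linearly, the ratio of the weights at times \<tau> and t is
  exp(-(t - \<tau>) \<open>l1_norm \<zeta>\<close> / T). By \<open>exp_time_integral\<close> its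
  time integral compensates the factor \<open>l1_norm \<zeta>\<close> coming from
  \<open>nl_symbol\<close>; the modulus of the propagator is simply 1.\<close>

lemma controlled_duhamel:
  assumes G: "controlled T G A" and T: "T > 0"
  shows "controlled T (duhamel T G) (T * A)"
  unfolding controlled_def
proof (intro conjI allI continuous_duhamel[OF G T])
  fix t \<zeta>
  define c where "c = clamp_time T t"
  have c: "0 \<le> c" "c \<le> T" using clamp_time_bounds[OF T, of t] by (auto simp: c_def)
  note A0 = controlledD(3)[OF G]
  define e where "e = (\<lambda>\<tau>. exp (- ((c - \<tau>) / T * l1_norm \<zeta>)))"
  have ie: "integrable lborel (\<lambda>\<tau>. indicator {0..c} \<tau> *\<^sub>R e \<tau>)"
  proof -
    have "continuous_on {0..c} e" unfolding e_def by (intro continuous_intros) (use T in auto)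
    from borel_integrable_atLeastAtMost'[OF this] show ?thesis by (simp add: set_integrable_def)
  qed
  \<comment> \<open>Clamping is invisible here, as \<tau> lies between 0 and the clamped time
    t.\<close>
  have wt: "evol_weight T \<tau> \<zeta> = evol_weight T t \<zeta> * e \<tau>" if "\<tau> \<in> {0..c}" for \<tau>
  proof -
    have "clamp_time T \<tau> = \<tau>" using that c by (intro clamp_time_id) auto
    then show ?thesis
      using T by (simp add: evol_weight_def e_def c_def[symmetric] exp_add[symmetric] diff_divide_distrib algebra_simps)
  qed
  have "cmod (LINT \<tau>|lborel. indicator {0..c} \<tau> *\<^sub>R (iexp (- \<tau> * dispersion \<zeta>) * G \<tau> \<zeta>))
     \<le> (LINT \<tau>|lborel. A * evol_weight T t \<zeta> * (indicator {0..c} \<tau> *\<^sub>R e \<tau>))"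
  proof (rule Bochner_Integration.integral_norm_bound_integral[OF duhamel_integrable[OF G]])
    show "integrable lborel (\<lambda>\<tau>. A * evol_weight T t \<zeta> * (indicator {0..c} \<tau> *\<^sub>R e \<tau>))" using ie by simp
    fix \<tau>
    show "cmod (indicator {0..c} \<tau> *\<^sub>R (iexp (- \<tau> * dispersion \<zeta>) * G \<tau> \<zeta>)) \<le> A * evol_weight T t \<zeta> * (indicator {0..c} \<tau> *\<^sub>R e \<tau>)"
      using controlledD(2)[OF G, of \<tau> \<zeta>] wt[of \<tau>]
      unfolding norm_scaleR norm_iexp_mult by (auto simp: indicator_def mult.assoc)
  qed
  then have I: "cmod (LINT \<tau>|lborel. indicator {0..c} \<tau> *\<^sub>R (iexp (- \<tau> * dispersion \<zeta>) * G \<tau> \<zeta>))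
     \<le> A * evol_weight T t \<zeta> * (LINT \<tau>|lborel. indicator {0..c} \<tau> *\<^sub>R e \<tau>)" by simp
  have e0: "0 \<le> (LINT \<tau>|lborel. indicator {0..c} \<tau> *\<^sub>R e \<tau>)"
    by (intro integral_nonneg_AE) (auto simp: e_def)
  have "cmod (duhamel T G t \<zeta>) \<le> (l1_norm \<zeta> / (2 * pi)\<^sup>2) * (A * evol_weight T t \<zeta> * (LINT \<tau>|lborel. indicator {0..c} \<tau> *\<^sub>R e \<tau>))"
    unfolding duhamel_def c_def[symmetric] mult.assoc[of "iexp _"] norm_iexp_mult norm_mult[of "nl_symbol _"]
    by (intro mult_mono cmod_nl_symbol I) (use l1_norm_nonneg in auto)
  also have "\<dots> = (1 / (2 * pi)\<^sup>2) * (A * evol_weight T t \<zeta> * (l1_norm \<zeta> * (LINT \<tau>|lborel. indicator {0..c} \<tau> *\<^sub>R e \<tau>)))"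
    by simp
  also have "\<dots> \<le> 1 * (A * evol_weight T t \<zeta> * T)"
  proof (rule mult_mono)
    have "1\<^sup>2 \<le> (2 * pi)\<^sup>2" using pi_gt3 by (intro power_mono) auto
    then show "1 / (2 * pi)\<^sup>2 \<le> 1" by simp
    show "A * evol_weight T t \<zeta> * (l1_norm \<zeta> * (LINT \<tau>|lborel. indicator {0..c} \<tau> *\<^sub>R e \<tau>)) \<le> A * evol_weight T t \<zeta> * T"
      unfolding e_def using A0 evol_weight_pos[of T t \<zeta>]
      by (intro mult_left_mono exp_time_integral T c l1_norm_nonneg) auto
  qed (use A0 evol_weight_pos[of T t \<zeta>] e0 l1_norm_nonneg[of \<zeta>] in auto)
  finally show "cmod (duhamel T G t \<zeta>) \<le> T * A * evol_weight T t \<zeta>" by (simp add: mult_ac)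
qed

lemma duhamel_diff:
  assumes "controlled T G A" "controlled T H B"
  shows "duhamel T (\<lambda>t \<zeta>. G t \<zeta> - H t \<zeta>) t \<zeta> = duhamel T G t \<zeta> - duhamel T H t \<zeta>"
  unfolding duhamel_def right_diff_distrib scaleR_diff_right
  by (subst Bochner_Integration.integral_diff[OF duhamel_integrable[OF assms(1)] duhamel_integrable[OF assms(2)]])
    (simp add: right_diff_distrib)

lemma has_vector_derivative_iexp_mult:
  "((\<lambda>r. iexp (r * w)) has_vector_derivative (\<i> * complex_of_real w * iexp (t * w))) (at t within S)"
proof -
  have "((\<lambda>z. exp (\<i> * (z * complex_of_real w))) has_field_derivative
      (\<i> * complex_of_real w * exp (\<i> * (complex_of_real t * complex_of_real w)))) (at (complex_of_real t))"
    by (auto intro!: derivative_eq_intros)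
  from has_vector_derivative_real_field[OF this] show ?thesis by simp
qed

lemma duhamel_derivative:
  assumes G: "controlled T G A" and T: "T > 0" and t: "t \<in> {0..T}"
  shows "((\<lambda>t. duhamel T G t \<zeta>) has_vector_derivative
    (\<i> * complex_of_real (dispersion \<zeta>) * duhamel T G t \<zeta> + nl_symbol \<zeta> * G t \<zeta>)) (at t within {0..T})"
proof -
  define k where "k = (\<lambda>\<tau>. iexp (- \<tau> * dispersion \<zeta>) * G \<tau> \<zeta>)"
  have kc: "continuous_on S k" for S
    unfolding k_def by (intro continuous_intros controlled_slice_continuous[OF G])
  have eq: "duhamel T G r \<zeta> = iexp (r * dispersion \<zeta>) * nl_symbol \<zeta> * integral {0..r} k" if "r \<in> {0..T}" for r
  proof -
    have "set_integrable lborel {0..r} k" by (rule borel_integrable_atLeastAtMost'[OF kc])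
    from set_borel_integral_eq_integral(2)[OF this] show ?thesis
      using that by (simp add: duhamel_def clamp_time_id k_def set_lebesgue_integral_def)
  qed
  have 1: "((\<lambda>r. integral {0..r} k) has_vector_derivative k t) (at t within {0..T})"
    by (rule integral_has_vector_derivative[OF kc t])
  have 2: "((\<lambda>r. iexp (r * dispersion \<zeta>)) has_vector_derivative (\<i> * complex_of_real (dispersion \<zeta>) * iexp (t * dispersion \<zeta>))) (at t within {0..T})"
    by (rule has_vector_derivative_iexp_mult)
  have 3: "iexp (t * dispersion \<zeta>) * k t = G t \<zeta>"
    unfolding k_def mult.assoc[symmetric] iexp_add[symmetric] by simp
  have "((\<lambda>r. iexp (r * dispersion \<zeta>) * nl_symbol \<zeta> * integral {0..r} k) has_vector_derivative
     (iexp (t * dispersion \<zeta>) * nl_symbol \<zeta> * k t + \<i> * complex_of_real (dispersion \<zeta>) * iexp (t * dispersion \<zeta>) * nl_symbol \<zeta> * integral {0..t} k)) (at t within {0..T})"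
    by (rule has_vector_derivative_mult[OF has_vector_derivative_mult_left[OF 2] 1])
  also have "iexp (t * dispersion \<zeta>) * nl_symbol \<zeta> * k t + \<i> * complex_of_real (dispersion \<zeta>) * iexp (t * dispersion \<zeta>) * nl_symbol \<zeta> * integral {0..t} k
    = \<i> * complex_of_real (dispersion \<zeta>) * duhamel T G t \<zeta> + nl_symbol \<zeta> * G t \<zeta>"
    unfolding eq[OF t] 3[symmetric] by (simp add: algebra_simps)
  finally show ?thesis by (rule has_vector_derivative_transform[OF t, rotated]) (rule eq)
qed

section \<open>Hermitian symmetry\<close>

text \<open>The spectra of real-valued functions. Solving within this class gives real solutions, so
  one construction serves both \<open>K = \<real>\<close> and \<open>K = UNIV\<close>.\<close>

definition hermitian :: "(plane \<Rightarrow> complex) \<Rightarrow> bool" where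
  "hermitian f \<longleftrightarrow> (\<forall>\<zeta>. f (- \<zeta>) = cnj (f \<zeta>))"

lemma hermitian_conv:
  assumes f: "hermitian f" and g: "hermitian g" and m: "f \<in> borel_measurable borel" "g \<in> borel_measurable borel"
  shows "hermitian (conv f g)"
  unfolding hermitian_def
proof
  fix \<zeta>
  note [measurable] = m
  have "conv f g (- \<zeta>) = (\<integral>\<mu>. f (0 - \<mu>) * g (- \<zeta> - (0 - \<mu>)) \<partial>lborel)"
    unfolding conv_def by (rule lborel_integral_reflect[symmetric]) measurable
  also have "\<dots> = (\<integral>\<mu>. cnj (f \<mu> * g (\<zeta> - \<mu>)) \<partial>lborel)"
  proof (intro Bochner_Integration.integral_cong refl)
    fix \<mu>
    have "g (- \<zeta> - (0 - \<mu>)) = cnj (g (\<zeta> - \<mu>))"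
      using g[unfolded hermitian_def, rule_format, of "\<zeta> - \<mu>"] by simp
    then show "f (0 - \<mu>) * g (- \<zeta> - (0 - \<mu>)) = cnj (f \<mu> * g (\<zeta> - \<mu>))"
      using f by (simp add: hermitian_def)
  qed
  finally show "conv f g (- \<zeta>) = cnj (conv f g \<zeta>)"
    by (simp only: conv_def Bochner_Integration.integral_cnj)
qed

lemma dispersion_minus: "dispersion (- \<zeta>) = - dispersion \<zeta>" by (simp add: dispersion_def)

lemma nl_symbol_minus: "nl_symbol (- \<zeta>) = cnj (nl_symbol \<zeta>)"
  unfolding nl_symbol_def by (simp add: field_simps)

lemma iexp_minus: "iexp (- x) = cnj (iexp x)" by (simp add: exp_cnj)

lemma hermitian_duhamel:
  assumes "\<And>t. hermitian (G t)"
  shows "hermitian (duhamel T G t)"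
  unfolding hermitian_def
proof
  fix \<zeta>
  have "duhamel T G t (- \<zeta>) = iexp (- (clamp_time T t * dispersion \<zeta>)) * cnj (nl_symbol \<zeta>) *
     (LINT \<tau>|lborel. cnj (indicator {0..clamp_time T t} \<tau> *\<^sub>R (iexp (- \<tau> * dispersion \<zeta>) * G \<tau> \<zeta>)))"
    using assms unfolding duhamel_def dispersion_minus nl_symbol_minus hermitian_def
    by (simp add: exp_cnj)
  then show "duhamel T G t (- \<zeta>) = cnj (duhamel T G t \<zeta>)"
    unfolding Bochner_Integration.integral_cnj iexp_minus by (simp add: duhamel_def)
qed

section \<open>Solutions with small data\<close>

text \<open>Together with \<open>div_weight\<close> this identifies controlled spectra with bounded
  continuous functions under the sup norm, so that completeness is available for the fixed point
  argument.\<close>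

definition mul_weight :: "real \<Rightarrow> ((real \<times> plane) \<Rightarrow>\<^sub>C complex) \<Rightarrow> real \<Rightarrow> plane \<Rightarrow> complex" where
  "mul_weight T f t \<zeta> = complex_of_real (evol_weight T t \<zeta>) * apply_bcontfun f (t, \<zeta>)"

definition div_weight :: "real \<Rightarrow> (real \<Rightarrow> plane \<Rightarrow> complex) \<Rightarrow> ((real \<times> plane) \<Rightarrow>\<^sub>C complex)" where
  "div_weight T a = Bcontfun (\<lambda>(t, \<zeta>). a t \<zeta> / complex_of_real (evol_weight T t \<zeta>))"

lemma controlled_mul_weight:
  assumes T: "T > 0" shows "controlled T (mul_weight T f) (norm f)"
  unfolding controlled_def
proof (intro conjI allI)
  show "continuous_on UNIV (\<lambda>(t, \<zeta>). mul_weight T f t \<zeta>)"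
    unfolding mul_weight_def split_def by (intro continuous_intros T) (simp_all add: continuous_intros)
  show "cmod (mul_weight T f t \<zeta>) \<le> norm f * evol_weight T t \<zeta>" for t \<zeta>
    unfolding mul_weight_def norm_mult using norm_bounded[of f "(t, \<zeta>)"] evol_weight_pos[of T t \<zeta>]
    by (simp add: mult.commute mult_left_mono)
qed

lemma div_weight_properties:
  assumes a: "controlled T a A" and T: "T > 0"
  shows "mul_weight T (div_weight T a) = a" and "norm (div_weight T a) \<le> A"
proof -
  let ?q = "\<lambda>(t, \<zeta>). a t \<zeta> / complex_of_real (evol_weight T t \<zeta>)"
  have b: "norm (?q p) \<le> A" for p
  proof -
    obtain t \<zeta> where p: "p = (t, \<zeta>)" by (cases p)
    show ?thesis using controlledD(2)[OF a, of t \<zeta>] evol_weight_pos[of T t \<zeta>]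
      by (simp add: p norm_divide divide_le_eq)
  qed
  have "continuous_on UNIV ?q"
    using controlledD(1)[OF a] evol_weight_pos[of T] T unfolding split_def
    by (intro continuous_intros) (auto simp: less_imp_neq[symmetric])
  then have q: "?q \<in> bcontfun" using b by (rule bcontfun_normI)
  have ap: "apply_bcontfun (div_weight T a) = ?q" unfolding div_weight_def by (rule Bcontfun_inverse[OF q])
  show "mul_weight T (div_weight T a) = a"
    using evol_weight_pos[of T] by (intro ext) (simp add: mul_weight_def ap less_imp_neq[symmetric])
  show "norm (div_weight T a) \<le> A" by (rule norm_bound) (simp only: ap b)
qed

lemma mul_weight_inject: "mul_weight T f = mul_weight T g \<Longrightarrow> f = g"
proof (rule bcontfun_eqI)
  fix p :: "real \<times> plane" assume eq: "mul_weight T f = mul_weight T g"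
  obtain t \<zeta> where p: "p = (t, \<zeta>)" by (cases p)
  show "apply_bcontfun f p = apply_bcontfun g p"
    using fun_cong[OF fun_cong[OF eq, of t], of \<zeta>] evol_weight_pos[of T t \<zeta>] by (simp add: mul_weight_def p)
qed

lemma mul_weight_diff: "mul_weight T (f - g) t \<zeta> = mul_weight T f t \<zeta> - mul_weight T g t \<zeta>"
  by (simp add: mul_weight_def right_diff_distrib)

lemma mul_weight_add: "mul_weight T (f + g) t \<zeta> = mul_weight T f t \<zeta> + mul_weight T g t \<zeta>"
  by (simp add: mul_weight_def distrib_left)

lemma mul_weight_scaleR: "mul_weight T (h *\<^sub>R f) t \<zeta> = complex_of_real h * mul_weight T f t \<zeta>"
  by (simp add: mul_weight_def scaleR_conv_of_real)

definition cube :: "(plane \<Rightarrow> complex) \<Rightarrow> plane \<Rightarrow> complex" where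
  "cube f = conv f (conv f f)"

definition duhamel3 :: "real \<Rightarrow> ((real \<times> plane) \<Rightarrow>\<^sub>C complex) \<Rightarrow> ((real \<times> plane) \<Rightarrow>\<^sub>C complex)
    \<Rightarrow> ((real \<times> plane) \<Rightarrow>\<^sub>C complex) \<Rightarrow> ((real \<times> plane) \<Rightarrow>\<^sub>C complex)" where
  "duhamel3 T f g k = div_weight T (duhamel T (\<lambda>t. conv (mul_weight T f t) (conv (mul_weight T g t) (mul_weight T k t))))"

context fixes T :: real assumes T: "T > 0" begin

lemmas controlled_mul_weight' = controlled_mul_weight[OF T]

lemma controlled_conv3:
  assumes "controlled T a A" "controlled T b B" "controlled T c C"
  shows "controlled T (\<lambda>t. conv (a t) (conv (b t) (c t))) (conv_const * A * (conv_const * B * C))"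
  by (intro controlled_conv assms T)

lemma controlled_duhamel3:
  "controlled T (duhamel T (\<lambda>t. conv (mul_weight T f t) (conv (mul_weight T g t) (mul_weight T k t)))) (T * (conv_const * norm f * (conv_const * norm g * norm k)))"
  by (intro controlled_duhamel controlled_conv3 controlled_mul_weight' T)

lemma mul_weight_duhamel3: "mul_weight T (duhamel3 T f g k) = duhamel T (\<lambda>t. conv (mul_weight T f t) (conv (mul_weight T g t) (mul_weight T k t)))"
  unfolding duhamel3_def by (rule div_weight_properties(1)[OF controlled_duhamel3 T])

lemma norm_duhamel3: "norm (duhamel3 T f g k) \<le> (T * conv_const\<^sup>2) * norm f * norm g * norm k"
  using div_weight_properties(2)[OF controlled_duhamel3 T, of f g k]
  by (simp add: duhamel3_def power2_eq_square mult_ac)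

text \<open>\<open>mul_weight\<close> is injective, so the identities may be checked on actual
  spectra, where they are linearity of the integrals in \<open>conv\<close> and
  \<open>duhamel\<close>.\<close>

lemma duhamel3_diff:
  shows "duhamel3 T (f - f') g k = duhamel3 T f g k - duhamel3 T f' g k"
    and "duhamel3 T f (g - g') k = duhamel3 T f g k - duhamel3 T f g' k"
    and "duhamel3 T f g (k - k') = duhamel3 T f g k - duhamel3 T f g k'"
proof -
  note cu = controlled_mul_weight' and c3 = controlled_conv3[OF controlled_mul_weight' controlled_mul_weight' controlled_mul_weight']
  have upd: "mul_weight T (f - f') t = (\<lambda>\<zeta>. mul_weight T f t \<zeta> - mul_weight T f' t \<zeta>)" for f f' t by (rule ext) (rule mul_weight_diff)
  have "mul_weight T (duhamel3 T (f - f') g k) = mul_weight T (duhamel3 T f g k - duhamel3 T f' g k)"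
    unfolding mul_weight_duhamel3 upd conv_diff(1)[OF cu cu controlled_conv[OF cu cu T] T]
    by (intro ext) (simp only: mul_weight_diff mul_weight_duhamel3 duhamel_diff[OF c3 c3])
  then show "duhamel3 T (f - f') g k = duhamel3 T f g k - duhamel3 T f' g k" by (rule mul_weight_inject)
  have "mul_weight T (duhamel3 T f (g - g') k) = mul_weight T (duhamel3 T f g k - duhamel3 T f g' k)"
    unfolding mul_weight_duhamel3 upd conv_diff(1)[OF cu cu cu T]
      conv_diff(2)[OF controlled_conv[OF cu cu T] controlled_conv[OF cu cu T] cu T]
    by (intro ext) (simp only: mul_weight_diff mul_weight_duhamel3 duhamel_diff[OF c3 c3])
  then show "duhamel3 T f (g - g') k = duhamel3 T f g k - duhamel3 T f g' k" by (rule mul_weight_inject)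
  have "mul_weight T (duhamel3 T f g (k - k')) = mul_weight T (duhamel3 T f g k - duhamel3 T f g k')"
    unfolding mul_weight_duhamel3 upd conv_diff(2)[OF cu cu cu T]
      conv_diff(2)[OF controlled_conv[OF cu cu T] controlled_conv[OF cu cu T] cu T]
    by (intro ext) (simp only: mul_weight_diff mul_weight_duhamel3 duhamel_diff[OF c3 c3])
  then show "duhamel3 T f g (k - k') = duhamel3 T f g k - duhamel3 T f g k'" by (rule mul_weight_inject)
qed

end

lemma evol_weight_minus: "evol_weight T t (- \<zeta>) = evol_weight T t \<zeta>"
  by (simp add: evol_weight_def l1_norm_def lorentz2_def lorentz_def)

text \<open>The weight is even in \<zeta>, so the symmetry can be imposed on the bounded continuous
  function itself, where it is visibly a closed condition.\<close>

definition herm_set :: "((real \<times> plane) \<Rightarrow>\<^sub>C complex) set" where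
  "herm_set = {f. \<forall>t \<zeta>. apply_bcontfun f (t, - \<zeta>) = cnj (apply_bcontfun f (t, \<zeta>))}"

lemma herm_set_iff: "f \<in> herm_set \<longleftrightarrow> (\<forall>t. hermitian (mul_weight T f t))"
  using evol_weight_pos[of T] by (auto simp: herm_set_def hermitian_def mul_weight_def evol_weight_minus less_imp_neq[symmetric])

lemma continuous_on_eval: "continuous_on UNIV (\<lambda>f::'a::topological_space \<Rightarrow>\<^sub>C 'b::metric_space. apply_bcontfun f p)"
  unfolding continuous_on_iff
proof (intro ballI allI impI)
  fix f :: "'a \<Rightarrow>\<^sub>C 'b" and e :: real assume "e > 0"
  then show "\<exists>d>0. \<forall>g\<in>UNIV. dist g f < d \<longrightarrow> dist (apply_bcontfun g p) (apply_bcontfun f p) < e"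
    using dist_bounded by (intro exI[of _ e]) (auto intro: le_less_trans)
qed

lemma closed_herm_set: "closed herm_set"
  unfolding herm_set_def
  by (intro closed_Collect_all closed_Collect_eq continuous_on_eval continuous_intros)

lemma conv_cmult: "conv (\<lambda>\<zeta>. c * f \<zeta>) g \<zeta> = c * conv f g \<zeta>" "conv f (\<lambda>\<zeta>. c * g \<zeta>) \<zeta> = c * conv f g \<zeta>"
  unfolding conv_def by (simp_all add: mult.assoc mult.left_commute[of _ c])

lemma cube_cmult: "cube (\<lambda>\<zeta>. c * f \<zeta>) \<zeta> = c ^ 3 * cube f \<zeta>"
  unfolding cube_def conv_cmult[abs_def] by (simp add: conv_cmult power3_eq_cube mult_ac)

lemma duhamel_cmult: "duhamel T (\<lambda>t \<zeta>. c * G t \<zeta>) t \<zeta> = c * duhamel T G t \<zeta>"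
proof -
  have eq: "(LINT \<tau>|lborel. indicator {0..clamp_time T t} \<tau> *\<^sub>R (iexp (- \<tau> * dispersion \<zeta>) * (c * G \<tau> \<zeta>)))
     = (LINT \<tau>|lborel. c * (indicator {0..clamp_time T t} \<tau> *\<^sub>R (iexp (- \<tau> * dispersion \<zeta>) * G \<tau> \<zeta>)))"
    by (simp add: mult_ac scaleR_conv_of_real)
  show ?thesis unfolding duhamel_def eq integral_mult_right_zero by (simp only: mult_ac)
qed

definition free_evol :: "real \<Rightarrow> (plane \<Rightarrow> complex) \<Rightarrow> real \<Rightarrow> plane \<Rightarrow> complex" where
  "free_evol T g t \<zeta> = iexp (clamp_time T t * dispersion \<zeta>) * g \<zeta>"

lemma controlled_free_evol:
  assumes T: "T > 0" and g: "continuous_on UNIV g"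
    and gb: "\<And>\<zeta>. cmod (g \<zeta>) \<le> B * (exp (- (2 * l1_norm \<zeta>)) * lorentz2 \<zeta>)"
  shows "controlled T (free_evol T g) B"
  unfolding controlled_def
proof (intro conjI allI)
  have "cmod (g 0) \<le> B * lorentz2 0" using gb[of 0] by (simp add: l1_norm_def)
  from order_trans[OF norm_ge_zero this] have B: "B \<ge> 0"
    using lorentz2_pos[of 0] by (simp add: zero_le_mult_iff)
  show "continuous_on UNIV (\<lambda>(t, \<zeta>). free_evol T g t \<zeta>)"
    unfolding free_evol_def split_def
    by (intro continuous_intros continuous_on_compose2[OF g]) auto
  show "cmod (free_evol T g t \<zeta>) \<le> B * evol_weight T t \<zeta>" for t \<zeta>
    unfolding free_evol_def norm_iexp_mult
    using order_trans[OF gb mult_left_mono[OF evol_weight_ge_start[OF T] B]] .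
qed

text \<open>The fixed point theorem with starting point h times the free evolution, inside
  \<open>herm_set\<close>. The bounds \<epsilon> and \<open>C\<close> depend on \<open>g\<close> and
  \<open>T\<close>, hence on N in the application; only the coefficient of h^3 will be compared
  across different N.\<close>

theorem small_data_solution:
  assumes T: "T > 0" and g: "continuous_on UNIV g" "hermitian g"
    and gb: "\<And>\<zeta>. cmod (g \<zeta>) \<le> B * (exp (- (2 * l1_norm \<zeta>)) * lorentz2 \<zeta>)"
  shows "\<exists>\<epsilon>>0. \<exists>C. \<forall>h. 0 \<le> h \<and> h \<le> \<epsilon> \<longrightarrow> (\<exists>V A. controlled T V A \<and> (\<forall>t. hermitian (V t)) \<and>
     (\<forall>t \<zeta>. V t \<zeta> = complex_of_real h * free_evol T g t \<zeta> + duhamel T (\<lambda>t. cube (V t)) t \<zeta>) \<and>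
     (\<forall>t \<zeta>. cmod (V t \<zeta> - complex_of_real h * free_evol T g t \<zeta>
         - complex_of_real (h ^ 3) * duhamel T (\<lambda>t. cube (free_evol T g t)) t \<zeta>) \<le> C * h ^ 4))"
proof -
  note lin = controlled_free_evol[OF T g(1) gb]
  have linh: "hermitian (free_evol T g t)" for t
    using g(2) by (simp add: hermitian_def free_evol_def dispersion_minus exp_cnj)
  define y where "y = div_weight T (free_evol T g)"
  have upy: "mul_weight T y = free_evol T g" unfolding y_def by (rule div_weight_properties(1)[OF lin T])
  define n where "n = norm y"
  define CQ where "CQ = T * conv_const\<^sup>2"
  have CQ: "CQ \<ge> 0" using T by (simp add: CQ_def)
  have n0: "n \<ge> 0" by (simp add: n_def)
  \<comment> \<open>Since \<epsilon> \<le> 1, h \<le> \<epsilon> implies h^2 \<le> \<epsilon>, and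
    the smallness condition of the fixed point theorem, quadratic in h, follows.\<close>
  define \<epsilon> where "\<epsilon> = 1 / (24 * CQ * n\<^sup>2 + 1)"
  have den: "24 * CQ * n\<^sup>2 + 1 \<ge> 1" using CQ by simp
  have \<epsilon>: "\<epsilon> > 0" "\<epsilon> \<le> 1" "24 * CQ * n\<^sup>2 * \<epsilon> \<le> 1"
    using den by (auto simp: \<epsilon>_def divide_le_eq)
  define C where "C = 96 * CQ\<^sup>2 * n ^ 5"
  have C: "C \<ge> 0" using n0 by (simp add: C_def)
  show ?thesis
  proof (rule exI[of _ \<epsilon>], intro exI[of _ C] conjI \<epsilon>(1) allI impI)
    fix h assume h: "0 \<le> h \<and> h \<le> \<epsilon>"
    define x0 where "x0 = h *\<^sub>R y"
    have nx0: "norm x0 = h * n" using h by (simp add: x0_def n_def)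
    have upx0: "mul_weight T x0 t = (\<lambda>\<zeta>. complex_of_real h * free_evol T g t \<zeta>)" for t
      by (rule ext) (simp add: x0_def mul_weight_scaleR upy)
    have x0S: "x0 \<in> herm_set"
      unfolding herm_set_iff[of _ T] upx0 using linh by (auto simp: hermitian_def)
    have hn: "h * h \<le> h * 1" using h \<epsilon> by (intro mult_left_mono) auto
    have small: "24 * CQ * (norm x0)\<^sup>2 \<le> 1"
    proof -
      have "24 * CQ * (norm x0)\<^sup>2 = 24 * CQ * n\<^sup>2 * (h * h)" by (simp add: nx0 power2_eq_square)
      also have "\<dots> \<le> 24 * CQ * n\<^sup>2 * \<epsilon>" using hn h CQ by (intro mult_left_mono) auto
      finally show ?thesis using \<epsilon>(3) by simp
    qed
    have inv: "x0 + duhamel3 T x x x \<in> herm_set" if "x \<in> herm_set" for x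
    proof -
      have hx: "hermitian (mul_weight T x t)" for t using that herm_set_iff[of x T] by blast
      have m: "mul_weight T x t \<in> borel_measurable borel" for t by (rule controlledD(5)[OF controlled_mul_weight[OF T]])
      have mc: "conv (mul_weight T x t) (mul_weight T x t) \<in> borel_measurable borel" for t
        by (rule controlledD(5)[OF controlled_conv[OF controlled_mul_weight[OF T] controlled_mul_weight[OF T] T]])
      have "hermitian (mul_weight T (duhamel3 T x x x) t)" for t
        unfolding mul_weight_duhamel3[OF T] by (intro hermitian_duhamel hermitian_conv hx m mc)
      moreover have "hermitian (mul_weight T x0 t)" for t using x0S herm_set_iff[of x0 T] by blast
      ultimately show ?thesis unfolding herm_set_iff[of _ T] by (simp add: hermitian_def mul_weight_add)
    qed
    obtain x where x: "x \<in> herm_set" "x = x0 + duhamel3 T x x x"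
       "norm (x - x0 - duhamel3 T x0 x0 x0) \<le> 96 * CQ\<^sup>2 * norm x0 ^ 5"
      using trilinear_fixed_point[OF duhamel3_diff[OF T] norm_duhamel3[OF T] _ closed_herm_set x0S inv]
        small CQ unfolding CQ_def by blast
    show "\<exists>V A. controlled T V A \<and> (\<forall>t. hermitian (V t)) \<and>
     (\<forall>t \<zeta>. V t \<zeta> = complex_of_real h * free_evol T g t \<zeta> + duhamel T (\<lambda>t. cube (V t)) t \<zeta>) \<and>
     (\<forall>t \<zeta>. cmod (V t \<zeta> - complex_of_real h * free_evol T g t \<zeta>
         - complex_of_real (h ^ 3) * duhamel T (\<lambda>t. cube (free_evol T g t)) t \<zeta>) \<le> C * h ^ 4)"
    proof (intro exI[of _ "mul_weight T x"] exI[of _ "norm x"] conjI allI controlled_mul_weight[OF T])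
      fix t \<zeta>
      show "hermitian (mul_weight T x t)" using x(1) herm_set_iff[of x T] by blast
      have "mul_weight T x t \<zeta> = mul_weight T (x0 + duhamel3 T x x x) t \<zeta>" using x(2) by simp
      then show "mul_weight T x t \<zeta> = complex_of_real h * free_evol T g t \<zeta> + duhamel T (\<lambda>t. cube (mul_weight T x t)) t \<zeta>"
        by (simp add: mul_weight_add upx0 mul_weight_duhamel3[OF T] cube_def)
      have "mul_weight T (duhamel3 T x0 x0 x0) t \<zeta> = duhamel T (\<lambda>t. cube (mul_weight T x0 t)) t \<zeta>"
        by (simp add: mul_weight_duhamel3[OF T] cube_def)
      also have "\<dots> = complex_of_real (h ^ 3) * duhamel T (\<lambda>t. cube (free_evol T g t)) t \<zeta>"
        unfolding upx0 cube_cmult[abs_def] duhamel_cmult by simp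
      finally have "mul_weight T x t \<zeta> - complex_of_real h * free_evol T g t \<zeta>
         - complex_of_real (h ^ 3) * duhamel T (\<lambda>t. cube (free_evol T g t)) t \<zeta>
         = mul_weight T (x - x0 - duhamel3 T x0 x0 x0) t \<zeta>" by (simp add: mul_weight_diff upx0)
      \<comment> \<open>The weight is at most 1, so the norm of the fixed point space bounds spectra
        pointwise.\<close>
      moreover have "cmod (mul_weight T (x - x0 - duhamel3 T x0 x0 x0) t \<zeta>) \<le> norm (x - x0 - duhamel3 T x0 x0 x0)"
        using controlled_lorentz2(2)[OF controlled_mul_weight[OF T] T] .
      moreover have "norm (x - x0 - duhamel3 T x0 x0 x0) \<le> C * h ^ 4"
      proof -
        \<comment> \<open>The quintic error is weakened, using h \<le> 1, to the quartic form that
          \<open>cubic_coefficient_bound\<close> expects.\<close>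
        have "96 * CQ\<^sup>2 * norm x0 ^ 5 = C * h ^ 4 * h"
          by (simp add: nx0 C_def power_mult_distrib eval_nat_numeral)
        also have "\<dots> \<le> C * h ^ 4 * 1" using h \<epsilon> C by (intro mult_left_mono) auto
        finally show ?thesis using x(3) by simp
      qed
      ultimately show "cmod (mul_weight T x t \<zeta> - complex_of_real h * free_evol T g t \<zeta>
         - complex_of_real (h ^ 3) * duhamel T (\<lambda>t. cube (free_evol T g t)) t \<zeta>) \<le> C * h ^ 4" by simp
    qed
  qed
qed

section \<open>Rapidly decaying spectra\<close>

text \<open>Unlike a fixed exponential weight, decay of every polynomial order is stable under
  multiplication by polynomials, hence under differentiation of the solution. Times are restricted
  to [0,T], where derivatives in time are taken.\<close>

definition rapid :: "real \<Rightarrow> (real \<Rightarrow> plane \<Rightarrow> complex) \<Rightarrow> bool" where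
  "rapid T W \<longleftrightarrow> continuous_on ({0..T} \<times> UNIV) (\<lambda>(t, \<zeta>). W t \<zeta>)
     \<and> (\<forall>n. \<exists>C. \<forall>t\<in>{0..T}. \<forall>\<zeta>. (1 + norm \<zeta>) ^ n * cmod (W t \<zeta>) \<le> C)"

lemma rapidD:
  assumes "rapid T W"
  shows "continuous_on ({0..T} \<times> UNIV) (\<lambda>(t, \<zeta>). W t \<zeta>)"
    "\<exists>C. \<forall>t\<in>{0..T}. \<forall>\<zeta>. (1 + norm \<zeta>) ^ n * cmod (W t \<zeta>) \<le> C"
  using assms unfolding rapid_def by blast+

lemma rapid_slices:
  assumes W: "rapid T W"
  shows "t \<in> {0..T} \<Longrightarrow> continuous_on UNIV (W t)" "t \<in> {0..T} \<Longrightarrow> W t \<in> borel_measurable borel"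
    "continuous_on {0..T} (\<lambda>t. W t \<zeta>)"
proof -
  show c: "continuous_on UNIV (W t)" if "t \<in> {0..T}" for t
  proof -
    have "continuous_on UNIV (\<lambda>\<zeta>. case (t, \<zeta>) of (t, \<zeta>) \<Rightarrow> W t \<zeta>)"
      by (rule continuous_on_compose2[OF rapidD(1)[OF W]]) (use that in \<open>auto intro: continuous_intros\<close>)
    then show ?thesis by simp
  qed
  show "W t \<in> borel_measurable borel" if "t \<in> {0..T}"
    by (rule borel_measurable_continuous_onI[OF c[OF that]])
  show "continuous_on {0..T} (\<lambda>t. W t \<zeta>)"
  proof -
    have "continuous_on {0..T} (\<lambda>t. case (t, \<zeta>) of (t, \<zeta>) \<Rightarrow> W t \<zeta>)"
      by (rule continuous_on_compose2[OF rapidD(1)[OF W]]) (auto intro: continuous_intros)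
    then show ?thesis by simp
  qed
qed

lemma norm_plane_bounds:
  fixes \<zeta> :: plane
  shows "\<bar>fst \<zeta>\<bar> \<le> norm \<zeta>" "\<bar>snd \<zeta>\<bar> \<le> norm \<zeta>" "norm \<zeta> \<le> l1_norm \<zeta>"
  using sqrt_sum_squares_le_sum_abs[of "fst \<zeta>" "snd \<zeta>"]
  by (simp_all add: l1_norm_def norm_prod_def)

lemma lorentz2_ge: "1 \<le> (1 + norm \<zeta>) ^ 4 * lorentz2 \<zeta>"
proof -
  have q: "1 + x\<^sup>2 \<le> (1 + norm \<zeta>)\<^sup>2" if "\<bar>x\<bar> \<le> norm \<zeta>" for x
  proof -
    have "x\<^sup>2 \<le> (norm \<zeta>)\<^sup>2" using that by (metis abs_ge_zero power2_abs power_mono)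
    then show ?thesis by (simp add: power2_sum add_increasing2)
  qed
  have "(1 + (fst \<zeta>)\<^sup>2) * (1 + (snd \<zeta>)\<^sup>2) \<le> (1 + norm \<zeta>)\<^sup>2 * (1 + norm \<zeta>)\<^sup>2"
    by (intro mult_mono q norm_plane_bounds) auto
  also have "\<dots> = (1 + norm \<zeta>) ^ 4" by (simp flip: power_add)
  finally have "(1 + (fst \<zeta>)\<^sup>2) * (1 + (snd \<zeta>)\<^sup>2) * lorentz2 \<zeta> \<le> (1 + norm \<zeta>) ^ 4 * lorentz2 \<zeta>"
    using lorentz2_pos[of \<zeta>] by (intro mult_right_mono) auto
  then show ?thesis by (simp add: lorentz2_def lorentz_def)
qed

text \<open>Four extra powers of decay are traded for an integrable factor that does not depend on
  time, which serves as majorant in all the dominated convergence arguments below.\<close>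

lemma rapid_lorentz2:
  assumes W: "rapid T W"
  shows "\<exists>C\<ge>0. \<forall>t\<in>{0..T}. \<forall>\<zeta>. (1 + norm \<zeta>) ^ n * cmod (W t \<zeta>) \<le> C * lorentz2 \<zeta>"
proof -
  obtain C where C: "\<And>t \<zeta>. t \<in> {0..T} \<Longrightarrow> (1 + norm \<zeta>) ^ (n + 4) * cmod (W t \<zeta>) \<le> C"
    using rapidD(2)[OF W, of "n + 4"] by blast
  have "(1 + norm \<zeta>) ^ n * cmod (W t \<zeta>) \<le> \<bar>C\<bar> * lorentz2 \<zeta>" if t: "t \<in> {0..T}" for t \<zeta>
  proof -
    have "(1 + norm \<zeta>) ^ n * cmod (W t \<zeta>) * 1 \<le> (1 + norm \<zeta>) ^ n * cmod (W t \<zeta>) * ((1 + norm \<zeta>) ^ 4 * lorentz2 \<zeta>)"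
      by (intro mult_left_mono lorentz2_ge) auto
    also have "\<dots> = ((1 + norm \<zeta>) ^ (n + 4) * cmod (W t \<zeta>)) * lorentz2 \<zeta>"
      by (simp add: power_add)
    also have "\<dots> \<le> \<bar>C\<bar> * lorentz2 \<zeta>"
      using C[OF t, of \<zeta>] lorentz2_pos[of \<zeta>] by (intro mult_right_mono) auto
    finally show ?thesis by simp
  qed
  then show ?thesis by (intro exI[of _ "\<bar>C\<bar>"]) auto
qed

lemma rapid_integrable:
  assumes W: "rapid T W" and t: "t \<in> {0..T}"
  shows "integrable lborel (W t)"
proof -
  obtain C where C: "C \<ge> 0" "\<And>t \<zeta>. t \<in> {0..T} \<Longrightarrow> (1 + norm \<zeta>) ^ 0 * cmod (W t \<zeta>) \<le> C * lorentz2 \<zeta>"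
    using rapid_lorentz2[OF W, of 0] by blast
  show ?thesis
    by (rule Bochner_Integration.integrable_bound[of _ "\<lambda>\<zeta>. C * lorentz2 \<zeta>"])
      (use C t rapid_slices(2)[OF W t] integrable_lorentz2 in \<open>auto intro!: AE_I2 simp: abs_mult abs_of_pos[OF lorentz2_pos]\<close>)
qed

lemma rapid_cong:
  assumes W: "rapid T W" and eq: "\<And>t \<zeta>. t \<in> {0..T} \<Longrightarrow> W' t \<zeta> = W t \<zeta>"
  shows "rapid T W'"
proof -
  have "continuous_on ({0..T} \<times> UNIV) (\<lambda>(t, \<zeta>). W' t \<zeta>)"
    by (rule continuous_on_eq[OF rapidD(1)[OF W]]) (auto simp: eq)
  then show ?thesis using W by (simp add: rapid_def eq)
qed

lemma rapid_add:
  assumes W: "rapid T W" and X: "rapid T X"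
  shows "rapid T (\<lambda>t \<zeta>. W t \<zeta> + X t \<zeta>)"
  unfolding rapid_def
proof (intro conjI allI)
  show "continuous_on ({0..T} \<times> UNIV) (\<lambda>(t, \<zeta>). W t \<zeta> + X t \<zeta>)"
    using rapidD(1)[OF W] rapidD(1)[OF X] unfolding split_def by (intro continuous_intros)
  fix n
  obtain C D where "\<And>t \<zeta>. t \<in> {0..T} \<Longrightarrow> (1 + norm \<zeta>) ^ n * cmod (W t \<zeta>) \<le> C"
    "\<And>t \<zeta>. t \<in> {0..T} \<Longrightarrow> (1 + norm \<zeta>) ^ n * cmod (X t \<zeta>) \<le> D"
    using rapidD(2)[OF W, of n] rapidD(2)[OF X, of n] by blast
  moreover have "(1 + norm \<zeta>) ^ n * cmod (W t \<zeta> + X t \<zeta>) \<le> (1 + norm \<zeta>) ^ n * cmod (W t \<zeta>) + (1 + norm \<zeta>) ^ n * cmod (X t \<zeta>)" for t \<zeta>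
    unfolding distrib_left[symmetric] by (intro mult_left_mono norm_triangle_ineq) auto
  ultimately show "\<exists>C. \<forall>t\<in>{0..T}. \<forall>\<zeta>. (1 + norm \<zeta>) ^ n * cmod (W t \<zeta> + X t \<zeta>) \<le> C"
    by (intro exI[of _ "C + D"]) (meson add_mono order_trans)
qed

definition poly_growth :: "(plane \<Rightarrow> complex) \<Rightarrow> bool" where
  "poly_growth p \<longleftrightarrow> continuous_on UNIV p \<and> (\<exists>c m. \<forall>\<zeta>. cmod (p \<zeta>) \<le> c * (1 + norm \<zeta>) ^ m)"

lemma poly_growth_mult:
  assumes "poly_growth p" "poly_growth q"
  shows "poly_growth (\<lambda>\<zeta>. p \<zeta> * q \<zeta>)"
proof -
  obtain c m d n where c: "\<And>\<zeta>. cmod (p \<zeta>) \<le> c * (1 + norm \<zeta>) ^ m" and d: "\<And>\<zeta>. cmod (q \<zeta>) \<le> d * (1 + norm \<zeta>) ^ n"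
    using assms unfolding poly_growth_def by meson
  have "cmod (p \<zeta> * q \<zeta>) \<le> (c * d) * (1 + norm \<zeta>) ^ (m + n)" for \<zeta>
  proof -
    have "cmod (p \<zeta>) * cmod (q \<zeta>) \<le> (c * (1 + norm \<zeta>) ^ m) * (d * (1 + norm \<zeta>) ^ n)"
      using order_trans[OF norm_ge_zero c] by (intro mult_mono c d) auto
    then show ?thesis by (simp add: norm_mult power_add mult_ac)
  qed
  then show ?thesis using assms unfolding poly_growth_def by (blast intro: continuous_intros)
qed

lemma poly_growth_const: "poly_growth (\<lambda>_. c)"
  unfolding poly_growth_def by (intro conjI exI[of _ "cmod c"] exI[of _ 0]) auto

lemma poly_growth_fst: "poly_growth (\<lambda>\<zeta>. complex_of_real (fst \<zeta>))"
  and poly_growth_snd: "poly_growth (\<lambda>\<zeta>. complex_of_real (snd \<zeta>))"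
proof -
  have 1: "cmod (complex_of_real (fst \<zeta>)) \<le> 1 * (1 + norm \<zeta>) ^ 1"
    and 2: "cmod (complex_of_real (snd \<zeta>)) \<le> 1 * (1 + norm \<zeta>) ^ 1" for \<zeta> :: plane
    using norm_plane_bounds(1,2)[of \<zeta>] by auto
  show "poly_growth (\<lambda>\<zeta>. complex_of_real (fst \<zeta>))"
    unfolding poly_growth_def using 1
    by (intro conjI continuous_intros exI[of _ "1::real"] exI[of _ "1::nat"]) auto
  show "poly_growth (\<lambda>\<zeta>. complex_of_real (snd \<zeta>))"
    unfolding poly_growth_def using 2
    by (intro conjI continuous_intros exI[of _ "1::real"] exI[of _ "1::nat"]) auto
qed

lemma poly_growth_power: "poly_growth p \<Longrightarrow> poly_growth (\<lambda>\<zeta>. p \<zeta> ^ n)"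
  by (induction n) (auto intro: poly_growth_mult poly_growth_const)

lemma poly_growth_add:
  assumes "poly_growth p" "poly_growth q"
  shows "poly_growth (\<lambda>\<zeta>. p \<zeta> + q \<zeta>)"
proof -
  obtain c m d n where c: "\<And>\<zeta>. cmod (p \<zeta>) \<le> c * (1 + norm \<zeta>) ^ m" and d: "\<And>\<zeta>. cmod (q \<zeta>) \<le> d * (1 + norm \<zeta>) ^ n"
    using assms unfolding poly_growth_def by meson
  have up: "e * (1 + norm \<zeta>) ^ k \<le> \<bar>e\<bar> * (1 + norm \<zeta>) ^ (m + n)" if "k \<le> m + n" for e :: real and k and \<zeta> :: plane
    using that by (intro mult_mono power_increasing) auto
  have "cmod (p \<zeta> + q \<zeta>) \<le> (\<bar>c\<bar> + \<bar>d\<bar>) * (1 + norm \<zeta>) ^ (m + n)" for \<zeta>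
    using norm_triangle_ineq[of "p \<zeta>" "q \<zeta>"] c[of \<zeta>] d[of \<zeta>] up[of m c \<zeta>] up[of n d \<zeta>]
    by (simp add: distrib_right)
  then show ?thesis using assms unfolding poly_growth_def by (blast intro: continuous_intros)
qed

lemma rapid_mult:
  assumes p: "poly_growth p" and W: "rapid T W"
  shows "rapid T (\<lambda>t \<zeta>. p \<zeta> * W t \<zeta>)"
  unfolding rapid_def
proof (intro conjI allI)
  have "continuous_on UNIV p" using p by (simp add: poly_growth_def)
  then have "continuous_on ({0..T} \<times> UNIV) (\<lambda>z. p (snd z))"
    by (rule continuous_on_compose2) (auto intro: continuous_intros)
  then show "continuous_on ({0..T} \<times> UNIV) (\<lambda>(t, \<zeta>). p \<zeta> * W t \<zeta>)"
    using rapidD(1)[OF W] unfolding split_def by (intro continuous_intros)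
  fix n
  obtain c m where c: "\<And>\<zeta>. cmod (p \<zeta>) \<le> c * (1 + norm \<zeta>) ^ m" using p unfolding poly_growth_def by blast
  obtain C where C: "\<And>t \<zeta>. t \<in> {0..T} \<Longrightarrow> (1 + norm \<zeta>) ^ (n + m) * cmod (W t \<zeta>) \<le> C"
    using rapidD(2)[OF W, of "n + m"] by blast
  have "(1 + norm \<zeta>) ^ n * cmod (p \<zeta> * W t \<zeta>) \<le> \<bar>c\<bar> * C" if t: "t \<in> {0..T}" for t \<zeta>
  proof -
    have "(1 + norm \<zeta>) ^ n * cmod (p \<zeta> * W t \<zeta>) = cmod (p \<zeta>) * ((1 + norm \<zeta>) ^ n * cmod (W t \<zeta>))"
      by (simp add: norm_mult mult_ac)
    also have "\<dots> \<le> (c * (1 + norm \<zeta>) ^ m) * ((1 + norm \<zeta>) ^ n * cmod (W t \<zeta>))"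
      by (intro mult_right_mono c) auto
    also have "\<dots> = c * ((1 + norm \<zeta>) ^ (n + m) * cmod (W t \<zeta>))" by (simp add: power_add mult_ac)
    also have "\<dots> \<le> \<bar>c\<bar> * C" by (intro mult_mono C t) auto
    finally show ?thesis .
  qed
  then show "\<exists>C. \<forall>t\<in>{0..T}. \<forall>\<zeta>. (1 + norm \<zeta>) ^ n * cmod (p \<zeta> * W t \<zeta>) \<le> C" by blast
qed

text \<open>From 1 + |\<zeta>| \<le> (1 + |\<mu>|) (1 + |\<zeta> - \<mu>|) the power of the output
  frequency is distributed over the factors. The majorant is uniform in \<zeta>, so it yields
  integrability, joint continuity and decay at once.\<close>

lemma rapid_conv_bounds:
  assumes W: "rapid T W" and X: "rapid T X"
  shows "\<exists>C\<ge>0. \<forall>t\<in>{0..T}. \<forall>\<mu> \<zeta>. (1 + norm \<zeta>) ^ n * cmod (W t \<mu> * X t (\<zeta> - \<mu>)) \<le> C * lorentz2 \<mu>"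
proof -
  obtain C where C: "C \<ge> 0" "\<And>t \<zeta>. t \<in> {0..T} \<Longrightarrow> (1 + norm \<zeta>) ^ n * cmod (W t \<zeta>) \<le> C * lorentz2 \<zeta>"
    using rapid_lorentz2[OF W, of n] by blast
  obtain D where D: "\<And>t \<zeta>. t \<in> {0..T} \<Longrightarrow> (1 + norm \<zeta>) ^ n * cmod (X t \<zeta>) \<le> D"
    using rapidD(2)[OF X, of n] by blast
  have "(1 + norm \<zeta>) ^ n * cmod (W t \<mu> * X t (\<zeta> - \<mu>)) \<le> (C * \<bar>D\<bar>) * lorentz2 \<mu>" if t: "t \<in> {0..T}" for t \<mu> \<zeta>
  proof -
    have "norm \<zeta> \<le> norm \<mu> + norm (\<zeta> - \<mu>)" using norm_triangle_ineq[of \<mu> "\<zeta> - \<mu>"] by simp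
    then have "1 + norm \<zeta> \<le> (1 + norm \<mu>) * (1 + norm (\<zeta> - \<mu>))"
      using mult_nonneg_nonneg[OF norm_ge_zero[of \<mu>] norm_ge_zero[of "\<zeta> - \<mu>"]]
      unfolding distrib_left distrib_right mult_1_left mult_1_right by linarith
    then have "(1 + norm \<zeta>) ^ n \<le> ((1 + norm \<mu>) * (1 + norm (\<zeta> - \<mu>))) ^ n" by (rule power_mono) auto
    then have "(1 + norm \<zeta>) ^ n * cmod (W t \<mu> * X t (\<zeta> - \<mu>))
       \<le> ((1 + norm \<mu>) * (1 + norm (\<zeta> - \<mu>))) ^ n * cmod (W t \<mu> * X t (\<zeta> - \<mu>))"
      by (rule mult_right_mono) auto
    also have "\<dots> = ((1 + norm \<mu>) ^ n * cmod (W t \<mu>)) * ((1 + norm (\<zeta> - \<mu>)) ^ n * cmod (X t (\<zeta> - \<mu>)))"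
      by (simp add: power_mult_distrib norm_mult mult_ac)
    also have "\<dots> \<le> (C * lorentz2 \<mu>) * \<bar>D\<bar>"
      using C(1) lorentz2_pos[of \<mu>] D[OF t, of "\<zeta> - \<mu>"] by (intro mult_mono C(2) t) auto
    finally show ?thesis by (simp add: mult_ac)
  qed
  then show ?thesis using C(1) by (intro exI[of _ "C * \<bar>D\<bar>"]) auto
qed

lemma rapid_conv_integrable:
  assumes W: "rapid T W" and X: "rapid T X" and t: "t \<in> {0..T}"
  shows "integrable lborel (\<lambda>\<mu>. W t \<mu> * X t (\<zeta> - \<mu>))"
proof -
  obtain C where C: "C \<ge> 0" "\<And>t \<mu> \<zeta>. t \<in> {0..T} \<Longrightarrow> (1 + norm \<zeta>) ^ 0 * cmod (W t \<mu> * X t (\<zeta> - \<mu>)) \<le> C * lorentz2 \<mu>"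
    using rapid_conv_bounds[OF W X, of 0] by blast
  note [measurable] = rapid_slices(2)[OF W t] rapid_slices(2)[OF X t]
  have "(\<lambda>\<mu>. W t \<mu> * X t (\<zeta> - \<mu>)) \<in> borel_measurable lborel" by measurable
  then show ?thesis
    by (rule Bochner_Integration.integrable_bound[of _ "\<lambda>\<mu>. C * lorentz2 \<mu>", rotated])
      (use C t integrable_lorentz2 in \<open>auto intro!: AE_I2 simp: abs_mult abs_of_pos[OF lorentz2_pos]\<close>)
qed

lemma rapid_conv:
  assumes W: "rapid T W" and X: "rapid T X"
  shows "rapid T (\<lambda>t. conv (W t) (X t))"
  unfolding rapid_def
proof (intro conjI allI)
  obtain C where C: "\<And>t \<mu> \<zeta>. t \<in> {0..T} \<Longrightarrow> (1 + norm \<zeta>) ^ 0 * cmod (W t \<mu> * X t (\<zeta> - \<mu>)) \<le> C * lorentz2 \<mu>"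
    using rapid_conv_bounds[OF W X, of 0] by blast
  have "continuous_on ({0..T} \<times> UNIV) (\<lambda>p. \<integral>\<mu>. W (fst p) \<mu> * X (fst p) (snd p - \<mu>) \<partial>lborel)"
  proof (rule continuous_on_integral_dominated[where B="\<lambda>\<mu>. C * lorentz2 \<mu>"])
    show "(\<lambda>\<mu>. W (fst p) \<mu> * X (fst p) (snd p - \<mu>)) \<in> borel_measurable lborel" if "p \<in> {0..T} \<times> UNIV" for p
      using borel_measurable_integrable[OF rapid_conv_integrable[OF W X, of "fst p" "snd p"]] that by auto
    show "continuous_on ({0..T} \<times> UNIV) (\<lambda>p. W (fst p) \<mu> * X (fst p) (snd p - \<mu>))" for \<mu>
    proof (intro continuous_intros)
      show "continuous_on ({0..T} \<times> UNIV) (\<lambda>p::real \<times> plane. W (fst p) \<mu>)"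
      proof -
        have "continuous_on ({0..T} \<times> UNIV) (\<lambda>p::real \<times> plane. case (fst p, \<mu>) of (t, \<zeta>) \<Rightarrow> W t \<zeta>)"
          by (rule continuous_on_compose2[OF rapidD(1)[OF W]]) (auto intro!: continuous_intros)
        then show ?thesis by simp
      qed
      show "continuous_on ({0..T} \<times> UNIV) (\<lambda>p::real \<times> plane. X (fst p) (snd p - \<mu>))"
      proof -
        have "continuous_on ({0..T} \<times> UNIV) (\<lambda>p::real \<times> plane. case (fst p, snd p - \<mu>) of (t, \<zeta>) \<Rightarrow> X t \<zeta>)"
          by (rule continuous_on_compose2[OF rapidD(1)[OF X]]) (auto intro!: continuous_intros)
        then show ?thesis by simp
      qed
    qed
    show "norm (W (fst p) \<mu> * X (fst p) (snd p - \<mu>)) \<le> C * lorentz2 \<mu>" if "p \<in> {0..T} \<times> UNIV" for p \<mu>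
      using C[of "fst p" "snd p" \<mu>] that by auto
  qed (use integrable_lorentz2 in auto)
  then show "continuous_on ({0..T} \<times> UNIV) (\<lambda>(t, \<zeta>). conv (W t) (X t) \<zeta>)"
    by (simp add: conv_def split_def)
  fix n
  obtain D where D: "\<And>t \<mu> \<zeta>. t \<in> {0..T} \<Longrightarrow> (1 + norm \<zeta>) ^ n * cmod (W t \<mu> * X t (\<zeta> - \<mu>)) \<le> D * lorentz2 \<mu>"
    using rapid_conv_bounds[OF W X, of n] by blast
  have "(1 + norm \<zeta>) ^ n * cmod (conv (W t) (X t) \<zeta>) \<le> (\<integral>\<mu>. D * lorentz2 \<mu> \<partial>lborel)" if t: "t \<in> {0..T}" for t \<zeta>
  proof -
    have "cmod (\<integral>\<mu>. (1 + norm \<zeta>) ^ n *\<^sub>R (W t \<mu> * X t (\<zeta> - \<mu>)) \<partial>lborel) \<le> (\<integral>\<mu>. D * lorentz2 \<mu> \<partial>lborel)"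
    proof (rule Bochner_Integration.integral_norm_bound_integral)
      show "norm ((1 + norm \<zeta>) ^ n *\<^sub>R (W t \<mu> * X t (\<zeta> - \<mu>))) \<le> D * lorentz2 \<mu>" for \<mu>
        using D[OF t, of \<zeta> \<mu>] unfolding norm_scaleR by (simp add: abs_of_nonneg)
    qed (use rapid_conv_integrable[OF W X t] integrable_lorentz2 in auto)
    then show ?thesis unfolding conv_def by (simp add: norm_scaleR)
  qed
  then show "\<exists>C. \<forall>t\<in>{0..T}. \<forall>\<zeta>. (1 + norm \<zeta>) ^ n * cmod (conv (W t) (X t) \<zeta>) \<le> C" by blast
qed

text \<open>Raise 1 + x \<le> (n + 1) (1 + x/n) \<le> (n + 1) exp(x/n) to the power n.\<close>

lemma power_exp_bound: "x \<ge> 0 \<Longrightarrow> (1 + x) ^ n \<le> real (Suc n) ^ n * exp x"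
proof (cases n)
  case (Suc m)
  assume x: "x \<ge> 0"
  have n: "real n > 0" using Suc by simp
  have "1 + x \<le> real (Suc n) * (1 + x / n)" using n x by (simp add: field_simps)
  also have "\<dots> \<le> real (Suc n) * exp (x / n)" by (intro mult_left_mono exp_ge_add_one_self) auto
  finally have "(1 + x) ^ n \<le> (real (Suc n) * exp (x / n)) ^ n" using x by (intro power_mono) auto
  also have "\<dots> = real (Suc n) ^ n * exp x"
    using n by (simp add: power_mult_distrib exp_of_nat_mult[symmetric])
  finally show ?thesis .
qed simp

lemma rapid_controlled:
  assumes V: "controlled T V A" and T: "T > 0"
  shows "rapid T V"
  unfolding rapid_def
proof (intro conjI allI)
  show "continuous_on ({0..T} \<times> UNIV) (\<lambda>(t, \<zeta>). V t \<zeta>)"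
    using controlledD(1)[OF V] by (rule continuous_on_subset) auto
  fix n
  have "(1 + norm \<zeta>) ^ n * cmod (V t \<zeta>) \<le> real (Suc n) ^ n * A" for t \<zeta>
  proof -
    have "cmod (V t \<zeta>) \<le> A * (exp (- l1_norm \<zeta>) * lorentz2 \<zeta>)"
      using order_trans[OF controlledD(2)[OF V] mult_left_mono[OF evol_weight_le_end[OF T] controlledD(3)[OF V]]] .
    also have "\<dots> \<le> A * (exp (- norm \<zeta>) * 1)"
      using norm_plane_bounds(3)[of \<zeta>] lorentz2_pos[of \<zeta>] lorentz2_le_1[of \<zeta>] controlledD(3)[OF V]
      by (intro mult_left_mono mult_mono) auto
    finally have "(1 + norm \<zeta>) ^ n * cmod (V t \<zeta>) \<le> (real (Suc n) ^ n * exp (norm \<zeta>)) * (A * (exp (- norm \<zeta>) * 1))"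
      by (intro mult_mono power_exp_bound) auto
    also have "\<dots> = real (Suc n) ^ n * A" by (simp add: mult_ac exp_minus)
    finally show ?thesis .
  qed
  then show "\<exists>C. \<forall>t\<in>{0..T}. \<forall>\<zeta>. (1 + norm \<zeta>) ^ n * cmod (V t \<zeta>) \<le> C" by blast
qed

section \<open>Differentiation in time\<close>

definition time_deriv :: "real \<Rightarrow> (real \<Rightarrow> plane \<Rightarrow> complex) \<Rightarrow> (real \<Rightarrow> plane \<Rightarrow> complex) \<Rightarrow> bool" where
  "time_deriv T W W' \<longleftrightarrow>
     (\<forall>t\<in>{0..T}. \<forall>\<zeta>. ((\<lambda>t. W t \<zeta>) has_vector_derivative W' t \<zeta>) (at t within {0..T}))"

text \<open>Differentiability of finite order, with all derivatives rapidly decaying. Finite orders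
  allow a bootstrap: the equation expresses a derivative of one order through terms differentiable
  to the order below.\<close>

primrec time_diff :: "real \<Rightarrow> nat \<Rightarrow> (real \<Rightarrow> plane \<Rightarrow> complex) \<Rightarrow> bool" where
  "time_diff T 0 W = rapid T W"
| "time_diff T (Suc n) W = (rapid T W \<and> (\<exists>W'. time_deriv T W W' \<and> time_diff T n W'))"

lemma time_diff_rapid: "time_diff T n W \<Longrightarrow> rapid T W"
  by (cases n) auto

lemma time_diff_Suc: "time_diff T (Suc n) W \<Longrightarrow> time_diff T n W"
  by (induction n arbitrary: W) (auto intro: time_diff_rapid)

lemma time_deriv_cong:
  assumes W: "time_deriv T W W'" and eq: "\<And>t \<zeta>. t \<in> {0..T} \<Longrightarrow> X t \<zeta> = W t \<zeta>"
  shows "time_deriv T X W'"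
  unfolding time_deriv_def
proof (intro ballI allI)
  fix t \<zeta> assume t: "t \<in> {0..T}"
  show "((\<lambda>t. X t \<zeta>) has_vector_derivative W' t \<zeta>) (at t within {0..T})"
    by (rule has_vector_derivative_transform[OF t, of _ "\<lambda>t. W t \<zeta>"]) (use W t eq in \<open>auto simp: time_deriv_def\<close>)
qed

lemma time_diff_cong:
  assumes "time_diff T n W" and "\<And>t \<zeta>. t \<in> {0..T} \<Longrightarrow> X t \<zeta> = W t \<zeta>"
  shows "time_diff T n X"
proof (cases n)
  case 0
  then show ?thesis using assms rapid_cong[of T W X] by simp
next
  case (Suc m)
  then obtain W' where W': "rapid T W" "time_deriv T W W'" "time_diff T m W'" using assms(1) by auto
  have "rapid T X" by (rule rapid_cong[OF W'(1) assms(2)])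
  moreover have "time_deriv T X W'" by (rule time_deriv_cong[OF W'(2) assms(2)])
  ultimately show ?thesis using W'(3) Suc by auto
qed

lemma time_diff_add: "time_diff T n W \<Longrightarrow> time_diff T n X \<Longrightarrow> time_diff T n (\<lambda>t \<zeta>. W t \<zeta> + X t \<zeta>)"
proof (induction n arbitrary: W X)
  case (Suc n)
  obtain W' X' where "time_deriv T W W'" "time_diff T n W'" "time_deriv T X X'" "time_diff T n X'"
    using Suc.prems by auto
  moreover from this have "time_deriv T (\<lambda>t \<zeta>. W t \<zeta> + X t \<zeta>) (\<lambda>t \<zeta>. W' t \<zeta> + X' t \<zeta>)"
    by (auto simp: time_deriv_def intro: has_vector_derivative_add)
  ultimately show ?case using Suc.IH Suc.prems by (auto intro!: rapid_add)
qed (auto intro: rapid_add)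

lemma time_diff_mult: "poly_growth p \<Longrightarrow> time_diff T n W \<Longrightarrow> time_diff T n (\<lambda>t \<zeta>. p \<zeta> * W t \<zeta>)"
proof (induction n arbitrary: W)
  case (Suc n)
  obtain W' where W': "time_deriv T W W'" "time_diff T n W'"
    using Suc.prems by auto
  have "time_deriv T (\<lambda>t \<zeta>. p \<zeta> * W t \<zeta>) (\<lambda>t \<zeta>. p \<zeta> * W' t \<zeta>)"
    using W'(1) by (auto simp: time_deriv_def intro: has_vector_derivative_mult_right)
  then show ?case using Suc.IH[OF Suc.prems(1) W'(2)] Suc.prems by (auto intro!: rapid_mult)
qed (auto intro: rapid_mult)

lemma time_deriv_conv:
  assumes W: "rapid T W" and W'r: "rapid T W'" and W': "time_deriv T W W'"
    and X: "rapid T X" and X'r: "rapid T X'" and X': "time_deriv T X X'"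
  shows "time_deriv T (\<lambda>t. conv (W t) (X t)) (\<lambda>t \<zeta>. conv (W t) (X' t) \<zeta> + conv (W' t) (X t) \<zeta>)"
  unfolding time_deriv_def
proof (intro ballI allI)
  fix t \<zeta> assume t: "t \<in> {0..T}"
  obtain C where C: "\<And>t \<mu> \<zeta>. t \<in> {0..T} \<Longrightarrow> (1 + norm \<zeta>) ^ 0 * cmod (W t \<mu> * X' t (\<zeta> - \<mu>)) \<le> C * lorentz2 \<mu>"
    using rapid_conv_bounds[OF W X'r, of 0] by blast
  obtain D where D: "\<And>t \<mu> \<zeta>. t \<in> {0..T} \<Longrightarrow> (1 + norm \<zeta>) ^ 0 * cmod (W' t \<mu> * X t (\<zeta> - \<mu>)) \<le> D * lorentz2 \<mu>"
    using rapid_conv_bounds[OF W'r X, of 0] by blast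
  let ?F' = "\<lambda>t \<mu>. W t \<mu> * X' t (\<zeta> - \<mu>) + W' t \<mu> * X t (\<zeta> - \<mu>)"
  note i1 = rapid_conv_integrable[OF W X'r t, of \<zeta>] and i2 = rapid_conv_integrable[OF W'r X t, of \<zeta>]
  have "((\<lambda>t. \<integral>\<mu>. W t \<mu> * X t (\<zeta> - \<mu>) \<partial>lborel) has_vector_derivative (\<integral>\<mu>. ?F' t \<mu> \<partial>lborel)) (at t within {0..T})"
  proof (rule has_vector_derivative_integral_dominated[where B="\<lambda>\<mu>. (C + D) * lorentz2 \<mu>"])
    show "?F' t \<in> borel_measurable lborel"
      using borel_measurable_integrable[OF Bochner_Integration.integrable_add[OF i1 i2]] .
    show "((\<lambda>t. W t \<mu> * X t (\<zeta> - \<mu>)) has_vector_derivative ?F' s \<mu>) (at s within {0..T})" if "s \<in> {0..T}" for s \<mu>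
      using that W' X' by (intro has_vector_derivative_mult) (auto simp: time_deriv_def)
    show "norm (?F' s \<mu>) \<le> (C + D) * lorentz2 \<mu>" if "s \<in> {0..T}" for s \<mu>
      using norm_triangle_ineq[of "W s \<mu> * X' s (\<zeta> - \<mu>)" "W' s \<mu> * X s (\<zeta> - \<mu>)"]
        C[OF that, of \<zeta> \<mu>] D[OF that, of \<zeta> \<mu>] by (simp add: distrib_right)
  qed (use t rapid_conv_integrable[OF W X] integrable_lorentz2 in auto)
  then show "((\<lambda>t. conv (W t) (X t) \<zeta>) has_vector_derivative (conv (W t) (X' t) \<zeta> + conv (W' t) (X t) \<zeta>)) (at t within {0..T})"
    using i1 i2 by (simp add: conv_def)
qed

lemma time_diff_conv: "time_diff T n W \<Longrightarrow> time_diff T n X \<Longrightarrow> time_diff T n (\<lambda>t. conv (W t) (X t))"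
proof (induction n arbitrary: W X)
  case (Suc n)
  obtain W' X' where *: "time_deriv T W W'" "time_diff T n W'" "time_deriv T X X'" "time_diff T n X'"
    using Suc.prems by auto
  have "time_deriv T (\<lambda>t. conv (W t) (X t)) (\<lambda>t \<zeta>. conv (W t) (X' t) \<zeta> + conv (W' t) (X t) \<zeta>)"
    using * Suc.prems by (intro time_deriv_conv) (auto intro: time_diff_rapid)
  moreover have "time_diff T n (\<lambda>t \<zeta>. conv (W t) (X' t) \<zeta> + conv (W' t) (X t) \<zeta>)"
    using Suc.prems * by (intro time_diff_add Suc.IH) (auto intro: time_diff_Suc simp del: time_diff.simps)
  ultimately show ?case using Suc.prems by (auto intro!: rapid_conv)
qed (auto intro: rapid_conv)

lemma time_deriv_unique:
  assumes T: "T > 0" and "time_deriv T W W'" "time_deriv T W W''" "t \<in> {0..T}"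
  shows "W' t \<zeta> = W'' t \<zeta>"
proof (rule vector_derivative_unique_within[where f="\<lambda>t. W t \<zeta>" and x=t and S="{0..T}"])
  show "at t within {0..T} \<noteq> bot"
    using T assms(4) by (simp add: trivial_limit_within islimpt_Icc)
qed (use assms in \<open>auto simp: time_deriv_def\<close>)

text \<open>\<open>time_diff\<close> may offer a different derivative for each order, but on a
  nondegenerate interval derivatives are unique, also at the end points, so one of them serves all
  orders.\<close>

lemma time_diff_all_step:
  assumes T: "T > 0" and W: "\<forall>n. time_diff T n W"
  shows "\<exists>W'. time_deriv T W W' \<and> (\<forall>n. time_diff T n W')"
proof -
  obtain W' where W': "time_deriv T W W'" using W[rule_format, of 1] by auto
  have "time_diff T n W'" for n
  proof -
    obtain W'' where "time_deriv T W W''" "time_diff T n W''" using W[rule_format, of "Suc n"] by auto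
    then show ?thesis using time_deriv_unique[OF T W'] by (auto intro: time_diff_cong)
  qed
  with W' show ?thesis by blast
qed

lemma time_diff_all_sequence:
  assumes T: "T > 0" and W: "\<forall>n. time_diff T n W"
  shows "\<exists>D. D 0 = W \<and> (\<forall>i. rapid T (D i) \<and> time_deriv T (D i) (D (Suc i)))"
proof -
  define D where "D = rec_nat W (\<lambda>_ X. SOME Y. time_deriv T X Y \<and> (\<forall>n. time_diff T n Y))"
  have step: "time_deriv T (D i) (D (Suc i)) \<and> (\<forall>n. time_diff T n (D (Suc i)))"
    if "\<forall>n. time_diff T n (D i)" for i
    using someI_ex[OF time_diff_all_step[OF T that]] by (simp add: D_def)
  have all: "\<forall>n. time_diff T n (D i)" for i
  proof (induction i)
    case 0
    show ?case using W by (simp add: D_def)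
  qed (use step in blast)
  have "rapid T (D i)" for i using all[of i, rule_format, of 0] by simp
  then show ?thesis using step all by (intro exI[of _ D]) (auto simp: D_def)
qed

section \<open>Smooth solutions from rapidly decaying spectra\<close>

lemma rapid_lorentz2_0:
  assumes "rapid T W"
  shows "\<exists>C\<ge>0. \<forall>t\<in>{0..T}. \<forall>\<zeta>. cmod (W t \<zeta>) \<le> C * lorentz2 \<zeta>"
  using rapid_lorentz2[OF assms, of 0] by simp

lemma inv_fourier_linear:
  assumes "integrable lborel f" "integrable lborel g"
  shows "inv_fourier (\<lambda>\<zeta>. f \<zeta> + g \<zeta>) z = inv_fourier f z + inv_fourier g z"
  unfolding inv_fourier_def
  using integrable_iexp_mult[OF assms(1), of z] integrable_iexp_mult[OF assms(2), of z]
  by (simp add: distrib_left)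

lemma inv_fourier_cmult: "inv_fourier (\<lambda>\<zeta>. c * f \<zeta>) z = c * inv_fourier f z"
proof -
  have "(\<integral>\<zeta>. iexp (z \<bullet> \<zeta>) * (c * f \<zeta>) \<partial>lborel) = (\<integral>\<zeta>. c * (iexp (z \<bullet> \<zeta>) * f \<zeta>) \<partial>lborel)"
    by (simp only: mult.left_commute)
  then show ?thesis unfolding inv_fourier_def by simp
qed

lemma inv_fourier_joint_continuous:
  assumes W: "rapid T W"
  shows "continuous_on ({0..T} \<times> UNIV) (\<lambda>(t, z). inv_fourier (W t) z)"
proof -
  obtain C where C: "\<And>t \<zeta>. t \<in> {0..T} \<Longrightarrow> cmod (W t \<zeta>) \<le> C * lorentz2 \<zeta>" using rapid_lorentz2_0[OF W] by blast
  have "continuous_on ({0..T} \<times> UNIV) (\<lambda>p. \<integral>\<zeta>. iexp (snd p \<bullet> \<zeta>) * W (fst p) \<zeta> \<partial>lborel)"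
  proof (rule continuous_on_integral_dominated[where B="\<lambda>\<zeta>. C * lorentz2 \<zeta>"])
    show "(\<lambda>\<zeta>. iexp (snd p \<bullet> \<zeta>) * W (fst p) \<zeta>) \<in> borel_measurable lborel" if "p \<in> {0..T} \<times> UNIV" for p
      using that by (intro borel_measurable_integrable integrable_iexp_mult rapid_integrable[OF W]) auto
    show "continuous_on ({0..T} \<times> UNIV) (\<lambda>p. iexp (snd p \<bullet> \<zeta>) * W (fst p) \<zeta>)" for \<zeta>
      by (intro continuous_intros continuous_on_compose2[OF rapid_slices(3)[OF W]]) auto
    show "norm (iexp (snd p \<bullet> \<zeta>) * W (fst p) \<zeta>) \<le> C * lorentz2 \<zeta>" if "p \<in> {0..T} \<times> UNIV" for p \<zeta>
      unfolding norm_iexp_mult using that by (intro C) auto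
  qed (use integrable_lorentz2 in auto)
  then show ?thesis unfolding inv_fourier_def split_def by (intro continuous_intros)
qed

definition ixi :: "plane \<Rightarrow> complex" where "ixi \<zeta> = \<i> * complex_of_real (fst \<zeta>)"
definition ieta :: "plane \<Rightarrow> complex" where "ieta \<zeta> = \<i> * complex_of_real (snd \<zeta>)"

lemma poly_growth_ixi: "poly_growth ixi" and poly_growth_ieta: "poly_growth ieta"
  unfolding ixi_def[abs_def] ieta_def[abs_def]
  by (intro poly_growth_mult poly_growth_const poly_growth_fst poly_growth_snd)+

lemma inv_fourier_deriv_t:
  assumes W: "rapid T W" and W': "rapid T W'" and d: "time_deriv T W W'" and t: "t \<in> {0..T}"
  shows "((\<lambda>t. inv_fourier (W t) z) has_vector_derivative inv_fourier (W' t) z) (at t within {0..T})"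
  unfolding inv_fourier_def
proof (intro has_vector_derivative_mult_right)
  obtain C where C: "\<And>t \<zeta>. t \<in> {0..T} \<Longrightarrow> cmod (W' t \<zeta>) \<le> C * lorentz2 \<zeta>" using rapid_lorentz2_0[OF W'] by blast
  show "((\<lambda>t. \<integral>\<zeta>. iexp (z \<bullet> \<zeta>) * W t \<zeta> \<partial>lborel) has_vector_derivative (\<integral>\<zeta>. iexp (z \<bullet> \<zeta>) * W' t \<zeta> \<partial>lborel)) (at t within {0..T})"
  proof (rule has_vector_derivative_integral_dominated[where B="\<lambda>\<zeta>. C * lorentz2 \<zeta>"])
    show "integrable lborel (\<lambda>\<zeta>. iexp (z \<bullet> \<zeta>) * W s \<zeta>)" if "s \<in> {0..T}" for s
      by (rule integrable_iexp_mult[OF rapid_integrable[OF W that]])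
    show "(\<lambda>\<zeta>. iexp (z \<bullet> \<zeta>) * W' t \<zeta>) \<in> borel_measurable lborel"
      by (rule borel_measurable_integrable[OF integrable_iexp_mult[OF rapid_integrable[OF W' t]]])
    show "((\<lambda>s. iexp (z \<bullet> \<zeta>) * W s \<zeta>) has_vector_derivative iexp (z \<bullet> \<zeta>) * W' s \<zeta>) (at s within {0..T})"
      if "s \<in> {0..T}" for s \<zeta>
      using d that by (intro has_vector_derivative_mult_right) (auto simp: time_deriv_def)
    show "norm (iexp (z \<bullet> \<zeta>) * W' s \<zeta>) \<le> C * lorentz2 \<zeta>" if "s \<in> {0..T}" for s \<zeta>
      unfolding norm_iexp_mult by (rule C[OF that])
  qed (use t integrable_lorentz2 in auto)
qed

lemma inv_fourier_deriv_xy: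
  assumes W: "rapid T W" and t: "t \<in> {0..T}"
  shows "((\<lambda>x. inv_fourier (W t) (x, y)) has_vector_derivative inv_fourier (\<lambda>\<zeta>. ixi \<zeta> * W t \<zeta>) (x, y)) (at x)"
    and "((\<lambda>y. inv_fourier (W t) (x, y)) has_vector_derivative inv_fourier (\<lambda>\<zeta>. ieta \<zeta> * W t \<zeta>) (x, y)) (at y)"
proof -
  note xW = rapid_mult[OF poly_growth_ixi W] and yW = rapid_mult[OF poly_growth_ieta W]
  obtain C where C: "\<And>t \<zeta>. t \<in> {0..T} \<Longrightarrow> cmod (ixi \<zeta> * W t \<zeta>) \<le> C * lorentz2 \<zeta>" using rapid_lorentz2_0[OF xW] by blast
  obtain D where D: "\<And>t \<zeta>. t \<in> {0..T} \<Longrightarrow> cmod (ieta \<zeta> * W t \<zeta>) \<le> D * lorentz2 \<zeta>" using rapid_lorentz2_0[OF yW] by blast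
  have ex: "((\<lambda>x. iexp ((x, y) \<bullet> \<zeta>)) has_vector_derivative ixi \<zeta> * iexp ((s, y) \<bullet> \<zeta>)) (at s within UNIV)" for s y \<zeta>
  proof -
    have "((\<lambda>r. iexp (r * fst \<zeta>) * iexp (y * snd \<zeta>)) has_vector_derivative
        (\<i> * complex_of_real (fst \<zeta>) * iexp (s * fst \<zeta>)) * iexp (y * snd \<zeta>)) (at s within UNIV)"
      by (intro has_vector_derivative_mult_left has_vector_derivative_iexp_mult)
    then show ?thesis by (simp only: inner_prod_def fst_conv snd_conv inner_real_def iexp_add ixi_def mult.assoc)
  qed
  have ey: "((\<lambda>y. iexp ((x, y) \<bullet> \<zeta>)) has_vector_derivative ieta \<zeta> * iexp ((x, s) \<bullet> \<zeta>)) (at s within UNIV)" for s x \<zeta>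
  proof -
    have "((\<lambda>r. iexp (x * fst \<zeta>) * iexp (r * snd \<zeta>)) has_vector_derivative
        iexp (x * fst \<zeta>) * (\<i> * complex_of_real (snd \<zeta>) * iexp (s * snd \<zeta>))) (at s within UNIV)"
      by (intro has_vector_derivative_mult_right has_vector_derivative_iexp_mult)
    then show ?thesis
      by (simp only: inner_prod_def fst_conv snd_conv inner_real_def iexp_add ieta_def mult.assoc mult.left_commute)
  qed
  show "((\<lambda>x. inv_fourier (W t) (x, y)) has_vector_derivative inv_fourier (\<lambda>\<zeta>. ixi \<zeta> * W t \<zeta>) (x, y)) (at x)"
    unfolding inv_fourier_def
  proof (intro has_vector_derivative_mult_right)
    show "((\<lambda>x. \<integral>\<zeta>. iexp ((x, y) \<bullet> \<zeta>) * W t \<zeta> \<partial>lborel) has_vector_derivative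
        (\<integral>\<zeta>. iexp ((x, y) \<bullet> \<zeta>) * (ixi \<zeta> * W t \<zeta>) \<partial>lborel)) (at x)"
    proof (rule has_vector_derivative_integral_dominated[where B="\<lambda>\<zeta>. C * lorentz2 \<zeta>" and S=UNIV])
      show "integrable lborel (\<lambda>\<zeta>. iexp ((s, y) \<bullet> \<zeta>) * W t \<zeta>)" for s
        by (rule integrable_iexp_mult[OF rapid_integrable[OF W t]])
      show "(\<lambda>\<zeta>. iexp ((x, y) \<bullet> \<zeta>) * (ixi \<zeta> * W t \<zeta>)) \<in> borel_measurable lborel"
        by (rule borel_measurable_integrable[OF integrable_iexp_mult[OF rapid_integrable[OF xW t]]])
      show "((\<lambda>s. iexp ((s, y) \<bullet> \<zeta>) * W t \<zeta>) has_vector_derivative iexp ((s, y) \<bullet> \<zeta>) * (ixi \<zeta> * W t \<zeta>)) (at s within UNIV)" for s \<zeta>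
        using has_vector_derivative_mult_left[OF ex[of y \<zeta> s], of "W t \<zeta>"] by (simp only: mult_ac)
      show "norm (iexp ((s, y) \<bullet> \<zeta>) * (ixi \<zeta> * W t \<zeta>)) \<le> C * lorentz2 \<zeta>" for s \<zeta>
        unfolding norm_iexp_mult by (rule C[OF t])
    qed (use integrable_lorentz2 in auto)
  qed
  show "((\<lambda>y. inv_fourier (W t) (x, y)) has_vector_derivative inv_fourier (\<lambda>\<zeta>. ieta \<zeta> * W t \<zeta>) (x, y)) (at y)"
    unfolding inv_fourier_def
  proof (intro has_vector_derivative_mult_right)
    show "((\<lambda>y. \<integral>\<zeta>. iexp ((x, y) \<bullet> \<zeta>) * W t \<zeta> \<partial>lborel) has_vector_derivative
        (\<integral>\<zeta>. iexp ((x, y) \<bullet> \<zeta>) * (ieta \<zeta> * W t \<zeta>) \<partial>lborel)) (at y)"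
    proof (rule has_vector_derivative_integral_dominated[where B="\<lambda>\<zeta>. D * lorentz2 \<zeta>" and S=UNIV])
      show "integrable lborel (\<lambda>\<zeta>. iexp ((x, s) \<bullet> \<zeta>) * W t \<zeta>)" for s
        by (rule integrable_iexp_mult[OF rapid_integrable[OF W t]])
      show "(\<lambda>\<zeta>. iexp ((x, y) \<bullet> \<zeta>) * (ieta \<zeta> * W t \<zeta>)) \<in> borel_measurable lborel"
        by (rule borel_measurable_integrable[OF integrable_iexp_mult[OF rapid_integrable[OF yW t]]])
      show "((\<lambda>s. iexp ((x, s) \<bullet> \<zeta>) * W t \<zeta>) has_vector_derivative iexp ((x, s) \<bullet> \<zeta>) * (ieta \<zeta> * W t \<zeta>)) (at s within UNIV)" for s \<zeta>
        using has_vector_derivative_mult_left[OF ey[of x \<zeta> s], of "W t \<zeta>"] by (simp only: mult_ac)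
      show "norm (iexp ((x, s) \<bullet> \<zeta>) * (ieta \<zeta> * W t \<zeta>)) \<le> D * lorentz2 \<zeta>" for s \<zeta>
        unfolding norm_iexp_mult by (rule D[OF t])
    qed (use integrable_lorentz2 in auto)
  qed
qed

lemma dx_inv_fourier:
  assumes "rapid T W" "t \<in> {0..T}"
  shows "dx (inv_fourier (W t)) = inv_fourier (\<lambda>\<zeta>. ixi \<zeta> * W t \<zeta>)"
    and "dy (inv_fourier (W t)) = inv_fourier (\<lambda>\<zeta>. ieta \<zeta> * W t \<zeta>)"
  using inv_fourier_deriv_xy[OF assms] by (auto simp: dx_def dy_def fun_eq_iff intro!: vector_derivative_at)

text \<open>The derivative of order (i, j, k) is the inverse transform of (i\<xi>)^j (i\<eta>)^k
  times the i-th time derivative of the spectrum; all these spectra are rapidly decaying.\<close>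

lemma smooth_slab_inv_fourier:
  assumes T: "T > 0" and V: "\<forall>n. time_diff T n V"
  shows "smooth_slab T (\<lambda>t. inv_fourier (V t))"
proof -
  obtain E where E: "E 0 = V" "\<And>i. rapid T (E i)" "\<And>i. time_deriv T (E i) (E (Suc i))"
    using time_diff_all_sequence[OF T V] by blast
  define G where "G = (\<lambda>i j k t \<zeta>. (ixi \<zeta> ^ j * ieta \<zeta> ^ k) * E i t \<zeta>)"
  have pg: "poly_growth (\<lambda>\<zeta>. ixi \<zeta> ^ j * ieta \<zeta> ^ k)" for j k
    by (intro poly_growth_mult poly_growth_power poly_growth_ixi poly_growth_ieta)
  have G: "rapid T (G i j k)" for i j k unfolding G_def by (rule rapid_mult[OF pg E(2)])
  have Gt: "time_deriv T (G i j k) (G (Suc i) j k)" for i j k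
    using E(3)[of i] unfolding G_def time_deriv_def by (auto intro: has_vector_derivative_mult_right)
  have Gx: "(\<lambda>\<zeta>. ixi \<zeta> * G i j k t \<zeta>) = G i (Suc j) k t" and Gy: "(\<lambda>\<zeta>. ieta \<zeta> * G i j k t \<zeta>) = G i j (Suc k) t" for i j k t
    by (auto simp: G_def mult_ac)
  show ?thesis
    unfolding smooth_slab_def
  proof (intro exI[of _ "\<lambda>i j k t. inv_fourier (G i j k t)"] conjI allI ballI)
    show "inv_fourier (G 0 0 0 t) = inv_fourier (V t)" for t by (simp add: G_def E(1))
    show "continuous_on ({0..T} \<times> UNIV) (\<lambda>(t, z). inv_fourier (G i j k t) z)" for i j k
      by (rule inv_fourier_joint_continuous[OF G])
    fix i j k t x y assume t: "t \<in> {0..T}"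
    show "((\<lambda>\<tau>. inv_fourier (G i j k \<tau>) (x, y)) has_vector_derivative inv_fourier (G (Suc i) j k t) (x, y)) (at t within {0..T})"
      by (rule inv_fourier_deriv_t[OF G G Gt t])
    show "((\<lambda>x. inv_fourier (G i j k t) (x, y)) has_vector_derivative inv_fourier (G i (Suc j) k t) (x, y)) (at x)"
      using inv_fourier_deriv_xy(1)[OF G t] by (simp only: Gx)
    show "((\<lambda>y. inv_fourier (G i j k t) (x, y)) has_vector_derivative inv_fourier (G i j (Suc k) t) (x, y)) (at y)"
      using inv_fourier_deriv_xy(2)[OF G t] by (simp only: Gy)
  qed
qed

lemma inv_fourier_cube:
  assumes f: "integrable lborel f"
  shows "inv_fourier f z ^ 3 = complex_of_real (1 / (2 * pi)\<^sup>2) * inv_fourier (cube f) z"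
proof -
  have "inv_fourier f z ^ 3 = inv_fourier f z * (inv_fourier f z * inv_fourier f z)" by (simp add: power3_eq_cube)
  also have "\<dots> = complex_of_real (1 / (2 * pi)) * (inv_fourier f z * inv_fourier (conv f f) z)"
    by (simp add: inv_fourier_mult[OF f f])
  also have "\<dots> = complex_of_real (1 / (2 * pi)\<^sup>2) * inv_fourier (cube f) z"
    by (simp add: inv_fourier_mult[OF f integrable_conv[OF f f]] cube_def power2_eq_square)
  finally show ?thesis .
qed

lemma inv_fourier_real:
  assumes "hermitian f" "f \<in> borel_measurable borel"
  shows "inv_fourier f z \<in> \<real>"
proof -
  note [measurable] = assms(2)
  have "(\<integral>\<zeta>. iexp (z \<bullet> \<zeta>) * f \<zeta> \<partial>lborel) = (\<integral>\<zeta>. iexp (z \<bullet> (0 - \<zeta>)) * f (0 - \<zeta>) \<partial>lborel)"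
    by (rule lborel_integral_reflect[symmetric]) measurable
  also have "\<dots> = (\<integral>\<zeta>. cnj (iexp (z \<bullet> \<zeta>) * f \<zeta>) \<partial>lborel)"
    using assms(1) by (simp add: hermitian_def exp_cnj)
  also have "\<dots> = cnj (\<integral>\<zeta>. iexp (z \<bullet> \<zeta>) * f \<zeta> \<partial>lborel)" by (rule Bochner_Integration.integral_cnj)
  finally have "(\<integral>\<zeta>. iexp (z \<bullet> \<zeta>) * f \<zeta> \<partial>lborel) \<in> \<real>" by (simp add: Reals_cnj_iff)
  then show ?thesis unfolding inv_fourier_def by (intro Reals_mult) auto
qed

lemma has_fourier_rapid:
  assumes W: "rapid T W" and t: "t \<in> {0..T}"
  shows "has_fourier (inv_fourier (W t)) (W t)"
proof -
  obtain C where C: "C \<ge> 0" "\<And>t \<zeta>. t \<in> {0..T} \<Longrightarrow> cmod (W t \<zeta>) \<le> C * lorentz2 \<zeta>" using rapid_lorentz2_0[OF W] by blast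
  have "cmod (W t \<zeta>) \<le> C" for \<zeta> using C(2)[OF t, of \<zeta>] mult_left_mono[OF lorentz2_le_1 C(1), of \<zeta>] by simp
  moreover have "isCont (W t) \<zeta>" for \<zeta>
    using rapid_slices(1)[OF W t] continuous_on_eq_continuous_at[OF open_UNIV, of "W t"] by blast
  ultimately show ?thesis by (intro has_fourier_inv_fourier rapid_integrable[OF W t]) auto
qed

lemma sob_weight_le: "sob_weight (\<lambda>_. 1) (real k) \<zeta> \<le> (1 + norm \<zeta>) ^ k"
proof -
  have "1 + (norm \<zeta>)\<^sup>2 \<le> (1 + norm \<zeta>)\<^sup>2" by (simp add: power2_sum)
  then have "(1 + (norm \<zeta>)\<^sup>2) powr (real k / 2) \<le> ((1 + norm \<zeta>)\<^sup>2) powr (real k / 2)"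
    by (intro powr_mono2) auto
  also have "\<dots> = ((1 + norm \<zeta>) powr 2) powr (real k / 2)"
    by (subst powr_numeral) (auto intro: add_nonneg_nonneg)
  also have "\<dots> = (1 + norm \<zeta>) powr real k" unfolding powr_powr by simp
  also have "\<dots> = (1 + norm \<zeta>) ^ k" using norm_ge_zero[of \<zeta>] by (intro powr_realpow) linarith
  finally show ?thesis by (simp add: sob_weight_def)
qed

lemma sob_weight_nonneg: "(\<And>\<zeta>. 0 \<le> m \<zeta>) \<Longrightarrow> 0 \<le> sob_weight m s \<zeta>"
  by (simp add: sob_weight_def)

text \<open>Distances are computed on the spectral side, where the square of the weighted difference
  is dominated, uniformly in time, by a multiple of \<open>lorentz2\<close>; continuity in time is
  dominated convergence.\<close>

lemma rapid_Hk:
  assumes W: "rapid T W" and h: "\<And>t. t \<in> {0..T} \<Longrightarrow> hermitian (W t)" and K: "\<real> \<subseteq> K"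
  shows "(\<lambda>t. inv_fourier (W t)) \<in> fst (C_space T (Hk K k))"
proof -
  let ?w = "sob_weight (\<lambda>_. 1) (real k)"
  have w0: "0 \<le> ?w \<zeta>" for \<zeta> by (rule sob_weight_nonneg) simp
  have wm[measurable]: "?w \<in> borel_measurable borel" by measurable
  obtain C where C: "C \<ge> 0" "\<And>t \<zeta>. t \<in> {0..T} \<Longrightarrow> (1 + norm \<zeta>) ^ k * cmod (W t \<zeta>) \<le> C * lorentz2 \<zeta>"
    using rapid_lorentz2[OF W, of k] by blast
  have wW: "?w \<zeta> * cmod (W t \<zeta>) \<le> C * lorentz2 \<zeta>" if "t \<in> {0..T}" for t \<zeta>
    using order_trans[OF mult_right_mono[OF sob_weight_le norm_ge_zero] C(2)[OF that, of \<zeta>]] .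
  have sq: "(?w \<zeta> * cmod (W r \<zeta> - W t \<zeta>))\<^sup>2 \<le> 4 * C\<^sup>2 * lorentz2 \<zeta>" if "r \<in> {0..T}" "t \<in> {0..T}" for r t \<zeta>
  proof -
    have "?w \<zeta> * cmod (W r \<zeta> - W t \<zeta>) \<le> ?w \<zeta> * cmod (W r \<zeta>) + ?w \<zeta> * cmod (W t \<zeta>)"
      unfolding distrib_left[symmetric] by (intro mult_left_mono norm_triangle_ineq4 w0)
    also have "\<dots> \<le> 2 * C * lorentz2 \<zeta>" using wW[OF that(1), of \<zeta>] wW[OF that(2), of \<zeta>] by simp
    finally have "(?w \<zeta> * cmod (W r \<zeta> - W t \<zeta>))\<^sup>2 \<le> (2 * C * lorentz2 \<zeta>)\<^sup>2"
      using w0[of \<zeta>] by (intro power_mono) auto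
    also have "\<dots> = 4 * C\<^sup>2 * lorentz2 \<zeta> * lorentz2 \<zeta>" by (simp add: power2_eq_square)
    also have "\<dots> \<le> 4 * C\<^sup>2 * lorentz2 \<zeta> * 1"
      using lorentz2_pos[of \<zeta>] lorentz2_le_1[of \<zeta>] by (intro mult_left_mono) auto
    finally show ?thesis by simp
  qed
  have mem: "inv_fourier (W t) \<in> fst (Hk K k)" if t: "t \<in> {0..T}" for t
  proof -
    note hf = has_fourier_rapid[OF W t]
    note [measurable] = rapid_slices(2)[OF W t]
    have "square_integrable (\<lambda>\<zeta>. complex_of_real (?w \<zeta>) * W t \<zeta>)"
    proof (rule square_integrableI)
      show "integrable lborel (\<lambda>\<zeta>. (cmod (complex_of_real (?w \<zeta>) * W t \<zeta>))\<^sup>2)"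
      proof (rule Bochner_Integration.integrable_bound[of _ "\<lambda>\<zeta>. C\<^sup>2 * lorentz2 \<zeta>"])
        show "AE \<zeta> in lborel. norm ((cmod (complex_of_real (?w \<zeta>) * W t \<zeta>))\<^sup>2) \<le> norm (C\<^sup>2 * lorentz2 \<zeta>)"
        proof (rule AE_I2)
          fix \<zeta>
          have "(?w \<zeta> * cmod (W t \<zeta>))\<^sup>2 \<le> (C * lorentz2 \<zeta>)\<^sup>2"
            using w0[of \<zeta>] wW[OF t, of \<zeta>] by (intro power_mono) auto
          also have "\<dots> = C\<^sup>2 * lorentz2 \<zeta> * lorentz2 \<zeta>" by (simp add: power2_eq_square)
          also have "\<dots> \<le> C\<^sup>2 * lorentz2 \<zeta> * 1"
            using lorentz2_pos[of \<zeta>] lorentz2_le_1[of \<zeta>] by (intro mult_left_mono) auto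
          finally show "norm ((cmod (complex_of_real (?w \<zeta>) * W t \<zeta>))\<^sup>2) \<le> norm (C\<^sup>2 * lorentz2 \<zeta>)"
            using w0[of \<zeta>] lorentz2_pos[of \<zeta>] by (simp add: norm_mult)
        qed
      qed (use integrable_lorentz2 in auto)
    qed measurable
    then have "mult_in_Hs (\<lambda>_. 1) (real k) (inv_fourier (W t))" unfolding mult_in_Hs_iff using hf by blast
    moreover have "inv_fourier (W t) z \<in> K" for z
      using inv_fourier_real[OF h[OF t] rapid_slices(2)[OF W t]] K by blast
    ultimately show ?thesis using has_fourierD(1)[OF hf] by (simp add: Hk_def)
  qed
  have dist: "snd (Hk K k) (inv_fourier (W r) - inv_fourier (W t)) = sqrt (\<integral>\<zeta>. (?w \<zeta> * cmod (W r \<zeta> - W t \<zeta>))\<^sup>2 \<partial>lborel)"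
    if "r \<in> {0..T}" "t \<in> {0..T}" for r t
  proof -
    have "has_fourier (inv_fourier (W r) - inv_fourier (W t)) (\<lambda>\<zeta>. W r \<zeta> - W t \<zeta>)"
      using has_fourier_add[OF has_fourier_rapid[OF W that(1)] has_fourier_cmult[OF has_fourier_rapid[OF W that(2)], of "-1"]]
      by (simp add: fun_diff_def)
    from mult_Hs_norm_eq[OF this, of "\<lambda>_. 1" "real k"] show ?thesis by (simp add: Hk_def)
  qed
  have cont: "continuous_on {0..T} (\<lambda>r. sqrt (\<integral>\<zeta>. (?w \<zeta> * cmod (W r \<zeta> - W t \<zeta>))\<^sup>2 \<partial>lborel))" if t: "t \<in> {0..T}" for t
  proof (intro continuous_on_real_sqrt continuous_on_integral_dominated[where B="\<lambda>\<zeta>. 4 * C\<^sup>2 * lorentz2 \<zeta>"])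
    show "(\<lambda>\<zeta>. (?w \<zeta> * cmod (W r \<zeta> - W t \<zeta>))\<^sup>2) \<in> borel_measurable lborel" if r: "r \<in> {0..T}" for r
    proof -
      note [measurable] = rapid_slices(2)[OF W t] rapid_slices(2)[OF W r]
      show ?thesis by measurable
    qed
    show "continuous_on {0..T} (\<lambda>r. (?w \<zeta> * cmod (W r \<zeta> - W t \<zeta>))\<^sup>2)" for \<zeta>
      by (intro continuous_intros rapid_slices(3)[OF W])
    show "norm ((?w \<zeta> * cmod (W r \<zeta> - W t \<zeta>))\<^sup>2) \<le> 4 * C\<^sup>2 * lorentz2 \<zeta>" if "r \<in> {0..T}" for r \<zeta>
      using sq[OF that t, of \<zeta>] by simp
  qed (use integrable_lorentz2 in auto)
  have "\<exists>d>0. \<forall>r\<in>{0..T}. \<bar>r - t\<bar> < d \<longrightarrow> snd (Hk K k) (inv_fourier (W r) - inv_fourier (W t)) < e"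
    if t: "t \<in> {0..T}" and e: "e > 0" for t e
  proof -
    have z: "sqrt (\<integral>\<zeta>. (?w \<zeta> * cmod (W t \<zeta> - W t \<zeta>))\<^sup>2 \<partial>lborel) = 0" by simp
    obtain d where d: "d > 0" "\<And>r. r \<in> {0..T} \<Longrightarrow> dist r t < d \<Longrightarrow>
        dist (sqrt (\<integral>\<zeta>. (?w \<zeta> * cmod (W r \<zeta> - W t \<zeta>))\<^sup>2 \<partial>lborel)) (sqrt (\<integral>\<zeta>. (?w \<zeta> * cmod (W t \<zeta> - W t \<zeta>))\<^sup>2 \<partial>lborel)) < e"
      using cont[OF t] t e unfolding continuous_on_iff by blast
    have "snd (Hk K k) (inv_fourier (W r) - inv_fourier (W t)) < e" if "r \<in> {0..T}" "\<bar>r - t\<bar> < d" for r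
      using d(2)[OF that(1)] that(2) unfolding dist[OF that(1) t] z by (simp add: dist_real_def)
    with d(1) show ?thesis by blast
  qed
  with mem show ?thesis unfolding C_space_def by simp
qed

text \<open>Differentiating the Duhamel formula turns it into an ordinary differential equation in t
  for each frequency. Its inverse transform is the partial differential equation, all derivatives
  being taken under the integral.\<close>

theorem smooth_solution_inv_fourier:
  assumes T: "T > 0" and V: "controlled T V A" and h: "\<And>t. hermitian (V t)" and K: "\<real> \<subseteq> K"
    and eq: "\<And>t \<zeta>. V t \<zeta> = free_evol T g t \<zeta> + duhamel T (\<lambda>t. cube (V t)) t \<zeta>"
  shows "smooth_solution K T (inv_fourier g) (\<lambda>t. inv_fourier (V t))"
proof -
  have rV: "rapid T V" by (rule rapid_controlled[OF V T])
  have cV: "controlled T (\<lambda>t. cube (V t)) (conv_const * A * (conv_const * A * A))"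
    unfolding cube_def by (rule controlled_conv3[OF T V V V])
  have rc: "rapid T (\<lambda>t. cube (V t))" by (rule rapid_controlled[OF cV T])
  have pnl: "poly_growth nl_symbol"
  proof -
    have "poly_growth (\<lambda>\<zeta>. - (\<i> / complex_of_real ((2 * pi)\<^sup>2)) * (complex_of_real (fst \<zeta>) + complex_of_real (snd \<zeta>)))"
      by (intro poly_growth_mult poly_growth_const poly_growth_add poly_growth_fst poly_growth_snd)
    then show ?thesis by (simp add: nl_symbol_def[abs_def] mult.commute)
  qed
  have pom: "poly_growth (\<lambda>\<zeta>. \<i> * complex_of_real (dispersion \<zeta>))"
    unfolding dispersion_def of_real_add of_real_power
    by (intro poly_growth_mult poly_growth_const poly_growth_add poly_growth_power poly_growth_fst poly_growth_snd)
  define R where "R = (\<lambda>t \<zeta>. \<i> * complex_of_real (dispersion \<zeta>) * V t \<zeta> + nl_symbol \<zeta> * cube (V t) \<zeta>)"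
  have dV: "time_deriv T V R"
    unfolding time_deriv_def
  proof (intro ballI allI)
    fix t \<zeta> assume t: "t \<in> {0..T}"
    have 1: "((\<lambda>t. iexp (t * dispersion \<zeta>) * g \<zeta> + duhamel T (\<lambda>t. cube (V t)) t \<zeta>) has_vector_derivative
      (\<i> * complex_of_real (dispersion \<zeta>) * iexp (t * dispersion \<zeta>) * g \<zeta> + (\<i> * complex_of_real (dispersion \<zeta>) * duhamel T (\<lambda>t. cube (V t)) t \<zeta> + nl_symbol \<zeta> * cube (V t) \<zeta>))) (at t within {0..T})"
      by (intro has_vector_derivative_add has_vector_derivative_mult_left has_vector_derivative_iexp_mult duhamel_derivative[OF cV T t])
    have "\<i> * complex_of_real (dispersion \<zeta>) * iexp (t * dispersion \<zeta>) * g \<zeta> + (\<i> * complex_of_real (dispersion \<zeta>) * duhamel T (\<lambda>t. cube (V t)) t \<zeta> + nl_symbol \<zeta> * cube (V t) \<zeta>) = R t \<zeta>"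
      unfolding R_def eq[of t \<zeta>] free_evol_def clamp_time_id[OF t] by (simp only: distrib_left mult.assoc add.assoc)
    with 1 have 2: "((\<lambda>t. iexp (t * dispersion \<zeta>) * g \<zeta> + duhamel T (\<lambda>t. cube (V t)) t \<zeta>) has_vector_derivative R t \<zeta>) (at t within {0..T})"
      by (simp only:)
    show "((\<lambda>t. V t \<zeta>) has_vector_derivative R t \<zeta>) (at t within {0..T})"
    proof (rule has_vector_derivative_transform[OF t _ 2])
      show "V t \<zeta> = iexp (t * dispersion \<zeta>) * g \<zeta> + duhamel T (\<lambda>t. cube (V t)) t \<zeta>" if "t \<in> {0..T}" for t
        by (subst eq) (simp only: free_evol_def clamp_time_id[OF that])
    qed
  qed
  \<comment> \<open>The bootstrap: if \<open>V\<close> has n time derivatives then so has the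
    right-hand side \<open>R\<close>, whence \<open>V\<close> has n + 1.\<close>
  have tdV: "\<forall>n. time_diff T n V"
  proof
    show "time_diff T n V" for n
    proof (induction n)
      case (Suc n)
      have "time_diff T n R"
        unfolding R_def cube_def by (intro time_diff_add time_diff_mult time_diff_conv pom pnl Suc)
      with dV rV show ?case by auto
    qed (simp add: rV)
  qed
  have rR: "rapid T R" unfolding R_def by (intro rapid_add rapid_mult pom pnl rV rc)
  have V0: "V 0 = g"
  proof
    fix \<zeta>
    have t0: "clamp_time T 0 = 0" using T by (simp add: clamp_time_def)
    \<comment> \<open>At time 0 the interval of integration is a single point.\<close>
    have "(LINT \<tau>|lborel. indicator {0..0} \<tau> *\<^sub>R (iexp (- \<tau> * dispersion \<zeta>) * cube (V \<tau>) \<zeta>)) = (LINT \<tau>::real|lborel. 0)"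
      by (rule integral_cong_AE) (use AE_neq_real[of 0] borel_measurable_integrable[OF duhamel_integrable[OF cV, of 0 \<zeta>]]
        in \<open>auto elim!: eventually_mono\<close>)
    then show "V 0 \<zeta> = g \<zeta>" by (subst eq) (simp add: free_evol_def duhamel_def t0)
  qed
  show ?thesis
    unfolding smooth_solution_def
  proof (intro conjI allI ballI smooth_slab_inv_fourier[OF T tdV] rapid_Hk[OF rV h K])
    show "inv_fourier (V 0) = inv_fourier g" by (simp add: V0)
    fix t z assume t: "t \<in> {0..T}"
    have vt: "vector_derivative (\<lambda>\<tau>. inv_fourier (V \<tau>) z) (at t within {0..T}) = inv_fourier (R t) z"
      using inv_fourier_deriv_t[OF rV rR dV t] T t
      by (intro vector_derivative_within_closed_interval) auto
    note r1 = rapid_mult[OF poly_growth_ixi rV] and r2 = rapid_mult[OF poly_growth_ieta rV]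
    note rr1 = rapid_mult[OF poly_growth_ixi r1] and rr2 = rapid_mult[OF poly_growth_ieta r2]
    note rrr1 = rapid_mult[OF poly_growth_ixi rr1] and rrr2 = rapid_mult[OF poly_growth_ieta rr2]
    have d3: "dx (dx (dx (inv_fourier (V t)))) = inv_fourier (\<lambda>\<zeta>. ixi \<zeta> * (ixi \<zeta> * (ixi \<zeta> * V t \<zeta>)))"
      "dy (dy (dy (inv_fourier (V t)))) = inv_fourier (\<lambda>\<zeta>. ieta \<zeta> * (ieta \<zeta> * (ieta \<zeta> * V t \<zeta>)))"
      by (simp_all only: dx_inv_fourier[OF rV t] dx_inv_fourier[OF r1 t] dx_inv_fourier[OF rr1 t]
          dx_inv_fourier[OF r2 t] dx_inv_fourier[OF rr2 t])
    define c where "c = complex_of_real (1 / (2 * pi)\<^sup>2)"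
    have rcc: "rapid T (\<lambda>t \<zeta>. c * cube (V t) \<zeta>)" by (intro rapid_mult poly_growth_const rc)
    have cub: "(\<lambda>w. inv_fourier (V t) w ^ 3) = inv_fourier (\<lambda>\<zeta>. c * cube (V t) \<zeta>)"
      unfolding inv_fourier_cube[OF rapid_integrable[OF rV t]] inv_fourier_cmult[abs_def] c_def ..
    have nl: "dx (\<lambda>w. inv_fourier (V t) w ^ 3) = inv_fourier (\<lambda>\<zeta>. ixi \<zeta> * (c * cube (V t) \<zeta>))"
      "dy (\<lambda>w. inv_fourier (V t) w ^ 3) = inv_fourier (\<lambda>\<zeta>. ieta \<zeta> * (c * cube (V t) \<zeta>))"
      unfolding cub by (rule dx_inv_fourier[OF rcc t])+
    note q1 = rapid_mult[OF poly_growth_ixi rcc] and q2 = rapid_mult[OF poly_growth_ieta rcc]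
    \<comment> \<open>The equation holds already for the integrands: the linear terms cancel, and
      the factor \<open>c\<close> from \<open>inv_fourier_cube\<close> matches the one in
      \<open>nl_symbol\<close>.\<close>
    have zero: "R t \<zeta> + (ixi \<zeta> * (ixi \<zeta> * (ixi \<zeta> * V t \<zeta>)) + ieta \<zeta> * (ieta \<zeta> * (ieta \<zeta> * V t \<zeta>)))
       + (ixi \<zeta> * (c * cube (V t) \<zeta>) + ieta \<zeta> * (c * cube (V t) \<zeta>)) = 0" for \<zeta>
    proof -
      have a: "nl_symbol \<zeta> = - (ixi \<zeta> + ieta \<zeta>) * c"
      proof -
        have "complex_of_real ((fst \<zeta> + snd \<zeta>) / (2 * pi)\<^sup>2) = (complex_of_real (fst \<zeta>) + complex_of_real (snd \<zeta>)) * c"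
          by (simp add: c_def add_divide_distrib)
        then show ?thesis unfolding nl_symbol_def ixi_def ieta_def by (simp add: algebra_simps)
      qed
      have b: "\<i> * complex_of_real (dispersion \<zeta>) = - (ixi \<zeta> ^ 3 + ieta \<zeta> ^ 3)"
        by (simp add: dispersion_def ixi_def ieta_def power_mult_distrib power3_eq_cube algebra_simps)
      show ?thesis unfolding R_def a b by (simp add: algebra_simps power3_eq_cube)
    qed
    have "inv_fourier (R t) z + (inv_fourier (\<lambda>\<zeta>. ixi \<zeta> * (ixi \<zeta> * (ixi \<zeta> * V t \<zeta>))) z + inv_fourier (\<lambda>\<zeta>. ieta \<zeta> * (ieta \<zeta> * (ieta \<zeta> * V t \<zeta>))) z)
       + (inv_fourier (\<lambda>\<zeta>. ixi \<zeta> * (c * cube (V t) \<zeta>)) z + inv_fourier (\<lambda>\<zeta>. ieta \<zeta> * (c * cube (V t) \<zeta>)) z)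
       = inv_fourier (\<lambda>\<zeta>. R t \<zeta> + (ixi \<zeta> * (ixi \<zeta> * (ixi \<zeta> * V t \<zeta>)) + ieta \<zeta> * (ieta \<zeta> * (ieta \<zeta> * V t \<zeta>)))
       + (ixi \<zeta> * (c * cube (V t) \<zeta>) + ieta \<zeta> * (c * cube (V t) \<zeta>))) z"
      using rapid_integrable[OF rR t] rapid_integrable[OF rrr1 t] rapid_integrable[OF rrr2 t]
        rapid_integrable[OF q1 t] rapid_integrable[OF q2 t]
      by (simp add: inv_fourier_linear)
    also have "\<dots> = 0" unfolding zero by (simp add: inv_fourier_def)
    finally show "vector_derivative (\<lambda>\<tau>. inv_fourier (V \<tau>) z) (at t within {0..T})
        + (dx (dx (dx (inv_fourier (V t)))) z + dy (dy (dy (inv_fourier (V t)))) z)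
        + (dx (\<lambda>w. (inv_fourier (V t) w) ^ 3) z + dy (\<lambda>w. (inv_fourier (V t) w) ^ 3) z) = 0"
      unfolding vt d3 nl .
  qed
qed

section \<open>Test data and test functionals\<close>

section \<open>A smooth bump function\<close>

text \<open>The class C^n of complex functions on the line, defined recursively so that closure
  properties follow by induction on n.\<close>

primrec cdiff :: "nat \<Rightarrow> (real \<Rightarrow> complex) \<Rightarrow> bool" where
  "cdiff 0 p = continuous_on UNIV p"
| "cdiff (Suc n) p = (\<exists>p'. (\<forall>x. (p has_vector_derivative p' x) (at x)) \<and> cdiff n p')"

lemma cdiff_SucI: "(\<And>x. (p has_vector_derivative p' x) (at x)) \<Longrightarrow> cdiff n p' \<Longrightarrow> cdiff (Suc n) p"
  unfolding cdiff.simps by (intro exI[of _ p']) blast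

lemma cdiff_SucE:
  assumes "cdiff (Suc n) p"
  obtains p' where "\<And>x. (p has_vector_derivative p' x) (at x)" "cdiff n p'"
  using assms unfolding cdiff.simps by blast

lemma differentiable_everywhere_continuous:
  fixes p :: "real \<Rightarrow> complex"
  assumes "\<And>x. (p has_vector_derivative p' x) (at x)"
  shows "continuous_on UNIV p"
  by (intro continuous_at_imp_continuous_on ballI has_vector_derivative_continuous[OF assms])

lemma cdiff_continuous: "cdiff n p \<Longrightarrow> continuous_on UNIV p"
  by (cases n) (auto intro: differentiable_everywhere_continuous simp del: cdiff.simps(2) elim!: cdiff_SucE)

lemma cdiff_Suc: "cdiff (Suc n) p \<Longrightarrow> cdiff n p"
proof (induction n arbitrary: p)
  case 0
  then show ?case using cdiff_continuous[of "Suc 0" p] by simp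
next
  case (Suc n)
  obtain p' where p': "\<And>x. (p has_vector_derivative p' x) (at x)" "cdiff (Suc n) p'"
    using cdiff_SucE[OF Suc.prems] by blast
  show ?case by (rule cdiff_SucI[OF p'(1) Suc.IH[OF p'(2)]])
qed

lemma cdiff_const: "cdiff n (\<lambda>_. c)"
  by (induction n arbitrary: c) (auto intro!: exI[of _ "\<lambda>_. 0"])

lemma cdiff_add: "cdiff n p \<Longrightarrow> cdiff n q \<Longrightarrow> cdiff n (\<lambda>x. p x + q x)"
proof (induction n arbitrary: p q)
  case (Suc n)
  obtain p' q' where *: "\<forall>x. (p has_vector_derivative p' x) (at x)" "cdiff n p'"
     "\<forall>x. (q has_vector_derivative q' x) (at x)" "cdiff n q'" using Suc.prems by auto
  have "((\<lambda>x. p x + q x) has_vector_derivative (p' x + q' x)) (at x)" for x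
    using * by (auto intro: has_vector_derivative_add)
  from cdiff_SucI[OF this Suc.IH[OF *(2,4)]] show ?case .
qed (auto intro: continuous_intros)

lemma cdiff_mult: "cdiff n p \<Longrightarrow> cdiff n q \<Longrightarrow> cdiff n (\<lambda>x. p x * q x)"
proof (induction n arbitrary: p q)
  case (Suc n)
  obtain p' q' where *: "\<forall>x. (p has_vector_derivative p' x) (at x)" "cdiff n p'"
     "\<forall>x. (q has_vector_derivative q' x) (at x)" "cdiff n q'" using Suc.prems by auto
  have "((\<lambda>x. p x * q x) has_vector_derivative (p x * q' x + p' x * q x)) (at x)" for x
    using * by (auto intro: has_vector_derivative_mult)
  moreover have "cdiff n (\<lambda>x. p x * q' x + p' x * q x)"
    using Suc.prems[THEN cdiff_Suc] * by (intro cdiff_add Suc.IH)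
  ultimately show ?case by (rule cdiff_SucI)
qed (auto intro: continuous_intros)

lemma cdiff_of_real_affine: "cdiff n (\<lambda>x. complex_of_real (a + b * x))"
proof (cases n)
  case (Suc m)
  have "((\<lambda>x. complex_of_real (a + b * x)) has_vector_derivative complex_of_real b) (at x)" for x
    by (rule bounded_linear.has_vector_derivative[OF bounded_linear_of_real])
      (auto intro!: derivative_eq_intros simp flip: has_real_derivative_iff_has_vector_derivative)
  from cdiff_SucI[OF this cdiff_const] show ?thesis unfolding Suc .
qed (auto intro!: continuous_intros)

lemma cdiff_power: "cdiff n p \<Longrightarrow> cdiff n (\<lambda>x. p x ^ k)"
  by (induction k) (auto intro: cdiff_const cdiff_mult)

lemma cdiff_affine: "cdiff n p \<Longrightarrow> cdiff n (\<lambda>x. p (a + b * x))"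
proof (induction n arbitrary: p)
  case (Suc n)
  obtain p' where *: "\<forall>x. (p has_vector_derivative p' x) (at x)" "cdiff n p'" using Suc.prems by auto
  have "((\<lambda>x. p (a + b * x)) has_vector_derivative complex_of_real b * p' (a + b * x)) (at x)" for x
  proof -
    have 1: "((\<lambda>x. a + b * x) has_vector_derivative b) (at x)"
      by (auto intro!: derivative_eq_intros simp flip: has_real_derivative_iff_has_vector_derivative)
    from vector_diff_chain_at[OF 1, of p "p' (a + b * x)"] * show ?thesis
      by (simp add: o_def scaleR_conv_of_real)
  qed
  moreover have "cdiff n (\<lambda>x. complex_of_real b * p' (a + b * x))"
    by (intro cdiff_mult cdiff_const Suc.IH *)
  ultimately show ?case by (rule cdiff_SucI)
next
  case 0
  then have "continuous_on UNIV p" by simp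
  then have "continuous_on UNIV (\<lambda>x. p (a + b * x))"
    by (rule continuous_on_compose2) (auto intro!: continuous_intros)
  then show ?case by simp
qed

text \<open>For k = 0 the standard smooth function exp(-1/x) extended by 0. The powers of 1/x make
  the family closed, up to linear combinations, under differentiation.\<close>

definition flat :: "nat \<Rightarrow> real \<Rightarrow> real" where
  "flat k x = (if x > 0 then (1 / x) ^ k * exp (- (1 / x)) else 0)"

text \<open>With u = 1/x this is boundedness of u^(k+2) exp(-u). The quadratic vanishing at 0 makes
  the difference quotient there tend to 0.\<close>

lemma flat_bound: "\<bar>flat k x\<bar> \<le> real (Suc (k + 2)) ^ (k + 2) * x\<^sup>2"
proof (cases "x > 0")
  case True
  define u where "u = 1 / x"
  have u: "u > 0" "x = 1 / u" using True by (auto simp: u_def)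
  have "u ^ (k + 2) \<le> (1 + u) ^ (k + 2)" using u by (intro power_mono) auto
  also have "\<dots> \<le> real (Suc (k + 2)) ^ (k + 2) * exp u" using u by (intro power_exp_bound) auto
  finally have "u ^ (k + 2) * exp (- u) \<le> real (Suc (k + 2)) ^ (k + 2) * exp u * exp (- u)"
    by (intro mult_right_mono) auto
  then have "u ^ (k + 2) * exp (- u) \<le> real (Suc (k + 2)) ^ (k + 2)"
    unfolding mult.assoc[of _ "exp u"] exp_minus_inverse mult_1_right .
  then have "u ^ k * exp (- u) * u\<^sup>2 \<le> real (Suc (k + 2)) ^ (k + 2)"
    by (simp only: power_add mult_ac)
  then have "u ^ k * exp (- u) \<le> real (Suc (k + 2)) ^ (k + 2) / u\<^sup>2" using u by (simp add: pos_le_divide_eq)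
  then show ?thesis using True u by (simp add: flat_def u_def[symmetric] power_one_over divide_inverse power_inverse)
next
  case False
  then show ?thesis by (simp add: flat_def)
qed

lemma flat_derivative: "(flat k has_real_derivative (flat (k + 2) x - real k * flat (k + 1) x)) (at x)"
proof -
  consider "x > 0" | "x < 0" | "x = 0" by linarith
  then show ?thesis
  proof cases
    case 1
    have u: "((\<lambda>x. 1 / x) has_real_derivative - ((1 / x)\<^sup>2)) (at x)"
      using 1 by (auto intro!: derivative_eq_intros simp: power2_eq_square)
    have e: "((\<lambda>x. exp (- (1 / x))) has_real_derivative exp (- (1 / x)) * (1 / x)\<^sup>2) (at x)"
      using DERIV_chain2[OF DERIV_exp DERIV_minus[OF u]] by simp
    have "real k * (- ((1 / x)\<^sup>2) * (1 / x) ^ (k - Suc 0)) * exp (- (1 / x)) + exp (- (1 / x)) * (1 / x)\<^sup>2 * (1 / x) ^ k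
        = flat (k + 2) x - real k * flat (k + 1) x"
      using 1 by (cases k) (simp_all add: flat_def power2_eq_square algebra_simps)
    then have d: "((\<lambda>x. (1 / x) ^ k * exp (- (1 / x))) has_real_derivative (flat (k + 2) x - real k * flat (k + 1) x)) (at x)"
      using DERIV_mult[OF DERIV_power[OF u, of k] e] by simp
    show ?thesis
      by (rule has_field_derivative_transform_within_open[OF d, of "{0<..}"]) (use 1 in \<open>auto simp: flat_def\<close>)
  next
    case 2
    have "((\<lambda>x. 0) has_real_derivative (flat (k + 2) x - real k * flat (k + 1) x)) (at x)"
      using 2 by (simp add: flat_def)
    then show ?thesis
      by (rule has_field_derivative_transform_within_open[of _ _ _ "{..<0}"]) (use 2 in \<open>auto simp: flat_def\<close>)
  next
    \<comment> \<open>At the junction the derivative is computed by hand; it is 0, in agreement with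
      the values of the family at 0.\<close>
    case 3
    define C where "C = real (Suc (k + 2)) ^ (k + 2)"
    have "((\<lambda>h. (flat k (0 + h) - flat k 0) / h) \<longlongrightarrow> 0) (at 0)"
    proof (rule tendsto_0_le[where K=C])
      show "((\<lambda>h::real. h) \<longlongrightarrow> 0) (at 0)" by (rule tendsto_ident_at)
      show "\<forall>\<^sub>F h in at 0. norm ((flat k (0 + h) - flat k 0) / h) \<le> norm h * C"
        unfolding eventually_at
      proof (intro exI[of _ 1] conjI ballI impI)
        fix h :: real assume h: "h \<noteq> 0 \<and> dist h 0 < 1"
        have "\<bar>flat k h\<bar> \<le> C * (\<bar>h\<bar> * \<bar>h\<bar>)"
          using flat_bound[of k h] by (simp add: C_def power2_eq_square)
        then have "\<bar>flat k h\<bar> / \<bar>h\<bar> \<le> \<bar>h\<bar> * C" using h by (simp add: divide_le_eq mult_ac)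
        then show "norm ((flat k (0 + h) - flat k 0) / h) \<le> norm h * C" by (simp add: flat_def)
      qed auto
    qed
    then show ?thesis using 3 by (simp add: DERIV_def flat_def)
  qed
qed

lemma cdiff_flat: "cdiff n (\<lambda>x. complex_of_real (flat k x))"
proof (induction n arbitrary: k)
  case 0
  have "continuous_on UNIV (flat k)"
    by (intro continuous_at_imp_continuous_on ballI DERIV_isCont[OF flat_derivative])
  then show ?case by (auto intro: continuous_intros)
next
  case (Suc n)
  have "((\<lambda>x. complex_of_real (flat k x)) has_vector_derivative
      complex_of_real (flat (k + 2) x) + complex_of_real (- real k) * complex_of_real (flat (k + 1) x)) (at x)" for x
  proof -
    have "(flat k has_vector_derivative (flat (k + 2) x - real k * flat (k + 1) x)) (at x)"
      using flat_derivative by (simp add: has_real_derivative_iff_has_vector_derivative)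
    from bounded_linear.has_vector_derivative[OF bounded_linear_of_real this, where 'a1=complex]
    show ?thesis by simp
  qed
  moreover have "cdiff n (\<lambda>x. complex_of_real (flat (k + 2) x) + complex_of_real (- real k) * complex_of_real (flat (k + 1) x))"
    by (intro cdiff_add cdiff_mult cdiff_const Suc)
  ultimately show ?case by (rule cdiff_SucI)
qed

definition bump :: "real \<Rightarrow> real" where "bump x = flat 0 (1 - x) * flat 0 (1 + x)"

lemma bump_nonneg: "0 \<le> bump x" and bump_le_1: "bump x \<le> 1"
  and bump_support: "\<bar>x\<bar> \<ge> 1 \<Longrightarrow> bump x = 0" and bump_minus: "bump (- x) = bump x"
  and bump_ge: "\<bar>x\<bar> \<le> 1 / 2 \<Longrightarrow> exp (- 4) \<le> bump x"
proof -
  have f: "0 \<le> flat 0 y" "flat 0 y \<le> 1" for y by (auto simp: flat_def)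
  show "0 \<le> bump x" "bump x \<le> 1" using f by (auto simp: bump_def intro!: mult_le_one)
  show "bump x = 0" if "\<bar>x\<bar> \<ge> 1" using that by (auto simp: bump_def flat_def)
  show "bump (- x) = bump x" by (simp add: bump_def mult.commute)
  show "exp (- 4) \<le> bump x" if x: "\<bar>x\<bar> \<le> 1 / 2"
  proof -
    \<comment> \<open>1/y is at most 2 there; the two factors of \<open>bump\<close> then give
      exp(-4).\<close>
    have e: "exp (- 2) \<le> flat 0 y" if "y \<ge> 1 / 2" for y
      using that by (auto simp: flat_def divide_simps)
    have "exp (- 2) * exp (- 2) \<le> flat 0 (1 - x) * flat 0 (1 + x)"
      using x f by (intro mult_mono e) auto
    then show ?thesis by (simp add: bump_def flip: exp_add)
  qed
qed

lemma cdiff_bump: "cdiff n (\<lambda>x. complex_of_real (bump (a + b * x)))"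
proof -
  have "cdiff n (\<lambda>x. complex_of_real (bump x))"
    using cdiff_mult[OF cdiff_affine[OF cdiff_flat[of n 0], of 1 "-1"] cdiff_affine[OF cdiff_flat[of n 0], of 1 1]]
    by (simp add: bump_def[abs_def])
  from cdiff_affine[OF this] show ?thesis .
qed

section \<open>Schwartz functions with compactly supported spectrum\<close>

definition fourier1 :: "(real \<Rightarrow> complex) \<Rightarrow> real \<Rightarrow> complex" where
  "fourier1 p x = (\<integral>\<xi>. iexp (x * \<xi>) * p \<xi> \<partial>lborel)"

lemma integrable_compact_support:
  fixes p :: "real \<Rightarrow> complex"
  assumes c: "continuous_on UNIV p" and s: "\<And>x. \<bar>x\<bar> > R \<Longrightarrow> p x = 0"
  shows "integrable lborel p"
proof -
  have "set_integrable lborel {-R..R} p"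
    using c by (intro borel_integrable_atLeastAtMost') (auto intro: continuous_on_subset)
  moreover have "(\<lambda>x. indicator {-R..R} x *\<^sub>R p x) = p"
    using s by (auto simp: indicator_def fun_eq_iff abs_if)
  ultimately show ?thesis by (simp add: set_integrable_def)
qed

lemma derivative_support:
  fixes p :: "real \<Rightarrow> complex"
  assumes d: "(p has_vector_derivative p') (at x)" and s: "\<And>x. \<bar>x\<bar> > R \<Longrightarrow> p x = 0" and x: "\<bar>x\<bar> > R"
  shows "p' = 0"
proof -
  have o: "open {y. \<bar>y\<bar> > R}" by (intro open_Collect_less continuous_intros)
  have "(p has_vector_derivative 0) (at x)"
    by (rule has_vector_derivative_transform_within_open[of "\<lambda>_. 0", OF _ o]) (use x s in auto)
  with d show ?thesis by (rule vector_derivative_unique_at)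
qed

text \<open>The fundamental theorem of calculus for the product of the character with
  \<open>p\<close>, on an interval beyond the support.\<close>

lemma fourier1_by_parts:
  assumes d: "\<And>x. (p has_vector_derivative p' x) (at x)" and c: "continuous_on UNIV p'"
    and s: "\<And>x. \<bar>x\<bar> > R \<Longrightarrow> p x = 0"
  shows "fourier1 p' x = - (\<i> * complex_of_real x) * fourier1 p x"
proof -
  have pc: "continuous_on UNIV p"
    by (rule differentiable_everywhere_continuous[OF d])
  have s': "p' x = 0" if "\<bar>x\<bar> > R" for x by (rule derivative_support[OF d s that])
  \<comment> \<open>Strictly larger than R, so that \<open>p\<close> vanishes at both end points;
    the absolute value covers negative R.\<close>
  define B where "B = \<bar>R\<bar> + 1"
  have i: "integrable lborel (\<lambda>\<xi>. iexp (x * \<xi>) * p \<xi>)" "integrable lborel (\<lambda>\<xi>. iexp (x * \<xi>) * p' \<xi>)"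
    using s s' by (auto intro!: integrable_compact_support[where R=R] continuous_intros pc c)
  define F where "F = (\<lambda>\<xi>. iexp (x * \<xi>) * p \<xi>)"
  define f where "f = (\<lambda>\<xi>. iexp (x * \<xi>) * p' \<xi> + \<i> * complex_of_real x * iexp (x * \<xi>) * p \<xi>)"
  have "(\<integral>\<xi>. indicator {-B..B} \<xi> *\<^sub>R f \<xi> \<partial>lborel) = F B - F (- B)"
  proof (rule integral_FTC_atLeastAtMost)
    show "- B \<le> B" by (simp add: B_def)
    show "(F has_vector_derivative f \<xi>) (at \<xi> within {-B..B})" for \<xi>
      unfolding F_def f_def
      using has_vector_derivative_mult[OF has_vector_derivative_iexp_mult[of x \<xi> "{-B..B}"] has_vector_derivative_at_within[OF d]]
      by (simp add: mult.commute[of x])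
    show "continuous_on {-B..B} f"
      unfolding f_def using continuous_on_subset[OF pc, of "{-B..B}"] continuous_on_subset[OF c, of "{-B..B}"]
      by (intro continuous_intros) auto
  qed
  also have "F B - F (- B) = 0" using s[of B] s[of "- B"] by (simp add: F_def B_def)
  also have "(\<lambda>\<xi>. indicator {-B..B} \<xi> *\<^sub>R f \<xi>) = f"
  proof
    fix \<xi>
    show "indicator {-B..B} \<xi> *\<^sub>R f \<xi> = f \<xi>"
    proof (cases "\<xi> \<in> {-B..B}")
      case False
      then have "\<bar>\<xi>\<bar> > R" by (auto simp: B_def)
      with s s' show ?thesis by (simp add: f_def)
    qed simp
  qed
  finally have "(\<integral>\<xi>. f \<xi> \<partial>lborel) = 0" .
  moreover have "(\<integral>\<xi>. f \<xi> \<partial>lborel) = fourier1 p' x + \<i> * complex_of_real x * fourier1 p x"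
    unfolding f_def fourier1_def mult.assoc[of "\<i> * complex_of_real x"]
    by (subst Bochner_Integration.integral_add[OF i(2) integrable_mult_right[OF i(1)]]) simp
  ultimately show ?thesis by (simp add: eq_neg_iff_add_eq_0)
qed

text \<open>Each integration by parts trades one derivative of \<open>p\<close> for one factor x;
  the support does not grow.\<close>

lemma fourier1_decay_power:
  assumes "cdiff n p" and "\<And>x. \<bar>x\<bar> > R \<Longrightarrow> p x = 0"
  shows "\<exists>C. \<forall>x. \<bar>x\<bar> ^ n * cmod (fourier1 p x) \<le> C"
  using assms
proof (induction n arbitrary: p)
  case 0
  have "cmod (fourier1 p x) \<le> (\<integral>\<xi>. cmod (p \<xi>) \<partial>lborel)" for x
    using integral_norm_bound[of lborel "\<lambda>\<xi>. iexp (x * \<xi>) * p \<xi>"] unfolding fourier1_def norm_iexp_mult .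
  then show ?case by auto
next
  case (Suc n)
  obtain p' where p': "\<And>x. (p has_vector_derivative p' x) (at x)" "cdiff n p'" using cdiff_SucE[OF Suc.prems(1)] by blast
  have s': "p' x = 0" if "\<bar>x\<bar> > R" for x by (rule derivative_support[OF p'(1) Suc.prems(2) that])
  obtain C where C: "\<And>x. \<bar>x\<bar> ^ n * cmod (fourier1 p' x) \<le> C" using Suc.IH[OF p'(2) s'] by blast
  have "\<bar>x\<bar> ^ Suc n * cmod (fourier1 p x) \<le> C" for x
  proof -
    have "fourier1 p' x = - (\<i> * complex_of_real x) * fourier1 p x"
      by (rule fourier1_by_parts[OF p'(1) cdiff_continuous[OF p'(2)] Suc.prems(2)])
    with C[of x] show ?thesis by (simp add: norm_mult mult_ac)
  qed
  then show ?case by blast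
qed

lemma fourier1_decay:
  assumes p: "\<And>n. cdiff n p" and s: "\<And>x. \<bar>x\<bar> > R \<Longrightarrow> p x = 0"
  shows "\<exists>C\<ge>0. \<forall>x. (1 + \<bar>x\<bar>) ^ n * cmod (fourier1 p x) \<le> C"
proof -
  obtain C D where C: "\<And>x. \<bar>x\<bar> ^ n * cmod (fourier1 p x) \<le> C" and D: "\<And>x. \<bar>x\<bar> ^ 0 * cmod (fourier1 p x) \<le> D"
    using fourier1_decay_power[OF p s] by meson
  have "(1 + \<bar>x\<bar>) ^ n * cmod (fourier1 p x) \<le> 2 ^ n * (\<bar>C\<bar> + \<bar>D\<bar>)" for x
  proof -
    have "(1 + \<bar>x\<bar>) ^ n \<le> (2 * max 1 \<bar>x\<bar>) ^ n" by (intro power_mono) auto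
    also have "\<dots> \<le> 2 ^ n * (1 + \<bar>x\<bar> ^ n)" by (auto simp: power_mult_distrib max_def)
    finally have "(1 + \<bar>x\<bar>) ^ n * cmod (fourier1 p x) \<le> 2 ^ n * (1 + \<bar>x\<bar> ^ n) * cmod (fourier1 p x)"
      by (intro mult_right_mono) auto
    also have "\<dots> = 2 ^ n * (cmod (fourier1 p x) + \<bar>x\<bar> ^ n * cmod (fourier1 p x))" by (simp add: algebra_simps)
    also have "\<dots> \<le> 2 ^ n * (\<bar>C\<bar> + \<bar>D\<bar>)"
      using C[of x] D[of x] by (intro mult_left_mono) auto
    finally show ?thesis .
  qed
  then show ?thesis by (intro exI[of _ "2 ^ n * (\<bar>C\<bar> + \<bar>D\<bar>)"]) auto
qed

lemma fourier1_derivative: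
  assumes c: "continuous_on UNIV p" and s: "\<And>x. \<bar>x\<bar> > R \<Longrightarrow> p x = 0"
  shows "(fourier1 p has_vector_derivative fourier1 (\<lambda>\<xi>. (\<i> * complex_of_real \<xi>) * p \<xi>) x) (at x)"
proof -
  have i0: "integrable lborel (\<lambda>\<xi>. iexp (r * \<xi>) * p \<xi>)" for r
    using s by (intro integrable_compact_support[where R=R] continuous_intros c) auto
  have i1: "integrable lborel (\<lambda>\<xi>. iexp (r * \<xi>) * ((\<i> * complex_of_real \<xi>) * p \<xi>))" for r
    using s by (intro integrable_compact_support[where R=R] continuous_intros c) auto
  have i2: "integrable lborel (\<lambda>\<xi>. (\<i> * complex_of_real \<xi>) * p \<xi>)"
    using s by (intro integrable_compact_support[where R=R] continuous_intros c) auto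
  show ?thesis
    unfolding fourier1_def
  proof (rule has_vector_derivative_integral_dominated[where S=UNIV and B="\<lambda>\<xi>. cmod ((\<i> * complex_of_real \<xi>) * p \<xi>)"])
    show "((\<lambda>r. iexp (r * \<xi>) * p \<xi>) has_vector_derivative iexp (r * \<xi>) * ((\<i> * complex_of_real \<xi>) * p \<xi>)) (at r within UNIV)" for r \<xi>
      using has_vector_derivative_mult_left[OF has_vector_derivative_iexp_mult[of \<xi> r UNIV], of "p \<xi>"]
      by (simp only: mult_ac)
    show "norm (iexp (r * \<xi>) * ((\<i> * complex_of_real \<xi>) * p \<xi>)) \<le> cmod ((\<i> * complex_of_real \<xi>) * p \<xi>)" for r \<xi>
      unfolding norm_iexp_mult by simp
  qed (use i0 i1 i2 in \<open>auto intro: integrable_norm\<close>)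
qed

text \<open>The transform factorises over the coordinates. Derivatives multiply the profiles by
  powers of i\<xi> or i\<eta>, which preserves smoothness and support, and smoothness of the
  profiles is decay of the transforms.\<close>

theorem schwartz_inv_fourier_product:
  assumes p: "\<And>n. cdiff n p" and q: "\<And>n. cdiff n q"
    and sp: "\<And>x. \<bar>x\<bar> > R \<Longrightarrow> p x = 0" and sq: "\<And>x. \<bar>x\<bar> > R \<Longrightarrow> q x = 0"
  shows "schwartz (inv_fourier (\<lambda>\<zeta>. p (fst \<zeta>) * q (snd \<zeta>)))"
proof -
  define m where "m = (\<lambda>j (p::real \<Rightarrow> complex) \<xi>. (\<i> * complex_of_real \<xi>) ^ j * p \<xi>)"
  have mp: "cdiff n (m j p)" if "\<And>n. cdiff n p" for n j p
  proof -
    have "cdiff n (\<lambda>\<xi>. complex_of_real \<xi>)" using cdiff_of_real_affine[of n 0 1] by simp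
    then show ?thesis unfolding m_def by (intro cdiff_mult cdiff_power cdiff_const that)
  qed
  have ms: "m j p x = 0" if "p x = 0" for j p x using that by (simp add: m_def)
  have mS: "(\<lambda>\<xi>. (\<i> * complex_of_real \<xi>) * m j p \<xi>) = m (Suc j) p" for j p by (simp add: m_def mult.assoc)
  define D where "D = (\<lambda>j k (z::plane). complex_of_real (1 / (2 * pi)) * (fourier1 (m j p) (fst z) * fourier1 (m k q) (snd z)))"
  have ip: "integrable lborel p" and iq: "integrable lborel q"
    using cdiff_continuous[OF p] cdiff_continuous[OF q] sp sq
    by (blast intro: integrable_compact_support)+
  have D0: "D 0 0 z = inv_fourier (\<lambda>\<zeta>. p (fst \<zeta>) * q (snd \<zeta>)) z" for z
  proof -
    obtain x y where z: "z = (x, y)" by (cases z)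
    have i1: "integrable lborel (\<lambda>\<xi>. iexp (x * \<xi>) * p \<xi>)" "integrable lborel (\<lambda>\<xi>. iexp (y * \<xi>) * q \<xi>)"
      using integrable_iexp_mult[OF ip, of x] integrable_iexp_mult[OF iq, of y] by simp_all
    note pr = integrable_lborel_product[OF i1]
    have "(\<integral>\<zeta>. iexp (z \<bullet> \<zeta>) * (p (fst \<zeta>) * q (snd \<zeta>)) \<partial>lborel)
       = (\<integral>\<zeta>. (case \<zeta> of (\<xi>, \<eta>) \<Rightarrow> (iexp (x * \<xi>) * p \<xi>) * (iexp (y * \<eta>) * q \<eta>)) \<partial>lborel)"
      unfolding z split_def inner_prod_def fst_conv snd_conv inner_real_def iexp_add by (simp only: mult_ac)
    also have "\<dots> = (\<integral>\<xi>. (\<integral>\<eta>. (iexp (x * \<xi>) * p \<xi>) * (iexp (y * \<eta>) * q \<eta>) \<partial>lborel) \<partial>lborel)"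
      using lborel_pair.integral_fst[OF pr] by (simp only: lborel_prod)
    also have "\<dots> = fourier1 p x * fourier1 q y"
      unfolding fourier1_def by (simp only: integral_mult_right_zero integral_mult_left_zero)
    finally show ?thesis by (simp add: D_def inv_fourier_def m_def z)
  qed
  have der: "(fourier1 (m j p) has_vector_derivative fourier1 (m (Suc j) p) x) (at x)"
    if "\<And>n. cdiff n p" "\<And>x. \<bar>x\<bar> > R \<Longrightarrow> p x = 0" for j p x
  proof -
    have "(fourier1 (m j p) has_vector_derivative fourier1 (\<lambda>\<xi>. (\<i> * complex_of_real \<xi>) * m j p \<xi>) x) (at x)"
      by (rule fourier1_derivative[where R=R]) (use cdiff_continuous[OF mp[OF that(1)]] ms that(2) in auto)
    then show ?thesis unfolding mS .
  qed
  have dec: "\<exists>C\<ge>0. \<forall>x. (1 + \<bar>x\<bar>) ^ n * cmod (fourier1 (m j p) x) \<le> C"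
    if "\<And>n. cdiff n p" "\<And>x. \<bar>x\<bar> > R \<Longrightarrow> p x = 0" for n j p
    by (rule fourier1_decay[where R=R]) (use mp[OF that(1)] ms that(2) in auto)
  show ?thesis
    unfolding schwartz_def
  proof (intro exI[of _ D] conjI allI)
    show "D 0 0 = inv_fourier (\<lambda>\<zeta>. p (fst \<zeta>) * q (snd \<zeta>))" by (rule ext) (rule D0)
    fix j k x y
    show "((\<lambda>x. D j k (x, y)) has_vector_derivative D (Suc j) k (x, y)) (at x)"
      unfolding D_def fst_conv snd_conv
      by (intro has_vector_derivative_mult_right has_vector_derivative_mult_left der p sp)
    show "((\<lambda>y. D j k (x, y)) has_vector_derivative D j (Suc k) (x, y)) (at y)"
      unfolding D_def fst_conv snd_conv
      by (intro has_vector_derivative_mult_right der q sq)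
  next
    fix j k n
    obtain A where A: "A \<ge> 0" "\<And>x. (1 + \<bar>x\<bar>) ^ n * cmod (fourier1 (m j p) x) \<le> A"
      using dec[OF p sp] by meson
    obtain B where B: "B \<ge> 0" "\<And>x. (1 + \<bar>x\<bar>) ^ n * cmod (fourier1 (m k q) x) \<le> B"
      using dec[OF q sq] by meson
    have "(1 + norm z) ^ n * cmod (D j k z) \<le> A * B" for z
    proof -
      have "1 + norm z \<le> (1 + \<bar>fst z\<bar>) * (1 + \<bar>snd z\<bar>)"
        using norm_plane_bounds(3)[of z] mult_nonneg_nonneg[OF abs_ge_zero[of "fst z"] abs_ge_zero[of "snd z"]]
        unfolding l1_norm_def distrib_left distrib_right mult_1_left mult_1_right by linarith
      then have "(1 + norm z) ^ n \<le> ((1 + \<bar>fst z\<bar>) * (1 + \<bar>snd z\<bar>)) ^ n" by (intro power_mono) auto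
      moreover have "cmod (D j k z) \<le> 1 * (cmod (fourier1 (m j p) (fst z)) * cmod (fourier1 (m k q) (snd z)))"
        unfolding D_def norm_mult norm_of_real using pi_gt3 by (intro mult_right_mono) auto
      ultimately have "(1 + norm z) ^ n * cmod (D j k z)
         \<le> ((1 + \<bar>fst z\<bar>) * (1 + \<bar>snd z\<bar>)) ^ n * (1 * (cmod (fourier1 (m j p) (fst z)) * cmod (fourier1 (m k q) (snd z))))"
        by (intro mult_mono) auto
      also have "\<dots> = ((1 + \<bar>fst z\<bar>) ^ n * cmod (fourier1 (m j p) (fst z))) * ((1 + \<bar>snd z\<bar>) ^ n * cmod (fourier1 (m k q) (snd z)))"
        by (simp add: power_mult_distrib mult_ac)
      also have "\<dots> \<le> A * B" using A B by (intro mult_mono) auto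
      finally show ?thesis .
    qed
    then show "\<exists>C. \<forall>z. (1 + norm z) ^ n * cmod (D j k z) \<le> C" by blast
  qed
qed

section \<open>The spaces \<open>H\<^bsup>s,a\<^esup>\<close> as seminormed spaces\<close>

lemma fst_Hsa_iff:
  "u \<in> fst (Hsa K s a) \<longleftrightarrow> square_integrable u \<and> (\<forall>z. u z \<in> K)
    \<and> mult_in_Hs (symb_xy a) s u \<and> mult_in_Hs (symb_yx a) s u"
  by (simp add: Hsa_def)

lemma snd_Hsa: "snd (Hsa K s a) u = mult_Hs_norm (symb_xy a) s u + mult_Hs_norm (symb_yx a) s u"
  by (simp add: Hsa_def)

lemma seminormed_space_Hsa:
  assumes K: "K = \<real> \<or> K = UNIV"
  shows "seminormed_space (Hsa K s a)"
proof -
  have conv_const: "0 \<in> K" and Kadd: "x \<in> K \<Longrightarrow> y \<in> K \<Longrightarrow> x + y \<in> K" and Kc: "x \<in> K \<Longrightarrow> c *\<^sub>R x \<in> K" for x y c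
    using K by (auto simp: scaleR_conv_of_real intro: Reals_add Reals_mult)
  have z: "mult_in_Hs m s 0" for m
    unfolding mult_in_Hs_iff zero_fun_def
    by (intro exI[of _ "\<lambda>_. 0"] conjI has_fourier_zero) (simp add: square_integrable_def)
  have "0 \<in> fst (Hsa K s a)"
    unfolding fst_Hsa_iff using z conv_const by (simp add: zero_fun_def square_integrable_def)
  moreover have "u + v \<in> fst (Hsa K s a) \<and> snd (Hsa K s a) (u + v) \<le> snd (Hsa K s a) u + snd (Hsa K s a) v"
    if u: "u \<in> fst (Hsa K s a)" and v: "v \<in> fst (Hsa K s a)" for u v
  proof -
    note ux = mult_Hs_add[of "symb_xy a" s u v] and uy = mult_Hs_add[of "symb_yx a" s u v]
    have "square_integrable (u + v)" using square_integrable_add[of u v] u v by (simp add: fst_Hsa_iff plus_fun_def)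
    then show ?thesis
      using u v ux uy Kadd symb_nonneg measurable_symb_xy measurable_symb_yx
      by (auto simp: fst_Hsa_iff snd_Hsa)
  qed
  moreover have "c *\<^sub>R u \<in> fst (Hsa K s a) \<and> snd (Hsa K s a) (c *\<^sub>R u) = \<bar>c\<bar> * snd (Hsa K s a) u"
    if u: "u \<in> fst (Hsa K s a)" for c u
  proof -
    note ux = mult_Hs_scale[of "symb_xy a" s u c] and uy = mult_Hs_scale[of "symb_yx a" s u c]
    have "square_integrable (c *\<^sub>R u)"
      using square_integrable_cmult[of u "complex_of_real c"] u by (simp add: fst_Hsa_iff scaleR_fun_def scaleR_conv_of_real)
    then show ?thesis
      using u ux uy Kc measurable_symb_xy measurable_symb_yx
      by (auto simp: fst_Hsa_iff snd_Hsa scaleR_fun_def distrib_left)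
  qed
  ultimately show ?thesis unfolding seminormed_space_def by blast
qed

text \<open>The free evolution is undone before integrating over the box, so that resonant
  contributions add up without oscillation in t. The factor i cancels the -i in
  \<open>nl_symbol\<close>, and the real part then measures the cubic term.\<close>

definition probe :: "plane set \<Rightarrow> real \<Rightarrow> (plane \<Rightarrow> complex) \<Rightarrow> real" where
  "probe B t g = Re (\<i> * (LINT \<zeta>|lborel. indicator B \<zeta> *\<^sub>R (iexp (- t * dispersion \<zeta>) * g \<zeta>)))"

lemma probe_integrable:
  assumes B: "B \<in> sets borel" "emeasure lborel B < \<infinity>" and g: "square_integrable g"
  shows "integrable lborel (\<lambda>\<zeta>. indicator B \<zeta> *\<^sub>R (iexp (- t * dispersion \<zeta>) * g \<zeta>))"
proof (rule Bochner_Integration.integrable_bound)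
  note [measurable] = square_integrableD(1)[OF g] B(1)
  have [measurable]: "dispersion \<in> borel_measurable borel"
    by (intro borel_measurable_continuous_onI continuous_intros)
  show "integrable lborel (\<lambda>\<zeta>. indicator B \<zeta> + (cmod (g \<zeta>))\<^sup>2 :: real)"
    using B square_integrableD(2)[OF g] by (intro Bochner_Integration.integrable_add integrable_real_indicator) auto
  have "cmod (g \<zeta>) \<le> 1 + (cmod (g \<zeta>))\<^sup>2" for \<zeta>
  proof -
    have "2 * cmod (g \<zeta>) \<le> 1 + (cmod (g \<zeta>))\<^sup>2"
      using zero_le_power2[of "cmod (g \<zeta>) - 1"] by (simp add: power2_eq_square algebra_simps)
    with norm_ge_zero[of "g \<zeta>"] show ?thesis by linarith
  qed
  then show "AE \<zeta> in lborel. norm (indicator B \<zeta> *\<^sub>R (iexp (- t * dispersion \<zeta>) * g \<zeta>)) \<le> norm (indicator B \<zeta> + (cmod (g \<zeta>))\<^sup>2 :: real)"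
    by (intro AE_I2) (auto simp: indicator_def abs_of_nonneg norm_mult)
  show "(\<lambda>\<zeta>. indicator B \<zeta> *\<^sub>R (iexp (- t * dispersion \<zeta>) * g \<zeta>)) \<in> borel_measurable lborel" by measurable
qed

lemma probe_cong_AE:
  assumes B: "B \<in> sets borel" "emeasure lborel B < \<infinity>" and g: "square_integrable g" and h: "square_integrable h"
    and gh: "AE \<zeta> in lborel. g \<zeta> = h \<zeta>"
  shows "probe B t g = probe B t h"
proof -
  have "(LINT \<zeta>|lborel. indicator B \<zeta> *\<^sub>R (iexp (- t * dispersion \<zeta>) * g \<zeta>)) = (LINT \<zeta>|lborel. indicator B \<zeta> *\<^sub>R (iexp (- t * dispersion \<zeta>) * h \<zeta>))"
    by (rule integral_cong_AE[OF borel_measurable_integrable[OF probe_integrable[OF B g]] borel_measurable_integrable[OF probe_integrable[OF B h]]])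
      (use gh in \<open>auto elim!: eventually_mono\<close>)
  then show ?thesis by (simp only: probe_def)
qed

lemma probe_add:
  assumes B: "B \<in> sets borel" "emeasure lborel B < \<infinity>" and g: "square_integrable g" and h: "square_integrable h"
  shows "probe B t (\<lambda>\<zeta>. g \<zeta> + h \<zeta>) = probe B t g + probe B t h"
  unfolding probe_def distrib_left scaleR_add_right
  by (subst Bochner_Integration.integral_add[OF probe_integrable[OF B g] probe_integrable[OF B h]]) (simp add: distrib_left)

lemma probe_cmult: "probe B t (\<lambda>\<zeta>. complex_of_real c * g \<zeta>) = c * probe B t g"
proof -
  have eq: "(LINT \<zeta>|lborel. indicator B \<zeta> *\<^sub>R (iexp (- t * dispersion \<zeta>) * (complex_of_real c * g \<zeta>)))
     = (LINT \<zeta>|lborel. complex_of_real c * (indicator B \<zeta> *\<^sub>R (iexp (- t * dispersion \<zeta>) * g \<zeta>)))"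
    by (simp only: scaleR_conv_of_real mult_ac)
  show ?thesis unfolding probe_def eq integral_mult_right_zero by simp
qed

lemma probe_bound:
  assumes B: "B \<in> sets borel" "emeasure lborel B < \<infinity>" and g: "square_integrable g"
    and c: "\<And>\<zeta>. \<zeta> \<in> B \<Longrightarrow> cmod (g \<zeta>) \<le> c"
  shows "\<bar>probe B t g\<bar> \<le> c * measure lborel B"
proof -
  have "cmod (LINT \<zeta>|lborel. indicator B \<zeta> *\<^sub>R (iexp (- t * dispersion \<zeta>) * g \<zeta>)) \<le> (LINT \<zeta>|lborel. c * indicator B \<zeta>)"
  proof (rule Bochner_Integration.integral_norm_bound_integral[OF probe_integrable[OF B g]])
    show "integrable lborel (\<lambda>\<zeta>. c * indicator B \<zeta> :: real)"
      using B by (intro integrable_mult_right integrable_real_indicator) auto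
    show "norm (indicator B \<zeta> *\<^sub>R (iexp (- t * dispersion \<zeta>) * g \<zeta>)) \<le> c * indicator B \<zeta>" for \<zeta>
      unfolding norm_scaleR norm_iexp_mult using c by (auto simp: indicator_def)
  qed
  also have "\<dots> = c * measure lborel B" using B(1) by simp
  finally have "cmod (\<i> * (LINT \<zeta>|lborel. indicator B \<zeta> *\<^sub>R (iexp (- t * dispersion \<zeta>) * g \<zeta>))) \<le> c * measure lborel B"
    by (simp add: norm_mult)
  then show ?thesis unfolding probe_def using abs_Re_le_cmod order_trans by blast
qed

text \<open>Cauchy-Schwarz against the indicator of the box, after inserting the Sobolev weight,
  which is at least w there. The measure of the box under the root is what makes small boxes good
  test sets.\<close>

lemma bounded_functional_probe:
  assumes B: "B \<in> sets borel" "emeasure lborel B < \<infinity>" and w: "w > 0"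
    and le: "\<And>\<zeta>. \<zeta> \<in> B \<Longrightarrow> w \<le> sob_weight (symb_xy a) s \<zeta>"
  shows "bounded_functional (Hsa K s a) (\<lambda>u. probe B t (fourier u)) (sqrt (measure lborel B) / w)"
proof -
  have hf: "has_fourier u (fourier u)" if "u \<in> fst (Hsa K s a)" for u
    using that fourier_AE_eq(1) unfolding fst_Hsa_iff mult_in_Hs_iff by blast
  note sq = has_fourierD(2)[OF hf]
  have add: "probe B t (fourier (u + v)) = probe B t (fourier u) + probe B t (fourier v)"
    if u: "u \<in> fst (Hsa K s a)" and v: "v \<in> fst (Hsa K s a)" for u v
  proof -
    have uv: "has_fourier (u + v) (\<lambda>\<zeta>. fourier u \<zeta> + fourier v \<zeta>)"
      using has_fourier_add[OF hf[OF u] hf[OF v]] by (simp add: plus_fun_def)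
    have "probe B t (fourier (u + v)) = probe B t (\<lambda>\<zeta>. fourier u \<zeta> + fourier v \<zeta>)"
      by (rule probe_cong_AE[OF B has_fourierD(2)[OF fourier_AE_eq(1)[OF uv]] has_fourierD(2)[OF uv] fourier_AE_eq(2)[OF uv]])
    then show ?thesis by (simp only: probe_add[OF B sq[OF u] sq[OF v]])
  qed
  have scale: "probe B t (fourier (c *\<^sub>R u)) = c * probe B t (fourier u)" if u: "u \<in> fst (Hsa K s a)" for u c
  proof -
    have cu: "has_fourier (c *\<^sub>R u) (\<lambda>\<zeta>. complex_of_real c * fourier u \<zeta>)"
      using has_fourier_cmult[OF hf[OF u], of "complex_of_real c"] by (simp add: scaleR_fun_def scaleR_conv_of_real)
    have "probe B t (fourier (c *\<^sub>R u)) = probe B t (\<lambda>\<zeta>. complex_of_real c * fourier u \<zeta>)"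
      by (rule probe_cong_AE[OF B has_fourierD(2)[OF fourier_AE_eq(1)[OF cu]] has_fourierD(2)[OF cu] fourier_AE_eq(2)[OF cu]])
    then show ?thesis by (simp only: probe_cmult)
  qed
  have bd: "\<bar>probe B t (fourier u)\<bar> \<le> sqrt (measure lborel B) / w * snd (Hsa K s a) u" if u: "u \<in> fst (Hsa K s a)" for u
  proof -
    let ?W = "\<lambda>\<zeta>. sob_weight (symb_xy a) s \<zeta> * cmod (fourier u \<zeta>)"
    note [measurable] = square_integrableD(1)[OF sq[OF u]] B(1)
    have W2: "integrable lborel (\<lambda>\<zeta>. (?W \<zeta>)\<^sup>2)"
      using u mult_in_HsD(2)[OF _ hf[OF u] measurable_symb_xy] by (simp add: fst_Hsa_iff)
    have iB: "integrable lborel (\<lambda>\<zeta>. (indicator B \<zeta> :: real)\<^sup>2)"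
    proof -
      have "(\<lambda>\<zeta>. (indicator B \<zeta> :: real)\<^sup>2) = indicator B" by (auto simp: indicator_def fun_eq_iff)
      then show ?thesis using B integrable_real_indicator[of B lborel] by simp
    qed
    have mB: "(\<integral>\<zeta>. (indicator B \<zeta> :: real)\<^sup>2 \<partial>lborel) = measure lborel B"
    proof -
      have "(\<lambda>\<zeta>. (indicator B \<zeta> :: real)\<^sup>2) = indicator B" by (auto simp: indicator_def fun_eq_iff)
      then show ?thesis using B(1) by simp
    qed
    note CS = integral_Cauchy_Schwarz[OF _ _ iB W2]
    have i: "integrable lborel (\<lambda>\<zeta>. indicator B \<zeta> * ?W \<zeta>)" by (rule CS(1)) measurable
    have "cmod (LINT \<zeta>|lborel. indicator B \<zeta> *\<^sub>R (iexp (- t * dispersion \<zeta>) * fourier u \<zeta>)) \<le> (LINT \<zeta>|lborel. (1 / w) * (indicator B \<zeta> * ?W \<zeta>))"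
    proof (rule Bochner_Integration.integral_norm_bound_integral[OF probe_integrable[OF B sq[OF u]]])
      show "integrable lborel (\<lambda>\<zeta>. (1 / w) * (indicator B \<zeta> * ?W \<zeta>))" using i by (rule integrable_mult_right)
      show "norm (indicator B \<zeta> *\<^sub>R (iexp (- t * dispersion \<zeta>) * fourier u \<zeta>)) \<le> (1 / w) * (indicator B \<zeta> * ?W \<zeta>)" for \<zeta>
      proof (cases "\<zeta> \<in> B")
        case True
        have "w * cmod (fourier u \<zeta>) \<le> ?W \<zeta>" by (intro mult_right_mono le True) auto
        then show ?thesis using True w unfolding norm_scaleR norm_iexp_mult by (simp add: field_simps)
      qed simp
    qed
    also have "\<dots> = (1 / w) * (LINT \<zeta>|lborel. indicator B \<zeta> * ?W \<zeta>)" by (rule integral_mult_right_zero)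
    also have "\<dots> \<le> (1 / w) * (sqrt (measure lborel B) * sqrt (\<integral>\<zeta>. (?W \<zeta>)\<^sup>2 \<partial>lborel))"
    proof (intro mult_left_mono)
      have "\<bar>LINT \<zeta>|lborel. indicator B \<zeta> * ?W \<zeta>\<bar> \<le> sqrt (measure lborel B) * sqrt (\<integral>\<zeta>. (?W \<zeta>)\<^sup>2 \<partial>lborel)"
        unfolding mB[symmetric] by (rule CS(2)) measurable
      then show "(LINT \<zeta>|lborel. indicator B \<zeta> * ?W \<zeta>) \<le> sqrt (measure lborel B) * sqrt (\<integral>\<zeta>. (?W \<zeta>)\<^sup>2 \<partial>lborel)" by linarith
    qed (use w in auto)
    also have "sqrt (\<integral>\<zeta>. (?W \<zeta>)\<^sup>2 \<partial>lborel) = mult_Hs_norm (symb_xy a) s u"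
      by (rule mult_Hs_norm_eq[OF hf[OF u] measurable_symb_xy, symmetric])
    also have "(1 / w) * (sqrt (measure lborel B) * mult_Hs_norm (symb_xy a) s u) \<le> (1 / w) * (sqrt (measure lborel B) * snd (Hsa K s a) u)"
    proof (intro mult_left_mono)
      \<comment> \<open>The other summand of the norm is dropped; near (N, 3) the
        \<open>symb_xy\<close> part dominates anyway for a \<ge> 0.\<close>
      show "mult_Hs_norm (symb_xy a) s u \<le> snd (Hsa K s a) u" by (simp add: snd_Hsa mult_Hs_norm_def)
    qed (use w in auto)
    finally have "cmod (\<i> * (LINT \<zeta>|lborel. indicator B \<zeta> *\<^sub>R (iexp (- t * dispersion \<zeta>) * fourier u \<zeta>))) \<le> sqrt (measure lborel B) / w * snd (Hsa K s a) u"
      by (simp add: norm_mult)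
    then show ?thesis unfolding probe_def using abs_Re_le_cmod order_trans by blast
  qed
  show ?thesis unfolding bounded_functional_def using add scale bd w by auto
qed

section \<open>The initial data\<close>

text \<open>Two symmetric bumps, so that the profile is even and the spectrum built from it belongs
  to a real function.\<close>

definition bump2 :: "real \<Rightarrow> real \<Rightarrow> real \<Rightarrow> real" where
  "bump2 c \<gamma> x = bump ((x - c) / \<gamma>) + bump ((x + c) / \<gamma>)"

lemma bump2_nonneg: "0 \<le> bump2 c \<gamma> x" and bump2_le: "bump2 c \<gamma> x \<le> 2"
  and bump2_minus: "bump2 c \<gamma> (- x) = bump2 c \<gamma> x"
proof -
  show "0 \<le> bump2 c \<gamma> x" "bump2 c \<gamma> x \<le> 2"
    using bump_nonneg[of "(x - c) / \<gamma>"] bump_nonneg[of "(x + c) / \<gamma>"] bump_le_1[of "(x - c) / \<gamma>"] bump_le_1[of "(x + c) / \<gamma>"]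
    by (auto simp: bump2_def)
  have "(- x - c) / \<gamma> = - ((x + c) / \<gamma>)" "(- x + c) / \<gamma> = - ((x - c) / \<gamma>)"
    unfolding minus_divide_left by simp_all
  then show "bump2 c \<gamma> (- x) = bump2 c \<gamma> x" by (simp only: bump2_def bump_minus add.commute)
qed

lemma bump2_support:
  assumes "\<gamma> > 0" "bump2 c \<gamma> x \<noteq> 0"
  shows "\<bar>x - c\<bar> < \<gamma> \<or> \<bar>x + c\<bar> < \<gamma>"
proof (rule ccontr)
  assume "\<not> ?thesis"
  then have "\<bar>(x - c) / \<gamma>\<bar> \<ge> 1" "\<bar>(x + c) / \<gamma>\<bar> \<ge> 1" using assms(1) by (auto simp: abs_divide)
  then show False using assms(2) bump_support by (simp add: bump2_def)
qed

lemma bump2_ge: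
  assumes "\<gamma> > 0" "\<bar>x - c\<bar> \<le> \<gamma> / 2 \<or> \<bar>x + c\<bar> \<le> \<gamma> / 2"
  shows "exp (- 4) \<le> bump2 c \<gamma> x"
proof -
  have "\<bar>(x - c) / \<gamma>\<bar> \<le> 1 / 2 \<or> \<bar>(x + c) / \<gamma>\<bar> \<le> 1 / 2"
    using assms by (auto simp: abs_divide divide_le_eq)
  then show ?thesis
    using bump_ge[of "(x - c) / \<gamma>"] bump_ge[of "(x + c) / \<gamma>"] bump_nonneg[of "(x - c) / \<gamma>"] bump_nonneg[of "(x + c) / \<gamma>"]
    by (auto simp: bump2_def)
qed

lemma cdiff_bump2: "cdiff n (\<lambda>x. complex_of_real (bump2 c \<gamma> x))"
proof -
  have "cdiff n (\<lambda>x. complex_of_real (bump (- c / \<gamma> + 1 / \<gamma> * x)) + complex_of_real (bump (c / \<gamma> + 1 / \<gamma> * x)))"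
    by (intro cdiff_add cdiff_bump)
  moreover have "- c / \<gamma> + 1 / \<gamma> * x = (x - c) / \<gamma>" "c / \<gamma> + 1 / \<gamma> * x = (x + c) / \<gamma>" for x
    by (simp_all add: field_simps add_divide_distrib diff_divide_distrib)
  ultimately show ?thesis by (simp only: bump2_def of_real_add)
qed

text \<open>Applied with \<open>\<gamma> = N\<^bsup>-1/2\<^esup>\<close>, the width up to which the cubic interaction of frequencies near
  \<open>(\<plusminus>N, \<plusminus>3)\<close> stays resonant.\<close>

definition spectrum :: "real \<Rightarrow> real \<Rightarrow> plane \<Rightarrow> real" where
  "spectrum N \<gamma> \<zeta> = bump2 N \<gamma> (fst \<zeta>) * bump2 3 1 (snd \<zeta>)"

lemma spectrum_nonneg: "0 \<le> spectrum N \<gamma> \<zeta>" and spectrum_le: "spectrum N \<gamma> \<zeta> \<le> 4"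
  and spectrum_minus: "spectrum N \<gamma> (- \<zeta>) = spectrum N \<gamma> \<zeta>"
  using bump2_nonneg bump2_le[of N \<gamma> "fst \<zeta>"] mult_mono[OF bump2_le[of N \<gamma> "fst \<zeta>"] bump2_le[of 3 1 "snd \<zeta>"]]
  by (auto simp: spectrum_def bump2_minus)

lemma spectrum_support:
  assumes "\<gamma> > 0" "spectrum N \<gamma> \<zeta> \<noteq> 0"
  shows "\<bar>fst \<zeta> - N\<bar> < \<gamma> \<or> \<bar>fst \<zeta> + N\<bar> < \<gamma>" "\<bar>snd \<zeta> - 3\<bar> < 1 \<or> \<bar>snd \<zeta> + 3\<bar> < 1"
  using assms bump2_support[of \<gamma> N "fst \<zeta>"] bump2_support[of 1 3 "snd \<zeta>"] by (auto simp: spectrum_def)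

lemma spectrum_ge:
  assumes "\<gamma> > 0" "\<bar>fst \<zeta> - N\<bar> \<le> \<gamma> / 2 \<or> \<bar>fst \<zeta> + N\<bar> \<le> \<gamma> / 2" "\<bar>snd \<zeta> - 3\<bar> \<le> 1 / 2 \<or> \<bar>snd \<zeta> + 3\<bar> \<le> 1 / 2"
  shows "exp (- 8) \<le> spectrum N \<gamma> \<zeta>"
proof -
  have "exp (- 4) * exp (- 4) \<le> bump2 N \<gamma> (fst \<zeta>) * bump2 3 1 (snd \<zeta>)"
    using assms by (intro mult_mono bump2_ge bump2_nonneg) auto
  then show ?thesis by (simp add: spectrum_def flip: exp_add)
qed

lemma continuous_spectrum: "continuous_on UNIV (\<lambda>\<zeta>. complex_of_real (spectrum N \<gamma> \<zeta>))"
proof -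
  have c: "continuous_on UNIV (\<lambda>x. complex_of_real (bump2 c \<gamma> x))" for c \<gamma>
    by (rule cdiff_continuous[OF cdiff_bump2])
  have "continuous_on UNIV (\<lambda>\<zeta>::plane. complex_of_real (bump2 N \<gamma> (fst \<zeta>)) * complex_of_real (bump2 3 1 (snd \<zeta>)))"
    by (intro continuous_intros continuous_on_compose2[OF c]) auto
  then show ?thesis by (simp add: spectrum_def)
qed

lemma measurable_spectrum: "(\<lambda>\<zeta>. complex_of_real (spectrum N \<gamma> \<zeta>)) \<in> borel_measurable borel"
  by (rule borel_measurable_continuous_onI[OF continuous_spectrum])

text \<open>Compact support and a positive minimum of the weight on it. The constant is
  exponentially large in N, which affects only the admissible size of h in the solution
  theorem.\<close>

lemma spectrum_decay:
  assumes \<gamma>: "0 < \<gamma>" "\<gamma> \<le> 1" and N: "N \<ge> 0"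
  shows "\<exists>B. \<forall>\<zeta>. cmod (complex_of_real (spectrum N \<gamma> \<zeta>)) \<le> B * (exp (- (2 * l1_norm \<zeta>)) * lorentz2 \<zeta>)"
proof -
  \<comment> \<open>A lower bound for the weight on |\<xi>| \<le> N + 1, |\<eta>| \<le> 4, which
    contains the support; there \<open>l1_norm\<close> is at most N + 5.\<close>
  define m where "m = exp (- (2 * (N + 5))) * (1 / (1 + (N + 1)\<^sup>2) * (1 / (1 + 4\<^sup>2)))"
  have m: "m > 0" unfolding m_def by (intro mult_pos_pos divide_pos_pos) auto
  have "spectrum N \<gamma> \<zeta> \<le> 4 / m * (exp (- (2 * l1_norm \<zeta>)) * lorentz2 \<zeta>)" for \<zeta>
  proof (cases "spectrum N \<gamma> \<zeta> = 0")
    case True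
    then show ?thesis using m lorentz2_pos[of \<zeta>] by simp
  next
    case False
    have b: "\<bar>fst \<zeta>\<bar> \<le> N + 1" "\<bar>snd \<zeta>\<bar> \<le> 4" using spectrum_support[OF \<gamma>(1) False] \<gamma> N by auto
    have lb: "1 / (1 + c\<^sup>2) \<le> lorentz x" if "\<bar>x\<bar> \<le> c" for x c
    proof -
      have "x\<^sup>2 \<le> c\<^sup>2" using that by (metis abs_ge_zero power2_abs power_mono)
      then show ?thesis unfolding lorentz_def by (intro divide_left_mono mult_pos_pos) auto
    qed
    have "m \<le> exp (- (2 * l1_norm \<zeta>)) * lorentz2 \<zeta>"
      unfolding m_def lorentz2_def using b
      by (intro mult_mono lb) (auto simp: l1_norm_def less_imp_le[OF lorentz_pos])
    then have "4 * 1 \<le> 4 * ((exp (- (2 * l1_norm \<zeta>)) * lorentz2 \<zeta>) / m)" using m by (intro mult_left_mono) auto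
    then show ?thesis using spectrum_le[of N \<gamma> \<zeta>] by simp
  qed
  then show ?thesis using spectrum_nonneg by (intro exI[of _ "4 / m"]) (auto simp: abs_of_nonneg)
qed

definition datum :: "real \<Rightarrow> real \<Rightarrow> plane \<Rightarrow> complex" where
  "datum N \<gamma> = inv_fourier (\<lambda>\<zeta>. complex_of_real (spectrum N \<gamma> \<zeta>))"

lemma integrable_spectrum:
  assumes "0 < \<gamma>" "\<gamma> \<le> 1" "N \<ge> 0"
  shows "integrable lborel (\<lambda>\<zeta>. complex_of_real (spectrum N \<gamma> \<zeta>))"
proof -
  obtain B where B: "\<And>\<zeta>. cmod (complex_of_real (spectrum N \<gamma> \<zeta>)) \<le> B * (exp (- (2 * l1_norm \<zeta>)) * lorentz2 \<zeta>)"
    using spectrum_decay[OF assms] by blast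
  show ?thesis
  proof (rule Bochner_Integration.integrable_bound)
    show "integrable lborel (\<lambda>\<zeta>. \<bar>B\<bar> * lorentz2 \<zeta>)" using integrable_lorentz2 by simp
    show "AE \<zeta> in lborel. norm (complex_of_real (spectrum N \<gamma> \<zeta>)) \<le> norm (\<bar>B\<bar> * lorentz2 \<zeta>)"
    proof (rule AE_I2)
      fix \<zeta>
      have "B * (exp (- (2 * l1_norm \<zeta>)) * lorentz2 \<zeta>) \<le> \<bar>B\<bar> * (1 * lorentz2 \<zeta>)"
        using l1_norm_nonneg[of \<zeta>] lorentz2_pos[of \<zeta>] by (intro mult_mono) auto
      from order_trans[OF B this] show "norm (complex_of_real (spectrum N \<gamma> \<zeta>)) \<le> norm (\<bar>B\<bar> * lorentz2 \<zeta>)"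
        using lorentz2_pos[of \<zeta>] by (simp add: abs_mult)
    qed
  qed (use measurable_spectrum in auto)
qed

lemma has_fourier_datum:
  assumes "0 < \<gamma>" "\<gamma> \<le> 1" "N \<ge> 0"
  shows "has_fourier (datum N \<gamma>) (\<lambda>\<zeta>. complex_of_real (spectrum N \<gamma> \<zeta>))"
  unfolding datum_def
proof (rule has_fourier_inv_fourier[OF integrable_spectrum[OF assms]])
  show "cmod (complex_of_real (spectrum N \<gamma> \<zeta>)) \<le> 4" for \<zeta>
    using spectrum_nonneg spectrum_le by (auto simp: abs_of_nonneg)
  show "AE \<zeta> in lborel. isCont (\<lambda>\<zeta>. complex_of_real (spectrum N \<gamma> \<zeta>)) \<zeta>"
    using continuous_spectrum[of N \<gamma>] continuous_on_eq_continuous_at[OF open_UNIV, of "\<lambda>\<zeta>. complex_of_real (spectrum N \<gamma> \<zeta>)"]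
    by (intro AE_I2) blast
qed

lemma hermitian_spectrum: "hermitian (\<lambda>\<zeta>. complex_of_real (spectrum N \<gamma> \<zeta>))"
  by (simp add: hermitian_def spectrum_minus)

lemma schwartz_datum:
  assumes "0 < \<gamma>" "\<gamma> \<le> 1" "N \<ge> 0"
  shows "schwartz (h *\<^sub>R datum N \<gamma>)"
proof -
  have "schwartz (inv_fourier (\<lambda>\<zeta>. (complex_of_real h * complex_of_real (bump2 N \<gamma> (fst \<zeta>))) * complex_of_real (bump2 3 1 (snd \<zeta>))))"
  proof (rule schwartz_inv_fourier_product[where R="N + 5" and p="\<lambda>x. complex_of_real h * complex_of_real (bump2 N \<gamma> x)" and q="\<lambda>x. complex_of_real (bump2 3 1 x)"])
    show "cdiff n (\<lambda>x. complex_of_real h * complex_of_real (bump2 N \<gamma> x))" for n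
      by (intro cdiff_mult cdiff_const cdiff_bump2)
    show "cdiff n (\<lambda>x. complex_of_real (bump2 3 1 x))" for n by (rule cdiff_bump2)
    show "complex_of_real h * complex_of_real (bump2 N \<gamma> x) = 0" if "\<bar>x\<bar> > N + 5" for x
      using bump2_support[OF assms(1), of N x] that assms by (cases "bump2 N \<gamma> x = 0") auto
    show "complex_of_real (bump2 3 1 x) = 0" if "\<bar>x\<bar> > N + 5" for x
      using bump2_support[of 1 3 x] that assms by (cases "bump2 3 1 x = 0") auto
  qed
  also have "(\<lambda>\<zeta>. (complex_of_real h * complex_of_real (bump2 N \<gamma> (fst \<zeta>))) * complex_of_real (bump2 3 1 (snd \<zeta>)))
     = (\<lambda>\<zeta>. complex_of_real h * complex_of_real (spectrum N \<gamma> \<zeta>))"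
    by (simp add: spectrum_def mult.assoc)
  also have "inv_fourier \<dots> = h *\<^sub>R datum N \<gamma>"
    by (rule ext) (simp add: inv_fourier_cmult datum_def scaleR_fun_def scaleR_conv_of_real)
  finally show ?thesis .
qed

section \<open>Size of the data\<close>

lemma powr_comparable:
  fixes r N s :: real
  assumes N: "N > 0" and r: "N / 5 \<le> r" "r \<le> 5 * N"
  shows "r powr s \<le> exp (\<bar>s\<bar> * ln 5) * N powr s" and "exp (- (\<bar>s\<bar> * ln 5)) * N powr s \<le> r powr s"
proof -
  have r0: "r > 0" using N r(1) by linarith
  have "ln r \<le> ln (5 * N)" "ln N \<le> ln (5 * r)" using N r r0 by (auto intro!: ln_mono)
  then have "\<bar>ln r - ln N\<bar> \<le> ln 5" using N r0 by (simp add: ln_mult)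
  then have "\<bar>s\<bar> * \<bar>ln r - ln N\<bar> \<le> \<bar>s\<bar> * ln 5" by (intro mult_left_mono) auto
  then have "\<bar>s * ln r - s * ln N\<bar> \<le> \<bar>s\<bar> * ln 5" by (simp add: abs_mult[symmetric] right_diff_distrib)
  then have "s * ln r \<le> \<bar>s\<bar> * ln 5 + s * ln N" "- (\<bar>s\<bar> * ln 5) + s * ln N \<le> s * ln r" by linarith+
  then have "exp (s * ln r) \<le> exp (\<bar>s\<bar> * ln 5 + s * ln N)" "exp (- (\<bar>s\<bar> * ln 5) + s * ln N) \<le> exp (s * ln r)"
    by simp_all
  then show "r powr s \<le> exp (\<bar>s\<bar> * ln 5) * N powr s" "exp (- (\<bar>s\<bar> * ln 5)) * N powr s \<le> r powr s"
    using N r0 by (simp_all only: powr_def exp_add) simp_all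
qed

text \<open>The loss in comparing weights with N^(s+a): one factor for the power s of the frequency,
  and one each for the powers a of |\<xi>| and |\<eta>|.\<close>

definition weight_ratio :: "real \<Rightarrow> real \<Rightarrow> real" where "weight_ratio s a = exp ((\<bar>s\<bar> + 2 * a) * ln 5)"

text \<open>Near the four centres |\<xi>| is of order N and |\<eta>| of order 1. The first weight is
  therefore of order N^(s+a), and the second of order N^(s-a), which is no larger since a \<ge>
  0.\<close>

lemma sob_weight_comparable:
  assumes N: "N \<ge> 10" and a: "0 \<le> a"
    and x: "\<bar>fst \<zeta> - N\<bar> < 1 \<or> \<bar>fst \<zeta> + N\<bar> < 1" and y: "\<bar>snd \<zeta> - 3\<bar> < 1 \<or> \<bar>snd \<zeta> + 3\<bar> < 1"
  shows "sob_weight (symb_xy a) s \<zeta> \<le> weight_ratio s a * N powr (s + a)"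
    and "sob_weight (symb_yx a) s \<zeta> \<le> weight_ratio s a * N powr (s + a)"
    and "N powr (s + a) / weight_ratio s a \<le> sob_weight (symb_xy a) s \<zeta>"
proof -
  define X Y where "X = \<bar>fst \<zeta>\<bar>" and "Y = \<bar>snd \<zeta>\<bar>"
  have X: "N / 2 \<le> X" "X \<le> 2 * N" and Y: "2 \<le> Y" "Y \<le> 4" using x y N by (auto simp: X_def Y_def)
  define r where "r = sqrt (1 + (norm \<zeta>)\<^sup>2)"
  have "X \<le> norm \<zeta>" "norm \<zeta> \<le> X + Y" using norm_plane_bounds[of \<zeta>] by (auto simp: X_def Y_def l1_norm_def)
  moreover have "norm \<zeta> \<le> r" unfolding r_def by (rule real_le_rsqrt) simp
  moreover have "r \<le> 1 + norm \<zeta>" unfolding r_def by (rule real_le_lsqrt) (auto simp: power2_sum)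
  \<comment> \<open>The frequency exceeds N/2, and r is at most 1 + 2N + 4; N \<ge> 10 puts both
    within a factor 5 of N.\<close>
  ultimately have r: "N / 5 \<le> r" "r \<le> 5 * N" using X Y N by auto
  have N0: "N > 0" using N by simp
  have rs: "(1 + (norm \<zeta>)\<^sup>2) powr (s / 2) = r powr s"
  proof -
    have "r = (1 + (norm \<zeta>)\<^sup>2) powr (1 / 2)" unfolding r_def by (simp add: powr_half_sqrt)
    then show ?thesis by (simp add: powr_powr)
  qed
  define e1 e2 where "e1 = exp (\<bar>s\<bar> * ln 5)" and "e2 = exp (a * ln 5)"
  have e: "e1 > 0" "e2 \<ge> 1" "weight_ratio s a = e1 * (e2 * e2)"
    using a by (auto simp: e1_def e2_def weight_ratio_def exp_add[symmetric] algebra_simps)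
  have R: "r powr s \<le> e1 * N powr s" "N powr s / e1 \<le> r powr s"
    using powr_comparable[OF N0 r, of s] by (auto simp: e1_def exp_minus field_simps)
  have Xa: "X powr a \<le> e2 * N powr a" "N powr a / e2 \<le> X powr a"
    using powr_comparable[OF N0, of X a] X N0 a by (auto simp: e2_def exp_minus field_simps)
  have Xma: "X powr (- a) \<le> e2 * N powr (- a)"
    using powr_comparable[OF N0, of X "- a"] X N0 a by (auto simp: e2_def)
  have Ya: "Y powr a \<le> e2" "Y powr (- a) \<le> 1" "1 / e2 \<le> Y powr (- a)"
  proof -
    have l: "0 \<le> ln Y" "ln Y \<le> ln 5" using Y by (auto intro!: ln_mono)
    then have "a * ln Y \<le> a * ln 5" "0 \<le> a * ln Y" using a by (auto intro!: mult_left_mono)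
    then show "Y powr a \<le> e2" "Y powr (- a) \<le> 1" "1 / e2 \<le> Y powr (- a)"
      using Y by (auto simp: powr_def e2_def exp_minus[symmetric] inverse_eq_divide[symmetric])
  qed
  have Ns: "N powr (s + a) = N powr s * N powr a" by (simp add: powr_add)
  have "N powr (- a) \<le> N powr a" using N a by (intro powr_mono) auto
  have wxy: "sob_weight (symb_xy a) s \<zeta> = r powr s * (X powr a * Y powr (- a))"
    and wyx: "sob_weight (symb_yx a) s \<zeta> = r powr s * (Y powr a * X powr (- a))"
    by (simp_all add: sob_weight_def rs symb_xy_def symb_yx_def split_def X_def Y_def)
  have "sob_weight (symb_xy a) s \<zeta> \<le> (e1 * N powr s) * ((e2 * N powr a) * 1)"
    unfolding wxy using e by (intro mult_mono R Xa Ya) auto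
  also have "\<dots> \<le> (e1 * N powr s) * ((e2 * N powr a) * e2)" using e by (intro mult_left_mono) auto
  finally show "sob_weight (symb_xy a) s \<zeta> \<le> weight_ratio s a * N powr (s + a)" by (simp add: e Ns mult_ac)
  have "sob_weight (symb_yx a) s \<zeta> \<le> (e1 * N powr s) * (e2 * (e2 * N powr (- a)))"
    unfolding wyx using e by (intro mult_mono R Xma Ya) auto
  also have "\<dots> \<le> (e1 * N powr s) * (e2 * (e2 * N powr a))"
    using e \<open>N powr (- a) \<le> N powr a\<close> by (intro mult_left_mono) auto
  finally show "sob_weight (symb_yx a) s \<zeta> \<le> weight_ratio s a * N powr (s + a)" by (simp add: e Ns mult_ac)
  have "(N powr s / e1) * ((N powr a / e2) * (1 / e2)) \<le> sob_weight (symb_xy a) s \<zeta>"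
    unfolding wxy using e by (intro mult_mono R Xa Ya) auto
  then show "N powr (s + a) / weight_ratio s a \<le> sob_weight (symb_xy a) s \<zeta>" by (simp add: e Ns mult_ac)
qed

lemma measure_plane_cbox:
  "x1 \<le> x2 \<Longrightarrow> y1 \<le> y2 \<Longrightarrow> measure lborel (cbox (x1, y1) (x2, y2)) = (x2 - x1) * (y2 - y1 :: real)"
  using content_Pair[of x1 y1 x2 y2] by simp

text \<open>The spectrum is at most 4 and lives in four boxes of area 4 \<gamma>, so the square of
  the norm is at most (4W)^2 times 16 \<gamma>. The four indicators are added, which needs no
  disjointness.\<close>

lemma datum_Hs:
  assumes \<gamma>: "0 < \<gamma>" "\<gamma> \<le> 1" and N: "N \<ge> 0" and m[measurable]: "m \<in> borel_measurable borel" and m0: "\<And>\<zeta>. 0 \<le> m \<zeta>"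
    and W: "0 \<le> W" "\<And>\<zeta>. spectrum N \<gamma> \<zeta> \<noteq> 0 \<Longrightarrow> sob_weight m s \<zeta> \<le> W"
  shows "mult_in_Hs m s (datum N \<gamma>)" "mult_Hs_norm m s (datum N \<gamma>) \<le> 16 * W * sqrt \<gamma>"
proof -
  define b :: "real \<Rightarrow> real \<Rightarrow> plane set" where "b = (\<lambda>x y. cbox (x - \<gamma>, y - 1) (x + \<gamma>, y + 1))"
  define I :: "plane \<Rightarrow> real" where "I = (\<lambda>\<zeta>. indicator (b N 3) \<zeta> + indicator (b N (-3)) \<zeta> + indicator (b (-N) 3) \<zeta> + indicator (b (-N) (-3)) \<zeta>)"
  have ib: "integrable lborel (indicator (b x y) :: plane \<Rightarrow> real)" for x y
    unfolding b_def by (intro integrable_real_indicator emeasure_bounded_finite bounded_cbox) auto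
  have mb: "measure lborel (b x y) = 4 * \<gamma>" for x y
    unfolding b_def using \<gamma> measure_plane_cbox[of "x - \<gamma>" "x + \<gamma>" "y - 1" "y + 1"] by simp
  have iI: "integrable lborel I" unfolding I_def by (intro Bochner_Integration.integrable_add ib)
  have mI: "integral\<^sup>L lborel I = 16 * \<gamma>" unfolding I_def using ib by (simp add: mb)
  let ?g = "\<lambda>\<zeta>. complex_of_real (spectrum N \<gamma> \<zeta>)"
  note hf = has_fourier_datum[OF \<gamma> N]
  note [measurable] = measurable_spectrum[of N \<gamma>]
  have w0: "0 \<le> sob_weight m s \<zeta>" for \<zeta> by (rule sob_weight_nonneg[OF m0])
  have pt: "(sob_weight m s \<zeta> * cmod (?g \<zeta>))\<^sup>2 \<le> (W * 4)\<^sup>2 * I \<zeta>" for \<zeta>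
  proof (cases "spectrum N \<gamma> \<zeta> = 0")
    case True
    then show ?thesis by (simp add: I_def)
  next
    case False
    have "sob_weight m s \<zeta> * cmod (?g \<zeta>) \<le> W * 4"
      using W(2)[OF False] spectrum_le[of N \<gamma> \<zeta>] spectrum_nonneg[of N \<gamma> \<zeta>] W(1)
      by (intro mult_mono) auto
    then have "(sob_weight m s \<zeta> * cmod (?g \<zeta>))\<^sup>2 \<le> (W * 4)\<^sup>2" using w0[of \<zeta>] by (intro power_mono) auto
    moreover have "1 \<le> I \<zeta>"
    proof -
      have mem: "\<zeta> \<in> b x y" if "\<bar>fst \<zeta> - x\<bar> < \<gamma>" "\<bar>snd \<zeta> - y\<bar> < 1" for x y
        using that unfolding b_def by (cases \<zeta>) (simp add: cbox_Pair_eq abs_diff_less_iff)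
      have "\<zeta> \<in> b N 3 \<or> \<zeta> \<in> b N (-3) \<or> \<zeta> \<in> b (-N) 3 \<or> \<zeta> \<in> b (-N) (-3)"
        using spectrum_support[OF \<gamma>(1) False] mem[of N 3] mem[of N "-3"] mem[of "-N" 3] mem[of "-N" "-3"]
        by simp blast
      moreover have "0 \<le> indicat_real (b x y) \<zeta>" "\<zeta> \<in> b x y \<Longrightarrow> indicat_real (b x y) \<zeta> = 1" for x y by auto
      ultimately show ?thesis unfolding I_def by (auto simp: indicator_def)
    qed
    ultimately show ?thesis
      using mult_left_mono[of 1 "I \<zeta>" "(W * 4)\<^sup>2"] unfolding mult_1_right by (meson order_trans zero_le_power2)
  qed
  have sq: "square_integrable (\<lambda>\<zeta>. complex_of_real (sob_weight m s \<zeta>) * ?g \<zeta>)"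
  proof (rule square_integrableI)
    show "(\<lambda>\<zeta>. complex_of_real (sob_weight m s \<zeta>) * ?g \<zeta>) \<in> borel_measurable borel" by measurable
    show "integrable lborel (\<lambda>\<zeta>. (cmod (complex_of_real (sob_weight m s \<zeta>) * ?g \<zeta>))\<^sup>2)"
    proof (rule Bochner_Integration.integrable_bound)
      show "integrable lborel (\<lambda>\<zeta>. (W * 4)\<^sup>2 * I \<zeta>)" using iI by (rule integrable_mult_right)
      show "AE \<zeta> in lborel. norm ((cmod (complex_of_real (sob_weight m s \<zeta>) * ?g \<zeta>))\<^sup>2) \<le> norm ((W * 4)\<^sup>2 * I \<zeta>)"
      proof (rule AE_I2)
        fix \<zeta>
        have "(cmod (complex_of_real (sob_weight m s \<zeta>) * ?g \<zeta>))\<^sup>2 = (sob_weight m s \<zeta> * cmod (?g \<zeta>))\<^sup>2"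
          using w0[of \<zeta>] by (simp add: norm_mult)
        with pt[of \<zeta>] show "norm ((cmod (complex_of_real (sob_weight m s \<zeta>) * ?g \<zeta>))\<^sup>2) \<le> norm ((W * 4)\<^sup>2 * I \<zeta>)"
          by simp
      qed
    qed measurable
  qed
  show mem: "mult_in_Hs m s (datum N \<gamma>)" unfolding mult_in_Hs_iff using hf sq by blast
  have "(\<integral>\<zeta>. (sob_weight m s \<zeta> * cmod (?g \<zeta>))\<^sup>2 \<partial>lborel) \<le> (\<integral>\<zeta>. (W * 4)\<^sup>2 * I \<zeta> \<partial>lborel)"
    by (rule integral_mono[OF mult_in_HsD(2)[OF mem hf m] integrable_mult_right[OF iI] pt])
  also have "\<dots> = (16 * W)\<^sup>2 * \<gamma>" by (simp add: mI power_mult_distrib)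
  finally have "mult_Hs_norm m s (datum N \<gamma>) \<le> sqrt ((16 * W)\<^sup>2 * \<gamma>)"
    unfolding mult_Hs_norm_eq[OF hf m] by simp
  also have "\<dots> = 16 * W * sqrt \<gamma>" using W(1) by (simp add: real_sqrt_mult)
  finally show "mult_Hs_norm m s (datum N \<gamma>) \<le> 16 * W * sqrt \<gamma>" .
qed

lemma datum_Hsa:
  assumes \<gamma>: "0 < \<gamma>" "\<gamma> \<le> 1" and N: "N \<ge> 10" and a: "0 \<le> a" and K: "\<real> \<subseteq> K"
  shows "datum N \<gamma> \<in> fst (Hsa K s a)" "snd (Hsa K s a) (datum N \<gamma>) \<le> 32 * weight_ratio s a * N powr (s + a) * sqrt \<gamma>"
proof -
  have N0: "N \<ge> 0" using N by simp
  have W0: "0 \<le> weight_ratio s a * N powr (s + a)" by (simp add: weight_ratio_def)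
  have sup: "\<bar>fst \<zeta> - N\<bar> < 1 \<or> \<bar>fst \<zeta> + N\<bar> < 1" "\<bar>snd \<zeta> - 3\<bar> < 1 \<or> \<bar>snd \<zeta> + 3\<bar> < 1"
    if "spectrum N \<gamma> \<zeta> \<noteq> 0" for \<zeta> using spectrum_support[OF \<gamma>(1) that] \<gamma>(2) by auto
  note D1 = datum_Hs[OF \<gamma> N0 measurable_symb_xy symb_nonneg(1) W0 sob_weight_comparable(1)[OF N a sup]]
  note D2 = datum_Hs[OF \<gamma> N0 measurable_symb_yx symb_nonneg(2) W0 sob_weight_comparable(2)[OF N a sup]]
  have "datum N \<gamma> z \<in> K" for z
    unfolding datum_def using inv_fourier_real[OF hermitian_spectrum measurable_spectrum] K by blast
  then show "datum N \<gamma> \<in> fst (Hsa K s a)"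
    unfolding fst_Hsa_iff using D1(1) D2(1) has_fourierD(1)[OF has_fourier_datum[OF \<gamma> N0]] by simp
  show "snd (Hsa K s a) (datum N \<gamma>) \<le> 32 * weight_ratio s a * N powr (s + a) * sqrt \<gamma>"
    unfolding snd_Hsa using D1(2) D2(2) by simp
qed

section \<open>Lower bound for the cubic term and contradiction\<close>

section \<open>The resonant interaction\<close>

lemma cube_sum_identity:
  fixes a b c :: real
  shows "a ^ 3 + b ^ 3 + c ^ 3 - (a + b + c) ^ 3 = - (3 * ((a + b) * (b + c) * (c + a)))"
  by (simp add: power3_eq_cube algebra_simps)

text \<open>Two of the pair sums cancel to size 2 \<gamma>, and the third is at most 3N. Their
  product is at most 12 \<gamma>^2 N, which is what the condition on the width controls.\<close>

lemma resonance_core: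
  fixes a b c N \<gamma> :: real
  assumes "N \<ge> 10" "0 < \<gamma>" "\<gamma> \<le> 1" "\<gamma>\<^sup>2 * N \<le> 1" and ab: "\<bar>a - N\<bar> < \<gamma>" "\<bar>b - N\<bar> < \<gamma>" "\<bar>c + N\<bar> < \<gamma>"
  shows "\<bar>(a + b) * (b + c) * (c + a)\<bar> \<le> 12"
proof -
  have "\<bar>a + b\<bar> \<le> 3 * N" "\<bar>b + c\<bar> \<le> 2 * \<gamma>" "\<bar>c + a\<bar> \<le> 2 * \<gamma>" using assms by auto
  then have "\<bar>a + b\<bar> * \<bar>b + c\<bar> * \<bar>c + a\<bar> \<le> (3 * N) * (2 * \<gamma>) * (2 * \<gamma>)"
    using assms by (intro mult_mono) auto
  also have "\<dots> = 12 * (\<gamma>\<^sup>2 * N)" by (simp add: power2_eq_square)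
  finally show ?thesis using assms(4) by (simp add: abs_mult)
qed

text \<open>Four cases of signs are possible up to order, and a sum near N singles out those with
  exactly one frequency near -N; the others sum to about 3N, -N or -3N. The factor 3 in
  \<open>cube_sum_identity\<close> turns 12 into 36.\<close>

lemma resonance_1d:
  fixes a b c N \<gamma> :: real
  assumes N: "N \<ge> 10" "0 < \<gamma>" "\<gamma> \<le> 1" "\<gamma>\<^sup>2 * N \<le> 1"
    and a: "\<bar>a - N\<bar> < \<gamma> \<or> \<bar>a + N\<bar> < \<gamma>" and b: "\<bar>b - N\<bar> < \<gamma> \<or> \<bar>b + N\<bar> < \<gamma>"
    and c: "\<bar>c - N\<bar> < \<gamma> \<or> \<bar>c + N\<bar> < \<gamma>" and s: "\<bar>a + b + c - N\<bar> \<le> \<gamma>"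
  shows "\<bar>a ^ 3 + b ^ 3 + c ^ 3 - (a + b + c) ^ 3\<bar> \<le> 36"
proof -
  consider "\<bar>a - N\<bar> < \<gamma>" "\<bar>b - N\<bar> < \<gamma>" "\<bar>c + N\<bar> < \<gamma>" | "\<bar>b - N\<bar> < \<gamma>" "\<bar>c - N\<bar> < \<gamma>" "\<bar>a + N\<bar> < \<gamma>"
    | "\<bar>c - N\<bar> < \<gamma>" "\<bar>a - N\<bar> < \<gamma>" "\<bar>b + N\<bar> < \<gamma>"
    using a b c by (elim disjE; use N(1-3) s in linarith)
  then have "\<bar>(a + b) * (b + c) * (c + a)\<bar> \<le> 12"
  proof cases
    case 1
    then show ?thesis by (rule resonance_core[OF N])
  next
    case 2
    from resonance_core[OF N this] show ?thesis by (simp add: mult_ac)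
  next
    case 3
    from resonance_core[OF N this] show ?thesis by (simp add: mult_ac)
  qed
  then show ?thesis unfolding cube_sum_identity by (simp add: abs_mult)
qed

text \<open>The eighths are chosen so that for \<zeta>, \<mu>, \<nu> in the box the third frequency
  \<zeta> - \<mu> - \<nu> is within 3/8 of the width from (-N, -3), hence within the half where the
  bumps are bounded below.\<close>

definition res_box :: "real \<Rightarrow> real \<Rightarrow> plane set" where
  "res_box N \<gamma> = cbox (N - \<gamma> / 8, 3 - 1 / 8) (N + \<gamma> / 8, 3 + 1 / 8)"

lemma res_box_iff: "\<zeta> \<in> res_box N \<gamma> \<longleftrightarrow> \<bar>fst \<zeta> - N\<bar> \<le> \<gamma> / 8 \<and> \<bar>snd \<zeta> - 3\<bar> \<le> 1 / 8"
  unfolding res_box_def abs_diff_le_iff by (cases \<zeta>) (simp add: cbox_Pair_eq conj_ac)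

lemma res_box_properties:
  shows "res_box N \<gamma> \<in> sets borel" "emeasure lborel (res_box N \<gamma>) < \<infinity>"
    and "\<gamma> > 0 \<Longrightarrow> measure lborel (res_box N \<gamma>) = \<gamma> / 16"
    and "integrable lborel (indicator (res_box N \<gamma>) :: plane \<Rightarrow> real)"
proof -
  show 1: "res_box N \<gamma> \<in> sets borel" "emeasure lborel (res_box N \<gamma>) < \<infinity>"
    unfolding res_box_def by (rule borel_closed[OF closed_cbox], rule emeasure_bounded_finite[OF bounded_cbox])
  show "\<gamma> > 0 \<Longrightarrow> measure lborel (res_box N \<gamma>) = \<gamma> / 16"
    unfolding res_box_def using measure_plane_cbox[of "N - \<gamma> / 8" "N + \<gamma> / 8" "3 - 1 / 8" "3 + 1 / 8"] by simp
  show "integrable lborel (indicator (res_box N \<gamma>) :: plane \<Rightarrow> real)"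
    using 1 by (intro integrable_real_indicator) auto
qed

text \<open>The \<xi> part contributes at most 36. In the \<eta> part all four frequencies are at
  most 4 in modulus, so their cubes contribute at most 4 * 64 = 256 and no cancellation is
  wanted.\<close>

lemma resonance_phase:
  assumes N: "N \<ge> 10" "0 < \<gamma>" "\<gamma> \<le> 1" "\<gamma>\<^sup>2 * N \<le> 1" and \<zeta>: "\<zeta> \<in> res_box N \<gamma>"
    and nz: "spectrum N \<gamma> \<mu> \<noteq> 0" "spectrum N \<gamma> \<nu> \<noteq> 0" "spectrum N \<gamma> (\<zeta> - \<mu> - \<nu>) \<noteq> 0"
  shows "\<bar>dispersion \<mu> + dispersion \<nu> + dispersion (\<zeta> - \<mu> - \<nu>) - dispersion \<zeta>\<bar> \<le> 300"
proof -
  note S = spectrum_support[OF N(2)]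
  have z: "\<bar>fst \<zeta> - N\<bar> \<le> \<gamma> / 8" "\<bar>snd \<zeta> - 3\<bar> \<le> 1 / 8" using \<zeta> by (auto simp: res_box_iff)
  have x: "\<bar>fst \<mu> ^ 3 + fst \<nu> ^ 3 + fst (\<zeta> - \<mu> - \<nu>) ^ 3 - (fst \<mu> + fst \<nu> + fst (\<zeta> - \<mu> - \<nu>)) ^ 3\<bar> \<le> 36"
    by (rule resonance_1d[OF N S(1)[OF nz(1)] S(1)[OF nz(2)] S(1)[OF nz(3)]]) (use z N in auto)
  have c: "\<bar>r ^ 3\<bar> \<le> 64" if "\<bar>r\<bar> \<le> 4" for r :: real
  proof -
    have "(64::real) = 4 ^ 3" by simp
    then show ?thesis unfolding power_abs by (simp only:) (rule power_mono[OF that], simp)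
  qed
  have d: "\<bar>snd \<eta>\<bar> \<le> 4" if "spectrum N \<gamma> \<eta> \<noteq> 0" for \<eta>
    using S(2)[OF that] by linarith
  have "\<bar>snd \<zeta>\<bar> \<le> 4" using z(2) by linarith
  note c[OF d[OF nz(1)]] c[OF d[OF nz(2)]] c[OF d[OF nz(3)]] c[OF this]
  moreover have e: "fst \<mu> + fst \<nu> + fst (\<zeta> - \<mu> - \<nu>) = fst \<zeta>" by simp
  ultimately show ?thesis using x unfolding dispersion_def e by linarith
qed

lemma cos_ge_half: "\<bar>x\<bar> \<le> 1 \<Longrightarrow> 1 / 2 \<le> cos (x::real)"
proof -
  assume x: "\<bar>x\<bar> \<le> 1"
  have "cos (pi / 3) \<le> cos \<bar>x\<bar>" using x pi_gt3 by (intro cos_monotone_0_pi_le) auto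
  then show ?thesis by (simp add: cos_60)
qed

lemma Re_integral_ge:
  fixes f :: "plane \<Rightarrow> complex"
  assumes f: "integrable lborel f" and b: "\<And>\<mu>. c * indicator (res_box N \<gamma>) \<mu> \<le> Re (f \<mu>)"
  shows "c * measure lborel (res_box N \<gamma>) \<le> Re (integral\<^sup>L lborel f)"
proof -
  have "(\<integral>\<mu>. c * indicator (res_box N \<gamma>) \<mu> \<partial>lborel) \<le> (\<integral>\<mu>. Re (f \<mu>) \<partial>lborel)"
    by (rule integral_mono[OF integrable_mult_right[OF res_box_properties(4)] integrable_Re[OF f] b])
  then show ?thesis using integral_Re[OF f] res_box_properties(1) by simp
qed

lemma iexp_add4: "iexp a * iexp b * iexp c * iexp d = iexp (a + b + c + d)"
  by (simp only: iexp_add)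

text \<open>After undoing the free evolution at \<zeta>, the double integrand is a nonnegative
  product of spectra times exp(i \<tau> \<Omega>). Where the product is nonzero, \<tau> |\<Omega>|
  \<le> 1, so the real part is nonnegative everywhere and can be bounded below by its part with
  \<mu> and \<nu> in the box. There three spectra of size at least exp(-8) give exp(-24).\<close>

lemma cube_lower_bound:
  assumes T: "T > 0" and N: "N \<ge> 10" "0 < \<gamma>" "\<gamma> \<le> 1" "\<gamma>\<^sup>2 * N \<le> 1" and \<zeta>: "\<zeta> \<in> res_box N \<gamma>"
    and \<tau>: "0 \<le> \<tau>" "\<tau> \<le> T" "\<tau> \<le> 1 / 300"
  shows "exp (- 24) / 2 * measure lborel (res_box N \<gamma>) ^ 2
    \<le> Re (iexp (- \<tau> * dispersion \<zeta>) * cube (free_evol T (\<lambda>\<zeta>. complex_of_real (spectrum N \<gamma> \<zeta>)) \<tau>) \<zeta>)"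
proof -
  define g where "g = (\<lambda>\<zeta>. complex_of_real (spectrum N \<gamma> \<zeta>))"
  define F where "F = free_evol T g \<tau>"
  define L where "L = exp (- 24) / (2::real)"
  define R where "R = measure lborel (res_box N \<gamma>)"
  have tct: "clamp_time T \<tau> = \<tau>" using \<tau> by (intro clamp_time_id) auto
  have F: "F \<mu> = iexp (\<tau> * dispersion \<mu>) * g \<mu>" for \<mu> by (simp add: F_def free_evol_def tct)
  obtain B where "\<And>\<zeta>. cmod (g \<zeta>) \<le> B * (exp (- (2 * l1_norm \<zeta>)) * lorentz2 \<zeta>)"
    using spectrum_decay[of \<gamma> N] N unfolding g_def by auto
  then have cF: "controlled T (free_evol T g) B"
    by (intro controlled_free_evol T) (use continuous_spectrum in \<open>auto simp: g_def\<close>)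
  have i1: "integrable lborel (\<lambda>\<mu>. F \<mu> * conv F F (\<zeta> - \<mu>))"
    using controlled_conv_integrable[OF cF controlled_conv[OF cF cF T] T, of \<tau> \<zeta>] by (simp add: F_def)
  have i2: "integrable lborel (\<lambda>\<nu>. F \<nu> * F (\<eta> - \<nu>))" for \<eta>
    using controlled_conv_integrable[OF cF cF T, of \<tau> \<eta>] by (simp add: F_def)
  have sp: "0 \<le> spectrum N \<gamma> \<mu>" for \<mu> by (rule spectrum_nonneg)
  have pt: "(L * indicator (res_box N \<gamma>) \<mu>) * indicator (res_box N \<gamma>) \<nu>
     \<le> Re (iexp (- \<tau> * dispersion \<zeta>) * F \<mu> * (F \<nu> * F (\<zeta> - \<mu> - \<nu>)))" for \<mu> \<nu>
  proof -
    define P where "P = spectrum N \<gamma> \<mu> * spectrum N \<gamma> \<nu> * spectrum N \<gamma> (\<zeta> - \<mu> - \<nu>)"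
    define \<Omega> where "\<Omega> = dispersion \<mu> + dispersion \<nu> + dispersion (\<zeta> - \<mu> - \<nu>) - dispersion \<zeta>"
    have P0: "P \<ge> 0" unfolding P_def by (intro mult_nonneg_nonneg sp)
    have eq: "- \<tau> * dispersion \<zeta> + \<tau> * dispersion \<mu> + \<tau> * dispersion \<nu> + \<tau> * dispersion (\<zeta> - \<mu> - \<nu>) = \<tau> * \<Omega>" by (simp add: \<Omega>_def algebra_simps)
    \<comment> \<open>The four phases combine to the resonance function \<Omega>.\<close>
    have "iexp (- \<tau> * dispersion \<zeta>) * iexp (\<tau> * dispersion \<mu>) * iexp (\<tau> * dispersion \<nu>) * iexp (\<tau> * dispersion (\<zeta> - \<mu> - \<nu>)) = iexp (\<tau> * \<Omega>)"
      unfolding iexp_add4 eq by (rule refl)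
    moreover have "x * (y * p) * ((z * q) * (w * r)) = (x * y * z * w) * (p * q * r)" for x y z w p q r :: complex
      by (simp only: mult_ac)
    ultimately have "iexp (- \<tau> * dispersion \<zeta>) * F \<mu> * (F \<nu> * F (\<zeta> - \<mu> - \<nu>)) = iexp (\<tau> * \<Omega>) * complex_of_real P"
      unfolding F g_def P_def of_real_mult by (simp only:)
    then have Re: "Re (iexp (- \<tau> * dispersion \<zeta>) * F \<mu> * (F \<nu> * F (\<zeta> - \<mu> - \<nu>))) = cos (\<tau> * \<Omega>) * P"
      by (simp add: Re_exp)
    \<comment> \<open>Where P vanishes nothing is known about the phase, but both sides are
      0.\<close>
    have half: "P / 2 \<le> cos (\<tau> * \<Omega>) * P"
    proof (cases "P = 0")
      case False
      then have "\<bar>\<Omega>\<bar> \<le> 300" unfolding \<Omega>_def by (intro resonance_phase[OF N \<zeta>]) (auto simp: P_def)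
      then have "\<tau> * \<bar>\<Omega>\<bar> \<le> 1 / 300 * 300" using \<tau> by (intro mult_mono) auto
      then have "1 / 2 \<le> cos (\<tau> * \<Omega>)" using \<tau> by (intro cos_ge_half) (simp add: abs_mult)
      from mult_right_mono[OF this P0] show ?thesis by simp
    qed simp
    show ?thesis
    proof (cases "\<mu> \<in> res_box N \<gamma> \<and> \<nu> \<in> res_box N \<gamma>")
      case True
      then have b: "\<bar>fst \<mu> - N\<bar> \<le> \<gamma> / 8" "\<bar>snd \<mu> - 3\<bar> \<le> 1 / 8" "\<bar>fst \<nu> - N\<bar> \<le> \<gamma> / 8" "\<bar>snd \<nu> - 3\<bar> \<le> 1 / 8"
         "\<bar>fst \<zeta> - N\<bar> \<le> \<gamma> / 8" "\<bar>snd \<zeta> - 3\<bar> \<le> 1 / 8" using \<zeta> by (auto simp: res_box_iff)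
      have "\<bar>fst (\<zeta> - \<mu> - \<nu>) + N\<bar> \<le> \<gamma> / 2" using b(1,3,5) N(2) unfolding fst_diff by linarith
      moreover have "\<bar>snd (\<zeta> - \<mu> - \<nu>) + 3\<bar> \<le> 1 / 2" using b(2,4,6) unfolding snd_diff by linarith
      ultimately have "exp (- 8) \<le> spectrum N \<gamma> (\<zeta> - \<mu> - \<nu>)" by (intro spectrum_ge[OF N(2)] disjI2)
      moreover have "exp (- 8) \<le> spectrum N \<gamma> \<mu>" using b(1,2) N(2) by (intro spectrum_ge disjI1) auto
      moreover have "exp (- 8) \<le> spectrum N \<gamma> \<nu>" using b(3,4) N(2) by (intro spectrum_ge disjI1) auto
      ultimately have "exp (- 8) * exp (- 8) * exp (- 8) \<le> P"
        unfolding P_def by (intro mult_mono mult_nonneg_nonneg sp) simp_all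
      then have "exp (- 24) \<le> P" by (simp flip: exp_add)
      then show ?thesis using half True unfolding Re by (simp add: L_def)
    next
      case False
      then have "(L * indicator (res_box N \<gamma>) \<mu>) * indicator (res_box N \<gamma>) \<nu> = 0"
        by (auto simp: indicator_eq_0_iff)
      with half P0 show ?thesis unfolding Re by linarith
    qed
  qed
  have inner: "(L * R) * indicator (res_box N \<gamma>) \<mu> \<le> Re (iexp (- \<tau> * dispersion \<zeta>) * (F \<mu> * conv F F (\<zeta> - \<mu>)))" for \<mu>
  proof -
    have "(L * indicator (res_box N \<gamma>) \<mu>) * R \<le> Re (\<integral>\<nu>. iexp (- \<tau> * dispersion \<zeta>) * F \<mu> * (F \<nu> * F (\<zeta> - \<mu> - \<nu>)) \<partial>lborel)"
      unfolding R_def by (rule Re_integral_ge[OF integrable_mult_right[OF i2] pt])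
    then show ?thesis unfolding integral_mult_right_zero conv_def by (simp only: mult_ac)
  qed
  have "(L * R) * R \<le> Re (\<integral>\<mu>. iexp (- \<tau> * dispersion \<zeta>) * (F \<mu> * conv F F (\<zeta> - \<mu>)) \<partial>lborel)"
    unfolding R_def by (rule Re_integral_ge[OF integrable_mult_right[OF i1] inner[unfolded R_def]])
  then show ?thesis
    unfolding integral_mult_right_zero cube_def conv_def[of _ "conv _ _"] F_def[symmetric] g_def[symmetric]
      R_def[symmetric] L_def[symmetric] by (simp add: power2_eq_square mult_ac)
qed

lemma controlled_square_integrable:
  assumes a: "controlled T a A" and T: "T > 0"
  shows "square_integrable (a t)"
proof (rule square_integrableI[OF controlledD(5)[OF a]])
  note [measurable] = controlledD(5)[OF a, of t]
  show "integrable lborel (\<lambda>\<zeta>. (cmod (a t \<zeta>))\<^sup>2)"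
  proof (rule Bochner_Integration.integrable_bound[of _ "\<lambda>\<zeta>. A * (A * lorentz2 \<zeta>)"])
    show "AE \<zeta> in lborel. norm ((cmod (a t \<zeta>))\<^sup>2) \<le> norm (A * (A * lorentz2 \<zeta>))"
    proof (rule AE_I2)
      fix \<zeta>
      have "cmod (a t \<zeta>) * cmod (a t \<zeta>) \<le> A * (A * lorentz2 \<zeta>)"
        using controlledD(3)[OF a] by (intro mult_mono controlled_lorentz2[OF a T]) auto
      then show "norm ((cmod (a t \<zeta>))\<^sup>2) \<le> norm (A * (A * lorentz2 \<zeta>))"
        by (simp add: power2_eq_square)
    qed
  qed (use integrable_lorentz2 in auto)
qed

text \<open>The bound for the integrand is uniform in time, so integrating over [0,t] gives the
  factor t; the symbol gives N. The measure \<gamma> / 16 of the box enters squared from the two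
  convolutions and once more from the probe.\<close>

lemma cubic_term_lower_bound:
  assumes T: "T > 0" and N: "N \<ge> 10" "0 < \<gamma>" "\<gamma> \<le> 1" "\<gamma>\<^sup>2 * N \<le> 1" and t: "0 \<le> t" "t \<le> T" "t \<le> 1 / 300"
  shows "N / (2 * pi)\<^sup>2 * t * (exp (- 24) / 2 * (\<gamma> / 16) ^ 3)
    \<le> probe (res_box N \<gamma>) t (duhamel T (\<lambda>t. cube (free_evol T (\<lambda>\<zeta>. complex_of_real (spectrum N \<gamma> \<zeta>)) t)) t)"
proof -
  define g where "g = (\<lambda>\<zeta>. complex_of_real (spectrum N \<gamma> \<zeta>))"
  define G where "G = (\<lambda>t. cube (free_evol T g t))"
  define R where "R = measure lborel (res_box N \<gamma>)"
  define L where "L = exp (- 24) / 2 * R ^ 2"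
  have R: "R = \<gamma> / 16" unfolding R_def by (rule res_box_properties(3)[OF N(2)])
  have L0: "0 \<le> L" by (simp add: L_def)
  obtain B where "\<And>\<zeta>. cmod (g \<zeta>) \<le> B * (exp (- (2 * l1_norm \<zeta>)) * lorentz2 \<zeta>)"
    using spectrum_decay[of \<gamma> N] N unfolding g_def by auto
  then have cF: "controlled T (free_evol T g) B"
    by (intro controlled_free_evol T) (use continuous_spectrum in \<open>auto simp: g_def\<close>)
  have cG: "controlled T G (conv_const * B * (conv_const * B * B))"
    unfolding G_def cube_def by (rule controlled_conv3[OF T cF cF cF])
  have tct: "clamp_time T t = t" using t by (intro clamp_time_id) auto
  define J where "J = (\<lambda>\<zeta>. LINT \<tau>|lborel. indicator {0..t} \<tau> *\<^sub>R (iexp (- \<tau> * dispersion \<zeta>) * G \<tau> \<zeta>))"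
  have J: "t * L \<le> Re (J \<zeta>)" if \<zeta>: "\<zeta> \<in> res_box N \<gamma>" for \<zeta>
  proof -
    note i = duhamel_integrable[OF cG, of t \<zeta>]
    have it: "integrable lborel (\<lambda>\<tau>. L * indicator {0..t} \<tau> :: real)"
      by (intro integrable_mult_right integrable_real_indicator emeasure_bounded_finite) auto
    have "(LINT \<tau>|lborel. L * indicator {0..t} \<tau>) \<le> (LINT \<tau>|lborel. Re (indicator {0..t} \<tau> *\<^sub>R (iexp (- \<tau> * dispersion \<zeta>) * G \<tau> \<zeta>)))"
    proof (rule integral_mono[OF it integrable_Re[OF i]])
      fix \<tau>
      show "L * indicator {0..t} \<tau> \<le> Re (indicator {0..t} \<tau> *\<^sub>R (iexp (- \<tau> * dispersion \<zeta>) * G \<tau> \<zeta>))"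
      proof (cases "\<tau> \<in> {0..t}")
        case True
        then have "L \<le> Re (iexp (- \<tau> * dispersion \<zeta>) * G \<tau> \<zeta>)"
          unfolding L_def R_def G_def g_def using t by (intro cube_lower_bound[OF T N \<zeta>]) auto
        then show ?thesis using True by simp
      qed simp
    qed
    then show ?thesis unfolding J_def integral_Re[OF i] using t by (simp add: mult.commute)
  qed
  \<comment> \<open>The phase in \<open>probe\<close> cancels the propagator in front of the Duhamel
    integral.\<close>
  have dh: "iexp (- t * dispersion \<zeta>) * duhamel T G t \<zeta> = nl_symbol \<zeta> * J \<zeta>" for \<zeta>
  proof -
    have "iexp (- t * dispersion \<zeta>) * iexp (t * dispersion \<zeta>) = 1" unfolding iexp_add[symmetric] by simp
    then show ?thesis unfolding duhamel_def tct J_def mult.assoc[symmetric] by (simp only: mult_1_left)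
  qed
  have i: "integrable lborel (\<lambda>\<zeta>. indicator (res_box N \<gamma>) \<zeta> *\<^sub>R (iexp (- t * dispersion \<zeta>) * duhamel T G t \<zeta>))"
    by (rule probe_integrable[OF res_box_properties(1,2) controlled_square_integrable[OF controlled_duhamel[OF cG T] T]])
  have "(N / (2 * pi)\<^sup>2 * (t * L)) * R
     \<le> Re (\<integral>\<zeta>. \<i> * (indicator (res_box N \<gamma>) \<zeta> *\<^sub>R (iexp (- t * dispersion \<zeta>) * duhamel T G t \<zeta>)) \<partial>lborel)"
    unfolding R_def
  proof (rule Re_integral_ge[OF integrable_mult_right[OF i]])
    fix \<zeta>
    show "(N / (2 * pi)\<^sup>2 * (t * L)) * indicator (res_box N \<gamma>) \<zeta>
       \<le> Re (\<i> * (indicator (res_box N \<gamma>) \<zeta> *\<^sub>R (iexp (- t * dispersion \<zeta>) * duhamel T G t \<zeta>)))"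
    proof (cases "\<zeta> \<in> res_box N \<gamma>")
      case True
      have "\<bar>fst \<zeta> - N\<bar> \<le> \<gamma> / 8" "\<bar>snd \<zeta> - 3\<bar> \<le> 1 / 8" using True by (auto simp: res_box_iff)
      \<comment> \<open>The second coordinate, near 3, outweighs the possible deficit \<gamma> / 8
        of the first.\<close>
      then have "N \<le> fst \<zeta> + snd \<zeta>" using N(3) by linarith
      then have "N / (2 * pi)\<^sup>2 * (t * L) \<le> (fst \<zeta> + snd \<zeta>) / (2 * pi)\<^sup>2 * Re (J \<zeta>)"
        using J[OF True] t L0 N by (intro mult_mono divide_right_mono) auto
      also have "\<dots> = Re (\<i> * (nl_symbol \<zeta> * J \<zeta>))"
      proof -
        have "\<i> * - (\<i> * x) = x" for x :: complex by (simp add: mult.assoc[symmetric])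
        then have "\<i> * nl_symbol \<zeta> = complex_of_real ((fst \<zeta> + snd \<zeta>) / (2 * pi)\<^sup>2)"
          unfolding nl_symbol_def .
        moreover have "Re (complex_of_real r * z) = r * Re z" for r z by simp
        ultimately show ?thesis unfolding mult.assoc[symmetric] by (simp only:)
      qed
      finally show ?thesis using True unfolding dh by simp
    qed simp
  qed
  then show ?thesis
    unfolding integral_mult_right_zero probe_def g_def[symmetric] G_def[symmetric]
    by (simp add: L_def R power2_eq_square power3_eq_cube mult_ac)
qed

section \<open>Failure of \<open>C\<^sup>3\<close> regularity\<close>

text \<open>For small h the datum lies in the ball and is Schwartz, and a smooth solution has been
  constructed for it, so \<open>S\<close> must return that solution. Its spectrum is known up to a
  quartic error, and \<open>probe\<close> is linear in the spectrum. The radius \<open>h0\<close>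
  may depend on N.\<close>

lemma data_to_solution_expansion:
  assumes K: "K = \<real> \<or> K = UNIV" and T: "T > 0" and \<delta>: "\<delta> > 0" and a: "0 \<le> a"
    and S: "data_to_solution K s a T \<delta> S"
    and N: "N \<ge> 10" "0 < \<gamma>" "\<gamma> \<le> 1" and t: "t \<in> {0..T}"
  shows "\<exists>c1 C h0. h0 > 0 \<and> (\<forall>h. 0 \<le> h \<longrightarrow> h \<le> h0 \<longrightarrow>
     \<bar>probe (res_box N \<gamma>) t (fourier (S (h *\<^sub>R datum N \<gamma>) t)) - c1 * h
       - probe (res_box N \<gamma>) t (duhamel T (\<lambda>t. cube (free_evol T (\<lambda>\<zeta>. complex_of_real (spectrum N \<gamma> \<zeta>)) t)) t) * h ^ 3\<bar>
     \<le> C * h ^ 4)"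
proof -
  let ?X = "Hsa K s a" and ?B = "res_box N \<gamma>"
  define g where "g = (\<lambda>\<zeta>. complex_of_real (spectrum N \<gamma> \<zeta>))"
  have N0: "N \<ge> 0" using N by simp
  have KR: "\<real> \<subseteq> K" using K by auto
  have X: "seminormed_space ?X" by (rule seminormed_space_Hsa[OF K])
  have \<phi>: "datum N \<gamma> \<in> fst ?X" by (rule datum_Hsa(1)[OF N(2,3,1) a KR])
  have gc: "continuous_on UNIV g" unfolding g_def by (rule continuous_spectrum)
  have gh: "hermitian g" unfolding g_def by (rule hermitian_spectrum)
  obtain B where gb: "\<And>\<zeta>. cmod (g \<zeta>) \<le> B * (exp (- (2 * l1_norm \<zeta>)) * lorentz2 \<zeta>)"
    using spectrum_decay[OF N(2,3) N0] unfolding g_def by blast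
  obtain \<epsilon> C where \<epsilon>: "\<epsilon> > 0" and sol: "\<And>h. 0 \<le> h \<Longrightarrow> h \<le> \<epsilon> \<Longrightarrow> \<exists>V A. controlled T V A \<and> (\<forall>t. hermitian (V t)) \<and>
     (\<forall>t \<zeta>. V t \<zeta> = complex_of_real h * free_evol T g t \<zeta> + duhamel T (\<lambda>t. cube (V t)) t \<zeta>) \<and>
     (\<forall>t \<zeta>. cmod (V t \<zeta> - complex_of_real h * free_evol T g t \<zeta>
         - complex_of_real (h ^ 3) * duhamel T (\<lambda>t. cube (free_evol T g t)) t \<zeta>) \<le> C * h ^ 4)"
    using small_data_solution[OF T gc gh gb] by blast
  define p where "p = snd ?X (datum N \<gamma>)"
  have p: "p \<ge> 0" unfolding p_def by (rule seminormed_space_more(6)[OF X \<phi>])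
  \<comment> \<open>The first bound gives the solution, the second puts the datum strictly inside
    the ball; \<open>p + 1\<close> covers \<open>p = 0\<close>.\<close>
  define h0 where "h0 = min \<epsilon> (\<delta> / (p + 1))"
  have h0: "h0 > 0" using \<epsilon> \<delta> p by (simp add: h0_def)
  define W1 where "W1 = duhamel T (\<lambda>t. cube (free_evol T g t)) t"
  have cF: "controlled T (free_evol T g) B" by (rule controlled_free_evol[OF T gc gb])
  have sF: "square_integrable (free_evol T g t)" by (rule controlled_square_integrable[OF cF T])
  have cG: "controlled T (\<lambda>t. cube (free_evol T g t)) (conv_const * B * (conv_const * B * B))"
    unfolding cube_def by (rule controlled_conv3[OF T cF cF cF])
  have sW: "square_integrable W1"
    unfolding W1_def by (rule controlled_square_integrable[OF controlled_duhamel[OF cG T] T])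
  note Bp = res_box_properties(1,2)[of N \<gamma>]
  show ?thesis
  proof (rule exI[of _ "probe ?B t (free_evol T g t)"], rule exI[of _ "C * measure lborel ?B"],
      rule exI[of _ h0], intro conjI h0 allI impI)
    fix h :: real assume h: "0 \<le> h" "h \<le> h0"
    then have h\<epsilon>: "h \<le> \<epsilon>" and h\<delta>: "h \<le> \<delta> / (p + 1)" by (auto simp: h0_def)
    obtain V A where V: "controlled T V A" "\<And>t. hermitian (V t)"
      and eq: "\<And>t \<zeta>. V t \<zeta> = complex_of_real h * free_evol T g t \<zeta> + duhamel T (\<lambda>t. cube (V t)) t \<zeta>"
      and err: "\<And>t \<zeta>. cmod (V t \<zeta> - complex_of_real h * free_evol T g t \<zeta>
         - complex_of_real (h ^ 3) * duhamel T (\<lambda>t. cube (free_evol T g t)) t \<zeta>) \<le> C * h ^ 4"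
      using sol[OF h(1) h\<epsilon>] by blast
    define v0 where "v0 = h *\<^sub>R datum N \<gamma>"
    have v0: "v0 = inv_fourier (\<lambda>\<zeta>. complex_of_real h * g \<zeta>)"
      unfolding v0_def datum_def g_def
      by (rule ext) (simp add: inv_fourier_cmult scaleR_fun_def scaleR_conv_of_real)
    have ss: "smooth_solution K T v0 (\<lambda>t. inv_fourier (V t))"
      unfolding v0
    proof (rule smooth_solution_inv_fourier[OF T V KR])
      show "V t \<zeta> = free_evol T (\<lambda>\<zeta>. complex_of_real h * g \<zeta>) t \<zeta> + duhamel T (\<lambda>t. cube (V t)) t \<zeta>" for t \<zeta>
        by (subst eq) (simp add: free_evol_def mult.left_commute)
    qed
    have "snd ?X v0 = h * p" using seminormed_spaceD(5)[OF X \<phi>, of h] h by (simp add: v0_def p_def)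
    also have "\<dots> \<le> \<delta> / (p + 1) * p" using h\<delta> p by (intro mult_right_mono) auto
    also have "\<dots> < \<delta>" using \<delta> p by (simp add: field_simps)
    finally have ball: "v0 \<in> open_ball0 ?X \<delta>"
      using seminormed_spaceD(4)[OF X \<phi>, of h] by (simp add: open_ball0_def v0_def)
    \<comment> \<open>The identity holds almost everywhere, which is enough for the two functions to
      share the spectrum \<open>V t\<close>.\<close>
    have ae: "AE z in lborel. S v0 t z = inv_fourier (V t) z"
      using S ball schwartz_datum[OF N(2,3) N0, of h] ss t unfolding data_to_solution_def v0_def[symmetric] by blast
    have "S v0 \<in> fst (C_space T ?X)" using S ball unfolding data_to_solution_def by blast
    then have "S v0 t \<in> fst ?X" using t unfolding C_space_def by auto
    then have sS: "square_integrable (S v0 t)" by (simp add: fst_Hsa_iff)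
    have hf: "has_fourier (S v0 t) (V t)"
      by (rule has_fourier_cong_AE[OF has_fourier_rapid[OF rapid_controlled[OF V(1) T] t] sS ae])
    have sV: "square_integrable (V t)" by (rule has_fourierD(2)[OF hf])
    have 1: "probe ?B t (fourier (S v0 t)) = probe ?B t (V t)"
      by (rule probe_cong_AE[OF Bp has_fourierD(2)[OF fourier_AE_eq(1)[OF hf]] sV fourier_AE_eq(2)[OF hf]])
    define R where "R = (\<lambda>\<zeta>. V t \<zeta> + complex_of_real (- h) * free_evol T g t \<zeta> + complex_of_real (- (h ^ 3)) * W1 \<zeta>)"
    note s1 = square_integrable_cmult[OF sF, of "complex_of_real (- h)"] and s2 = square_integrable_cmult[OF sW, of "complex_of_real (- (h ^ 3))"]
    have "probe ?B t R = probe ?B t (V t) + (- h) * probe ?B t (free_evol T g t) + (- (h ^ 3)) * probe ?B t W1"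
      unfolding R_def by (simp only: probe_add[OF Bp square_integrable_add[OF sV s1] s2] probe_add[OF Bp sV s1] probe_cmult)
    moreover have "\<bar>probe ?B t R\<bar> \<le> C * h ^ 4 * measure lborel ?B"
    proof (rule probe_bound[OF Bp])
      show "square_integrable R" unfolding R_def by (intro square_integrable_add sV s1 s2)
      show "cmod (R \<zeta>) \<le> C * h ^ 4" for \<zeta> using err[of t \<zeta>] by (simp add: R_def W1_def)
    qed
    ultimately show "\<bar>probe ?B t (fourier (S (h *\<^sub>R datum N \<gamma>) t)) - probe ?B t (free_evol T g t) * h
       - probe ?B t (duhamel T (\<lambda>t. cube (free_evol T (\<lambda>\<zeta>. complex_of_real (spectrum N \<gamma> \<zeta>)) t)) t) * h ^ 3\<bar>
     \<le> C * measure lborel ?B * h ^ 4"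
      using 1 unfolding v0_def W1_def g_def[symmetric] by (simp add: algebra_simps)
  qed
qed

theorem proposition1p5:
  fixes s a :: real and K :: "complex set"
  assumes "0 \<le> a" and "a \<le> 1 / 4" and "s + a < 1 / 4"
    and "K = \<real> \<or> K = UNIV"
  shows "\<not> (\<exists>T > 0. \<exists>\<delta> > 0. \<exists>S.
            data_to_solution K s a T \<delta> S \<and>
            C3_map (Hsa K s a) (open_ball0 (Hsa K s a) \<delta>) (C_space T (Hsa K s a)) S)"
proof
  let ?X = "Hsa K s a"
  assume "\<exists>T > 0. \<exists>\<delta> > 0. \<exists>S. data_to_solution K s a T \<delta> S \<and>
            C3_map ?X (open_ball0 ?X \<delta>) (C_space T ?X) S"
  then obtain T \<delta> S where T: "T > 0" and \<delta>: "\<delta> > 0" and S: "data_to_solution K s a T \<delta> S"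
    and C3: "C3_map ?X (open_ball0 ?X \<delta>) (C_space T ?X) S" by blast
  have KR: "\<real> \<subseteq> K" using assms(4) by auto
  have X: "seminormed_space ?X" by (rule seminormed_space_Hsa[OF assms(4)])
  have Y: "seminormed_space (C_space T ?X)" using T by (intro seminormed_space_C_space[OF X]) simp
  obtain M where M: "\<And>\<phi> l C c1 c3 K' h0. \<phi> \<in> fst ?X \<Longrightarrow> bounded_functional (C_space T ?X) l C \<Longrightarrow> h0 > 0 \<Longrightarrow>
     (\<forall>h. 0 \<le> h \<longrightarrow> h \<le> h0 \<longrightarrow> \<bar>l (S (h *\<^sub>R \<phi>)) - c1 * h - c3 * h^3\<bar> \<le> K' * h^4) \<Longrightarrow>
     \<bar>c3\<bar> \<le> M * C * snd ?X \<phi> ^ 3"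
    using C3_map_cubic_coefficient[OF X Y \<delta> C3] by blast
  \<comment> \<open>One observation time for all N: short enough for the phase bound 300, and
    positive.\<close>
  define t where "t = min T (1 / 300)"
  have t: "0 < t" "t \<le> T" "t \<le> 1 / 300" using T by (auto simp: t_def)
  define \<sigma> where "\<sigma> = s + a"
  define \<kappa> where "\<kappa> = weight_ratio s a"
  have \<kappa>: "\<kappa> > 0" by (simp add: \<kappa>_def weight_ratio_def)
  define q where "q = 1 / (2 * pi)\<^sup>2 * t * (exp (- 24) / 2 * (1 / 16) ^ 3)"
  have q: "q > 0" using t by (simp add: q_def)
  define D where "D = \<bar>M\<bar> * (\<kappa> / 4) * (32 * \<kappa>) ^ 3"
  have main: "q * N powr (1 / 2 - 2 * \<sigma>) \<le> D" if N: "N \<ge> 10" for N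
  proof -
    \<comment> \<open>Then \<gamma>^2 N = 1, the limit of the condition in
      \<open>resonance_core\<close>.\<close>
    define \<gamma> where "\<gamma> = 1 / sqrt N"
    have N0: "N > 0" using N by simp
    have sN: "sqrt N \<ge> 1" using N by simp
    have \<gamma>: "0 < \<gamma>" "\<gamma> \<le> 1" "\<gamma>\<^sup>2 * N \<le> 1" "\<gamma>\<^sup>2 = 1 / N" using N sN by (auto simp: \<gamma>_def power_divide)
    have t': "t \<in> {0..T}" using t by simp
    define w where "w = N powr \<sigma> / \<kappa>"
    have w: "w > 0" using N0 \<kappa> by (simp add: w_def)
    have wle: "w \<le> sob_weight (symb_xy a) s \<zeta>" if "\<zeta> \<in> res_box N \<gamma>" for \<zeta>
      unfolding w_def \<sigma>_def \<kappa>_def using that \<gamma>(2)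
      by (intro sob_weight_comparable(3)[OF N assms(1)]) (auto simp: res_box_iff)
    have R: "measure lborel (res_box N \<gamma>) = \<gamma> / 16" by (rule res_box_properties(3)[OF \<gamma>(1)])
    have l: "bounded_functional (C_space T ?X) (\<lambda>v. probe (res_box N \<gamma>) t (fourier (v t))) (sqrt (\<gamma> / 16) / w)"
      unfolding R[symmetric]
      by (intro bounded_functional_C_space[OF X t'] bounded_functional_probe res_box_properties(1,2) w wle)
    obtain c1 C h0 where e: "h0 > 0" "\<forall>h. 0 \<le> h \<longrightarrow> h \<le> h0 \<longrightarrow>
     \<bar>probe (res_box N \<gamma>) t (fourier (S (h *\<^sub>R datum N \<gamma>) t)) - c1 * h
       - probe (res_box N \<gamma>) t (duhamel T (\<lambda>t. cube (free_evol T (\<lambda>\<zeta>. complex_of_real (spectrum N \<gamma> \<zeta>)) t)) t) * h ^ 3\<bar>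
     \<le> C * h ^ 4"
      using data_to_solution_expansion[OF assms(4) T \<delta> assms(1) S N \<gamma>(1,2) t'] by blast
    define c3 where "c3 = probe (res_box N \<gamma>) t (duhamel T (\<lambda>t. cube (free_evol T (\<lambda>\<zeta>. complex_of_real (spectrum N \<gamma> \<zeta>)) t)) t)"
    have \<phi>: "datum N \<gamma> \<in> fst ?X" "snd ?X (datum N \<gamma>) \<le> 32 * \<kappa> * N powr \<sigma> * sqrt \<gamma>"
      using datum_Hsa[OF \<gamma>(1,2) N assms(1) KR] by (auto simp: \<kappa>_def \<sigma>_def)
    have \<phi>0: "0 \<le> snd ?X (datum N \<gamma>)" by (rule seminormed_space_more(6)[OF X \<phi>(1)])
    have up: "\<bar>c3\<bar> \<le> M * (sqrt (\<gamma> / 16) / w) * snd ?X (datum N \<gamma>) ^ 3"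
      by (rule M[OF \<phi>(1) l e(1)]) (use e(2) in \<open>simp only: c3_def\<close>)
    have "N / (2 * pi)\<^sup>2 * t * (exp (- 24) / 2 * (\<gamma> / 16) ^ 3) \<le> c3"
      unfolding c3_def by (rule cubic_term_lower_bound[OF T N \<gamma>(1-3)]) (use t in auto)
    then have low: "q * (N * \<gamma> ^ 3) \<le> c3" by (simp add: q_def power_divide mult_ac)
    have "c3 \<le> \<bar>c3\<bar>" by simp
    also note up
    also have "M * (sqrt (\<gamma> / 16) / w) * snd ?X (datum N \<gamma>) ^ 3
       \<le> \<bar>M\<bar> * (sqrt (\<gamma> / 16) / w) * (32 * \<kappa> * N powr \<sigma> * sqrt \<gamma>) ^ 3"
      using \<phi>(2) \<phi>0 w \<gamma>(1) by (intro mult_mono power_mono divide_right_mono) auto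
    \<comment> \<open>Power count with \<sigma> = s + a: the functional contributes \<gamma>^(1/2)
      N^(-\<sigma>), the cube of the datum N^(3\<sigma>) \<gamma>^(3/2). Against the lower bound N
      \<gamma>^3, dividing by \<gamma>^2 leaves N \<gamma> = N^(1/2) on the left.\<close>
    also have "\<dots> = D * (N powr (2 * \<sigma>) * \<gamma>\<^sup>2)"
    proof -
      have "sqrt (\<gamma> / 16) = sqrt \<gamma> / 4" using real_sqrt_divide[of \<gamma> 16] by simp
      moreover have "sqrt \<gamma> * sqrt \<gamma> ^ 3 = \<gamma>\<^sup>2"
      proof -
        have "sqrt \<gamma> * sqrt \<gamma> ^ 3 = (sqrt \<gamma> * sqrt \<gamma>) * (sqrt \<gamma> * sqrt \<gamma>)" by (simp only: power3_eq_cube mult_ac)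
        then show ?thesis using \<gamma>(1) by (simp add: power2_eq_square)
      qed
      moreover have "(N powr \<sigma>) ^ 3 / N powr \<sigma> = N powr (2 * \<sigma>)"
      proof -
        have "(N powr \<sigma>) ^ 3 = N powr (2 * \<sigma>) * N powr \<sigma>"
          by (simp only: power3_eq_cube powr_add[symmetric]) simp
        then show ?thesis using N0 by simp
      qed
      moreover have "\<bar>M\<bar> * (r / 4 / (n / \<kappa>)) * (32 * \<kappa> * n * r) ^ 3 = (\<bar>M\<bar> * (\<kappa> / 4) * (32 * \<kappa>) ^ 3) * ((n ^ 3 / n) * (r * r ^ 3))" for r n :: real
        by (simp add: power_mult_distrib)
      ultimately show ?thesis unfolding D_def w_def by (simp only:)
    qed
    finally have "q * (N * \<gamma> ^ 3) \<le> D * (N powr (2 * \<sigma>) * \<gamma>\<^sup>2)" using low by linarith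
    then have "(q * (N * \<gamma>)) * \<gamma>\<^sup>2 \<le> (D * N powr (2 * \<sigma>)) * \<gamma>\<^sup>2"
      by (simp add: power2_eq_square power3_eq_cube mult_ac)
    then have "q * (N * \<gamma>) \<le> D * N powr (2 * \<sigma>)" using \<gamma>(1) by (simp only: mult_le_cancel_right) auto
    moreover have "N * \<gamma> = N powr (1 / 2)"
      using N0 by (simp add: \<gamma>_def powr_half_sqrt real_div_sqrt)
    moreover have "N powr (1 / 2) = N powr (1 / 2 - 2 * \<sigma>) * N powr (2 * \<sigma>)" by (simp add: powr_add[symmetric])
    ultimately have "(q * N powr (1 / 2 - 2 * \<sigma>)) * N powr (2 * \<sigma>) \<le> D * N powr (2 * \<sigma>)" by (simp add: mult_ac)
    moreover have "N powr (2 * \<sigma>) > 0" using N0 by simp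
    ultimately show ?thesis using mult_right_le_imp_le by blast
  qed
  define e where "e = 1 / 2 - 2 * \<sigma>"
  have e: "e > 0" using assms(3) by (simp add: e_def \<sigma>_def)
  \<comment> \<open>Makes N^e exceed |D| / q, contradicting \<open>main\<close>; the maximum with 10
    respects the standing lower bound on N.\<close>
  define N where "N = max 10 ((\<bar>D\<bar> / q + 1) powr (1 / e))"
  have "\<bar>D\<bar> / q + 1 = ((\<bar>D\<bar> / q + 1) powr (1 / e)) powr e"
    using e q by (simp add: powr_powr add_nonneg_pos)
  also have "\<dots> \<le> N powr e" using e by (intro powr_mono2) (auto simp: N_def)
  finally have "q * (\<bar>D\<bar> / q + 1) \<le> q * N powr e" using q by (intro mult_left_mono) auto
  also have "\<dots> \<le> D" using main[of N] by (simp add: N_def e_def)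
  finally show False using q by (simp add: distrib_left)
qed

end
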